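(* For the nonautonomous Ornstein-Uhlenbeck evolution operator $G(t,s)$ associated with the operators $\mathcal{L}(t)$, one has $\mathfrak{A}_p=\mathfrak{B}_p$ for every $p>1$. Moreover, for every $p>1$ and every $\omega\in(\omega_0(U),0)$ there exists a positive constant $M_{p,\omega}$ such that $$\|G(t,s)f-m_s(f)\|_{L^p(\mathbb{R}^d,\mu_t)}\le M_{p,\omega}e^{\omega(t-s)}\|f\|_{L^p(\mathbb{R}^d,\mu_s)}$$ for all $t>s$ and all $f\in L^p(\mathbb{R}^d,\mu_s)$.
   Context: For $t\in\mathbb{R}$ let $(\mathcal{L}(t)\zeta)(x)=\frac12\mathrm{Tr}(B(t)B^*(t)D^2\zeta(x))+\langle A(t)x+g(t),\nabla\zeta(x)\rangle$, $x\in\mathbb{R}^d$, where $A,B:\mathbb{R}\to\mathcal{L}(\mathbb{R}^d)$ (real $d\times d$ matrices) and $g:\mathbb{R}\to\mathbb{R}^d$ are continuous and bounded, and $Q(t):=\frac12B(t)B(t)^*$ satisfies $\langle Q(t)\xi,\xi\rangle\ge\eta_0|\xi|^2$ for all $t\in\mathbb{R}$, $\xi\in\mathbb{R}^d$, with a constant $\eta_0>0$. For $s\in\mathbb{R}$ let $U(\cdot,s)$ be the matrix solution of $D_tU(t,s)=-A(t)U(t,s)$, $t\in\mathbb{R}$, $U(s,s)=\mathrm{Id}$, and assume $$\omega_0(U):=\inf\{\omega\in\mathbb{R}:\exists M_\omega\ge1\text{ such that }\|U(t,s)\|\le M_\omega e^{\omega(s-t)}\text{ for all }t\le s\}<0.$$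 For $f\in C_b(\mathbb{R}^d)$ (bounded continuous functions) and $s\in\mathbb{R}$, $(t,x)\mapsto(G(t,s)f)(x)$ is the unique bounded classical solution of $D_tu=\mathcal{L}(t)u$ for $t>s$, $u(s,\cdot)=f$. The Gaussian measures $$\mu_t(dx)=(2\pi)^{-d/2}(\det Q_t)^{-1/2}e^{-\frac12\langle Q_t^{-1}(x-g_t),x-g_t\rangle}dx,\quad t\in\mathbb{R},$$ with $Q_t=\int_t^{+\infty}U(t,\xi)B(\xi)B^*(\xi)U^*(t,\xi)\,d\xi$ and $g_t=\int_t^{+\infty}U(t,\xi)g(\xi)\,d\xi$, form the unique tight evolution system of measures for $G(t,s)$, i.e. $\int G(t,s)f\,d\mu_t=\int f\,d\mu_s$ for $t>s$ and $f\in C_b(\mathbb{R}^d)$, and for every $\varepsilon>0$ there is $R>0$ with $\mu_t(\mathbb{R}^d\setminus B(0,R))\le\varepsilon$ for all $t\in\mathbb{R}$. $G(t,s)$ extends to a contraction from $L^p(\mathbb{R}^d,\mu_s)$ to $L^p(\mathbb{R}^d,\mu_t)$ for $p\ge1$, $t>s$. Notation: $m_s(f)=\int_{\mathbb{R}^d}f\,d\mu_s$. For $p\in(1,+\infty)$: - $\mathfrak{A}_p$ is the set of all $\omega\in\mathbb{R}$ for which there is $M_{p,\omega}>0$ such that $\|G(t,s)f-m_s(f)\|_{L^p(\mathbb{R}^d,\mu_t)}\le M_{p,\omega}e^{\omega(t-s)}\|f\|_{L^p(\mathbb{R}^d,\mu_s)}$ for all $s<t$ in $\mathbb{R}$ and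 all $f\in L^p(\mathbb{R}^d,\mu_s)$; - $\mathfrak{B}_p$ is the set of all $\omega\in\mathbb{R}$ for which there is $N_{p,\omega}>0$ such that $\|\,|\nabla_xG(t,s)f|\,\|_{L^p(\mathbb{R}^d,\mu_t)}\le N_{p,\omega}e^{\omega(t-s)}\|f\|_{L^p(\mathbb{R}^d,\mu_s)}$ for all $s,t\in\mathbb{R}$ with $t-s\ge1$ and all $f\in L^p(\mathbb{R}^d,\mu_s)$. *)

theory Defs
  imports "HOL-Analysis.Analysis"
begin

definition grad :: "(real^'n \<Rightarrow> real) \<Rightarrow> real^'n \<Rightarrow> real^'n" where
  "grad \<phi> x = (\<chi> i. frechet_derivative \<phi> (at x) (axis i 1))"

definition hessian :: "(real^'n \<Rightarrow> real) \<Rightarrow> real^'n \<Rightarrow> real^'n^'n" where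
  "hessian \<phi> x = jacobian (grad \<phi>) (at x)"

text \<open>Distributional gradient: \<open>F\<close> is the weak gradient of \<open>h\<close>, tested against compactly
  supported \<open>C\<^sup>1\<close> functions. It is unique up to Lebesgue null sets.\<close>

definition has_weak_gradient :: "(real^'n \<Rightarrow> real) \<Rightarrow> (real^'n \<Rightarrow> real^'n) \<Rightarrow> bool" where
  "has_weak_gradient h F \<longleftrightarrow>
     (\<forall>K. compact K \<longrightarrow> set_integrable lborel K h \<and> set_integrable lborel K F) \<and>
     (\<forall>\<phi>. (\<forall>x. \<phi> differentiable (at x)) \<and> continuous_on UNIV (grad \<phi>)
            \<and> compact (closure {x. \<phi> x \<noteq> 0}) \<longrightarrow>
        (LINT x|lborel. h x *\<^sub>R grad \<phi> x) = - (LINT x|lborel. \<phi> x *\<^sub>R F x))"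

definition C_b :: "(real^'n \<Rightarrow> real) set" where
  "C_b = {f. continuous_on UNIV f \<and> bounded (range f)}"

text \<open>\<open>L\<^sup>p\<close> is represented by functions rather than by classes modulo null sets; the value of
  \<open>Lp_norm\<close> is meaningful only for members of \<open>Lp\<close>.\<close>

definition Lp :: "real \<Rightarrow> 'a measure \<Rightarrow> ('a \<Rightarrow> 'b::real_normed_vector) set" where
  "Lp p M = {f \<in> borel_measurable M. integrable M (\<lambda>x. norm (f x) powr p)}"

definition Lp_norm :: "real \<Rightarrow> 'a measure \<Rightarrow> ('a \<Rightarrow> 'b::real_normed_vector) \<Rightarrow> real" where
  "Lp_norm p M f = (LINT x|M. norm (f x) powr p) powr (1 / p)"

definition OU_operator :: "(real \<Rightarrow> real^'n^'n) \<Rightarrow> (real \<Rightarrow> real^'n^'n) \<Rightarrow> (real \<Rightarrow> real^'n) \<Rightarrow>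
    real \<Rightarrow> (real^'n \<Rightarrow> real) \<Rightarrow> real^'n \<Rightarrow> real" where
  "OU_operator A B g t \<zeta> x =
     1 / 2 * trace (B t ** transpose (B t) ** hessian \<zeta> x) + (A t *v x + g t) \<bullet> grad \<zeta> x"

definition C12_after :: "real \<Rightarrow> (real \<Rightarrow> real^'n \<Rightarrow> real) \<Rightarrow> bool" where
  "C12_after s u \<longleftrightarrow>
     (\<forall>t>s. \<forall>x. (\<lambda>\<tau>. u \<tau> x) differentiable (at t) \<and> u t differentiable (at x)
               \<and> grad (u t) differentiable (at x)) \<and>
     continuous_on ({s<..} \<times> UNIV) (\<lambda>(t, x). deriv (\<lambda>\<tau>. u \<tau> x) t) \<and>
     continuous_on ({s<..} \<times> UNIV) (\<lambda>(t, x). grad (u t) x) \<and>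
     continuous_on ({s<..} \<times> UNIV) (\<lambda>(t, x). hessian (u t) x)"

definition bounded_classical_solution ::
  "(real \<Rightarrow> real^'n^'n) \<Rightarrow> (real \<Rightarrow> real^'n^'n) \<Rightarrow> (real \<Rightarrow> real^'n) \<Rightarrow>
    real \<Rightarrow> (real^'n \<Rightarrow> real) \<Rightarrow> (real \<Rightarrow> real^'n \<Rightarrow> real) \<Rightarrow> bool" where
  "bounded_classical_solution A B g s f u \<longleftrightarrow>
     continuous_on ({s..} \<times> UNIV) (\<lambda>(t, x). u t x) \<and>
     bounded ((\<lambda>(t, x). u t x) ` ({s..} \<times> UNIV)) \<and>
     C12_after s u \<and>
     (\<forall>t>s. \<forall>x. deriv (\<lambda>\<tau>. u \<tau> x) t = OU_operator A B g t (u t) x) \<and>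
     (\<forall>x. u s x = f x)"

text \<open>Solutions are functions on all of \<open>\<real>\<close> in time but are constrained only on \<open>[s, \<infinity>)\<close>, so the
  description ranges over the (unique) value at time \<open>t \<ge> s\<close>.\<close>

definition evol :: "(real \<Rightarrow> real^'n^'n) \<Rightarrow> (real \<Rightarrow> real^'n^'n) \<Rightarrow> (real \<Rightarrow> real^'n) \<Rightarrow>
    real \<Rightarrow> real \<Rightarrow> (real^'n \<Rightarrow> real) \<Rightarrow> real^'n \<Rightarrow> real" where
  "evol A B g t s f = (THE v. \<exists>u. bounded_classical_solution A B g s f u \<and> v = u t)"

definition omega0 :: "(real \<Rightarrow> real \<Rightarrow> real^'n^'n) \<Rightarrow> real" where
  "omega0 U = Inf {\<omega>. \<exists>M\<ge>1. \<forall>t s. t \<le> s \<longrightarrow> onorm (\<lambda>x. U t s *v x) \<le> M * exp (\<omega> * (s - t))}"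

definition cov :: "(real \<Rightarrow> real^'n^'n) \<Rightarrow> (real \<Rightarrow> real \<Rightarrow> real^'n^'n) \<Rightarrow> real \<Rightarrow> real^'n^'n" where
  "cov B U t = (LINT \<xi>:{t..}|lborel. U t \<xi> ** B \<xi> ** transpose (B \<xi>) ** transpose (U t \<xi>))"

definition mean :: "(real \<Rightarrow> real^'n) \<Rightarrow> (real \<Rightarrow> real \<Rightarrow> real^'n^'n) \<Rightarrow> real \<Rightarrow> real^'n" where
  "mean g U t = (LINT \<xi>:{t..}|lborel. U t \<xi> *v g \<xi>)"

definition mu :: "(real \<Rightarrow> real^'n^'n) \<Rightarrow> (real \<Rightarrow> real^'n) \<Rightarrow> (real \<Rightarrow> real \<Rightarrow> real^'n^'n) \<Rightarrow>
    real \<Rightarrow> (real^'n) measure" where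
  "mu B g U t = density lborel (\<lambda>x. ennreal
     ((2 * pi) powr (- real CARD('n) / 2) * det (cov B U t) powr (- 1 / 2) *
      exp (- 1 / 2 * ((matrix_inv (cov B U t) *v (x - mean g U t)) \<bullet> (x - mean g U t)))))"

text \<open>The continuous extension from \<open>L\<^sup>p(\<mu>\<^sub>s)\<close> to \<open>L\<^sup>p(\<mu>\<^sub>t)\<close> of the evolution operator on
  \<open>C_b\<close>, which is dense in \<open>L\<^sup>p(\<mu>\<^sub>s)\<close>. The limit is unique up to null sets, and the choice
  operator picks a representative.\<close>

definition evol_Lp :: "(real \<Rightarrow> real^'n^'n) \<Rightarrow> (real \<Rightarrow> real^'n^'n) \<Rightarrow> (real \<Rightarrow> real^'n) \<Rightarrow>
    (real \<Rightarrow> real \<Rightarrow> real^'n^'n) \<Rightarrow> real \<Rightarrow> real \<Rightarrow> real \<Rightarrow> (real^'n \<Rightarrow> real) \<Rightarrow> real^'n \<Rightarrow> real" where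
  "evol_Lp A B g U p t s f = (SOME h. h \<in> Lp p (mu B g U t) \<and>
     (\<exists>\<phi> :: nat \<Rightarrow> real^'n \<Rightarrow> real. (\<forall>k. \<phi> k \<in> C_b) \<and>
        (\<lambda>k. Lp_norm p (mu B g U s) (\<lambda>x. \<phi> k x - f x)) \<longlonglongrightarrow> 0 \<and>
        (\<lambda>k. Lp_norm p (mu B g U t) (\<lambda>x. evol A B g t s (\<phi> k) x - h x)) \<longlonglongrightarrow> 0))"

definition decay_exponents :: "(real \<Rightarrow> real^'n^'n) \<Rightarrow> (real \<Rightarrow> real^'n^'n) \<Rightarrow> (real \<Rightarrow> real^'n) \<Rightarrow>
    (real \<Rightarrow> real \<Rightarrow> real^'n^'n) \<Rightarrow> real \<Rightarrow> real set" where
  "decay_exponents A B g U p = {\<omega>. \<exists>M>0. \<forall>s t. s < t \<longrightarrow> (\<forall>f \<in> Lp p (mu B g U s).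
     Lp_norm p (mu B g U t) (\<lambda>x. evol_Lp A B g U p t s f x - (LINT y|mu B g U s. f y))
       \<le> M * exp (\<omega> * (t - s)) * Lp_norm p (mu B g U s) f)}"

text \<open>Members of \<open>L\<^sup>p\<close> are defined only up to null sets, so the gradient is the weak one, as in
  \<open>W\<^sup>1\<^sup>,\<^sup>p(\<real>\<^sup>d, \<mu>\<^sub>t)\<close>; an \<open>L\<^sup>p\<close> bound for it includes that it exists and lies in \<open>L\<^sup>p(\<mu>\<^sub>t)\<close>.\<close>

definition gradient_decay_exponents :: "(real \<Rightarrow> real^'n^'n) \<Rightarrow> (real \<Rightarrow> real^'n^'n) \<Rightarrow>
    (real \<Rightarrow> real^'n) \<Rightarrow> (real \<Rightarrow> real \<Rightarrow> real^'n^'n) \<Rightarrow> real \<Rightarrow> real set" where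
  "gradient_decay_exponents A B g U p = {\<omega>. \<exists>N>0. \<forall>s t. t - s \<ge> 1 \<longrightarrow> (\<forall>f \<in> Lp p (mu B g U s).
     \<exists>F. has_weak_gradient (evol_Lp A B g U p t s f) F \<and> F \<in> Lp p (mu B g U t) \<and>
       Lp_norm p (mu B g U t) F \<le> N * exp (\<omega> * (t - s)) * Lp_norm p (mu B g U s) f)}"

end

theory Submission
  imports Defs "HOL-Probability.Probability"
begin

text \<open>Both sets of exponents equal the set of \<open>\<omega>\<close> for which \<open>\<parallel>U(s,t)\<parallel> \<le> M exp(\<omega>(t - s))\<close> whenever
  \<open>t - s \<ge> 1\<close>, a condition that does not mention \<open>p\<close> and that every \<open>\<omega> > \<omega>\<^sub>0(U)\<close> satisfies.
  By Mehler's formula, \<open>G(t,s)f(x)\<close> is the integral of \<open>f\<close> against a Gaussian measure with mean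
  \<open>U(s,t)x + const\<close> and a covariance \<open>Q(s,t)\<close> independent of \<open>x\<close>.

  Necessity is seen on the linear functions \<open>f(x) = \<langle>x,v\<rangle>\<close>, for which \<open>G(t,s)f - m\<^sub>s(f)\<close> is the centred
  linear function with gradient \<open>U(s,t)\<^sup>* v\<close>. Sufficiency for the gradient: differentiating the kernel
  gives \<open>\<nabla>G(t,s)f(x)\<close> as the integral of \<open>f\<close> against the kernel times a vector of norm at most
  \<open>\<parallel>U(s,t)\<parallel>\<close> times a random variable with moments bounded uniformly in \<open>t - s \<ge> 1\<close>, and Hoelder's
  inequality and the invariance of the \<open>\<mu>\<^sub>t\<close> give the \<open>L\<^sup>p\<close> bound. Sufficiency for
  \<open>G(t,s)f - m\<^sub>s(f)\<close>: combine this with the Poincare inequality in \<open>L\<^sup>p(\<mu>\<^sub>t)\<close>.\<close>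

declare transpose_matrix_vector [simp del]

section \<open>Linear algebra: operator norms, inverses and factors of positive definite
  matrices\<close>

abbreviation opn :: "real^'n^'m \<Rightarrow> real" where
  "opn M \<equiv> onorm (\<lambda>x. M *v x)"

lemma inner_matrix_transpose: "(M *v x) \<bullet> y = x \<bullet> (transpose M *v y)" for M :: "real^'n^'m"
  by (metis dot_lmul_matrix inner_commute transpose_transpose vector_transpose_matrix)

lemma norm_mat_vec_le: "norm (M *v x) \<le> opn M * norm x" for M :: "real^'n^'m"
  by (rule onorm) auto

lemma opn_nonneg: "0 \<le> opn M" for M :: "real^'n^'m"
  by (rule onorm_pos_le) auto

text \<open>From |M^T y|^2 = <M M^T y, y> one factor |M^T y| cancels. Applied to the transpose as
  well, this gives equality.\<close>

lemma opn_transpose_le: "opn (transpose M) \<le> opn M" for M :: "real^'n^'m"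
proof (rule onorm_le)
  fix y
  let ?v = "transpose M *v y"
  have "norm ?v ^ 2 = (M *v ?v) \<bullet> y"
    by (simp add: inner_matrix_transpose power2_norm_eq_inner)
  also have "\<dots> \<le> norm (M *v ?v) * norm y" by (rule norm_cauchy_schwarz)
  also have "\<dots> \<le> (opn M * norm ?v) * norm y"
    by (intro mult_right_mono norm_mat_vec_le) auto
  finally have "norm ?v * norm ?v \<le> (opn M * norm y) * norm ?v" by (simp add: power2_eq_square ac_simps)
  then show "norm ?v \<le> opn M * norm y"
    by (metis mult_nonneg_nonneg mult_right_le_imp_le norm_ge_zero opn_nonneg order.order_iff_strict)
qed

lemma opn_transpose: "opn (transpose M) = opn M" for M :: "real^'n^'m"
  using opn_transpose_le[of M] opn_transpose_le[of "transpose M"] by simp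

text \<open>The \<open>norm\<close> of a matrix is the Euclidean norm of its entries, whereas
  \<open>omega0\<close> is defined with the operator norm. This converts decay of \<open>U\<close>
  into bounds for matrix-valued integrals.\<close>

lemma norm_matrix_le_opn: "norm M \<le> CARD('m) * CARD('n) * opn M" for M :: "real^'n^'m"
proof -
  have "norm M \<le> (\<Sum>i\<in>UNIV. norm (M $ i))" by (simp add: norm_vec_def L2_set_le_sum)
  also have "\<dots> \<le> (\<Sum>i\<in>UNIV. \<Sum>j\<in>UNIV. \<bar>M $ i $ j\<bar>)"
    by (intro sum_mono norm_le_l1_cart)
  also have "\<dots> \<le> (\<Sum>i\<in>(UNIV::'m set). \<Sum>j\<in>(UNIV::'n set). opn M)"
    by (intro sum_mono matrix_component_le_onorm)
  finally show ?thesis by simp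
qed

lemma bounded_bilinear_mat_mult: "bounded_bilinear (\<lambda>(M::real^'n^'m) (N::real^'k^'n). M ** N)"
proof -
  have "bilinear (\<lambda>(M::real^'n^'m) (N::real^'k^'n). M ** N)"
    unfolding bilinear_def
    by (auto intro!: linearI simp: matrix_matrix_mult_def vec_eq_iff algebra_simps sum.distrib sum_distrib_left)
  then show ?thesis by (simp add: bilinear_conv_bounded_bilinear)
qed

lemma bounded_bilinear_mat_vec: "bounded_bilinear (\<lambda>(M::real^'n^'m) x. M *v x)"
proof -
  have "bilinear (\<lambda>(M::real^'n^'m) x. M *v x)"
    unfolding bilinear_def
    by (auto intro!: linearI simp: matrix_vector_mult_def vec_eq_iff algebra_simps sum.distrib sum_distrib_left)
  then show ?thesis by (simp add: bilinear_conv_bounded_bilinear)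
qed

lemma bounded_linear_transpose: "bounded_linear (transpose :: real^'n^'m \<Rightarrow> _)"
  by (intro linear_conv_bounded_linear[THEN iffD1] linearI) (auto simp: transpose_def vec_eq_iff)

lemma bounded_linear_trace: "bounded_linear (trace :: real^'n^'n \<Rightarrow> _)"
  by (intro linear_conv_bounded_linear[THEN iffD1] linearI) (auto simp: trace_def sum.distrib sum_distrib_left)

lemma matrix_inv_mult:
  fixes M :: "real^'n^'n"
  assumes "invertible M"
  shows "M ** matrix_inv M = mat 1" "matrix_inv M ** M = mat 1"
proof -
  have "M ** matrix_inv M = mat 1 \<and> matrix_inv M ** M = mat 1"
    unfolding matrix_inv_def by (rule someI_ex) (use assms in \<open>simp add: invertible_def\<close>)
  then show "M ** matrix_inv M = mat 1" "matrix_inv M ** M = mat 1" by auto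
qed

lemma matrix_inv_unique_right:
  fixes M N :: "real^'n^'n"
  assumes "M ** N = mat 1"
  shows "matrix_inv M = N"
proof -
  have inv: "invertible M" using assms invertible_right_inverse by blast
  have "matrix_inv M = matrix_inv M ** (M ** N)" using assms by simp
  also have "\<dots> = N" by (simp add: matrix_mul_assoc matrix_inv_mult[OF inv])
  finally show ?thesis .
qed

lemma matrix_inv_vec:
  fixes M :: "real^'n^'n"
  assumes "invertible M"
  shows "M *v (matrix_inv M *v x) = x" "matrix_inv M *v (M *v x) = x"
  by (simp_all add: matrix_vector_mul_assoc matrix_inv_mult[OF assms])

lemma invertible_posdef:
  fixes Q :: "real^'n^'n"
  assumes "\<And>v. v \<noteq> 0 \<Longrightarrow> (Q *v v) \<bullet> v > 0"
  shows "invertible Q"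
proof -
  have "\<forall>x. Q *v x = 0 \<longrightarrow> x = 0" using assms by (metis inner_zero_left less_irrefl)
  then show ?thesis by (simp add: invertible_left_inverse matrix_left_invertible_ker)
qed

text \<open>Gram--Schmidt in the inner product of \<open>Q\<close>, one index at a time.\<close>

lemma posdef_orthonormal_family:
  fixes Q :: "real^'n^'n"
  assumes pos: "\<And>v. v \<noteq> 0 \<Longrightarrow> (Q *v v) \<bullet> v > 0" and sym: "transpose Q = Q"
  shows "\<exists>v::'n \<Rightarrow> real^'n. \<forall>i\<in>J. \<forall>j\<in>J. (Q *v v i) \<bullet> v j = (if i = j then 1 else 0)"
proof (induction J rule: finite_induct[OF finite])
  case (2 k J)
  then obtain v :: "'n \<Rightarrow> real^'n"
    where v: "\<forall>i\<in>J. \<forall>j\<in>J. (Q *v v i) \<bullet> v j = (if i = j then 1 else 0)" by blast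
  let ?S = "(\<lambda>i. Q *v v i) ` J"
  \<comment> \<open>Fewer vectors \<open>Q *v v i\<close> than the dimension have been used, so some
    nonzero x is orthogonal to all of them; normalised in the inner product of \<open>Q\<close> it
    becomes the next member of the family.\<close>
  have "dim ?S \<le> card ?S" by (rule dim_le_card') auto
  also have "\<dots> \<le> card J" by (rule card_image_le) auto
  also have "\<dots> < card (insert k J)" using 2 by simp
  also have "\<dots> \<le> DIM(real^'n)" by (simp add: card_mono)
  finally obtain x where x: "x \<noteq> 0" "\<And>y. y \<in> span ?S \<Longrightarrow> orthogonal x y"
    using orthogonal_to_subspace_exists by metis
  have ort: "(Q *v v i) \<bullet> x = 0" if "i \<in> J" for i
    using x(2)[of "Q *v v i"] that by (auto simp: span_base orthogonal_def inner_commute)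
  have ort': "(Q *v x) \<bullet> v i = 0" if "i \<in> J" for i
    using ort[OF that] by (metis inner_commute inner_matrix_transpose sym)
  define r where "r = sqrt ((Q *v x) \<bullet> x)"
  have r: "r > 0" "r * r = (Q *v x) \<bullet> x" using pos[OF x(1)] by (auto simp: r_def)
  define w where "w = (1 / r) *\<^sub>R x"
  have ww: "(Q *v w) \<bullet> w = 1" using r(1) by (simp add: w_def matrix_vector_mult_scaleR r(2)[symmetric])
  have wv: "(Q *v w) \<bullet> v i = 0" "(Q *v v i) \<bullet> w = 0" if "i \<in> J" for i
    using ort[OF that] ort'[OF that] by (auto simp: w_def matrix_vector_mult_scaleR)
  show ?case
    by (rule exI[of _ "v(k := w)"]) (use 2 v ww wv in auto)
qed auto

text \<open>Any factor with \<open>S ** transpose S = Q\<close> carries the standard Gaussian to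
  covariance \<open>Q\<close>. If the rows of \<open>W\<close> are orthonormal for \<open>Q\<close>,
  then W Q W^T = 1, and the inverse of \<open>W\<close> is such a factor.\<close>

lemma posdef_factor:
  fixes Q :: "real^'n^'n"
  assumes pos: "\<And>v. v \<noteq> 0 \<Longrightarrow> (Q *v v) \<bullet> v > 0" and sym: "transpose Q = Q"
  obtains S :: "real^'n^'n" where "invertible S" "S ** transpose S = Q"
proof -
  obtain v :: "'n \<Rightarrow> real^'n" where v: "\<And>i j. (Q *v v i) \<bullet> v j = (if i = j then 1 else 0)"
    using posdef_orthonormal_family[OF pos sym, of UNIV] by auto
  define W where "W = (\<chi> i. v i)"
  have W: "W ** (Q ** transpose W) = mat 1"
  proof -
    have "(W ** (Q ** transpose W)) $ i $ j = (mat 1 :: real^'n^'n) $ i $ j" for i j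
    proof -
      have "(W ** (Q ** transpose W)) $ i $ j = v i \<bullet> (Q *v v j)"
        by (simp add: W_def matrix_matrix_mult_def matrix_vector_mult_def transpose_def inner_vec_def)
      then show ?thesis using v[of j i] by (simp add: inner_commute mat_def)
    qed
    then show ?thesis by (simp add: vec_eq_iff)
  qed
  have invW: "invertible W" using W invertible_right_inverse by blast
  have invT: "invertible (transpose W)" using invW by (rule transpose_invertible)
  define S where "S = matrix_inv W"
  have SW: "W ** S = mat 1" "S ** W = mat 1" unfolding S_def by (rule matrix_inv_mult[OF invW])+
  have TS: "transpose W ** transpose S = mat 1"
    by (metis SW(2) matrix_transpose_mul transpose_mat)
  have "S ** transpose S = S ** (W ** (Q ** transpose W)) ** transpose S" by (simp add: W)
  also have "\<dots> = (S ** W) ** Q ** (transpose W ** transpose S)" by (simp add: matrix_mul_assoc)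
  also have "\<dots> = Q" by (simp add: SW TS)
  finally have "S ** transpose S = Q" .
  moreover have "invertible S" using SW invertible_def by blast
  ultimately show ?thesis using that by blast
qed

lemma det_factor:
  fixes S Q :: "real^'n^'n"
  assumes "S ** transpose S = Q"
  shows "det Q = (det S)\<^sup>2"
  using assms by (metis det_mul det_transpose power2_eq_square)

text \<open>The inverse of \<open>Q\<close> is S^{-T} S^{-1}, so the exponent of a Gaussian density
  becomes |S^{-1}(x - m)|^2.\<close>

lemma inverse_factor:
  fixes S Q :: "real^'n^'n"
  assumes "invertible S" "S ** transpose S = Q"
  shows "invertible Q" "(matrix_inv Q *v x) \<bullet> y = (matrix_inv S *v x) \<bullet> (matrix_inv S *v y)"
proof -
  have T: "transpose S ** transpose (matrix_inv S) = mat 1"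
    by (metis assms(1) matrix_inv_mult(2) matrix_transpose_mul transpose_mat)
  have "Q ** (transpose (matrix_inv S) ** matrix_inv S) = S ** (transpose S ** transpose (matrix_inv S)) ** matrix_inv S"
    by (simp add: assms(2)[symmetric] matrix_mul_assoc)
  then have e: "Q ** (transpose (matrix_inv S) ** matrix_inv S) = mat 1"
    by (simp add: T matrix_inv_mult[OF assms(1)])
  show "invertible Q" using e invertible_right_inverse by blast
  show "(matrix_inv Q *v x) \<bullet> y = (matrix_inv S *v x) \<bullet> (matrix_inv S *v y)"
    unfolding matrix_inv_unique_right[OF e]
    by (simp add: matrix_vector_mul_assoc[symmetric] inner_matrix_transpose)
qed

text \<open>|S^T v|^2 = <Q v, v>, so an upper bound for the quadratic form bounds the transpose of
  any factor, and thus the factor.\<close>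

lemma opn_factor_le:
  fixes S Q :: "real^'n^'n"
  assumes "S ** transpose S = Q" "c \<ge> 0" "\<And>v. (Q *v v) \<bullet> v \<le> c * (norm v)\<^sup>2"
  shows "opn S \<le> sqrt c"
proof -
  have "norm (transpose S *v v) \<le> sqrt c * norm v" for v
  proof -
    have "(norm (transpose S *v v))\<^sup>2 = (Q *v v) \<bullet> v"
      by (simp add: assms(1)[symmetric] matrix_vector_mul_assoc[symmetric] inner_matrix_transpose power2_norm_eq_inner)
    also have "\<dots> \<le> c * (norm v)\<^sup>2" by (rule assms)
    finally have "sqrt ((norm (transpose S *v v))\<^sup>2) \<le> sqrt (c * (norm v)\<^sup>2)" by (rule real_sqrt_le_mono)
    then show ?thesis by (simp add: real_sqrt_mult)
  qed
  then have "opn (transpose S) \<le> sqrt c" by (rule onorm_le)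
  then show ?thesis by (simp only: opn_transpose)
qed

section \<open>Gaussian measures\<close>

definition gauss_density :: "real^'n^'n \<Rightarrow> real^'n \<Rightarrow> real^'n \<Rightarrow> real" where
  "gauss_density Q m x = (2 * pi) powr (- real CARD('n) / 2) * det Q powr (- 1 / 2) *
      exp (- 1 / 2 * ((matrix_inv Q *v (x - m)) \<bullet> (x - m)))"

definition normal :: "real^'n^'n \<Rightarrow> real^'n \<Rightarrow> (real^'n) measure" where
  "normal Q m = density lborel (\<lambda>x. ennreal (gauss_density Q m x))"

definition std_density :: "real^'n \<Rightarrow> real" where
  "std_density x = (2 * pi) powr (- real CARD('n) / 2) * exp (- 1 / 2 * (norm x)\<^sup>2)"

definition stdg :: "(real^'n) measure" where
  "stdg = density lborel (\<lambda>x. ennreal (std_density x))"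

lemma sets_stdg [measurable_cong, simp]: "sets stdg = sets borel" by (simp add: stdg_def)
lemma space_stdg [simp]: "space stdg = UNIV" by (simp add: stdg_def)
lemma sets_normal [measurable_cong, simp]: "sets (normal Q m) = sets borel" by (simp add: normal_def)
lemma space_normal [simp]: "space (normal Q m) = UNIV" by (simp add: normal_def)

lemma mat_vec_measurable [measurable]: "(\<lambda>x. M *v x) \<in> borel_measurable borel" for M :: "real^'n^'m"
  by (intro borel_measurable_continuous_onI linear_continuous_on) auto

lemma gauss_density_nonneg [simp]: "0 \<le> gauss_density Q m x" by (simp add: gauss_density_def)
lemma std_density_nonneg [simp]: "0 \<le> std_density x" by (simp add: std_density_def)

lemma gauss_density_measurable [measurable]: "gauss_density Q m \<in> borel_measurable borel"
  unfolding gauss_density_def by measurable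
lemma std_density_measurable [measurable]: "std_density \<in> borel_measurable borel"
  unfolding std_density_def by measurable

text \<open>Reduces the total mass of \<open>stdg\<close> to the one-dimensional normal density by
  Fubini.\<close>

lemma std_density_eq_prod: "std_density x = (\<Prod>b\<in>Basis. normal_density 0 1 (x \<bullet> b))"
  for x :: "real^'n"
proof -
  have "(\<Prod>b\<in>Basis. normal_density 0 1 (x \<bullet> b)) = (\<Prod>b\<in>Basis. (1 / sqrt (2 * pi)) * exp (- (x \<bullet> b)\<^sup>2 / 2))"
    by (simp add: normal_density_def)
  also have "\<dots> = (1 / sqrt (2 * pi)) ^ CARD('n) * exp (\<Sum>b\<in>Basis. - (x \<bullet> b)\<^sup>2 / 2)"
    unfolding prod.distrib by (simp add: exp_sum)
  also have "1 / sqrt (2 * pi) = (2 * pi) powr (- 1 / 2)"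
    by (simp add: powr_minus_divide powr_half_sqrt)
  also have "((2 * pi) powr (- 1 / 2)) ^ CARD('n) = (2 * pi) powr (real CARD('n) * (- 1 / 2))"
    by (rule powr_power) auto
  also have "(\<Sum>b\<in>Basis. - (x \<bullet> b)\<^sup>2 / 2) = - 1 / 2 * (\<Sum>b\<in>Basis. (x \<bullet> b)\<^sup>2)"
    by (simp add: sum_negf sum_divide_distrib)
  also have "(\<Sum>b\<in>Basis. (x \<bullet> b)\<^sup>2) = (norm x)\<^sup>2"
    unfolding power2_norm_eq_inner euclidean_inner[of x x] by (simp add: power2_eq_square)
  finally show ?thesis by (simp add: std_density_def)
qed

lemma prob_space_stdg: "prob_space (stdg :: (real^'n) measure)"
proof
  have "emeasure (stdg :: (real^'n) measure) (space stdg) = (\<integral>\<^sup>+x. ennreal (std_density (x::real^'n)) \<partial>lborel)"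
    by (simp add: stdg_def emeasure_density)
  also have "\<dots> = (\<integral>\<^sup>+x. (\<Prod>b\<in>Basis. ennreal (normal_density 0 1 ((x::real^'n) \<bullet> b))) \<partial>lborel)"
    by (simp add: std_density_eq_prod prod_ennreal)
  also have "\<dots> = (\<Prod>b\<in>(Basis::(real^'n) set). (\<integral>\<^sup>+x. ennreal (normal_density 0 1 x) \<partial>lborel))"
    by (rule nn_integral_lborel_prod) auto
  also have "(\<integral>\<^sup>+x. ennreal (normal_density 0 1 x) \<partial>lborel) = 1"
    using prob_space.emeasure_space_1[OF prob_space_normal_density[of 1 0]] by (simp add: emeasure_density)
  finally show "emeasure (stdg :: (real^'n) measure) (space stdg) = 1" by simp
qed

interpretation stdg: prob_space "stdg :: (real^'n) measure" by (rule prob_space_stdg)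

lemma sigma_finite_stdg: "sigma_finite_measure (stdg :: (real^'n) measure)"
  by (rule stdg.sigma_finite_measure_axioms)

subsection \<open>Linear substitutions\<close>

lemma nn_integral_lborel_translate:
  fixes a :: "'a::euclidean_space"
  assumes [measurable]: "f \<in> borel_measurable borel"
  shows "(\<integral>\<^sup>+x. f (a + x) \<partial>lborel) = (\<integral>\<^sup>+x. f x \<partial>lborel)"
  by (subst (2) lborel_distr_plus[of a, symmetric]) (simp add: nn_integral_distr)

lemma prod_Basis_cart: "(\<Prod>b\<in>(Basis :: (real^'n) set). f b) = (\<Prod>i\<in>UNIV. f (axis i 1))"
proof -
  have "(Basis :: (real^'n) set) = range (\<lambda>i. axis i 1)" by (auto simp: Basis_vec_def)
  then show ?thesis unfolding \<open>Basis = _\<close> by (subst prod.reindex) (auto simp: inj_on_def axis_eq_axis)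
qed

text \<open>Integrate over the coordinate m first: with the other coordinates fixed, the shear is a
  translation in that coordinate.\<close>

lemma nn_integral_lborel_shear:
  fixes f :: "real^'n \<Rightarrow> ennreal"
  assumes mn: "m \<noteq> n" and [measurable]: "f \<in> borel_measurable borel"
  shows "(\<integral>\<^sup>+x. f (x + (c * x $ n) *\<^sub>R axis m 1) \<partial>lborel) = (\<integral>\<^sup>+x. f x \<partial>lborel)"
proof -
  interpret product_sigma_finite "\<lambda>_::real^'n. lborel :: real measure"
    by standard
  let ?e = "axis m 1 :: real^'n" and ?e' = "axis n 1 :: real^'n"
  let ?I = "Basis - {?e}"
  let ?T = "\<lambda>x. \<Sum>b\<in>Basis. x b *\<^sub>R (b :: real^'n)"
  have ee: "?e \<in> Basis" "?e' \<in> Basis" "?e \<noteq> ?e'" using mn by (auto simp: Basis_vec_def axis_eq_axis)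
  have B: "Basis = insert ?e ?I" using ee by auto
  have [measurable]: "?T \<in> borel_measurable (\<Pi>\<^sub>M b\<in>Basis. lborel)"
    by measurable
  have split: "(\<integral>\<^sup>+x. h x \<partial>lborel) = (\<integral>\<^sup>+x. (\<integral>\<^sup>+y. h (?T (x(?e := y))) \<partial>lborel) \<partial>(\<Pi>\<^sub>M b\<in>?I. lborel))"
    if [measurable]: "h \<in> borel_measurable borel" for h :: "real^'n \<Rightarrow> ennreal"
  proof -
    have "(\<integral>\<^sup>+x. h x \<partial>lborel) = (\<integral>\<^sup>+x. h (?T x) \<partial>(\<Pi>\<^sub>M b\<in>Basis. lborel))"
      by (subst lborel_eq) (simp add: nn_integral_distr)
    also have "\<dots> = (\<integral>\<^sup>+x. h (?T x) \<partial>(\<Pi>\<^sub>M b\<in>insert ?e ?I. lborel))"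
      using B by simp
    also have "\<dots> = (\<integral>\<^sup>+x. (\<integral>\<^sup>+y. h (?T (x(?e := y))) \<partial>lborel) \<partial>(\<Pi>\<^sub>M b\<in>?I. lborel))"
      by (rule product_nn_integral_insert) (auto simp: B[symmetric])
    finally show ?thesis .
  qed
  have T: "?T (x(?e := y)) = (\<Sum>b\<in>?I. x b *\<^sub>R b) + y *\<^sub>R ?e" for x y
  proof -
    have "?T (x(?e := y)) = (x(?e := y)) ?e *\<^sub>R ?e + (\<Sum>b\<in>?I. (x(?e := y)) b *\<^sub>R b)"
      using ee by (intro sum.remove) auto
    also have "(\<Sum>b\<in>?I. (x(?e := y)) b *\<^sub>R b) = (\<Sum>b\<in>?I. x b *\<^sub>R b)" by (intro sum.cong) auto
    finally show ?thesis by simp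
  qed
  have Tn: "?T (x(?e := y)) $ n = x ?e'" for x y
  proof -
    have "?T (x(?e := y)) $ n = ?T (x(?e := y)) \<bullet> ?e'" by (simp add: inner_axis)
    also have "\<dots> = x ?e'" using ee by (simp only: inner_sum_left_Basis fun_upd_other)
    finally show ?thesis .
  qed
  have "(\<integral>\<^sup>+x. f (x + (c * x $ n) *\<^sub>R axis m 1) \<partial>lborel)
      = (\<integral>\<^sup>+x. (\<integral>\<^sup>+y. f ((\<Sum>b\<in>?I. x b *\<^sub>R b) + (c * x ?e' + y) *\<^sub>R ?e) \<partial>lborel) \<partial>(\<Pi>\<^sub>M b\<in>?I. lborel))"
    by (subst split, measurable) (simp only: Tn, simp only: T, simp add: algebra_simps)
  also have "\<dots> = (\<integral>\<^sup>+x. (\<integral>\<^sup>+y. f ((\<Sum>b\<in>?I. x b *\<^sub>R b) + y *\<^sub>R ?e) \<partial>lborel) \<partial>(\<Pi>\<^sub>M b\<in>?I. lborel))"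
    by (intro nn_integral_cong nn_integral_lborel_translate) measurable
  also have "\<dots> = (\<integral>\<^sup>+x. f x \<partial>lborel)"
    by (subst split) (simp_all only: T assms)
  finally show ?thesis .
qed

lemma nn_integral_lborel_permute:
  fixes f :: "real^'n \<Rightarrow> ennreal"
  assumes p: "p permutes (UNIV :: 'n set)" and [measurable]: "f \<in> borel_measurable borel"
  shows "(\<integral>\<^sup>+x. f (\<chi> i. x $ p i) \<partial>lborel) = (\<integral>\<^sup>+x. f x \<partial>lborel)"
proof -
  let ?h = "\<lambda>x::real^'n. \<chi> i. x $ p i"
  have [measurable]: "?h \<in> borel_measurable borel"
    by (intro borel_measurable_continuous_onI continuous_intros)
  have pi: "p (inv p i) = i" "inv p (p i) = i" for i using permutes_inverses[OF p] by auto
  have "lborel = distr lborel borel ?h"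
  proof (rule lborel_eqI)
    fix l u :: "real^'n" assume lu: "\<And>b. b \<in> Basis \<Longrightarrow> l \<bullet> b \<le> u \<bullet> b"
    have lu': "l $ i \<le> u $ i" for i using lu[of "axis i 1"] by (simp add: inner_axis)
    let ?l = "\<chi> i. l $ inv p i" and ?u = "\<chi> i. u $ inv p i"
    have "?h -` box l u = box ?l ?u"
    proof -
      have "(\<forall>i. l $ i < x $ p i \<and> x $ p i < u $ i) \<longleftrightarrow> (\<forall>i. l $ inv p i < x $ i \<and> x $ i < u $ inv p i)" for x :: "real^'n"
        by (metis pi)
      then show ?thesis by (auto simp: mem_box_cart)
    qed
    moreover have "emeasure lborel (box ?l ?u) = (\<Prod>b\<in>Basis. (?u - ?l) \<bullet> b)"
      using lu' by (intro emeasure_lborel_box) (auto simp: Basis_vec_def inner_axis)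
    moreover have "(\<Prod>b\<in>Basis. (?u - ?l) \<bullet> b) = (\<Prod>b\<in>Basis. (u - l) \<bullet> b)"
      using prod.permute[OF permutes_inv[OF p], of "\<lambda>i. u $ i - l $ i"]
      by (simp add: prod_Basis_cart inner_axis o_def)
    ultimately show "emeasure (distr lborel borel ?h) (box l u) = (\<Prod>b\<in>Basis. (u - l) \<bullet> b)"
      by (simp add: emeasure_distr)
  qed simp
  then have "(\<integral>\<^sup>+x. f x \<partial>lborel) = (\<integral>\<^sup>+x. f x \<partial>distr lborel borel ?h)" by simp
  then show ?thesis by (simp add: nn_integral_distr)
qed

text \<open>The change of variables theorems of the library need a well-ordered index type, hence the
  detour through elementary matrices.\<close>

definition scales_lborel :: "real^'n^'n \<Rightarrow> bool" where
  "scales_lborel L \<longleftrightarrow> (det L \<noteq> 0 \<longrightarrow> (\<forall>f\<in>borel_measurable borel.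
     (\<integral>\<^sup>+x. f x \<partial>lborel) = ennreal \<bar>det L\<bar> * (\<integral>\<^sup>+x. f (L *v x) \<partial>lborel)))"

text \<open>The condition \<open>det L \<noteq> 0\<close> inside \<open>scales_lborel\<close> lets
  the induction pass through singular matrices: a zero row is vacuous, and a product with nonzero
  determinant has two such factors. Diagonal matrices scale the coordinates; swaps and shears
  preserve the measure.\<close>

lemma nn_integral_lborel_linear_nonzero_det:
  fixes L :: "real^'n^'n"
  shows "scales_lborel L"
proof (rule induct_matrix_elementary[of scales_lborel])
  fix M N :: "real^'n^'n"
  assume M: "scales_lborel M"
    and N: "scales_lborel N"
  show "scales_lborel (M ** N)"
    unfolding scales_lborel_def
  proof (intro impI ballI)
    fix f :: "real^'n \<Rightarrow> ennreal" assume nz: "det (M ** N) \<noteq> 0" and [measurable]: "f \<in> borel_measurable borel"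
    have "(\<integral>\<^sup>+x. f x \<partial>lborel) = ennreal \<bar>det M\<bar> * (\<integral>\<^sup>+x. f (M *v x) \<partial>lborel)"
      by (rule M[unfolded scales_lborel_def, rule_format]) (use nz in \<open>auto simp: det_mul\<close>)
    also have "(\<integral>\<^sup>+x. f (M *v x) \<partial>lborel) = ennreal \<bar>det N\<bar> * (\<integral>\<^sup>+x. f (M *v (N *v x)) \<partial>lborel)"
      by (rule N[unfolded scales_lborel_def, rule_format]) (use nz in \<open>auto simp: det_mul\<close>)
    finally show "(\<integral>\<^sup>+x. f x \<partial>lborel) = ennreal \<bar>det (M ** N)\<bar> * (\<integral>\<^sup>+x. f ((M ** N) *v x) \<partial>lborel)"
      by (simp add: det_mul abs_mult ennreal_mult mult.assoc matrix_vector_mul_assoc)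
  qed
next
  fix M :: "real^'n^'n" and i assume "row i M = 0"
  then show "scales_lborel M"
    unfolding scales_lborel_def using det_zero_row(2) by blast
next
  fix M :: "real^'n^'n" assume diag: "\<And>i j. i \<noteq> j \<Longrightarrow> M $ i $ j = 0"
  have dM: "det M = (\<Prod>i\<in>UNIV. M $ i $ i)" by (rule det_diagonal) (use diag in auto)
  show "scales_lborel M"
    unfolding scales_lborel_def
  proof (intro impI ballI)
    fix f :: "real^'n \<Rightarrow> ennreal" assume nz: "det M \<noteq> 0" and [measurable]: "f \<in> borel_measurable borel"
    define c where "c b = (M *v b) \<bullet> b" for b :: "real^'n"
    have c: "c (axis i 1) = M $ i $ i" for i
      by (simp add: c_def inner_axis matrix_vector_mult_basis column_def)
    have cnz: "c b \<noteq> 0" if b: "b \<in> Basis" for b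
    proof -
      obtain i where "b = axis i 1" using b by (auto simp: Basis_vec_def)
      then show ?thesis using nz c[of i] by (simp add: dM)
    qed
    have Mx: "(\<Sum>j\<in>Basis. (c j * (x \<bullet> j)) *\<^sub>R j) = M *v x" for x :: "real^'n"
    proof -
      have "(M *v x) $ i = M $ i $ i * x $ i" for i
      proof -
        have "(M *v x) $ i = (\<Sum>j\<in>UNIV. M $ i $ j * x $ j)" by (simp add: matrix_vector_mult_def)
        also have "\<dots> = (\<Sum>j\<in>UNIV. if j = i then M $ i $ i * x $ i else 0)"
          by (rule sum.cong) (use diag in auto)
        finally have "(M *v x) $ i = (\<Sum>j\<in>UNIV. if j = i then M $ i $ i * x $ i else 0)" .
        then show ?thesis by simp
      qed
      then have "(M *v x) \<bullet> axis i 1 = c (axis i 1) * (x \<bullet> axis i 1)" for i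
        unfolding c by (simp add: inner_axis)
      then have "(M *v x) \<bullet> j = c j * (x \<bullet> j)" if "j \<in> Basis" for j
        using that by (auto simp: Basis_vec_def)
      then have "(\<Sum>j\<in>Basis. (c j * (x \<bullet> j)) *\<^sub>R j) = (\<Sum>j\<in>Basis. ((M *v x) \<bullet> j) *\<^sub>R j)"
        by (intro sum.cong) auto
      then show ?thesis by (simp add: euclidean_representation)
    qed
    have "lborel = density (distr lborel borel (\<lambda>x. 0 + (\<Sum>j\<in>Basis. (c j * (x \<bullet> j)) *\<^sub>R j))) (\<lambda>_. (\<Prod>j\<in>Basis. \<bar>c j\<bar>))"
      by (rule lborel_affine_euclidean) (use cnz in auto)
    also have "\<dots> = density (distr lborel borel (\<lambda>x. M *v x)) (\<lambda>_. ennreal \<bar>det M\<bar>)"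
      by (simp add: Mx prod_Basis_cart c dM abs_prod)
    finally have "(\<integral>\<^sup>+x. f x \<partial>lborel) = (\<integral>\<^sup>+x. f x \<partial>density (distr lborel borel (\<lambda>x. M *v x)) (\<lambda>_. ennreal \<bar>det M\<bar>))"
      by simp
    also have "\<dots> = ennreal \<bar>det M\<bar> * (\<integral>\<^sup>+x. f (M *v x) \<partial>lborel)"
      by (simp add: nn_integral_density nn_integral_distr nn_integral_cmult)
    finally show "(\<integral>\<^sup>+x. f x \<partial>lborel) = ennreal \<bar>det M\<bar> * (\<integral>\<^sup>+x. f (M *v x) \<partial>lborel)" .
  qed
next
  fix m n :: 'n assume "m \<noteq> n"
  let ?p = "Transposition.transpose m n"
  let ?M = "(\<chi> i j. mat 1 $ i $ ?p j) :: real^'n^'n"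
  have p: "?p permutes UNIV" by (rule permutes_swap_id) auto
  have d: "\<bar>det ?M\<bar> = 1"
    by (simp add: det_permute_columns[OF p] sign_swap_id abs_mult)
  have "(?M *v x) $ i = x $ ?p i" for x i
  proof -
    have "(?M *v x) $ i = (\<Sum>j\<in>UNIV. mat 1 $ i $ ?p j * x $ j)" by (simp add: matrix_vector_mult_def)
    also have "\<dots> = (\<Sum>j\<in>UNIV. if j = ?p i then x $ j else 0)"
      by (rule sum.cong) (auto simp: mat_def)
    finally have "(?M *v x) $ i = (\<Sum>j\<in>UNIV. if j = ?p i then x $ j else 0)" .
    then show ?thesis by simp
  qed
  then have M: "?M *v x = (\<chi> i. x $ ?p i)" for x by (simp add: vec_eq_iff)
  show "scales_lborel ?M"
    unfolding scales_lborel_def M d using nn_integral_lborel_permute[OF p] by simp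
next
  fix m n :: 'n and c assume mn: "m \<noteq> n"
  let ?M = "(\<chi> i j. if i = m \<and> j = n then c else of_bool (i = j)) :: real^'n^'n"
  have "?M = (\<chi> k. if k = m then row m (mat 1) + c *s row n (mat 1) else row k (mat 1))"
    using mn by (auto simp: vec_eq_iff row_def mat_def)
  then have d: "det ?M = 1" using det_row_operation[OF mn, of "mat 1" c] by simp
  have M: "?M *v x = x + (c * x $ n) *\<^sub>R axis m 1" for x
  proof -
    have "(?M *v x) $ i = (x + (c * x $ n) *\<^sub>R axis m 1) $ i" for i
    proof -
      have "(?M *v x) $ i = (\<Sum>j\<in>UNIV. (if i = m \<and> j = n then c else of_bool (i = j)) * x $ j)"
        by (simp add: matrix_vector_mult_def)
      also have "\<dots> = (\<Sum>j\<in>UNIV. (if j = i then x $ i else 0) + (if j = n then (if i = m then c * x $ n else 0) else 0))"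
        by (rule sum.cong) (use mn in auto)
      finally show ?thesis by (simp add: sum.distrib axis_def)
    qed
    then show ?thesis by (simp add: vec_eq_iff)
  qed
  show "scales_lborel ?M"
    unfolding scales_lborel_def M d using nn_integral_lborel_shear[OF mn] by simp
qed

lemma nn_integral_lborel_linear:
  fixes L :: "real^'n^'n"
  assumes "invertible L" and "f \<in> borel_measurable borel"
  shows "(\<integral>\<^sup>+x. f x \<partial>lborel) = ennreal \<bar>det L\<bar> * (\<integral>\<^sup>+x. f (L *v x) \<partial>lborel)"
  by (rule nn_integral_lborel_linear_nonzero_det[unfolded scales_lborel_def, rule_format]) (use assms in \<open>auto simp: invertible_det_nz\<close>)

lemma nn_integral_lborel_affine:
  fixes a :: "'a::euclidean_space"
  assumes c: "c \<noteq> 0" and [measurable]: "f \<in> borel_measurable borel"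
  shows "(\<integral>\<^sup>+x. f x \<partial>lborel) = ennreal (\<bar>c\<bar> ^ DIM('a)) * (\<integral>\<^sup>+x. f (a + c *\<^sub>R x) \<partial>lborel)"
  by (subst lborel_affine[OF c, of a]) (simp add: nn_integral_density nn_integral_distr nn_integral_cmult)

text \<open>The Jacobian of z -> m + S z cancels the normalisation, because (det Q)^{-1/2} = 1 /
  |det S|.\<close>

lemma gauss_density_factor:
  fixes S Q :: "real^'n^'n"
  assumes S: "invertible S" "S ** transpose S = Q"
  shows "\<bar>det S\<bar> * gauss_density Q m (m + S *v z) = std_density z"
proof -
  have "(det S)\<^sup>2 powr (- 1 / 2) = inverse \<bar>det S\<bar>"
    by (simp add: powr_minus powr_half_sqrt)
  moreover have "det S \<noteq> 0" using S(1) by (simp add: invertible_det_nz)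
  ultimately show ?thesis
    by (simp add: gauss_density_def std_density_def det_factor[OF S(2)] inverse_factor[OF S] matrix_inv_vec[OF S(1)] power2_norm_eq_inner)
qed

lemma nn_integral_normal:
  fixes S Q :: "real^'n^'n"
  assumes S: "invertible S" "S ** transpose S = Q" and [measurable]: "f \<in> borel_measurable borel"
  shows "(\<integral>\<^sup>+x. f x \<partial>normal Q m) = (\<integral>\<^sup>+z. f (m + S *v z) \<partial>stdg)"
proof -
  have "(\<integral>\<^sup>+x. f x \<partial>normal Q m) = (\<integral>\<^sup>+x. ennreal (gauss_density Q m x) * f x \<partial>lborel)"
    by (simp add: normal_def nn_integral_density)
  also have "\<dots> = (\<integral>\<^sup>+x. ennreal (gauss_density Q m (m + x)) * f (m + x) \<partial>lborel)"
    by (rule nn_integral_lborel_translate[symmetric]) measurable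
  also have "\<dots> = ennreal \<bar>det S\<bar> * (\<integral>\<^sup>+z. ennreal (gauss_density Q m (m + S *v z)) * f (m + S *v z) \<partial>lborel)"
    by (rule nn_integral_lborel_linear[OF S(1)]) measurable
  also have "\<dots> = (\<integral>\<^sup>+z. ennreal (\<bar>det S\<bar> * gauss_density Q m (m + S *v z)) * f (m + S *v z) \<partial>lborel)"
    by (subst nn_integral_cmult[symmetric]) (auto simp: ennreal_mult mult.assoc)
  also have "\<dots> = (\<integral>\<^sup>+z. f (m + S *v z) \<partial>stdg)"
    by (simp add: gauss_density_factor[OF S] stdg_def nn_integral_density)
  finally show ?thesis .
qed

lemma normal_eq_distr:
  fixes S Q :: "real^'n^'n"
  assumes S: "invertible S" "S ** transpose S = Q"
  shows "normal Q m = distr stdg borel (\<lambda>z. m + S *v z)"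
proof (rule measure_eqI)
  fix X assume "X \<in> sets (normal Q m)"
  then have [measurable]: "X \<in> sets borel" by simp
  have "emeasure (normal Q m) X = (\<integral>\<^sup>+x. indicator X x \<partial>normal Q m)" by simp
  also have "\<dots> = (\<integral>\<^sup>+x. indicator X (m + S *v x) \<partial>stdg)"
    by (rule nn_integral_normal[OF S]) simp
  also have "\<dots> = (\<integral>\<^sup>+x. indicator X x \<partial>distr stdg borel (\<lambda>z. m + S *v z))"
    by (subst nn_integral_distr) auto
  finally show "emeasure (normal Q m) X = emeasure (distr stdg borel (\<lambda>z. m + S *v z)) X" by simp
qed simp

lemma prob_space_normal:
  fixes S Q :: "real^'n^'n"
  assumes S: "invertible S" "S ** transpose S = Q"
  shows "prob_space (normal Q m)"
  unfolding normal_eq_distr[OF S] by (rule stdg.prob_space_distr) simp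

subsection \<open>Convolution and rotation\<close>

text \<open>Completing the square. For independent standard Gaussians x, z and w = M x + N z, the
  vector M^T w is the conditional mean of x given w. In terms of w and y = x - M^T w the exponent of
  the joint density has no mixed term.\<close>

lemma convolution_exponent:
  fixes M N :: "real^'n^'n"
  assumes MN: "M ** transpose M + N ** transpose N = mat 1" and N: "invertible N"
  shows "(norm (transpose M *v w + y))\<^sup>2 + (norm (matrix_inv N *v (w - M *v (transpose M *v w + y))))\<^sup>2
     = (norm w)\<^sup>2 + (norm y)\<^sup>2 + (norm (matrix_inv N *v (M *v y)))\<^sup>2"
proof -
  define z' where "z' = transpose N *v w"
  define u where "u = matrix_inv N *v (M *v y)"
  have Nu: "N *v u = M *v y" by (simp add: u_def matrix_inv_vec[OF N])
  have w: "M *v (transpose M *v w) + N *v z' = w"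
    by (metis MN matrix_vector_mul_assoc matrix_vector_mul_lid matrix_vector_mult_add_rdistrib z'_def)
  have "w - M *v (transpose M *v w + y) = N *v (z' - u)"
    using w Nu by (simp add: matrix_vector_right_distrib matrix_vector_mult_diff_distrib algebra_simps)
  then have z: "matrix_inv N *v (w - M *v (transpose M *v w + y)) = z' - u"
    by (simp add: matrix_inv_vec[OF N])
  have c1: "(transpose M *v w) \<bullet> y = w \<bullet> (M *v y)" and c2: "z' \<bullet> u = w \<bullet> (M *v y)"
    by (simp_all add: inner_matrix_transpose z'_def Nu)
  have n: "(transpose M *v w) \<bullet> (transpose M *v w) + z' \<bullet> z' = w \<bullet> w"
    using arg_cong[OF w, of "\<lambda>v. v \<bullet> w"] by (simp add: inner_matrix_transpose z'_def inner_add_left)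
  show ?thesis unfolding z u_def[symmetric]
    using c1 c2 n by (simp add: power2_norm_eq_inner inner_add_left inner_add_right inner_diff_left inner_diff_right inner_commute)
qed

lemma nn_integral_stdg:
  "f \<in> borel_measurable borel \<Longrightarrow> (\<integral>\<^sup>+x. f x \<partial>stdg) = (\<integral>\<^sup>+x. ennreal (std_density x) * f x \<partial>lborel)"
  by (simp add: stdg_def nn_integral_density)

text \<open>In the variables w and y the joint density splits into \<open>std_density w\<close>
  times a function \<open>h\<close> of y. The y-integral is thus a constant independent of
  \<open>F\<close>; its value is read off afterwards from \<open>F\<close> = 1.\<close>

lemma stdg_convolution_aux:
  fixes M N :: "real^'n^'n"
  assumes MN: "M ** transpose M + N ** transpose N = mat 1" and N: "invertible N"
  shows "\<exists>C. \<forall>F\<in>borel_measurable borel. (\<integral>\<^sup>+x. (\<integral>\<^sup>+z. F (M *v x + N *v z) \<partial>stdg) \<partial>stdg) = C * (\<integral>\<^sup>+w. F w \<partial>stdg)"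
proof -
  let ?I = "matrix_inv N"
  have I: "invertible ?I" using matrix_inv_mult[OF N] invertible_def by blast
  define h where "h y = std_density y * exp (- 1 / 2 * (norm (?I *v (M *v y)))\<^sup>2)" for y :: "real^'n"
  have [measurable]: "h \<in> borel_measurable borel" unfolding h_def by measurable
  have hn: "0 \<le> h y" for y by (simp add: h_def)
  define C where "C = ennreal \<bar>det ?I\<bar> * (\<integral>\<^sup>+y. ennreal (h y) \<partial>lborel)"
  have key: "std_density (transpose M *v w + y) * std_density (?I *v (w - M *v (transpose M *v w + y))) = std_density w * h y" for w y
  proof -
    have "exp (- 1 / 2 * (norm (transpose M *v w + y))\<^sup>2) * exp (- 1 / 2 * (norm (?I *v (w - M *v (transpose M *v w + y))))\<^sup>2)
       = exp (- 1 / 2 * ((norm (transpose M *v w + y))\<^sup>2 + (norm (?I *v (w - M *v (transpose M *v w + y))))\<^sup>2))"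
      by (simp add: exp_add[symmetric] algebra_simps)
    also have "\<dots> = exp (- 1 / 2 * (norm w)\<^sup>2) * exp (- 1 / 2 * (norm y)\<^sup>2) * exp (- 1 / 2 * (norm (?I *v (M *v y)))\<^sup>2)"
      unfolding convolution_exponent[OF MN N] by (simp add: exp_add[symmetric] algebra_simps)
    finally show ?thesis by (simp add: std_density_def h_def)
  qed
  have "(\<integral>\<^sup>+x. (\<integral>\<^sup>+z. F (M *v x + N *v z) \<partial>stdg) \<partial>stdg) = C * (\<integral>\<^sup>+w. F w \<partial>stdg)"
    if [measurable]: "F \<in> borel_measurable borel" for F
  proof -
    have inner: "(\<integral>\<^sup>+z. F (M *v x + N *v z) \<partial>stdg) = ennreal \<bar>det ?I\<bar> * (\<integral>\<^sup>+w. ennreal (std_density (?I *v (w - M *v x))) * F w \<partial>lborel)" for x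
    proof -
      have "(\<integral>\<^sup>+z. F (M *v x + N *v z) \<partial>stdg) = (\<integral>\<^sup>+z. ennreal (std_density z) * F (M *v x + N *v z) \<partial>lborel)"
        by (rule nn_integral_stdg) measurable
      also have "\<dots> = ennreal \<bar>det ?I\<bar> * (\<integral>\<^sup>+v. ennreal (std_density (?I *v v)) * F (M *v x + v) \<partial>lborel)"
        by (subst nn_integral_lborel_linear[OF I]) (simp_all add: matrix_inv_vec[OF N])
      also have "(\<integral>\<^sup>+v. ennreal (std_density (?I *v v)) * F (M *v x + v) \<partial>lborel) = (\<integral>\<^sup>+w. ennreal (std_density (?I *v (w - M *v x))) * F w \<partial>lborel)"
        by (subst nn_integral_lborel_translate[of _ "M *v x", symmetric]) simp_all
      finally show ?thesis .
    qed
    have "(\<integral>\<^sup>+x. (\<integral>\<^sup>+z. F (M *v x + N *v z) \<partial>stdg) \<partial>stdg)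
       = ennreal \<bar>det ?I\<bar> * (\<integral>\<^sup>+x. ennreal (std_density x) * (\<integral>\<^sup>+w. ennreal (std_density (?I *v (w - M *v x))) * F w \<partial>lborel) \<partial>lborel)"
      unfolding inner by (subst nn_integral_stdg) (auto simp: nn_integral_cmult[symmetric] mult.left_commute)
    also have "(\<integral>\<^sup>+x. ennreal (std_density x) * (\<integral>\<^sup>+w. ennreal (std_density (?I *v (w - M *v x))) * F w \<partial>lborel) \<partial>lborel)
       = (\<integral>\<^sup>+x. (\<integral>\<^sup>+w. ennreal (std_density x * std_density (?I *v (w - M *v x))) * F w \<partial>lborel) \<partial>lborel)"
      by (subst nn_integral_cmult[symmetric]) (auto simp: ennreal_mult mult.assoc)
    also have "\<dots> = (\<integral>\<^sup>+w. (\<integral>\<^sup>+x. ennreal (std_density x * std_density (?I *v (w - M *v x))) * F w \<partial>lborel) \<partial>lborel)"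
      by (rule lborel_pair.Fubini') measurable
    also have "\<dots> = (\<integral>\<^sup>+w. (\<integral>\<^sup>+y. ennreal (h y) * (ennreal (std_density w) * F w) \<partial>lborel) \<partial>lborel)"
    proof (rule nn_integral_cong)
      fix w
      have "(\<integral>\<^sup>+x. ennreal (std_density x * std_density (?I *v (w - M *v x))) * F w \<partial>lborel)
        = (\<integral>\<^sup>+y. ennreal (std_density (transpose M *v w + y) * std_density (?I *v (w - M *v (transpose M *v w + y)))) * F w \<partial>lborel)"
        by (rule nn_integral_lborel_translate[symmetric]) measurable
      then show "(\<integral>\<^sup>+x. ennreal (std_density x * std_density (?I *v (w - M *v x))) * F w \<partial>lborel) = (\<integral>\<^sup>+y. ennreal (h y) * (ennreal (std_density w) * F w) \<partial>lborel)"
        unfolding key by (simp add: ennreal_mult hn ac_simps)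
    qed
    also have "\<dots> = (\<integral>\<^sup>+w. (\<integral>\<^sup>+y. ennreal (h y) \<partial>lborel) * (ennreal (std_density w) * F w) \<partial>lborel)"
      by (simp add: nn_integral_multc)
    also have "\<dots> = (\<integral>\<^sup>+y. ennreal (h y) \<partial>lborel) * (\<integral>\<^sup>+w. F w \<partial>stdg)"
      by (simp add: nn_integral_cmult nn_integral_stdg)
    finally show ?thesis by (simp add: C_def mult.assoc)
  qed
  then show ?thesis by blast
qed

lemma stdg_convolution:
  fixes M N :: "real^'n^'n"
  assumes MN: "M ** transpose M + N ** transpose N = mat 1" and N: "invertible N"
    and F: "F \<in> borel_measurable borel"
  shows "(\<integral>\<^sup>+x. (\<integral>\<^sup>+z. F (M *v x + N *v z) \<partial>stdg) \<partial>stdg) = (\<integral>\<^sup>+w. F w \<partial>stdg)"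
proof -
  obtain C where C: "\<forall>F\<in>borel_measurable borel. (\<integral>\<^sup>+x. (\<integral>\<^sup>+z. F (M *v x + N *v z) \<partial>stdg) \<partial>stdg) = C * (\<integral>\<^sup>+w. F w \<partial>stdg)"
    using stdg_convolution_aux[OF MN N] by blast
  have 1: "(\<integral>\<^sup>+x. 1 \<partial>(stdg :: (real^'n) measure)) = 1" using stdg.emeasure_space_1 by simp
  have "C = 1" using C[THEN bspec, of "\<lambda>_. 1"] unfolding 1 by simp
  with C F show ?thesis by simp
qed

text \<open>The rotation is performed as two substitutions in one variable: for fixed y, x is
  replaced by w = c x + s y; then for fixed w, y is replaced by v with y = s w + c v. The Jacobians
  c^{-n} and c^n cancel, and c > 0 makes the division by c legitimate.\<close>

lemma stdg_rotation:
  fixes F :: "real^'n \<Rightarrow> real^'n \<Rightarrow> ennreal"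
  assumes cs: "c\<^sup>2 + s\<^sup>2 = 1" "c > 0" and [measurable]: "(\<lambda>(x, y). F x y) \<in> borel_measurable (borel \<Otimes>\<^sub>M borel)"
  shows "(\<integral>\<^sup>+x. (\<integral>\<^sup>+y. F (c *\<^sub>R x + s *\<^sub>R y) (c *\<^sub>R y - s *\<^sub>R x) \<partial>stdg) \<partial>stdg) = (\<integral>\<^sup>+x. (\<integral>\<^sup>+y. F x y \<partial>stdg) \<partial>stdg)"
proof -
  let ?d = "std_density :: real^'n \<Rightarrow> real"
  have dd: "?d x * ?d y = (2 * pi) powr (- real CARD('n) / 2) * (2 * pi) powr (- real CARD('n) / 2) * exp (- 1 / 2 * ((norm x)\<^sup>2 + (norm y)\<^sup>2))" for x y
    by (simp add: std_density_def exp_add[symmetric] algebra_simps)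
  have rot: "?d (c *\<^sub>R w - s *\<^sub>R v) * ?d (s *\<^sub>R w + c *\<^sub>R v) = ?d w * ?d v" for w v
  proof -
    have "(norm (c *\<^sub>R w - s *\<^sub>R v))\<^sup>2 + (norm (s *\<^sub>R w + c *\<^sub>R v))\<^sup>2 = (c\<^sup>2 + s\<^sup>2) * (norm w)\<^sup>2 + (c\<^sup>2 + s\<^sup>2) * (norm v)\<^sup>2"
      unfolding power2_norm_eq_inner
      by (simp add: inner_add_left inner_add_right inner_diff_left inner_diff_right inner_commute algebra_simps power2_eq_square)
    then show ?thesis unfolding dd cs by simp
  qed
  have "(\<integral>\<^sup>+x. (\<integral>\<^sup>+y. F (c *\<^sub>R x + s *\<^sub>R y) (c *\<^sub>R y - s *\<^sub>R x) \<partial>stdg) \<partial>stdg)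
     = (\<integral>\<^sup>+x. (\<integral>\<^sup>+y. ennreal (?d x * ?d y) * F (c *\<^sub>R x + s *\<^sub>R y) (c *\<^sub>R y - s *\<^sub>R x) \<partial>lborel) \<partial>lborel)"
    by (simp add: nn_integral_stdg nn_integral_cmult[symmetric] ennreal_mult mult.assoc)
  also have "\<dots> = (\<integral>\<^sup>+y. (\<integral>\<^sup>+x. ennreal (?d x * ?d y) * F (c *\<^sub>R x + s *\<^sub>R y) (c *\<^sub>R y - s *\<^sub>R x) \<partial>lborel) \<partial>lborel)"
    by (rule lborel_pair.Fubini') measurable
  also have "\<dots> = (\<integral>\<^sup>+y. ennreal (\<bar>1 / c\<bar> ^ CARD('n)) * (\<integral>\<^sup>+w. ennreal (?d ((1 / c) *\<^sub>R (w - s *\<^sub>R y)) * ?d y) * F w ((1 / c) *\<^sub>R (y - s *\<^sub>R w)) \<partial>lborel) \<partial>lborel)"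
  proof (rule nn_integral_cong)
    fix y :: "real^'n"
    let ?a = "(- s / c) *\<^sub>R y"
    have a: "?a + (1 / c) *\<^sub>R w = (1 / c) *\<^sub>R (w - s *\<^sub>R y)" for w :: "real^'n"
      by (simp add: algebra_simps)
    have b: "c *\<^sub>R ((1 / c) *\<^sub>R (w - s *\<^sub>R y)) + s *\<^sub>R y = w" for w :: "real^'n" using cs by simp
    have d: "c *\<^sub>R y - s *\<^sub>R ((1 / c) *\<^sub>R (w - s *\<^sub>R y)) = (1 / c) *\<^sub>R (y - s *\<^sub>R w)" for w :: "real^'n"
    proof -
      have "c *\<^sub>R (c *\<^sub>R y - s *\<^sub>R ((1 / c) *\<^sub>R (w - s *\<^sub>R y))) = (c\<^sup>2 + s\<^sup>2) *\<^sub>R y - s *\<^sub>R w"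
        using cs(2) by (simp add: algebra_simps power2_eq_square)
      then have "c *\<^sub>R (c *\<^sub>R y - s *\<^sub>R ((1 / c) *\<^sub>R (w - s *\<^sub>R y))) = y - s *\<^sub>R w" using cs(1) by simp
      then have "(1 / c) *\<^sub>R (c *\<^sub>R (c *\<^sub>R y - s *\<^sub>R ((1 / c) *\<^sub>R (w - s *\<^sub>R y)))) = (1 / c) *\<^sub>R (y - s *\<^sub>R w)" by simp
      then show ?thesis using cs(2) by simp
    qed
    show "(\<integral>\<^sup>+x. ennreal (?d x * ?d y) * F (c *\<^sub>R x + s *\<^sub>R y) (c *\<^sub>R y - s *\<^sub>R x) \<partial>lborel)
      = ennreal (\<bar>1 / c\<bar> ^ CARD('n)) * (\<integral>\<^sup>+w. ennreal (?d ((1 / c) *\<^sub>R (w - s *\<^sub>R y)) * ?d y) * F w ((1 / c) *\<^sub>R (y - s *\<^sub>R w)) \<partial>lborel)"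
      by (subst nn_integral_lborel_affine[of "1 / c" _ ?a], use cs in simp, measurable) (simp only: a b d DIM_cart DIM_real mult_1_right)
  qed
  also have "\<dots> = ennreal (\<bar>1 / c\<bar> ^ CARD('n)) * (\<integral>\<^sup>+y. (\<integral>\<^sup>+w. ennreal (?d ((1 / c) *\<^sub>R (w - s *\<^sub>R y)) * ?d y) * F w ((1 / c) *\<^sub>R (y - s *\<^sub>R w)) \<partial>lborel) \<partial>lborel)"
    by (rule nn_integral_cmult) measurable
  also have "(\<integral>\<^sup>+y. (\<integral>\<^sup>+w. ennreal (?d ((1 / c) *\<^sub>R (w - s *\<^sub>R y)) * ?d y) * F w ((1 / c) *\<^sub>R (y - s *\<^sub>R w)) \<partial>lborel) \<partial>lborel)
     = (\<integral>\<^sup>+w. (\<integral>\<^sup>+y. ennreal (?d ((1 / c) *\<^sub>R (w - s *\<^sub>R y)) * ?d y) * F w ((1 / c) *\<^sub>R (y - s *\<^sub>R w)) \<partial>lborel) \<partial>lborel)"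
    by (rule lborel_pair.Fubini') measurable
  also have "\<dots> = (\<integral>\<^sup>+w. ennreal (\<bar>c\<bar> ^ CARD('n)) * (\<integral>\<^sup>+v. ennreal (?d w * ?d v) * F w v \<partial>lborel) \<partial>lborel)"
  proof (rule nn_integral_cong)
    fix w :: "real^'n"
    have a: "(1 / c) *\<^sub>R (w - s *\<^sub>R (s *\<^sub>R w + c *\<^sub>R v)) = c *\<^sub>R w - s *\<^sub>R v" for v :: "real^'n"
    proof -
      have "w - s *\<^sub>R (s *\<^sub>R w + c *\<^sub>R v) = (c\<^sup>2 + s\<^sup>2) *\<^sub>R w - s *\<^sub>R (s *\<^sub>R w + c *\<^sub>R v)" using cs(1) by simp
      also have "\<dots> = c *\<^sub>R (c *\<^sub>R w - s *\<^sub>R v)" by (simp add: algebra_simps power2_eq_square)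
      finally show ?thesis using cs(2) by simp
    qed
    have b: "(1 / c) *\<^sub>R (s *\<^sub>R w + c *\<^sub>R v - s *\<^sub>R w) = v" for v :: "real^'n" using cs(2) by simp
    show "(\<integral>\<^sup>+y. ennreal (?d ((1 / c) *\<^sub>R (w - s *\<^sub>R y)) * ?d y) * F w ((1 / c) *\<^sub>R (y - s *\<^sub>R w)) \<partial>lborel)
       = ennreal (\<bar>c\<bar> ^ CARD('n)) * (\<integral>\<^sup>+v. ennreal (?d w * ?d v) * F w v \<partial>lborel)"
      by (subst nn_integral_lborel_affine[of c _ "s *\<^sub>R w"], use cs in simp, measurable) (simp only: a b rot DIM_cart DIM_real mult_1_right)
  qed
  also have "\<dots> = ennreal (\<bar>c\<bar> ^ CARD('n)) * (\<integral>\<^sup>+w. (\<integral>\<^sup>+v. ennreal (?d w * ?d v) * F w v \<partial>lborel) \<partial>lborel)"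
    by (rule nn_integral_cmult) measurable
  also have "ennreal (\<bar>1 / c\<bar> ^ CARD('n)) * \<dots> = ennreal (\<bar>1 / c\<bar> ^ CARD('n) * \<bar>c\<bar> ^ CARD('n)) * (\<integral>\<^sup>+w. (\<integral>\<^sup>+v. ennreal (?d w * ?d v) * F w v \<partial>lborel) \<partial>lborel)"
    by (simp add: ennreal_mult mult.assoc)
  also have "\<bar>1 / c\<bar> ^ CARD('n) * \<bar>c\<bar> ^ CARD('n) = 1" using cs(2) by (simp add: power_mult_distrib[symmetric])
  also have "ennreal 1 * (\<integral>\<^sup>+w. (\<integral>\<^sup>+v. ennreal (?d w * ?d v) * F w v \<partial>lborel) \<partial>lborel) = (\<integral>\<^sup>+x. (\<integral>\<^sup>+y. F x y \<partial>stdg) \<partial>stdg)"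
    by (simp add: nn_integral_stdg nn_integral_cmult[symmetric] ennreal_mult mult.assoc)
  finally show ?thesis .
qed

subsection \<open>Moments\<close>

text \<open>Combine 1 + r <= exp r with q r <= q^2 / (4a) + a r^2, a completed square. Polynomial
  factors are absorbed into Gaussians this way.\<close>

lemma powr_le_exp_square:
  fixes a q r :: real
  assumes "a > 0" "q \<ge> 0" "r \<ge> 0"
  shows "(1 + r) powr q \<le> exp (q\<^sup>2 / (4 * a)) * exp (a * r\<^sup>2)"
proof -
  have "(1 + r) powr q \<le> exp r powr q" by (rule powr_mono2) (use assms exp_ge_add_one_self in auto)
  also have "\<dots> = exp (q * r)" by (simp add: powr_def)
  also have "q * r \<le> q\<^sup>2 / (4 * a) + a * r\<^sup>2"
  proof -
    have "0 \<le> (q - 2 * a * r)\<^sup>2 / (4 * a)" using assms by simp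
    then show ?thesis using assms by (simp add: field_simps power2_eq_square)
  qed
  finally show ?thesis by (simp add: exp_add)
qed

lemma norm_square_eq_sum: "(norm x)\<^sup>2 = (\<Sum>b\<in>Basis. (x \<bullet> b)\<^sup>2)" for x :: "'a::euclidean_space"
  unfolding power2_norm_eq_inner euclidean_inner[of x x] by (simp add: power2_eq_square)

text \<open>Up to a constant the integrand is a product of one-dimensional normal densities of
  variance 1 / (2a).\<close>

lemma integrable_exp_neg_square:
  assumes a: "a > 0"
  shows "integrable lborel (\<lambda>x::'a::euclidean_space. exp (- a * (norm x)\<^sup>2))"
proof -
  define \<sigma> where "\<sigma> = sqrt (1 / (2 * a))"
  have \<sigma>: "\<sigma> > 0" "\<sigma>\<^sup>2 = 1 / (2 * a)" using a by (auto simp: \<sigma>_def)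
  have e: "exp (- a * t\<^sup>2) = sqrt (2 * pi * \<sigma>\<^sup>2) * normal_density 0 \<sigma> t" for t
    using a by (simp add: normal_density_def \<sigma>(2) field_simps)
  have e2: "exp (- a * (norm x)\<^sup>2) = (\<Prod>b\<in>Basis. exp (- a * (x \<bullet> b)\<^sup>2))" for x :: 'a
    by (simp only: norm_square_eq_sum sum_distrib_left exp_sum finite_Basis)
  have i: "integrable lborel (\<lambda>t::real. exp (- a * t\<^sup>2))"
    unfolding e using \<sigma>(1) by simp
  have "(\<integral>\<^sup>+(x::'a). ennreal (exp (- a * (norm x)\<^sup>2)) \<partial>lborel) = (\<integral>\<^sup>+(x::'a). (\<Prod>b\<in>Basis. ennreal (exp (- a * (x \<bullet> b)\<^sup>2))) \<partial>lborel)"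
    unfolding e2 by (simp add: prod_ennreal)
  also have "\<dots> = (\<Prod>b\<in>(Basis::'a set). (\<integral>\<^sup>+x. ennreal (exp (- a * x\<^sup>2)) \<partial>lborel))"
    by (rule nn_integral_lborel_prod) auto
  also have "\<dots> < \<infinity>"
    using i by (simp add: integrable_iff_bounded power_less_top_ennreal ennreal_power)
  finally show ?thesis by (intro integrableI_bounded) auto
qed

lemma integrable_stdg_exp:
  assumes "a < 1 / 2"
  shows "integrable stdg (\<lambda>x::real^'n. exp (a * (norm x)\<^sup>2))"
proof -
  have "integrable lborel (\<lambda>x::real^'n. (2 * pi) powr (- real CARD('n) / 2) * exp (- (1 / 2 - a) * (norm x)\<^sup>2))"
    using integrable_exp_neg_square[of "1 / 2 - a"] assms by auto
  moreover have "(\<lambda>x::real^'n. (2 * pi) powr (- real CARD('n) / 2) * exp (- (1 / 2 - a) * (norm x)\<^sup>2)) = (\<lambda>x. std_density x *\<^sub>R exp (a * (norm x)\<^sup>2))"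
    by (simp add: fun_eq_iff std_density_def exp_add[symmetric] algebra_simps)
  ultimately have "integrable lborel (\<lambda>x::real^'n. std_density x *\<^sub>R exp (a * (norm x)\<^sup>2))" by (simp only:)
  then show ?thesis unfolding stdg_def by (subst integrable_density) auto
qed

lemma integrable_stdg_moment:
  assumes "q \<ge> 0"
  shows "integrable stdg (\<lambda>x::real^'n. (1 + norm x) powr q)"
proof (rule Bochner_Integration.integrable_bound)
  show "integrable stdg (\<lambda>x::real^'n. exp (q\<^sup>2 / (4 * (1 / 4))) * exp (1 / 4 * (norm x)\<^sup>2))"
    using integrable_stdg_exp[of "1 / 4"] by auto
  show "AE x in (stdg :: (real^'n) measure). norm ((1 + norm x) powr q) \<le> norm (exp (q\<^sup>2 / (4 * (1 / 4))) * exp (1 / 4 * (norm x)\<^sup>2))"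
    using powr_le_exp_square[of "1/4" q] assms by (intro AE_I2) auto
qed measurable

section \<open>The matrix flow and the covariances\<close>

lemma opn_le_norm: "\<exists>K\<ge>0. \<forall>M::real^'n^'m. opn M \<le> K * norm M"
proof -
  obtain K where K: "K > 0" "\<And>(M::real^'n^'m) x. norm (M *v x) \<le> norm M * norm x * K"
    using bounded_bilinear.pos_bounded[OF bounded_bilinear_mat_vec] by blast
  have "opn M \<le> K * norm M" for M :: "real^'n^'m"
    by (rule onorm_le) (use K(2)[of M] in \<open>simp add: ac_simps\<close>)
  then show ?thesis using K(1) by (meson less_imp_le)
qed

text \<open>This form suits \<open>U\<close> in its second argument and the matrix inverse, where an
  algebraic identity rewrites the difference quotient.\<close>

lemma has_vector_derivative_iff_tendsto:
  fixes f :: "real \<Rightarrow> 'a::real_normed_vector"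
  shows "(f has_vector_derivative f') (at t) \<longleftrightarrow> ((\<lambda>y. (f y - f t) /\<^sub>R (y - t)) \<longlongrightarrow> f') (at t)"
proof -
  have e: "norm (f y - f t - (y - t) *\<^sub>R f') / norm (y - t) = norm ((f y - f t) /\<^sub>R (y - t) - f')" if "y \<noteq> t" for y
  proof -
    have "(f y - f t) /\<^sub>R (y - t) - f' = (f y - f t - (y - t) *\<^sub>R f') /\<^sub>R (y - t)"
      using that by (simp add: scaleR_diff_right)
    then show ?thesis by (simp add: divide_inverse abs_inverse)
  qed
  have "(f has_vector_derivative f') (at t) \<longleftrightarrow> ((\<lambda>y. norm (f y - f t - (y - t) *\<^sub>R f') / norm (y - t)) \<longlongrightarrow> 0) (at t)"
    unfolding has_vector_derivative_def has_derivative_iff_norm by (simp add: bounded_linear_scaleR_left)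
  also have "\<dots> \<longleftrightarrow> ((\<lambda>y. norm ((f y - f t) /\<^sub>R (y - t) - f')) \<longlongrightarrow> 0) (at t)"
    by (rule Lim_cong_within[OF refl refl refl e])
  also have "\<dots> \<longleftrightarrow> ((\<lambda>y. (f y - f t) /\<^sub>R (y - t)) \<longlongrightarrow> f') (at t)"
    by (simp only: tendsto_norm_zero_iff Lim_null[symmetric])
  finally show ?thesis .
qed

text \<open>Gronwall for |X|^2: its derivative is at most 2a|X|^2 in absolute value, so
  exp(-2at)|X|^2 decreases and exp(2at)|X|^2 increases, which covers both time directions. With X(s)
  = 0 this is the uniqueness statement behind the cocycle law.\<close>

lemma ode_growth:
  fixes X :: "real \<Rightarrow> real^'n" and A :: "real \<Rightarrow> real^'n^'n"
  assumes X: "\<And>t. (X has_vector_derivative - (A t *v X t)) (at t)" and A: "\<And>t. opn (A t) \<le> a"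
  shows "norm (X t) \<le> exp (a * \<bar>t - s\<bar>) * norm (X s)"
proof -
  have AX: "\<bar>(A \<tau> *v X \<tau>) \<bullet> X \<tau>\<bar> \<le> a * (X \<tau> \<bullet> X \<tau>)" for \<tau>
  proof -
    have "\<bar>(A \<tau> *v X \<tau>) \<bullet> X \<tau>\<bar> \<le> norm (A \<tau> *v X \<tau>) * norm (X \<tau>)" by (rule Cauchy_Schwarz_ineq2)
    also have "\<dots> \<le> (opn (A \<tau>) * norm (X \<tau>)) * norm (X \<tau>)" by (intro mult_right_mono norm_mat_vec_le) auto
    also have "\<dots> \<le> (a * norm (X \<tau>)) * norm (X \<tau>)" by (intro mult_right_mono A) auto
    finally show ?thesis by (simp add: power2_norm_eq_inner[symmetric] power2_eq_square mult.assoc)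
  qed
  have D: "((\<lambda>\<tau>. exp (k * \<tau>) * (X \<tau> \<bullet> X \<tau>)) has_real_derivative exp (k * \<tau>) * (k * (X \<tau> \<bullet> X \<tau>) - 2 * ((A \<tau> *v X \<tau>) \<bullet> X \<tau>))) (at \<tau>)" for k \<tau>
  proof -
    have "((\<lambda>\<tau>. X \<tau> \<bullet> X \<tau>) has_real_derivative - 2 * ((A \<tau> *v X \<tau>) \<bullet> X \<tau>)) (at \<tau>)"
      unfolding has_real_derivative_iff_has_vector_derivative
      using bounded_bilinear.has_vector_derivative[OF bounded_bilinear_inner X X, of \<tau>] by (simp add: inner_commute)
    from DERIV_mult[OF _ this, of "\<lambda>\<tau>. exp (k * \<tau>)" "exp (k * \<tau>) * k"] show ?thesis
      by (rule DERIV_cong) (auto intro!: derivative_eq_intros simp: algebra_simps)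
  qed
  have ee: "exp x * (exp y * z) = exp (x + y) * z" for x y z :: real by (simp add: exp_add)
  have fin: "norm (X t) \<le> exp c * norm (X s)" if "X t \<bullet> X t \<le> exp (2 * c) * (X s \<bullet> X s)" for c
  proof (rule power2_le_imp_le)
    show "(norm (X t))\<^sup>2 \<le> (exp c * norm (X s))\<^sup>2"
      using that by (simp add: power_mult_distrib power2_norm_eq_inner exp_double)
  qed auto
  show ?thesis
  proof (cases "s \<le> t")
    case True
    have "exp (- 2 * a * t) * (X t \<bullet> X t) \<le> exp (- 2 * a * s) * (X s \<bullet> X s)"
    proof (rule DERIV_nonpos_imp_nonincreasing[OF True])
      fix \<tau>
      have "exp (- 2 * a * \<tau>) * (- 2 * a * (X \<tau> \<bullet> X \<tau>) - 2 * ((A \<tau> *v X \<tau>) \<bullet> X \<tau>)) \<le> 0"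
        using AX[of \<tau>] by (intro mult_nonneg_nonpos) auto
      then show "\<exists>y. ((\<lambda>\<tau>. exp (- 2 * a * \<tau>) * (X \<tau> \<bullet> X \<tau>)) has_real_derivative y) (at \<tau>) \<and> y \<le> 0"
        using D by blast
    qed
    then have "exp (2 * a * t) * (exp (- 2 * a * t) * (X t \<bullet> X t)) \<le> exp (2 * a * t) * (exp (- 2 * a * s) * (X s \<bullet> X s))"
      by (intro mult_left_mono) auto
    then have "X t \<bullet> X t \<le> exp (2 * (a * (t - s))) * (X s \<bullet> X s)"
      unfolding ee by (simp add: algebra_simps)
    then show ?thesis using fin True by simp
  next
    case False
    then have "t \<le> s" by simp
    have "exp (2 * a * t) * (X t \<bullet> X t) \<le> exp (2 * a * s) * (X s \<bullet> X s)"
    proof (rule DERIV_nonneg_imp_nondecreasing[OF \<open>t \<le> s\<close>])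
      fix \<tau>
      have "exp (2 * a * \<tau>) * (2 * a * (X \<tau> \<bullet> X \<tau>) - 2 * ((A \<tau> *v X \<tau>) \<bullet> X \<tau>)) \<ge> 0"
        using AX[of \<tau>] by (intro mult_nonneg_nonneg) auto
      then show "\<exists>y. ((\<lambda>\<tau>. exp (2 * a * \<tau>) * (X \<tau> \<bullet> X \<tau>)) has_real_derivative y) (at \<tau>) \<and> y \<ge> 0"
        using D by blast
    qed
    then have "exp (- 2 * a * t) * (exp (2 * a * t) * (X t \<bullet> X t)) \<le> exp (- 2 * a * t) * (exp (2 * a * s) * (X s \<bullet> X s))"
      by (intro mult_left_mono) auto
    then have "X t \<bullet> X t \<le> exp (2 * (a * (s - t))) * (X s \<bullet> X s)"
      unfolding ee by (simp add: algebra_simps)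
    then show ?thesis using fin False by simp
  qed
qed

lemma set_integrable_exp_decay:
  fixes k :: real
  assumes "k > 0"
  shows "set_integrable lborel {s..} (\<lambda>\<xi>. exp (- k * (\<xi> - s)))"
    "(LINT \<xi>:{s..}|lborel. exp (- k * (\<xi> - s))) = 1 / k"
proof -
  have "((\<lambda>\<xi>. exp (k * s) * exp (- k * \<xi>)) has_integral exp (k * s) * (exp (- k * s) / k)) {s..}"
    by (intro has_integral_mult_right has_integral_exp_minus_to_infinity assms)
  then have h: "((\<lambda>\<xi>. exp (- k * (\<xi> - s))) has_integral 1 / k) {s..}"
    by (simp add: exp_add[symmetric] algebra_simps)
  have "(\<lambda>\<xi>. exp (- k * (\<xi> - s))) absolutely_integrable_on {s..}"
    using h by (intro nonnegative_absolutely_integrable_1) (auto intro: has_integral_integrable)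
  then show i: "set_integrable lborel {s..} (\<lambda>\<xi>. exp (- k * (\<xi> - s)))"
    unfolding set_integrable_def by (subst (asm) integrable_completion) auto
  show "(LINT \<xi>:{s..}|lborel. exp (- k * (\<xi> - s))) = 1 / k"
    using set_borel_integral_eq_integral(2)[OF i] h by (simp add: integral_unique)
qed

section \<open>The coefficients, the matrix flow and its growth\<close>

locale ornstein_uhlenbeck =
  fixes A B :: "real \<Rightarrow> real^'n^'n" and g :: "real \<Rightarrow> real^'n"
    and U :: "real \<Rightarrow> real \<Rightarrow> real^'n^'n" and \<eta>\<^sub>0 :: real
  assumes A_cont: "continuous_on UNIV A" and A_bounded: "bounded (range A)"
    and B_cont: "continuous_on UNIV B" and B_bounded: "bounded (range B)"
    and g_cont: "continuous_on UNIV g" and g_bounded: "bounded (range g)"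
    and eta_pos: "\<eta>\<^sub>0 > 0"
    and elliptic: "\<And>t \<xi>. (((1 / 2) *\<^sub>R (B t ** transpose (B t))) *v \<xi>) \<bullet> \<xi> \<ge> \<eta>\<^sub>0 * (norm \<xi>)\<^sup>2"
    and U_deriv: "\<And>t s. ((\<lambda>\<tau>. U \<tau> s) has_vector_derivative - (A t ** U t s)) (at t)"
    and U_id: "\<And>s. U s s = mat 1"
    and omega0_neg: "omega0 U < 0"
begin

lemma A_opn_bound: "\<exists>a\<ge>0. \<forall>t. opn (A t) \<le> a"
proof -
  obtain K where K: "K \<ge> 0" "\<forall>M::real^'n^'n. opn M \<le> K * norm M" using opn_le_norm by blast
  obtain b where b: "\<And>t. norm (A t) \<le> b" using A_bounded by (auto simp: bounded_iff)
  have "opn (A t) \<le> K * b" for t using K b[of t] by (meson mult_left_mono order_trans)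
  moreover have "K * b \<ge> 0" using calculation[of 0] opn_nonneg[of "A 0"] by linarith
  ultimately show ?thesis by blast
qed

definition alpha where "alpha = (SOME a. a \<ge> 0 \<and> (\<forall>t. opn (A t) \<le> a))"

lemma alpha: "alpha \<ge> 0" "opn (A t) \<le> alpha"
  using someI_ex[of "\<lambda>a. a \<ge> 0 \<and> (\<forall>t. opn (A t) \<le> a)"] A_opn_bound unfolding alpha_def by auto

lemma U_vec_deriv: "((\<lambda>\<tau>. U \<tau> s *v v) has_vector_derivative - (A t *v (U t s *v v))) (at t)"
proof -
  have "((\<lambda>\<tau>. U \<tau> s *v v) has_vector_derivative (- (A t ** U t s)) *v v) (at t)"
    by (rule bounded_linear.has_vector_derivative[OF bounded_bilinear.bounded_linear_left[OF bounded_bilinear_mat_vec] U_deriv])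
  moreover have "(- (A t ** U t s)) *v v = - (A t *v (U t s *v v))"
    by (simp add: matrix_vector_mul_assoc bounded_bilinear.minus_left[OF bounded_bilinear_mat_vec])
  ultimately show ?thesis by simp
qed

lemma U_vec_bound: "norm (U t s *v v) \<le> exp (alpha * \<bar>t - s\<bar>) * norm v"
  using ode_growth[of "\<lambda>t. U t s *v v" A alpha t s] U_vec_deriv alpha(2) by (simp add: U_id)

lemma U_bound: "opn (U t s) \<le> exp (alpha * \<bar>t - s\<bar>)"
  by (rule onorm_le) (rule U_vec_bound)

text \<open>As functions of t both sides, applied to a vector, solve the same linear equation and
  agree at t = s; \<open>ode_growth\<close> makes their difference vanish.\<close>

lemma U_cocycle: "U t s ** U s r = U t r"
proof -
  have "U t s *v (U s r *v v) - U t r *v v = 0" for v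
  proof -
    let ?X = "\<lambda>t. U t s *v (U s r *v v) - U t r *v v"
    have "(?X has_vector_derivative - (A t *v ?X t)) (at t)" for t
      using has_vector_derivative_diff[OF U_vec_deriv[of s "U s r *v v" t] U_vec_deriv[of r v t]]
      by (simp add: matrix_vector_mult_diff_distrib)
    from ode_growth[of ?X A alpha t s, OF this alpha(2)] show ?thesis by (simp add: U_id)
  qed
  then show ?thesis by (simp add: matrix_eq matrix_vector_mul_assoc[symmetric])
qed

lemma U_inverse: "U t s ** U s t = mat 1"
  by (simp add: U_cocycle U_id)

text \<open>The inverse of \<open>U t s\<close> is \<open>U s t\<close>, which has the same
  exponential bound. This lower bound lets the ellipticity of B B^T survive transport by the
  flow.\<close>

lemma U_vec_lower: "norm v \<le> exp (alpha * \<bar>t - s\<bar>) * norm (transpose (U t s) *v v)"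
proof -
  have "transpose (U s t) *v (transpose (U t s) *v v) = v"
    by (metis U_inverse matrix_transpose_mul matrix_vector_mul_assoc matrix_vector_mul_lid transpose_mat)
  then have "norm v \<le> opn (transpose (U s t)) * norm (transpose (U t s) *v v)"
    by (metis norm_mat_vec_le)
  also have "\<dots> \<le> exp (alpha * \<bar>t - s\<bar>) * norm (transpose (U t s) *v v)"
    using U_bound[of s t] by (intro mult_right_mono) (auto simp: opn_transpose abs_minus_commute)
  finally show ?thesis .
qed

lemma isCont_U_first: "isCont (\<lambda>\<tau>. U \<tau> s) t"
  using U_deriv has_vector_derivative_continuous by blast

text \<open>The equation controls only the first argument of \<open>U\<close>. The cocycle law moves
  the increment there: U(s,\<tau>) - U(s,t) = U(s,\<tau>) (1 - U(\<tau>,t)), where the first factor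
  is locally bounded.\<close>

lemma isCont_U: "isCont (\<lambda>\<tau>. U s \<tau>) t"
proof -
  have e: "U s \<tau> = U s t + U s \<tau> ** (mat 1 - U \<tau> t)" for \<tau>
  proof -
    have "U s \<tau> ** (mat 1 - U \<tau> t) = U s \<tau> - U s \<tau> ** U \<tau> t"
      by (simp add: bounded_bilinear.diff_right[OF bounded_bilinear_mat_mult])
    then show ?thesis by (simp add: U_cocycle)
  qed
  let ?k = "real (CARD('n) * CARD('n)) * exp (alpha * (\<bar>s - t\<bar> + 1))"
  obtain K where K: "\<And>(M::real^'n^'n) (N::real^'n^'n). norm (M ** N) \<le> norm M * norm N * K" "K > 0"
    using bounded_bilinear.pos_bounded[OF bounded_bilinear_mat_mult] by blast
  have "((\<lambda>\<tau>. U s \<tau> - U s t) \<longlongrightarrow> 0) (at t)"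
  proof (rule Lim_null_comparison)
    show "\<forall>\<^sub>F \<tau> in at t. norm (U s \<tau> - U s t) \<le> ?k * norm (mat 1 - U \<tau> t) * K"
      unfolding eventually_at
    proof (intro exI[of _ 1] conjI ballI impI)
      fix \<tau> assume t: "\<tau> \<noteq> t \<and> dist \<tau> t < 1"
      have "norm (U s \<tau>) \<le> real (CARD('n) * CARD('n)) * opn (U s \<tau>)" by (rule norm_matrix_le_opn)
      also have "\<dots> \<le> real (CARD('n) * CARD('n)) * exp (alpha * \<bar>s - \<tau>\<bar>)"
        by (intro mult_left_mono U_bound) auto
      also have "\<dots> \<le> ?k"
        using t alpha(1) by (intro mult_left_mono) (auto simp: dist_real_def intro!: mult_left_mono)
      finally have k: "norm (U s \<tau>) \<le> ?k" .
      have "norm (U s \<tau> - U s t) = norm (U s \<tau> ** (mat 1 - U \<tau> t))" using e[of \<tau>] by (metis add_diff_cancel_left')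
      also have "\<dots> \<le> norm (U s \<tau>) * norm (mat 1 - U \<tau> t) * K" by (rule K)
      also have "\<dots> \<le> ?k * norm (mat 1 - U \<tau> t) * K" using k K(2) by (intro mult_right_mono) auto
      finally show "norm (U s \<tau> - U s t) \<le> ?k * norm (mat 1 - U \<tau> t) * K" .
    qed simp
    have "((\<lambda>\<tau>. ?k * norm (mat 1 - U \<tau> t) * K) \<longlongrightarrow> ?k * norm (mat 1 - U t t) * K) (at t)"
      using isCont_U_first[of t t] by (intro tendsto_intros) (simp add: isCont_def)
    then show "((\<lambda>\<tau>. ?k * norm (mat 1 - U \<tau> t) * K) \<longlongrightarrow> 0) (at t)" by (simp add: U_id)
  qed
  then show ?thesis unfolding isCont_def by (rule Lim_null[THEN iffD2])
qed

lemma continuous_on_U: "continuous_on X (\<lambda>\<tau>. U s \<tau>)"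
  by (simp add: continuous_at_imp_continuous_on isCont_U)

text \<open>The same identity for difference quotients: the quotient in the second argument equals
  -U(s,\<tau>) times the quotient of \<open>U\<close> in its first argument at t, where U(t,t) =
  1.\<close>

lemma U_second_deriv: "((\<lambda>\<tau>. U s \<tau>) has_vector_derivative U s t ** A t) (at t)"
proof -
  have "((\<lambda>\<tau>. - (U s \<tau> ** ((U \<tau> t - U t t) /\<^sub>R (\<tau> - t)))) \<longlongrightarrow> - (U s t ** (- (A t ** U t t)))) (at t)"
  proof (intro tendsto_minus bounded_bilinear.tendsto[OF bounded_bilinear_mat_mult])
    show "((\<lambda>\<tau>. U s \<tau>) \<longlongrightarrow> U s t) (at t)" using isCont_U by (simp add: isCont_def)
    show "((\<lambda>\<tau>. (U \<tau> t - U t t) /\<^sub>R (\<tau> - t)) \<longlongrightarrow> - (A t ** U t t)) (at t)"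
      using U_deriv[of t t] by (simp add: has_vector_derivative_iff_tendsto)
  qed
  moreover have "- (U s \<tau> ** ((U \<tau> t - U t t) /\<^sub>R (\<tau> - t))) = (U s \<tau> - U s t) /\<^sub>R (\<tau> - t)" for \<tau>
    by (simp add: bounded_bilinear.scaleR_right[OF bounded_bilinear_mat_mult] bounded_bilinear.diff_right[OF bounded_bilinear_mat_mult] U_cocycle U_id scaleR_diff_right)
  moreover have "- (U s t ** (- (A t ** U t t))) = U s t ** A t"
    by (simp add: bounded_bilinear.minus_right[OF bounded_bilinear_mat_mult] U_id)
  ultimately show ?thesis by (simp add: has_vector_derivative_iff_tendsto)
qed


text \<open>An infimum need not be attained, so an admissible exponent \<open>w\<close> strictly
  below \<omega> is taken and then enlarged to \<omega>. The bound by \<open>alpha\<close> shows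
  that the set of exponents is nonempty.\<close>

lemma decay_of_gt_omega0:
  assumes "omega0 U < \<omega>"
  shows "\<exists>M\<ge>1. \<forall>t s. t \<le> s \<longrightarrow> opn (U t s) \<le> M * exp (\<omega> * (s - t))"
proof -
  let ?S = "{\<omega>. \<exists>M\<ge>1. \<forall>t s. t \<le> s \<longrightarrow> opn (U t s) \<le> M * exp (\<omega> * (s - t))}"
  have "opn (U t s) \<le> 1 * exp (alpha * (s - t))" if "t \<le> s" for t s
    using U_bound[of t s] that by simp
  then have "alpha \<in> ?S" by (auto intro!: exI[of _ 1])
  then have "?S \<noteq> {}" by auto
  then obtain w where w: "w \<in> ?S" "w < \<omega>"
    using cInf_lessD[OF \<open>?S \<noteq> {}\<close>, of \<omega>] assms unfolding omega0_def by blast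
  then obtain M where M: "M \<ge> 1" "\<And>t s. t \<le> s \<Longrightarrow> opn (U t s) \<le> M * exp (w * (s - t))" by auto
  have "opn (U t s) \<le> M * exp (\<omega> * (s - t))" if "t \<le> s" for t s
  proof -
    have "M * exp (w * (s - t)) \<le> M * exp (\<omega> * (s - t))"
      using M(1) w(2) that by (intro mult_left_mono) (auto intro!: mult_right_mono)
    with M(2)[OF that] show ?thesis by linarith
  qed
  with M(1) show ?thesis by blast
qed

lemma exp_decay: "\<exists>\<delta>>0. \<exists>M\<ge>1. \<forall>t s. t \<le> s \<longrightarrow> norm (U t s) \<le> M * exp (- \<delta> * (s - t))"
proof -
  \<comment> \<open>Halving a negative number raises it while keeping it negative: the half is an
    admissible rate that still decays.\<close>
  have "omega0 U < omega0 U / 2" using omega0_neg by simp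
  from decay_of_gt_omega0[OF this] obtain M where
    M: "M \<ge> 1" "\<And>t s. t \<le> s \<Longrightarrow> opn (U t s) \<le> M * exp (omega0 U / 2 * (s - t))" by blast
  have "norm (U t s) \<le> real (CARD('n) * CARD('n)) * M * exp (- (- omega0 U / 2) * (s - t))" if "t \<le> s" for t s
  proof -
    have "norm (U t s) \<le> real (CARD('n) * CARD('n)) * opn (U t s)" by (rule norm_matrix_le_opn)
    also have "\<dots> \<le> real (CARD('n) * CARD('n)) * (M * exp (omega0 U / 2 * (s - t)))"
      by (intro mult_left_mono M(2)[OF that]) auto
    finally show ?thesis by (simp add: mult.assoc)
  qed
  moreover have "real (CARD('n) * CARD('n)) * M \<ge> 1 * 1"
    using M(1) by (intro mult_mono) (auto simp: Suc_le_eq simp flip: of_nat_mult)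
  ultimately show ?thesis using omega0_neg by (intro exI[of _ "- omega0 U / 2"] conjI exI[of _ "real (CARD('n) * CARD('n)) * M"]) auto
qed

text \<open>\<open>Qf s t\<close> and \<open>gf s t\<close> are the covariance and the shift of the
  mean accumulated between s and t; as t tends to infinity they become \<open>cov B U s\<close> and
  \<open>mean g U s\<close>.\<close>

definition W where "W s \<xi> = U s \<xi> ** B \<xi> ** transpose (B \<xi>) ** transpose (U s \<xi>)"
definition Qf where "Qf s t = integral {s..t} (W s)"
definition gf where "gf s t = integral {s..t} (\<lambda>\<xi>. U s \<xi> *v g \<xi>)"

lemma W_continuous: "continuous_on X (W s)"
proof -
  have B: "continuous_on X B" using B_cont continuous_on_subset by blast
  have tr: "continuous_on X (\<lambda>\<xi>. transpose (F \<xi>))" if "continuous_on X F" for F :: "real \<Rightarrow> real^'n^'n"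
    using bounded_linear.continuous_on[OF bounded_linear_transpose that] .
  show ?thesis unfolding W_def
    by (intro bounded_bilinear.continuous_on[OF bounded_bilinear_mat_mult] tr B continuous_on_U)
qed

lemma Ug_continuous: "continuous_on X (\<lambda>\<xi>. U s \<xi> *v g \<xi>)"
  using g_cont continuous_on_subset by (intro bounded_bilinear.continuous_on[OF bounded_bilinear_mat_vec] continuous_on_U) blast

lemma W_decay: "\<exists>\<delta>>0. \<exists>C. \<forall>s \<xi>. s \<le> \<xi> \<longrightarrow> norm (W s \<xi>) \<le> C * exp (- \<delta> * (\<xi> - s))"
proof -
  obtain \<delta> M where d: "\<delta> > 0" "M \<ge> 1" "\<And>t s. t \<le> s \<Longrightarrow> norm (U t s) \<le> M * exp (- \<delta> * (s - t))"
    using exp_decay by blast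
  obtain K where K: "\<And>(M::real^'n^'n) (N::real^'n^'n). norm (M ** N) \<le> norm M * norm N * K" "K > 0"
    using bounded_bilinear.pos_bounded[OF bounded_bilinear_mat_mult] by blast
  obtain T where T: "\<And>M::real^'n^'n. norm (transpose M) \<le> norm M * T" "T > 0"
    using bounded_linear.pos_bounded[OF bounded_linear_transpose] by blast
  obtain b where b: "\<And>t. norm (B t) \<le> b" using B_bounded by (auto simp: bounded_iff)
  have b0: "b \<ge> 0" using b[of 0] norm_ge_zero order_trans by blast
  have "norm (W s \<xi>) \<le> (((M * b * K) * (b * T) * K) * (M * T) * K) * exp (- \<delta> * (\<xi> - s))" if "s \<le> \<xi>" for s \<xi>
  proof -
    let ?e = "exp (- \<delta> * (\<xi> - s))"
    have e1: "?e \<le> 1" using d(1) that by simp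
    have M0: "M \<ge> 0" using d(2) by simp
    have U1: "norm (U s \<xi>) \<le> M * ?e" by (rule d(3)[OF that])
    \<comment> \<open>Of the two factors U in \<open>W\<close> only one keeps its exponential decay;
      the other is merely bounded by \<open>M\<close>, so that the rate stays \<delta>.\<close>
    also have "\<dots> \<le> M * 1" by (intro mult_left_mono e1 M0)
    finally have U2: "norm (U s \<xi>) \<le> M" by simp
    have "norm (U s \<xi> ** B \<xi>) \<le> norm (U s \<xi>) * norm (B \<xi>) * K" by (rule K(1))
    also have "\<dots> \<le> M * b * K" using K(2) b0 M0 by (intro mult_mono U2 b) auto
    finally have 1: "norm (U s \<xi> ** B \<xi>) \<le> M * b * K" .
    have Tb: "norm (transpose (B \<xi>)) \<le> b * T" using T(1)[of "B \<xi>"] b[of \<xi>] T(2) by (meson mult_right_mono order_trans less_imp_le)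
    have TU: "norm (transpose (U s \<xi>)) \<le> M * ?e * T" using T(1)[of "U s \<xi>"] U1 T(2) by (meson mult_right_mono order_trans less_imp_le)
    have "norm (U s \<xi> ** B \<xi> ** transpose (B \<xi>)) \<le> norm (U s \<xi> ** B \<xi>) * norm (transpose (B \<xi>)) * K" by (rule K(1))
    also have "\<dots> \<le> (M * b * K) * (b * T) * K" using K(2) b0 M0 T(2) by (intro mult_mono 1 Tb) auto
    finally have 2: "norm (U s \<xi> ** B \<xi> ** transpose (B \<xi>)) \<le> (M * b * K) * (b * T) * K" .
    have "norm (W s \<xi>) \<le> norm (U s \<xi> ** B \<xi> ** transpose (B \<xi>)) * norm (transpose (U s \<xi>)) * K" unfolding W_def by (rule K(1))
    also have "\<dots> \<le> ((M * b * K) * (b * T) * K) * (M * ?e * T) * K" using K(2) b0 M0 T(2) by (intro mult_mono 2 TU) auto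
    finally show ?thesis by (simp add: ac_simps)
  qed
  with d(1) show ?thesis by blast
qed

lemma Ug_decay: "\<exists>\<delta>>0. \<exists>C. \<forall>s \<xi>. s \<le> \<xi> \<longrightarrow> norm (U s \<xi> *v g \<xi>) \<le> C * exp (- \<delta> * (\<xi> - s))"
proof -
  obtain \<delta> M where d: "\<delta> > 0" "M \<ge> 1" "\<And>t s. t \<le> s \<Longrightarrow> norm (U t s) \<le> M * exp (- \<delta> * (s - t))"
    using exp_decay by blast
  obtain K where K: "\<And>(M::real^'n^'n) x. norm (M *v x) \<le> norm M * norm x * K" "K > 0"
    using bounded_bilinear.pos_bounded[OF bounded_bilinear_mat_vec] by blast
  obtain b where b: "\<And>t. norm (g t) \<le> b" using g_bounded by (auto simp: bounded_iff)
  have b0: "b \<ge> 0" using b[of 0] norm_ge_zero order_trans by blast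
  have "norm (U s \<xi> *v g \<xi>) \<le> (M * b * K) * exp (- \<delta> * (\<xi> - s))" if "s \<le> \<xi>" for s \<xi>
  proof -
    have "norm (U s \<xi> *v g \<xi>) \<le> norm (U s \<xi>) * norm (g \<xi>) * K" by (rule K(1))
    also have "\<dots> \<le> (M * exp (- \<delta> * (\<xi> - s))) * b * K" using K(2) b0 d(2) by (intro mult_mono d(3)[OF that] b) auto
    finally show ?thesis by (simp add: ac_simps)
  qed
  with d(1) show ?thesis by blast
qed

end

text \<open>Shared by covariance and mean: integrability on a half-line, a bound that does not
  depend on s, and the splitting of the half-line at t.\<close>

lemma tail_integral:
  fixes h :: "real \<Rightarrow> 'a::euclidean_space"
  assumes h: "continuous_on UNIV h" and k: "k > 0" and b: "\<And>\<xi>. s \<le> \<xi> \<Longrightarrow> norm (h \<xi>) \<le> C * exp (- k * (\<xi> - s))"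
  shows "set_integrable lborel {s..} h" "norm (LINT \<xi>:{s..}|lborel. h \<xi>) \<le> C / k"
    "s \<le> t \<Longrightarrow> (LINT \<xi>:{s..}|lborel. h \<xi>) = integral {s..t} h + (LINT \<xi>:{t..}|lborel. h \<xi>)"
proof -
  have [measurable]: "h \<in> borel_measurable borel" by (rule borel_measurable_continuous_onI[OF h])
  note e = set_integrable_exp_decay[OF k, of s]
  have i: "set_integrable lborel {s..} (\<lambda>\<xi>. C * exp (- k * (\<xi> - s)))" using e(1) by (rule set_integrable_mult_right)
  show si: "set_integrable lborel {s..} h"
  proof (rule set_integrable_bound[OF i])
    show "set_borel_measurable lborel {s..} h" unfolding set_borel_measurable_def by measurable
    show "AE x in lborel. x \<in> {s..} \<longrightarrow> norm (h x) \<le> norm (C * exp (- k * (x - s)))"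
    proof (intro AE_I2 impI)
      fix x assume "x \<in> {s..}"
      then have "norm (h x) \<le> C * exp (- k * (x - s))" by (intro b) simp
      then show "norm (h x) \<le> norm (C * exp (- k * (x - s)))" unfolding real_norm_def by linarith
    qed
  qed
  have "norm (LINT \<xi>:{s..}|lborel. h \<xi>) \<le> (LINT \<xi>:{s..}|lborel. C * exp (- k * (\<xi> - s)))"
    unfolding set_lebesgue_integral_def
  proof (rule Bochner_Integration.integral_norm_bound_integral)
    show "integrable lborel (\<lambda>x. indicat_real {s..} x *\<^sub>R h x)" using si by (simp add: set_integrable_def)
    show "integrable lborel (\<lambda>x. indicat_real {s..} x *\<^sub>R (C * exp (- k * (x - s))))" using i by (simp add: set_integrable_def)
  qed (use b in \<open>auto simp: indicator_def\<close>)
  also have "\<dots> = C / k" using e(2) by simp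
  finally show "norm (LINT \<xi>:{s..}|lborel. h \<xi>) \<le> C / k" .
  assume st: "s \<le> t"
  have 1: "set_integrable lborel {s..t} h" and 2: "set_integrable lborel {t..} h"
    by (rule set_integrable_subset[OF si]; use st in auto)+
  have "{s..} = {s..t} \<union> {t..}" using st by auto
  moreover have "(LINT \<xi>:{s..t} \<union> {t..}|lborel. h \<xi>) = (LINT \<xi>:{s..t}|lborel. h \<xi>) + (LINT \<xi>:{t..}|lborel. h \<xi>)"
  proof (rule set_integral_Un_AE[OF _ _ _ 1 2])
    show "AE x in lborel. \<not> (x \<in> {s..t} \<and> x \<in> {t..})"
      using AE_lborel_singleton[of t] by eventually_elim auto
  qed auto
  ultimately show "(LINT \<xi>:{s..}|lborel. h \<xi>) = integral {s..t} h + (LINT \<xi>:{t..}|lborel. h \<xi>)"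
    using set_borel_integral_eq_integral(2)[OF 1] by simp
qed

lemma set_integral_bounded_linear:
  assumes T: "bounded_linear T" and f: "set_integrable M X f"
  shows "T (LINT x:X|M. f x) = (LINT x:X|M. T (f x))" "set_integrable M X (\<lambda>x. T (f x))"
proof -
  interpret bounded_linear T by (rule T)
  show "T (LINT x:X|M. f x) = (LINT x:X|M. T (f x))"
    using integral_bounded_linear[OF T f[unfolded set_integrable_def]] by (simp add: set_lebesgue_integral_def scaleR)
  show "set_integrable M X (\<lambda>x. T (f x))"
    using integrable_bounded_linear[OF T f[unfolded set_integrable_def]] by (simp add: set_integrable_def scaleR)
qed

lemma indefinite_integral_continuous:
  fixes h :: "real \<Rightarrow> 'a::euclidean_space"
  assumes h: "continuous_on UNIV h"
  shows "continuous_on {s..} (\<lambda>t. integral {s..t} h)"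
  unfolding continuous_on_eq_continuous_within
proof
  fix t assume t: "t \<in> {s..}"
  have "continuous_on {s..t+1} (\<lambda>t. integral {s..t} h)"
    by (rule indefinite_integral_continuous_1 integrable_continuous_interval continuous_on_subset[OF h])+ auto
  moreover have "at t within {s..t+1} = at t within {s..}"
    by (rule at_within_nhd[of _ "{..<t+1}"]) auto
  moreover have "t \<in> {s..t+1}" using t by simp
  ultimately show "continuous (at t within {s..}) (\<lambda>t. integral {s..t} h)"
    by (metis continuous_on_eq_continuous_within)
qed

lemma indefinite_integral_deriv:
  fixes h :: "real \<Rightarrow> 'a::euclidean_space"
  assumes h: "continuous_on UNIV h" and t: "s < t"
  shows "((\<lambda>t. integral {s..t} h) has_vector_derivative h t) (at t)"
proof -
  have "((\<lambda>t. integral {s..t} h) has_vector_derivative h t) (at t within {s..t+1})"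
    by (rule integral_has_vector_derivative) (use t continuous_on_subset[OF h] in auto)
  moreover have "at t within {s..t+1} = at t"
    by (rule at_within_interior) (use t in auto)
  ultimately show ?thesis by simp
qed

section \<open>Covariances and means: splitting in time and uniform ellipticity\<close>

context ornstein_uhlenbeck
begin

lemma cov_eq: "cov B U s = (LINT \<xi>:{s..}|lborel. W s \<xi>)"
  by (simp add: cov_def W_def)

lemma W_integrable: "set_integrable lborel {s..} (W s)"
proof -
  obtain \<delta> C where "\<delta> > 0" "\<And>s \<xi>. s \<le> \<xi> \<Longrightarrow> norm (W s \<xi>) \<le> C * exp (- \<delta> * (\<xi> - s))" using W_decay by blast
  then show ?thesis by (rule tail_integral(1)[OF W_continuous])
qed

lemma Ug_integrable: "set_integrable lborel {s..} (\<lambda>\<xi>. U s \<xi> *v g \<xi>)"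
proof -
  obtain \<delta> C where "\<delta> > 0" "\<And>s \<xi>. s \<le> \<xi> \<Longrightarrow> norm (U s \<xi> *v g \<xi>) \<le> C * exp (- \<delta> * (\<xi> - s))" using Ug_decay by blast
  then show ?thesis by (rule tail_integral(1)[OF Ug_continuous])
qed

lemma cov_norm_bound: "\<exists>C. \<forall>s. norm (cov B U s) \<le> C"
proof -
  obtain \<delta> C where "\<delta> > 0" "\<And>s \<xi>. s \<le> \<xi> \<Longrightarrow> norm (W s \<xi>) \<le> C * exp (- \<delta> * (\<xi> - s))" using W_decay by blast
  then have "norm (cov B U s) \<le> C / \<delta>" for s unfolding cov_eq by (rule tail_integral(2)[OF W_continuous])
  then show ?thesis by blast
qed

lemma mean_bound: "\<exists>C. \<forall>s. norm (mean g U s) \<le> C"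
proof -
  obtain \<delta> C where "\<delta> > 0" "\<And>s \<xi>. s \<le> \<xi> \<Longrightarrow> norm (U s \<xi> *v g \<xi>) \<le> C * exp (- \<delta> * (\<xi> - s))" using Ug_decay by blast
  then have "norm (mean g U s) \<le> C / \<delta>" for s unfolding mean_def by (rule tail_integral(2)[OF Ug_continuous])
  then show ?thesis by blast
qed

lemma W_cocycle: "W s \<xi> = U s t ** W t \<xi> ** transpose (U s t)"
proof -
  have e: "U s \<xi> = U s t ** U t \<xi>" by (simp add: U_cocycle)
  show ?thesis unfolding W_def e by (simp add: matrix_transpose_mul matrix_mul_assoc)
qed

text \<open>The half-line is split at t, and the tail is transported from t to s by
  \<open>W_cocycle\<close>. Together with \<open>mean_split\<close> this identity is the source of
  the invariance of the measures \<open>mu\<close>.\<close>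

lemma cov_split:
  assumes "s \<le> t"
  shows "cov B U s = Qf s t + U s t ** cov B U t ** transpose (U s t)"
proof -
  obtain \<delta> C where "\<delta> > 0" "\<And>s \<xi>. s \<le> \<xi> \<Longrightarrow> norm (W s \<xi>) \<le> C * exp (- \<delta> * (\<xi> - s))" using W_decay by blast
  then have "cov B U s = Qf s t + (LINT \<xi>:{t..}|lborel. W s \<xi>)"
    unfolding cov_eq Qf_def by (rule tail_integral(3)[OF W_continuous _ _ assms])
  also have "(LINT \<xi>:{t..}|lborel. W s \<xi>) = (LINT \<xi>:{t..}|lborel. U s t ** W t \<xi> ** transpose (U s t))"
    by (simp add: W_cocycle[of s _ t])
  also have "\<dots> = U s t ** cov B U t ** transpose (U s t)"
    unfolding cov_eq
    by (rule set_integral_bounded_linear(1)[OF bounded_linear_compose[OF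
          bounded_bilinear.bounded_linear_left[OF bounded_bilinear_mat_mult] bounded_bilinear.bounded_linear_right[OF bounded_bilinear_mat_mult]] W_integrable, symmetric])
  finally show ?thesis .
qed

lemma mean_split:
  assumes "s \<le> t"
  shows "mean g U s = gf s t + U s t *v mean g U t"
proof -
  obtain \<delta> C where "\<delta> > 0" "\<And>s \<xi>. s \<le> \<xi> \<Longrightarrow> norm (U s \<xi> *v g \<xi>) \<le> C * exp (- \<delta> * (\<xi> - s))" using Ug_decay by blast
  then have "mean g U s = gf s t + (LINT \<xi>:{t..}|lborel. U s \<xi> *v g \<xi>)"
    unfolding mean_def gf_def by (rule tail_integral(3)[OF Ug_continuous _ _ assms])
  also have "(LINT \<xi>:{t..}|lborel. U s \<xi> *v g \<xi>) = (LINT \<xi>:{t..}|lborel. U s t *v (U t \<xi> *v g \<xi>))"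
    by (simp add: matrix_vector_mul_assoc U_cocycle)
  also have "\<dots> = U s t *v mean g U t"
    unfolding mean_def by (rule set_integral_bounded_linear(1)[OF matrix_vector_mul_bounded_linear Ug_integrable, symmetric])
  finally show ?thesis .
qed

lemma W_sym: "transpose (W s \<xi>) = W s \<xi>"
  by (simp add: W_def matrix_transpose_mul matrix_mul_assoc)

lemma cov_sym: "transpose (cov B U s) = cov B U s"
  unfolding cov_eq by (subst set_integral_bounded_linear(1)[OF bounded_linear_transpose W_integrable]) (simp add: W_sym)

lemma Qf_sym: "transpose (Qf s t) = Qf s t"
proof -
  have "integral {s..t} (transpose \<circ> W s) = transpose (integral {s..t} (W s))"
    by (rule integral_linear[OF integrable_continuous_interval[OF W_continuous] bounded_linear_transpose])
  moreover have "transpose \<circ> W s = W s" by (simp add: fun_eq_iff W_sym)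
  ultimately show ?thesis by (simp add: Qf_def)
qed

lemma bounded_linear_quadratic: "bounded_linear (\<lambda>M. (M *v v) \<bullet> w)" for v w :: "real^'n"
  by (rule bounded_linear_compose[OF bounded_linear_inner_left bounded_bilinear.bounded_linear_left[OF bounded_bilinear_mat_vec]])

lemma W_quadratic: "(W s \<xi> *v v) \<bullet> v = ((B \<xi> ** transpose (B \<xi>)) *v (transpose (U s \<xi>) *v v)) \<bullet> (transpose (U s \<xi>) *v v)"
  by (simp add: W_def matrix_mul_assoc[symmetric] matrix_vector_mul_assoc[symmetric] inner_matrix_transpose)

lemma BBT_lower: "((B \<xi> ** transpose (B \<xi>)) *v v) \<bullet> v \<ge> 2 * \<eta>\<^sub>0 * (norm v)\<^sup>2"
  using elliptic[of v \<xi>] by (simp add: scaleR_matrix_vector_assoc[symmetric])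

text \<open>Ellipticity is applied at the transported vector U(s,\<xi>)^T v, whose length is at
  least exp(-alpha |\<xi> - s|) |v|.\<close>

lemma W_lower: "(W s \<xi> *v v) \<bullet> v \<ge> 2 * \<eta>\<^sub>0 * exp (- 2 * alpha * \<bar>\<xi> - s\<bar>) * (norm v)\<^sup>2"
proof -
  let ?w = "transpose (U s \<xi>) *v v"
  have "norm v \<le> exp (alpha * \<bar>\<xi> - s\<bar>) * norm ?w" using U_vec_lower[of v s \<xi>] by (simp add: abs_minus_commute)
  then have "(norm v)\<^sup>2 \<le> (exp (alpha * \<bar>\<xi> - s\<bar>) * norm ?w)\<^sup>2" by (intro power_mono) auto
  then have "exp (- 2 * alpha * \<bar>\<xi> - s\<bar>) * (norm v)\<^sup>2 \<le> exp (- 2 * alpha * \<bar>\<xi> - s\<bar>) * (exp (alpha * \<bar>\<xi> - s\<bar>) * norm ?w)\<^sup>2"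
    by (intro mult_left_mono) auto
  also have "\<dots> = (exp (- 2 * alpha * \<bar>\<xi> - s\<bar>) * (exp (alpha * \<bar>\<xi> - s\<bar>))\<^sup>2) * (norm ?w)\<^sup>2"
    by (simp only: power_mult_distrib mult.assoc)
  also have "exp (- 2 * alpha * \<bar>\<xi> - s\<bar>) * (exp (alpha * \<bar>\<xi> - s\<bar>))\<^sup>2 = 1"
    unfolding exp_double[symmetric] by (simp add: mult_exp_exp)
  also have "1 * (norm ?w)\<^sup>2 = (norm ?w)\<^sup>2" by simp
  finally have "2 * \<eta>\<^sub>0 * (exp (- 2 * alpha * \<bar>\<xi> - s\<bar>) * (norm v)\<^sup>2) \<le> 2 * \<eta>\<^sub>0 * (norm ?w)\<^sup>2"
    using eta_pos by (intro mult_left_mono) auto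
  also have "\<dots> \<le> (W s \<xi> *v v) \<bullet> v" unfolding W_quadratic by (rule BBT_lower)
  finally show ?thesis by (simp add: mult.assoc)
qed

lemma W_nonneg: "(W s \<xi> *v v) \<bullet> v \<ge> 0"
proof -
  have "2 * \<eta>\<^sub>0 * exp (- 2 * alpha * \<bar>\<xi> - s\<bar>) * (norm v)\<^sup>2 \<ge> 0" using eta_pos by simp
  then show ?thesis using W_lower[of \<xi> s v] by linarith
qed

text \<open>A lower bound for the quadratic form of \<open>W s \<xi>\<close> when |\<xi> - s| <= 1;
  integrated over a unit interval it bounds every \<open>Qf s t\<close> with t - s >= 1 and every
  covariance from below.\<close>

definition lam where "lam = 2 * \<eta>\<^sub>0 * exp (- 2 * alpha)"

lemma lam_pos: "lam > 0" using eta_pos by (simp add: lam_def)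

text \<open>The integrand is nonnegative, so only [s, s + h] is kept. The choice h = 1 gives the
  uniform bound for t - s >= 1, while small h gives positive definiteness for every s < t.\<close>

lemma Qf_lower:
  assumes h: "0 \<le> h" "h \<le> 1" "h \<le> t - s"
  shows "(Qf s t *v v) \<bullet> v \<ge> h * lam * (norm v)\<^sup>2"
proof -
  have ic: "(\<lambda>\<xi>. (W s \<xi> *v v) \<bullet> v) integrable_on {s..r}" for r
    by (rule integrable_continuous_interval bounded_linear.continuous_on[OF bounded_linear_quadratic] W_continuous)+
  have "h * lam * (norm v)\<^sup>2 = integral {s..s+h} (\<lambda>_. lam * (norm v)\<^sup>2)" using h by simp
  also have "\<dots> \<le> integral {s..s+h} (\<lambda>\<xi>. (W s \<xi> *v v) \<bullet> v)"
  proof (rule integral_le[OF _ ic])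
    fix \<xi> assume x: "\<xi> \<in> {s..s+h}"
    have "lam * (norm v)\<^sup>2 \<le> 2 * \<eta>\<^sub>0 * exp (- 2 * alpha * \<bar>\<xi> - s\<bar>) * (norm v)\<^sup>2"
    proof -
      have "alpha * \<bar>\<xi> - s\<bar> \<le> alpha * 1" using x h alpha(1) by (intro mult_left_mono) auto
      then show ?thesis unfolding lam_def using eta_pos by (intro mult_right_mono mult_left_mono) auto
    qed
    also have "\<dots> \<le> (W s \<xi> *v v) \<bullet> v" by (rule W_lower)
    finally show "lam * (norm v)\<^sup>2 \<le> (W s \<xi> *v v) \<bullet> v" .
  qed auto
  also have "\<dots> \<le> integral {s..t} (\<lambda>\<xi>. (W s \<xi> *v v) \<bullet> v)"
    by (rule integral_subset_le[OF _ ic ic]) (use h W_nonneg in auto)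
  also have "\<dots> = (Qf s t *v v) \<bullet> v"
    unfolding Qf_def
    by (rule integral_linear[OF integrable_continuous_interval[OF W_continuous] bounded_linear_quadratic, unfolded o_def])
  finally show ?thesis .
qed

lemma Qf_pos:
  assumes "s < t" "v \<noteq> 0"
  shows "(Qf s t *v v) \<bullet> v > 0"
proof -
  have "min 1 (t - s) * lam * (norm v)\<^sup>2 > 0" using assms lam_pos by simp
  then show ?thesis using Qf_lower[of "min 1 (t - s)" t s v] assms by linarith
qed

lemma cov_nonneg: "(cov B U s *v v) \<bullet> v \<ge> 0"
proof -
  have "(cov B U s *v v) \<bullet> v = (LINT \<xi>:{s..}|lborel. (W s \<xi> *v v) \<bullet> v)"
    unfolding cov_eq by (rule set_integral_bounded_linear(1)[OF bounded_linear_quadratic W_integrable])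
  also have "\<dots> \<ge> 0" unfolding set_lebesgue_integral_def
    by (intro Bochner_Integration.integral_nonneg) (simp add: W_nonneg)
  finally show ?thesis .
qed

lemma cov_quadratic_split:
  assumes "s \<le> t"
  shows "(cov B U s *v v) \<bullet> v = (Qf s t *v v) \<bullet> v + (cov B U t *v (transpose (U s t) *v v)) \<bullet> (transpose (U s t) *v v)"
  unfolding cov_split[OF assms]
  by (simp add: matrix_vector_mult_add_rdistrib inner_add_left matrix_mul_assoc[symmetric] matrix_vector_mul_assoc[symmetric] inner_matrix_transpose)

lemma cov_lower: "(cov B U s *v v) \<bullet> v \<ge> lam * (norm v)\<^sup>2"
  using cov_quadratic_split[of s "s + 1" v] Qf_lower[of 1 "s + 1" s v] cov_nonneg[of "s + 1" "transpose (U s (s + 1)) *v v"] by simp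

lemma cov_pos: "v \<noteq> 0 \<Longrightarrow> (cov B U s *v v) \<bullet> v > 0"
  by (rule less_le_trans[OF _ cov_lower]) (simp add: lam_pos)

lemma cov_upper: "\<exists>C>0. \<forall>s v. (cov B U s *v v) \<bullet> v \<le> C * (norm v)\<^sup>2"
proof -
  obtain C where C: "\<And>s. norm (cov B U s) \<le> C" using cov_norm_bound by blast
  obtain K where K: "\<And>(M::real^'n^'n) x. norm (M *v x) \<le> norm M * norm x * K" "K > 0"
    using bounded_bilinear.pos_bounded[OF bounded_bilinear_mat_vec] by blast
  have "(cov B U s *v v) \<bullet> v \<le> (\<bar>C\<bar> + 1) * K * (norm v)\<^sup>2" for s v
  proof -
    have "(cov B U s *v v) \<bullet> v \<le> norm (cov B U s *v v) * norm v" by (rule norm_cauchy_schwarz)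
    also have "\<dots> \<le> (norm (cov B U s) * norm v * K) * norm v" by (intro mult_right_mono K(1)) auto
    also have "\<dots> \<le> ((\<bar>C\<bar> + 1) * norm v * K) * norm v"
      using C[of s] K(2) by (intro mult_right_mono) auto
    finally show ?thesis by (simp add: power2_eq_square ac_simps)
  qed
  moreover have "(\<bar>C\<bar> + 1) * K > 0" using K(2) by (simp add: add_nonneg_pos)
  ultimately show ?thesis by blast
qed

text \<open>The transported remainder in \<open>cov_split\<close> is nonnegative. Hence upper bounds
  for the covariances hold for \<open>Qf s t\<close> uniformly in t.\<close>

lemma Qf_le_cov: "s \<le> t \<Longrightarrow> (Qf s t *v v) \<bullet> v \<le> (cov B U s *v v) \<bullet> v"
  using cov_quadratic_split[of s t v] cov_nonneg[of t "transpose (U s t) *v v"] by linarith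

lemma Qf_continuous: "continuous_on {s..} (Qf s)"
  unfolding Qf_def by (rule indefinite_integral_continuous[OF W_continuous])
lemma gf_continuous: "continuous_on {s..} (gf s)"
  unfolding gf_def by (rule indefinite_integral_continuous[OF Ug_continuous])
lemma Qf_deriv: "s < t \<Longrightarrow> (Qf s has_vector_derivative W s t) (at t)"
  unfolding Qf_def by (rule indefinite_integral_deriv[OF W_continuous])
lemma gf_deriv: "s < t \<Longrightarrow> (gf s has_vector_derivative U s t *v g t) (at t)"
  unfolding gf_def by (rule indefinite_integral_deriv[OF Ug_continuous])
lemma Qf_self: "Qf s s = 0" and gf_self: "gf s s = 0"
  by (simp_all add: Qf_def gf_def)

end

section \<open>Uniqueness of bounded classical solutions\<close>

lemma has_derivative_grad:
  fixes \<phi> :: "real^'n \<Rightarrow> real"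
  assumes "\<phi> differentiable (at x)"
  shows "(\<phi> has_derivative (\<lambda>h. grad \<phi> x \<bullet> h)) (at x)"
proof -
  let ?D = "frechet_derivative \<phi> (at x)"
  have D: "(\<phi> has_derivative ?D) (at x)" using assms frechet_derivative_works by blast
  then have lin: "linear ?D" by (rule has_derivative_linear)
  have "?D h = grad \<phi> x \<bullet> h" for h
  proof -
    have "?D h = ?D (\<Sum>i\<in>UNIV. (h $ i) *\<^sub>R axis i 1)"
      using basis_expansion[of h] by (simp add: scalar_mult_eq_scaleR)
    also have "\<dots> = (\<Sum>i\<in>UNIV. (h $ i) * ?D (axis i 1))"
      by (simp add: linear_sum[OF lin] linear_scale[OF lin])
    finally show ?thesis by (simp add: grad_def inner_vec_def mult.commute)
  qed
  then have "?D = (\<lambda>h. grad \<phi> x \<bullet> h)" by auto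
  then show ?thesis using D by simp
qed

lemma grad_unique:
  fixes \<phi> :: "real^'n \<Rightarrow> real"
  assumes "(\<phi> has_derivative (\<lambda>h. a \<bullet> h)) (at x)"
  shows "grad \<phi> x = a"
proof -
  have "frechet_derivative \<phi> (at x) = (\<lambda>h. a \<bullet> h)" using frechet_derivative_at[OF assms] by simp
  then show ?thesis by (simp add: grad_def vec_eq_iff inner_axis)
qed

lemma has_derivative_hessian:
  fixes \<phi> :: "real^'n \<Rightarrow> real"
  assumes "grad \<phi> differentiable (at x)"
  shows "(grad \<phi> has_derivative (\<lambda>h. hessian \<phi> x *v h)) (at x)"
  unfolding hessian_def using assms by (simp add: jacobian_works)

lemma hessian_unique:
  fixes \<phi> :: "real^'n \<Rightarrow> real"
  assumes "(grad \<phi> has_derivative (\<lambda>h. M *v h)) (at x)"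
  shows "hessian \<phi> x = M"
proof -
  have "frechet_derivative (grad \<phi>) (at x) = (\<lambda>h. M *v h)" using frechet_derivative_at[OF assms] by simp
  then show ?thesis by (simp add: hessian_def jacobian_def)
qed

text \<open>Writes the second-order part of the operator as a sum of second derivatives along the
  columns of \<open>B\<close>, so that one-dimensional tests suffice at a maximum.\<close>

lemma trace_congruence:
  fixes B H :: "real^'n^'n"
  shows "trace (B ** transpose B ** H) = (\<Sum>j\<in>UNIV. (H *v column j B) \<bullet> column j B)"
proof -
  have "trace (B ** transpose B ** H) = trace (B ** (transpose B ** H))" by (simp add: matrix_mul_assoc)
  also have "\<dots> = trace (transpose B ** H ** B)" by (rule trace_mul_sym)
  also have "\<dots> = (\<Sum>j\<in>UNIV. (H *v column j B) \<bullet> column j B)"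
  proof -
    have "(transpose B ** H ** B) $ j $ j = (H *v column j B) \<bullet> column j B" for j
    proof -
      have "(transpose B ** H ** B) $ j $ j = ((transpose B ** H ** B) *v axis j 1) $ j"
        by (simp add: matrix_vector_mult_basis column_def)
      also have "\<dots> = (transpose B *v (H *v (B *v axis j 1))) \<bullet> axis j 1"
        by (simp add: inner_axis matrix_vector_mul_assoc matrix_mul_assoc)
      also have "\<dots> = (H *v (B *v axis j 1)) \<bullet> (B *v axis j 1)"
        by (simp add: inner_matrix_transpose)
      finally show ?thesis by (simp add: matrix_vector_mult_basis)
    qed
    then show ?thesis by (simp add: trace_def)
  qed
  finally show ?thesis .
qed

text \<open>If d were positive, the first derivative, which vanishes at 0, would be positive just to
  the right, and the mean value theorem would contradict the maximum.\<close>

lemma second_derivative_test: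
  fixes \<phi> :: "real \<Rightarrow> real"
  assumes d1: "\<And>\<tau>. (\<phi> has_real_derivative \<phi>1 \<tau>) (at \<tau>)" and d2: "(\<phi>1 has_real_derivative d) (at 0)"
    and r: "r > 0" and max: "\<And>\<tau>. \<bar>\<tau>\<bar> < r \<Longrightarrow> \<phi> \<tau> \<le> \<phi> 0"
  shows "\<phi>1 0 = 0" "d \<le> 0"
proof -
  show z: "\<phi>1 0 = 0" by (rule DERIV_local_max[OF d1 r]) (use max in auto)
  show "d \<le> 0"
  proof (rule ccontr)
    assume "\<not> d \<le> 0"
    then obtain e where e: "e > 0" "\<And>h. 0 < h \<Longrightarrow> h < e \<Longrightarrow> \<phi>1 0 < \<phi>1 (0 + h)"
      using DERIV_pos_inc_right[OF d2] by auto
    define h where "h = min e r / 2"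
    have h: "0 < h" "h < e" "h < r" using e r by (auto simp: h_def)
    obtain z where z': "0 < z" "z < h" "\<phi> h - \<phi> 0 = (h - 0) * \<phi>1 z"
      using MVT2[of 0 h \<phi> \<phi>1] d1 h(1) by blast
    have "\<phi>1 z > 0" using e(2)[of z] z' h z by simp
    then have "(h - 0) * \<phi>1 z > 0" using h(1) by simp
    with z'(3) have "\<phi> h > \<phi> 0" by linarith
    then show False using max[of h] h by simp
  qed
qed

context ornstein_uhlenbeck
begin

lemma BBT_trace_bound: "\<exists>C\<ge>0. \<forall>t. (\<Sum>j\<in>UNIV. (norm (column j (B t)))\<^sup>2) \<le> C"
proof -
  obtain b where b: "\<And>t. norm (B t) \<le> b" using B_bounded by (auto simp: bounded_iff)
  obtain K where K: "K \<ge> 0" "\<And>M::real^'n^'n. opn M \<le> K * norm M" using opn_le_norm by blast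
  have "(\<Sum>j\<in>UNIV. (norm (column j (B t)))\<^sup>2) \<le> (\<Sum>j\<in>(UNIV::'n set). (K * b)\<^sup>2)" for t
  proof (intro sum_mono power_mono)
    fix j :: 'n
    have "norm (column j (B t)) \<le> opn (B t)" by (rule norm_column_le_onorm)
    also have "\<dots> \<le> K * b" using K b by (meson mult_left_mono order_trans)
    finally show "norm (column j (B t)) \<le> K * b" .
  qed auto
  then show ?thesis by (intro exI[of _ "\<Sum>j\<in>(UNIV::'n set). (K * b)\<^sup>2"] conjI sum_nonneg) auto
qed

text \<open>The left side is the operator applied to V(x) = 1 + |x|^2, since V has gradient 2x and
  Hessian 2. The strict inequality makes exp(Lc t) V(x) a strict supersolution.\<close>

lemma Lyapunov_constant: "\<exists>Lc>0. \<forall>t x. (\<Sum>j\<in>UNIV. (norm (column j (B t)))\<^sup>2) + 2 * ((A t *v x + g t) \<bullet> x) < Lc * (1 + (norm x)\<^sup>2)"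
proof -
  obtain C where C: "C \<ge> 0" "\<And>t. (\<Sum>j\<in>UNIV. (norm (column j (B t)))\<^sup>2) \<le> C" using BBT_trace_bound by blast
  obtain G where G: "\<And>t. norm (g t) \<le> G" using g_bounded by (auto simp: bounded_iff)
  define Lc where "Lc = C + 2 * alpha + G\<^sup>2 + 2"
  have "(\<Sum>j\<in>UNIV. (norm (column j (B t)))\<^sup>2) + 2 * ((A t *v x + g t) \<bullet> x) < Lc * (1 + (norm x)\<^sup>2)" for t x
  proof -
    have 1: "(A t *v x) \<bullet> x \<le> alpha * (norm x)\<^sup>2"
    proof -
      have "(A t *v x) \<bullet> x \<le> norm (A t *v x) * norm x" by (rule norm_cauchy_schwarz)
      also have "\<dots> \<le> (alpha * norm x) * norm x"
        by (intro mult_right_mono order_trans[OF norm_mat_vec_le mult_right_mono[OF alpha(2)]]) auto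
      finally show ?thesis by (simp add: power2_eq_square mult.assoc)
    qed
    have 2: "2 * (g t \<bullet> x) \<le> G\<^sup>2 + (norm x)\<^sup>2"
    proof -
      have "g t \<bullet> x \<le> norm (g t) * norm x" by (rule norm_cauchy_schwarz)
      also have "\<dots> \<le> G * norm x" by (intro mult_right_mono G) auto
      finally have "2 * (g t \<bullet> x) \<le> 2 * G * norm x" by simp
      also have "\<dots> \<le> G\<^sup>2 + (norm x)\<^sup>2" using sum_squares_bound[of G "norm x"] by simp
      finally show ?thesis .
    qed
    have "Lc * (1 + (norm x)\<^sup>2) = C + 2 * alpha + G\<^sup>2 + 2 + (C + 2 * alpha + G\<^sup>2 + 2) * (norm x)\<^sup>2"
      by (simp add: Lc_def algebra_simps)
    moreover have "(C + G\<^sup>2 + 1) * (norm x)\<^sup>2 \<ge> 0" using C(1) by (intro mult_nonneg_nonneg) auto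
    then have "(C + 2 * alpha + G\<^sup>2 + 2) * (norm x)\<^sup>2 \<ge> 2 * alpha * (norm x)\<^sup>2 + (norm x)\<^sup>2"
      by (simp add: algebra_simps)
    ultimately show ?thesis using 1 2 C(2)[of t] alpha(1) by (simp add: inner_add_left)
  qed
  moreover have "Lc > 0" using C(1) alpha(1) by (simp add: Lc_def add_nonneg_pos)
  ultimately show ?thesis by blast
qed

text \<open>A maximum principle on an unbounded domain. The difference of the solutions is penalised
  by a small multiple \<open>E\<close> of the strict supersolution 1 + |x|^2. If it were positive
  somewhere, the penalised difference \<open>v\<close> would have a positive maximum on a compact
  cylinder, neither at the initial time nor on the lateral boundary, and there the equation is
  contradicted.\<close>

lemma classical_solution_le:
  assumes u: "bounded_classical_solution A B g s f u" and u': "bounded_classical_solution A B g s f u'"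
    and t0: "s \<le> t0"
  shows "u t0 x0 \<le> u' t0 x0"
proof (rule ccontr)
  assume neg: "\<not> u t0 x0 \<le> u' t0 x0"
  obtain Lc where lam: "Lc > 0" "\<And>t x. (\<Sum>j\<in>UNIV. (norm (column j (B t)))\<^sup>2) + 2 * ((A t *v x + g t) \<bullet> x) < Lc * (1 + (norm x)\<^sup>2)"
    using Lyapunov_constant by blast
  have init: "u s x = u' s x" for x using u u' by (simp add: bounded_classical_solution_def)
  have "t0 \<noteq> s" using neg init by auto
  with t0 have st0: "s < t0" by simp
  obtain M1 where M1: "\<And>t x. s \<le> t \<Longrightarrow> \<bar>u t x\<bar> \<le> M1"
    using u unfolding bounded_classical_solution_def bounded_iff by force
  obtain M2 where M2: "\<And>t x. s \<le> t \<Longrightarrow> \<bar>u' t x\<bar> \<le> M2"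
    using u' unfolding bounded_classical_solution_def bounded_iff by force
  define d where "d = u t0 x0 - u' t0 x0"
  have d: "d > 0" using neg by (simp add: d_def)
  \<comment> \<open>Makes the penalty at (t0, x0) equal to d / 2, so that \<open>v t0 x0\<close>
    stays positive.\<close>
  define \<epsilon> where "\<epsilon> = d / (2 * exp (Lc * (t0 - s)) * (1 + (norm x0)\<^sup>2))"
  have pos1: "1 + (norm x)\<^sup>2 > 0" for x :: "real^'n" by (simp add: add_pos_nonneg)
  have eps: "\<epsilon> > 0" using d pos1 by (simp add: \<epsilon>_def)
  define E where "E t = \<epsilon> * exp (Lc * (t - s))" for t
  define v where "v t x = u t x - u' t x - E t * (1 + (norm x)\<^sup>2)" for t x
  have E: "E t \<ge> \<epsilon>" "E t > 0" if "s \<le> t" for t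
    using that eps lam(1) by (auto simp: E_def)
  have v0: "v t0 x0 > 0"
  proof -
    have "E t0 * (1 + (norm x0)\<^sup>2) = d / 2"
    proof -
      have "d / (2 * Y * Z) * Y * Z = d / 2" if "Y > 0" "Z > 0" for Y Z :: real using that by simp
      from this[of "exp (Lc * (t0 - s))" "1 + (norm x0)\<^sup>2"] show ?thesis
        using pos1[of x0] by (simp only: E_def \<epsilon>_def exp_gt_zero)
    qed
    then show ?thesis using d by (simp add: v_def d_def[symmetric])
  qed
  \<comment> \<open>On the sphere of this radius the penalty exceeds any possible difference of the
    two bounded solutions, so the maximum lies strictly inside.\<close>
  define R where "R = max (norm x0) (sqrt ((\<bar>M1\<bar> + \<bar>M2\<bar>) / \<epsilon>))"
  have R0: "R \<ge> 0" by (simp add: R_def le_max_iff_disj)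
  have Rb: "\<epsilon> * (1 + R\<^sup>2) > \<bar>M1\<bar> + \<bar>M2\<bar>"
  proof -
    have "sqrt ((\<bar>M1\<bar> + \<bar>M2\<bar>) / \<epsilon>) \<le> R" by (simp add: R_def)
    then have "(sqrt ((\<bar>M1\<bar> + \<bar>M2\<bar>) / \<epsilon>))\<^sup>2 \<le> R\<^sup>2" by (rule power_mono) (use eps in auto)
    then have "(\<bar>M1\<bar> + \<bar>M2\<bar>) / \<epsilon> \<le> R\<^sup>2" using eps by simp
    then have "\<bar>M1\<bar> + \<bar>M2\<bar> \<le> R\<^sup>2 * \<epsilon>" using eps by (simp add: field_simps)
    then show ?thesis using eps by (simp add: algebra_simps)
  qed
  let ?K = "{s..t0} \<times> cball (0::real^'n) R"
  have Ksub: "?K \<subseteq> {s..} \<times> UNIV" by auto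
  have cont: "continuous_on ?K (\<lambda>p. v (fst p) (snd p))"
  proof -
    have 1: "continuous_on ?K (\<lambda>p. u (fst p) (snd p))" and 2: "continuous_on ?K (\<lambda>p. u' (fst p) (snd p))"
      using u u' continuous_on_subset[OF _ Ksub] unfolding bounded_classical_solution_def by (auto simp: case_prod_beta)
    show ?thesis unfolding v_def E_def by (intro continuous_intros 1 2)
  qed
  have "compact ?K" by (intro compact_Times) auto
  moreover have in0: "(t0, x0) \<in> ?K" using st0 by (simp add: R_def)
  ultimately obtain p where p: "p \<in> ?K" "\<And>q. q \<in> ?K \<Longrightarrow> v (fst q) (snd q) \<le> v (fst p) (snd p)"
    using continuous_attains_sup[OF _ _ cont] by blast
  obtain t1 x1 where p1: "p = (t1, x1)" by (cases p)
  have t1: "s \<le> t1" "t1 \<le> t0" and x1: "norm x1 \<le> R" using p(1) by (auto simp: p1)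
  have mx: "v t x \<le> v t1 x1" if "s \<le> t" "t \<le> t0" "norm x \<le> R" for t x
    using p(2)[of "(t, x)"] that by (simp add: p1)
  have vpos: "v t1 x1 > 0" using mx[of t0 x0] v0 in0 st0 by auto
  have "t1 \<noteq> s"
  proof
    assume "t1 = s"
    then have "v t1 x1 = - \<epsilon> * (1 + (norm x1)\<^sup>2)" by (simp add: v_def init E_def)
    also have "\<dots> < 0" using eps pos1[of x1] by simp
    finally show False using vpos by simp
  qed
  then have st1: "s < t1" using t1 by simp
  have x1R: "norm x1 < R"
  proof (rule ccontr)
    assume "\<not> norm x1 < R"
    then have "norm x1 = R" using x1 by simp
    then have "E t1 * (1 + (norm x1)\<^sup>2) \<ge> \<epsilon> * (1 + R\<^sup>2)" using E[OF t1(1)] by (intro mult_mono) auto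
    moreover have "u t1 x1 - u' t1 x1 \<le> \<bar>M1\<bar> + \<bar>M2\<bar>" using M1[OF t1(1), of x1] M2[OF t1(1), of x1] by linarith
    ultimately have "v t1 x1 < 0" using Rb unfolding v_def by linarith
    then show False using vpos by simp
  qed
  have du: "u t1 differentiable (at x)" "grad (u t1) differentiable (at x)" "(\<lambda>\<tau>. u \<tau> x) differentiable (at t1)"
    "deriv (\<lambda>\<tau>. u \<tau> x) t1 = OU_operator A B g t1 (u t1) x" for x
    using u st1 unfolding bounded_classical_solution_def C12_after_def by auto
  have du': "u' t1 differentiable (at x)" "grad (u' t1) differentiable (at x)" "(\<lambda>\<tau>. u' \<tau> x) differentiable (at t1)"
    "deriv (\<lambda>\<tau>. u' \<tau> x) t1 = OU_operator A B g t1 (u' t1) x" for x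
    using u' st1 unfolding bounded_classical_solution_def C12_after_def by auto
  let ?D = "grad (u t1) x1 - grad (u' t1) x1"
  let ?H = "hessian (u t1) x1 - hessian (u' t1) x1"
  \<comment> \<open>The first and second derivative tests along every line through x1: there the
    difference of the solutions has the gradient of the penalty and a Hessian bounded by that of the
    penalty.\<close>
  have dir: "?D \<bullet> b = 2 * E t1 * (x1 \<bullet> b) \<and> (?H *v b) \<bullet> b \<le> 2 * E t1 * (norm b)\<^sup>2" for b
  proof -
    define \<phi> where "\<phi> \<tau> = v t1 (x1 + \<tau> *\<^sub>R b)" for \<tau>
    define \<phi>1 where "\<phi>1 \<tau> = (grad (u t1) (x1 + \<tau> *\<^sub>R b) - grad (u' t1) (x1 + \<tau> *\<^sub>R b)) \<bullet> b - E t1 * (2 * ((x1 + \<tau> *\<^sub>R b) \<bullet> b))" for \<tau>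
    have line: "((\<lambda>\<tau>. x1 + \<tau> *\<^sub>R b) has_derivative (\<lambda>h. h *\<^sub>R b)) (at \<tau>)" for \<tau>
      by (auto intro!: derivative_eq_intros)
    have d1: "(\<phi> has_real_derivative \<phi>1 \<tau>) (at \<tau>)" for \<tau>
    proof -
      have a: "((\<lambda>\<tau>. u t1 (x1 + \<tau> *\<^sub>R b)) has_derivative (\<lambda>h. grad (u t1) (x1 + \<tau> *\<^sub>R b) \<bullet> (h *\<^sub>R b))) (at \<tau>)"
        by (rule has_derivative_compose[OF line has_derivative_grad[OF du(1)]])
      have a': "((\<lambda>\<tau>. u' t1 (x1 + \<tau> *\<^sub>R b)) has_derivative (\<lambda>h. grad (u' t1) (x1 + \<tau> *\<^sub>R b) \<bullet> (h *\<^sub>R b))) (at \<tau>)"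
        by (rule has_derivative_compose[OF line has_derivative_grad[OF du'(1)]])
      have c: "((\<lambda>\<tau>. E t1 * (1 + (x1 + \<tau> *\<^sub>R b) \<bullet> (x1 + \<tau> *\<^sub>R b))) has_derivative (\<lambda>h. E t1 * (2 * ((x1 + \<tau> *\<^sub>R b) \<bullet> (h *\<^sub>R b))))) (at \<tau>)"
        by (rule derivative_eq_intros line refl)+ (auto simp: inner_commute)
      have "((\<lambda>\<tau>. u t1 (x1 + \<tau> *\<^sub>R b) - u' t1 (x1 + \<tau> *\<^sub>R b) - E t1 * (1 + (x1 + \<tau> *\<^sub>R b) \<bullet> (x1 + \<tau> *\<^sub>R b))) has_derivative
        (\<lambda>h. grad (u t1) (x1 + \<tau> *\<^sub>R b) \<bullet> (h *\<^sub>R b) - grad (u' t1) (x1 + \<tau> *\<^sub>R b) \<bullet> (h *\<^sub>R b) - E t1 * (2 * ((x1 + \<tau> *\<^sub>R b) \<bullet> (h *\<^sub>R b))))) (at \<tau>)"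
        by (intro has_derivative_diff a a' c)
      moreover have "(\<lambda>h. grad (u t1) (x1 + \<tau> *\<^sub>R b) \<bullet> (h *\<^sub>R b) - grad (u' t1) (x1 + \<tau> *\<^sub>R b) \<bullet> (h *\<^sub>R b) - E t1 * (2 * ((x1 + \<tau> *\<^sub>R b) \<bullet> (h *\<^sub>R b)))) = (*) (\<phi>1 \<tau>)"
        unfolding fun_eq_iff \<phi>1_def by (simp add: algebra_simps inner_diff_left)
      ultimately show ?thesis unfolding \<phi>_def v_def has_field_derivative_def power2_norm_eq_inner by simp
    qed
    have d2: "(\<phi>1 has_real_derivative ((?H *v b) \<bullet> b - 2 * E t1 * (b \<bullet> b))) (at 0)"
    proof -
      have z: "x1 = x1 + 0 *\<^sub>R b" by simp
      have a: "((\<lambda>\<tau>. grad (u t1) (x1 + \<tau> *\<^sub>R b)) has_derivative (\<lambda>h. hessian (u t1) x1 *v (h *\<^sub>R b))) (at 0)"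
        by (rule has_derivative_compose[OF line[of 0], where g = "grad (u t1)" and g' = "\<lambda>h. hessian (u t1) x1 *v h"]) (use has_derivative_hessian[OF du(2)] in simp)
      have a': "((\<lambda>\<tau>. grad (u' t1) (x1 + \<tau> *\<^sub>R b)) has_derivative (\<lambda>h. hessian (u' t1) x1 *v (h *\<^sub>R b))) (at 0)"
        by (rule has_derivative_compose[OF line[of 0], where g = "grad (u' t1)" and g' = "\<lambda>h. hessian (u' t1) x1 *v h"]) (use has_derivative_hessian[OF du'(2)] in simp)
      have c: "((\<lambda>\<tau>. E t1 * (2 * ((x1 + \<tau> *\<^sub>R b) \<bullet> b))) has_derivative (\<lambda>h. E t1 * (2 * ((h *\<^sub>R b) \<bullet> b)))) (at 0)"
        by (rule derivative_eq_intros line refl)+ auto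
      have "(\<phi>1 has_derivative (\<lambda>h. (hessian (u t1) x1 *v (h *\<^sub>R b) - hessian (u' t1) x1 *v (h *\<^sub>R b)) \<bullet> b - E t1 * (2 * ((h *\<^sub>R b) \<bullet> b)))) (at 0)"
        unfolding \<phi>1_def
        by (intro has_derivative_diff c has_derivative_inner_left a a')
      moreover have "(\<lambda>h. (hessian (u t1) x1 *v (h *\<^sub>R b) - hessian (u' t1) x1 *v (h *\<^sub>R b)) \<bullet> b - E t1 * (2 * ((h *\<^sub>R b) \<bullet> b))) = (*) ((?H *v b) \<bullet> b - 2 * E t1 * (b \<bullet> b))"
        unfolding fun_eq_iff by (simp add: matrix_vector_mult_scaleR matrix_vector_mult_diff_rdistrib inner_diff_left algebra_simps)
      ultimately show ?thesis unfolding has_field_derivative_def by simp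
    qed
    define r where "r = (R - norm x1) / (norm b + 1)"
    have bpos: "norm b + 1 > 0" by (simp add: add_nonneg_pos)
    have r: "r > 0" using x1R bpos by (simp add: r_def)
    have max: "\<phi> \<tau> \<le> \<phi> 0" if "\<bar>\<tau>\<bar> < r" for \<tau>
    proof -
      have "\<bar>\<tau>\<bar> * norm b \<le> r * (norm b + 1)" using that by (intro mult_mono) auto
      also have "\<dots> = R - norm x1" using bpos by (simp add: r_def)
      finally have "norm (x1 + \<tau> *\<^sub>R b) \<le> R" using norm_triangle_ineq[of x1 "\<tau> *\<^sub>R b"] by simp
      then show ?thesis using mx[of t1 "x1 + \<tau> *\<^sub>R b"] t1 by (simp add: \<phi>_def)
    qed
    note T = second_derivative_test[OF d1 d2 r max]
    from T show ?thesis by (simp add: \<phi>1_def power2_norm_eq_inner)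
  qed
  have D: "?D = (2 * E t1) *\<^sub>R x1"
    by (rule vector_eq_rdot[THEN iffD1]) (use dir in auto)
  have tr: "trace (B t1 ** transpose (B t1) ** ?H) \<le> 2 * E t1 * (\<Sum>j\<in>UNIV. (norm (column j (B t1)))\<^sup>2)"
    unfolding trace_congruence sum_distrib_left by (intro sum_mono) (use dir in auto)
  define w' where "w' = deriv (\<lambda>\<tau>. u \<tau> x1) t1 - deriv (\<lambda>\<tau>. u' \<tau> x1) t1"
  have w': "((\<lambda>\<tau>. v \<tau> x1) has_real_derivative w' - Lc * E t1 * (1 + (norm x1)\<^sup>2)) (at t1)"
  proof -
    have a: "((\<lambda>\<tau>. u \<tau> x1) has_real_derivative deriv (\<lambda>\<tau>. u \<tau> x1) t1) (at t1)"
      and a': "((\<lambda>\<tau>. u' \<tau> x1) has_real_derivative deriv (\<lambda>\<tau>. u' \<tau> x1) t1) (at t1)"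
      using du(3) du'(3) by (auto simp: DERIV_deriv_iff_real_differentiable)
    show ?thesis unfolding v_def E_def w'_def
      by (rule derivative_eq_intros a a' refl)+ (simp add: algebra_simps)
  qed
  \<comment> \<open>Since t1 may be the final time, only earlier times are compared; they force the
    time derivative of \<open>v\<close> at t1 to be nonnegative.\<close>
  have "w' - Lc * E t1 * (1 + (norm x1)\<^sup>2) \<ge> 0"
  proof (rule ccontr)
    assume "\<not> w' - Lc * E t1 * (1 + (norm x1)\<^sup>2) \<ge> 0"
    then obtain e where e: "e > 0" "\<And>h. 0 < h \<Longrightarrow> h < e \<Longrightarrow> v t1 x1 < v (t1 - h) x1"
      using DERIV_neg_dec_left[OF w'] by auto
    define h where "h = min e (t1 - s) / 2"
    have h: "0 < h" "h < e" "h < t1 - s" using e(1) st1 by (auto simp: h_def)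
    have "v (t1 - h) x1 \<le> v t1 x1" using h t1 x1 by (intro mx) auto
    then show False using e(2)[OF h(1,2)] by simp
  qed
  moreover have "w' \<le> E t1 * ((\<Sum>j\<in>UNIV. (norm (column j (B t1)))\<^sup>2) + 2 * ((A t1 *v x1 + g t1) \<bullet> x1))"
  proof -
    have "w' = 1 / 2 * trace (B t1 ** transpose (B t1) ** ?H) + (A t1 *v x1 + g t1) \<bullet> ?D"
    proof -
      have "trace (B t1 ** transpose (B t1) ** ?H) = trace (B t1 ** transpose (B t1) ** hessian (u t1) x1) - trace (B t1 ** transpose (B t1) ** hessian (u' t1) x1)"
        by (simp add: bounded_bilinear.diff_right[OF bounded_bilinear_mat_mult] trace_sub)
      then show ?thesis unfolding w'_def du(4) du'(4) OU_operator_def by (simp add: inner_diff_right algebra_simps)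
    qed
    also have "\<dots> = 1 / 2 * trace (B t1 ** transpose (B t1) ** ?H) + 2 * E t1 * ((A t1 *v x1 + g t1) \<bullet> x1)"
      by (simp only: D) simp
    finally show ?thesis using tr by (simp add: algebra_simps)
  qed
  moreover have "E t1 * ((\<Sum>j\<in>UNIV. (norm (column j (B t1)))\<^sup>2) + 2 * ((A t1 *v x1 + g t1) \<bullet> x1)) < E t1 * (Lc * (1 + (norm x1)\<^sup>2))"
    by (intro mult_strict_left_mono lam(2) E(2) t1)
  ultimately show False by (simp add: algebra_simps)
qed

lemma classical_solution_unique:
  assumes "bounded_classical_solution A B g s f u" "bounded_classical_solution A B g s f u'" "s \<le> t"
  shows "u t = u' t"
  using classical_solution_le[OF assms] classical_solution_le[OF assms(2,1,3)] by (intro ext antisym)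

lemma evol_eqI:
  assumes "bounded_classical_solution A B g s f u" "s \<le> t"
  shows "evol A B g t s f = u t"
  unfolding evol_def using assms classical_solution_unique by (intro the_equality) blast+

end

section \<open>Differentiation of parametric integrals, determinants and inverses\<close>

text \<open>Dominated convergence along sequences, which determine limits in a first countable
  space.\<close>

lemma parametric_integral_tendsto:
  fixes K :: "'a::first_countable_topology \<Rightarrow> 'b \<Rightarrow> 'c::{banach, second_countable_topology}"
  assumes lim: "\<And>y. y \<in> space M \<Longrightarrow> ((\<lambda>p. K p y) \<longlongrightarrow> K0 y) (at p0 within S)"
    and bound: "\<forall>\<^sub>F p in at p0 within S. \<forall>y\<in>space M. norm (K p y) \<le> D y" and D: "integrable M D"
    and meas: "\<And>p. p \<in> S \<Longrightarrow> K p \<in> borel_measurable M" and meas0: "K0 \<in> borel_measurable M"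
  shows "((\<lambda>p. \<integral>y. K p y \<partial>M) \<longlongrightarrow> (\<integral>y. K0 y \<partial>M)) (at p0 within S)"
  unfolding tendsto_at_iff_sequentially
proof (intro allI impI)
  fix X assume X: "\<forall>i. X i \<in> S - {p0}" "X \<longlonglongrightarrow> p0"
  have f: "filterlim X (at p0 within S) sequentially"
    unfolding filterlim_at using X by (auto intro!: eventually_sequentiallyI)
  have "\<forall>\<^sub>F i in sequentially. \<forall>y\<in>space M. norm (K (X i) y) \<le> D y"
    using filterlim_iff[THEN iffD1, OF f] bound by blast
  then obtain N where N: "\<And>i. i \<ge> N \<Longrightarrow> \<forall>y\<in>space M. norm (K (X i) y) \<le> D y"
    unfolding eventually_sequentially by blast
  have "(\<lambda>i. \<integral>y. K (X (i + N)) y \<partial>M) \<longlonglongrightarrow> (\<integral>y. K0 y \<partial>M)"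
  proof (rule integral_dominated_convergence[where w = D])
    show "AE y in M. (\<lambda>i. K (X (i + N)) y) \<longlonglongrightarrow> K0 y"
    proof (intro AE_I2)
      fix y assume "y \<in> space M"
      from filterlim_compose[OF lim[OF this] f] have "(\<lambda>i. K (X i) y) \<longlonglongrightarrow> K0 y" .
      then show "(\<lambda>i. K (X (i + N)) y) \<longlonglongrightarrow> K0 y" by (rule LIMSEQ_ignore_initial_segment)
    qed
    show "AE y in M. norm (K (X (i + N)) y) \<le> D y" for i using N[of "i + N"] by auto
  qed (use X D meas meas0 in auto)
  then show "((\<lambda>p. \<integral>y. K p y \<partial>M) \<circ> X) \<longlonglongrightarrow> (\<integral>y. K0 y \<partial>M)"
    unfolding o_def by (rule LIMSEQ_offset)
qed

text \<open>The normalised remainder tends to 0 pointwise, and the mean value inequality on the ball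
  bounds it by \<open>2 * D y\<close>; dominated convergence then applies to the remainder
  itself.\<close>

lemma parametric_integral_has_derivative:
  fixes K :: "'a::euclidean_space \<Rightarrow> 'b \<Rightarrow> 'c::euclidean_space"
  assumes r: "r > 0"
    and der: "\<And>p y. p \<in> ball p0 r \<Longrightarrow> y \<in> space M \<Longrightarrow> ((\<lambda>p. K p y) has_derivative K' p y) (at p)"
    and bound: "\<And>p y h. p \<in> ball p0 r \<Longrightarrow> y \<in> space M \<Longrightarrow> norm (K' p y h) \<le> D y * norm h"
    and D: "integrable M D"
    and int: "\<And>p. p \<in> ball p0 r \<Longrightarrow> integrable M (K p)"
    and meas': "\<And>h. (\<lambda>y. K' p0 y h) \<in> borel_measurable M"
  shows "((\<lambda>p. \<integral>y. K p y \<partial>M) has_derivative (\<lambda>h. \<integral>y. K' p0 y h \<partial>M)) (at p0)"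
proof -
  have p0: "p0 \<in> ball p0 r" using r by simp
  have lin: "linear (K' p0 y)" if "y \<in> space M" for y using der[OF p0 that] has_derivative_linear by blast
  have int': "integrable M (\<lambda>y. K' p0 y h)" for h
  proof (rule Bochner_Integration.integrable_bound)
    show "integrable M (\<lambda>y. D y * norm h)" using D by auto
    show "AE y in M. norm (K' p0 y h) \<le> norm (D y * norm h)"
      using bound[OF p0] by (intro AE_I2) (auto intro: order_trans[OF _ abs_ge_self])
  qed (rule meas')
  have bl: "bounded_linear (\<lambda>h. \<integral>y. K' p0 y h \<partial>M)"
  proof (rule bounded_linear_intro[where K = "\<integral>y. D y \<partial>M"])
    fix h k c
    show "(\<integral>y. K' p0 y (h + k) \<partial>M) = (\<integral>y. K' p0 y h \<partial>M) + (\<integral>y. K' p0 y k \<partial>M)"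
      by (subst Bochner_Integration.integral_add[symmetric, OF int' int'])
        (auto intro!: Bochner_Integration.integral_cong simp: linear_add[OF lin])
    show "(\<integral>y. K' p0 y (c *\<^sub>R h) \<partial>M) = c *\<^sub>R (\<integral>y. K' p0 y h \<partial>M)"
    proof -
      have "(\<integral>y. K' p0 y (c *\<^sub>R h) \<partial>M) = (\<integral>y. c *\<^sub>R K' p0 y h \<partial>M)"
        by (rule Bochner_Integration.integral_cong) (auto simp: linear_scale[OF lin])
      then show ?thesis by simp
    qed
    have "norm (\<integral>y. K' p0 y h \<partial>M) \<le> (\<integral>y. norm (K' p0 y h) \<partial>M)" by (rule integral_norm_bound)
    also have "\<dots> \<le> (\<integral>y. D y * norm h \<partial>M)"
      by (rule integral_mono) (use D bound[OF p0] int' in auto)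
    finally have "norm (\<integral>y. K' p0 y h \<partial>M) \<le> (\<integral>y. D y * norm h \<partial>M)" .
    then show "norm (\<integral>y. K' p0 y h \<partial>M) \<le> norm h * (\<integral>y. D y \<partial>M)" by (simp add: mult.commute)
  qed
  let ?R = "\<lambda>p y. (K p y - K p0 y - K' p0 y (p - p0)) /\<^sub>R norm (p - p0)"
  have R0: "((\<lambda>p. \<integral>y. ?R p y \<partial>M) \<longlongrightarrow> (\<integral>y. 0 \<partial>M)) (at p0 within ball p0 r)"
  proof (rule parametric_integral_tendsto[where D = "\<lambda>y. 2 * D y"])
    fix y assume y: "y \<in> space M"
    have "((\<lambda>p. norm (K p y - K p0 y - K' p0 y (p - p0)) / norm (p - p0)) \<longlongrightarrow> 0) (at p0)"
      using der[OF p0 y] unfolding has_derivative_iff_norm by blast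
    then have "((\<lambda>p. norm (?R p y)) \<longlongrightarrow> 0) (at p0)" by (simp add: divide_inverse mult.commute)
    then have "((\<lambda>p. ?R p y) \<longlongrightarrow> 0) (at p0)" by (simp only: tendsto_norm_zero_iff)
    then show "((\<lambda>p. ?R p y) \<longlongrightarrow> 0) (at p0 within ball p0 r)" by (rule tendsto_within_subset) simp
  next
    have "\<forall>y\<in>space M. norm (?R p y) \<le> 2 * D y" if p: "p \<in> ball p0 r" "p \<noteq> p0" for p
    proof
      fix y assume y: "y \<in> space M"
      have "norm (K p y - K p0 y) \<le> D y * norm (p - p0)"
      proof (rule differentiable_bound[of "ball p0 r" "\<lambda>p. K p y" "\<lambda>p. K' p y"])
        show "\<And>x. x \<in> ball p0 r \<Longrightarrow> ((\<lambda>p. K p y) has_derivative K' x y) (at x within ball p0 r)"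
          using der y has_derivative_at_withinI by blast
        show "\<And>x. x \<in> ball p0 r \<Longrightarrow> onorm (K' x y) \<le> D y" using bound y by (intro onorm_le) auto
      qed (use p p0 in auto)
      moreover have "norm (K' p0 y (p - p0)) \<le> D y * norm (p - p0)" by (rule bound[OF p0 y])
      ultimately have "norm (K p y - K p0 y - K' p0 y (p - p0)) \<le> 2 * D y * norm (p - p0)"
        using norm_triangle_ineq4[of "K p y - K p0 y" "K' p0 y (p - p0)"] by linarith
      then have "norm (K p y - K p0 y - K' p0 y (p - p0)) / norm (p - p0) \<le> 2 * D y"
        using p(2) by (simp add: divide_le_eq)
      then show "norm (?R p y) \<le> 2 * D y" by (simp add: divide_inverse mult.commute)
    qed
    then show "\<forall>\<^sub>F p in at p0 within ball p0 r. \<forall>y\<in>space M. norm (?R p y) \<le> 2 * D y"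
      unfolding eventually_at using r by (intro exI[of _ r]) auto
  qed (use D int p0 meas' in \<open>auto intro!: borel_measurable_scaleR borel_measurable_diff\<close>)
  have eq: "(\<integral>y. ?R p y \<partial>M) = ((\<integral>y. K p y \<partial>M) - (\<integral>y. K p0 y \<partial>M) - (\<integral>y. K' p0 y (p - p0) \<partial>M)) /\<^sub>R norm (p - p0)"
    if "p \<in> ball p0 r" for p
    using int[OF that] int[OF p0] int' by simp
  have "\<forall>\<^sub>F p in at p0 within ball p0 r. p \<in> ball p0 r" by (simp add: eventually_at_filter)
  then have ev: "\<forall>\<^sub>F p in at p0 within ball p0 r. (\<integral>y. ?R p y \<partial>M) = ((\<integral>y. K p y \<partial>M) - (\<integral>y. K p0 y \<partial>M) - (\<integral>y. K' p0 y (p - p0) \<partial>M)) /\<^sub>R norm (p - p0)"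
    by eventually_elim (rule eq)
  have "((\<lambda>p. ((\<integral>y. K p y \<partial>M) - (\<integral>y. K p0 y \<partial>M) - (\<integral>y. K' p0 y (p - p0) \<partial>M)) /\<^sub>R norm (p - p0)) \<longlongrightarrow> 0) (at p0 within ball p0 r)"
    using tendsto_cong[OF ev, THEN iffD1, OF R0] by simp
  then have "((\<lambda>p. ((\<integral>y. K p y \<partial>M) - (\<integral>y. K p0 y \<partial>M) - (\<integral>y. K' p0 y (p - p0) \<partial>M)) /\<^sub>R norm (p - p0)) \<longlongrightarrow> 0) (at p0)"
    using at_within_open[OF p0 open_ball] by simp
  then have "((\<lambda>p. norm ((\<integral>y. K p y \<partial>M) - (\<integral>y. K p0 y \<partial>M) - (\<integral>y. K' p0 y (p - p0) \<partial>M)) / norm (p - p0)) \<longlongrightarrow> 0) (at p0)"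
    by (subst (asm) tendsto_norm_zero_iff[symmetric]) (simp add: divide_inverse mult.commute)
  with bl show ?thesis unfolding has_derivative_iff_norm by blast
qed

text \<open>In the Leibniz expansion a permutation other than the identity moves at least two
  indices. After one factor is differentiated, another off-diagonal factor of the identity matrix is
  left and equals 0.\<close>

lemma DERIV_det_at_identity:
  fixes N :: "real \<Rightarrow> real^'n^'n"
  assumes N: "(N has_vector_derivative N') (at t)" and id: "N t = mat 1"
  shows "((\<lambda>\<tau>. det (N \<tau>)) has_real_derivative trace N') (at t)"
proof -
  have e: "((\<lambda>\<tau>. N \<tau> $ i $ j) has_real_derivative N' $ i $ j) (at t)" for i j
    unfolding has_real_derivative_iff_has_vector_derivative
    by (rule bounded_linear.has_vector_derivative[OF bounded_linear_compose[OF bounded_linear_vec_nth bounded_linear_vec_nth] N])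
  let ?P = "{p. p permutes (UNIV :: 'n set)}"
  let ?d = "\<lambda>p. of_int (sign p) * (\<Sum>i\<in>UNIV. N' $ i $ p i * (\<Prod>j\<in>UNIV - {i}. N t $ j $ p j))"
  have "((\<lambda>\<tau>. \<Sum>p\<in>?P. of_int (sign p) * (\<Prod>i\<in>UNIV. N \<tau> $ i $ p i)) has_real_derivative (\<Sum>p\<in>?P. ?d p)) (at t)"
    by (intro DERIV_sum DERIV_cmult has_field_derivative_prod e)
  moreover have "(\<Sum>p\<in>?P. ?d p) = (\<Sum>p\<in>?P. if p = id then trace N' else 0)"
  proof (rule sum.cong)
    fix p assume p: "p \<in> ?P"
    show "?d p = (if p = id then trace N' else 0)"
    proof (cases "p = id")
      case True
      then show ?thesis by (simp add: id mat_def trace_def sign_id)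
    next
      case False
      have "(\<Prod>j\<in>UNIV - {i}. N t $ j $ p j) = 0" for i
      proof -
        have "\<exists>j. j \<noteq> i \<and> p j \<noteq> j"
        proof (rule ccontr)
          assume "\<nexists>j. j \<noteq> i \<and> p j \<noteq> j"
          then have fixp: "\<And>j. j \<noteq> i \<Longrightarrow> p j = j" by blast
          have "p i = i"
          proof (rule ccontr)
            assume "p i \<noteq> i"
            then have "p (p i) = p i" by (rule fixp)
            moreover have "inj p" using p permutes_inj by blast
            ultimately have "p i = i" by (simp add: inj_eq)
            with \<open>p i \<noteq> i\<close> show False by simp
          qed
          have "p x = x" for x using fixp \<open>p i = i\<close> by (cases "x = i") auto
          then have "p = id" by (simp add: fun_eq_iff)
          with False show False by simp
        qed
        then obtain j where j: "j \<noteq> i" "p j \<noteq> j" by blast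
        have "\<exists>j\<in>UNIV - {i}. N t $ j $ p j = 0"
          by (rule bexI[of _ j]) (use j in \<open>auto simp: id mat_def\<close>)
        then show ?thesis by (intro prod_zero) auto
      qed
      then have "?d p = 0" by (simp only: mult_zero_right sum.neutral_const)
      then show ?thesis using False by simp
    qed
  qed simp
  ultimately show ?thesis
    by (simp add: det_def permutes_id finite_permutations)
qed

text \<open>Jacobi's formula: factoring out \<open>M t\<close> reduces to a curve through the
  identity.\<close>

lemma DERIV_det:
  fixes M :: "real \<Rightarrow> real^'n^'n"
  assumes M: "(M has_vector_derivative M') (at t)" and inv: "invertible (M t)"
  shows "((\<lambda>\<tau>. det (M \<tau>)) has_real_derivative det (M t) * trace (matrix_inv (M t) ** M')) (at t)"
proof -
  let ?N = "\<lambda>\<tau>. matrix_inv (M t) ** M \<tau>"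
  have "(?N has_vector_derivative matrix_inv (M t) ** M') (at t)"
    by (rule bounded_linear.has_vector_derivative[OF bounded_bilinear.bounded_linear_right[OF bounded_bilinear_mat_mult] M])
  then have "((\<lambda>\<tau>. det (?N \<tau>)) has_real_derivative trace (matrix_inv (M t) ** M')) (at t)"
    by (rule DERIV_det_at_identity) (simp add: matrix_inv_mult[OF inv])
  then have "((\<lambda>\<tau>. det (M t) * det (?N \<tau>)) has_real_derivative det (M t) * trace (matrix_inv (M t) ** M')) (at t)"
    by (rule DERIV_cmult)
  moreover have "det (M t) * det (?N \<tau>) = det (M \<tau>)" for \<tau>
    by (simp add: det_mul[symmetric] matrix_mul_assoc matrix_inv_mult[OF inv])
  ultimately show ?thesis by simp
qed

lemma inverse_posdef_bound:
  fixes Q :: "real^'n^'n"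
  assumes c: "c > 0" and Q: "\<And>v. (Q *v v) \<bullet> v \<ge> c * (norm v)\<^sup>2"
  shows "invertible Q" "norm (matrix_inv Q *v w) \<le> norm w / c"
proof -
  have "(Q *v v) \<bullet> v > 0" if "v \<noteq> 0" for v
    by (rule less_le_trans[OF _ Q]) (use c that in simp)
  then show inv: "invertible Q" by (rule invertible_posdef)
  let ?v = "matrix_inv Q *v w"
  have "c * (norm ?v)\<^sup>2 \<le> w \<bullet> ?v" using Q[of ?v] by (simp add: matrix_inv_vec[OF inv])
  also have "\<dots> \<le> norm w * norm ?v" by (rule norm_cauchy_schwarz)
  finally have "(c * norm ?v) * norm ?v \<le> norm w * norm ?v" by (simp add: power2_eq_square mult.assoc)
  then have "c * norm ?v \<le> norm w"
    by (cases "norm ?v = 0") (auto simp: mult_le_cancel_right)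
  then show "norm ?v \<le> norm w / c" using c by (simp add: field_simps)
qed

text \<open>With P the inverse, P(\<tau>) - P(t) = -P(\<tau>) (M(\<tau>) - M(t)) P(t). The uniform
  lower bound on the form bounds P near t; the identity then gives continuity first and the
  derivative afterwards.\<close>

lemma matrix_inv_has_vector_derivative:
  fixes M :: "real \<Rightarrow> real^'n^'n"
  assumes M: "(M has_vector_derivative M') (at t)" and c: "c > 0"
    and pos: "\<forall>\<^sub>F \<tau> in nhds t. \<forall>v. (M \<tau> *v v) \<bullet> v \<ge> c * (norm v)\<^sup>2"
  shows "((\<lambda>\<tau>. matrix_inv (M \<tau>)) has_vector_derivative - (matrix_inv (M t) ** M' ** matrix_inv (M t))) (at t)"
proof -
  let ?P = "\<lambda>\<tau>. matrix_inv (M \<tau>)"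
  have post: "\<And>v. (M t *v v) \<bullet> v \<ge> c * (norm v)\<^sup>2" using eventually_nhds_x_imp_x[OF pos] by blast
  note invt = inverse_posdef_bound(1)[OF c post]
  have pos': "\<forall>\<^sub>F \<tau> in at t. \<forall>v. (M \<tau> *v v) \<bullet> v \<ge> c * (norm v)\<^sup>2"
    using pos by (simp add: eventually_nhds_conv_at)
  have diff: "\<forall>\<^sub>F \<tau> in at t. invertible (M \<tau>) \<and> norm (?P \<tau>) \<le> real (CARD('n) * CARD('n)) * (1 / c)
     \<and> ?P \<tau> - ?P t = - (?P \<tau> ** (M \<tau> - M t) ** ?P t)"
    using pos'
  proof eventually_elim
    case (elim \<tau>)
    note inv = inverse_posdef_bound(1)[OF c, of "M \<tau>"] 
    have i: "invertible (M \<tau>)" by (rule inv) (use elim in blast)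
    have "norm (?P \<tau>) \<le> real (CARD('n) * CARD('n)) * opn (?P \<tau>)" by (rule norm_matrix_le_opn)
    also have "\<dots> \<le> real (CARD('n) * CARD('n)) * (1 / c)"
    proof (intro mult_left_mono onorm_le)
      fix w show "norm (?P \<tau> *v w) \<le> 1 / c * norm w"
        using inverse_posdef_bound(2)[OF c, of "M \<tau>" w] elim by simp
    qed simp
    finally have b: "norm (?P \<tau>) \<le> real (CARD('n) * CARD('n)) * (1 / c)" .
    have "?P \<tau> ** (M \<tau> - M t) ** ?P t = (?P \<tau> ** M \<tau>) ** ?P t - ?P \<tau> ** (M t ** ?P t)"
      by (simp add: bounded_bilinear.diff_left[OF bounded_bilinear_mat_mult] bounded_bilinear.diff_right[OF bounded_bilinear_mat_mult] matrix_mul_assoc)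
    also have "\<dots> = ?P t - ?P \<tau>" by (simp add: matrix_inv_mult[OF i] matrix_inv_mult[OF invt])
    finally show ?case using i b by simp
  qed
  have cont: "((\<lambda>\<tau>. M \<tau>) \<longlongrightarrow> M t) (at t)"
    using has_vector_derivative_continuous[OF M] by (simp add: isCont_def)
  obtain K where K: "\<And>(M::real^'n^'n) (N::real^'n^'n). norm (M ** N) \<le> norm M * norm N * K" "K > 0"
    using bounded_bilinear.pos_bounded[OF bounded_bilinear_mat_mult] by blast
  have P0: "((\<lambda>\<tau>. ?P \<tau> - ?P t) \<longlongrightarrow> 0) (at t)"
  proof (rule Lim_null_comparison)
    let ?b = "\<lambda>\<tau>. (real (CARD('n) * CARD('n)) * (1 / c) * norm (M \<tau> - M t) * K) * norm (?P t) * K"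
    show "\<forall>\<^sub>F \<tau> in at t. norm (?P \<tau> - ?P t) \<le> ?b \<tau>"
      using diff
    proof eventually_elim
      case (elim \<tau>)
      have "norm (?P \<tau> - ?P t) = norm (?P \<tau> ** (M \<tau> - M t) ** ?P t)" using elim by simp
      also have "\<dots> \<le> norm (?P \<tau> ** (M \<tau> - M t)) * norm (?P t) * K" by (rule K(1))
      also have "\<dots> \<le> (norm (?P \<tau>) * norm (M \<tau> - M t) * K) * norm (?P t) * K"
        using K(2) by (intro mult_right_mono K(1)) auto
      also have "\<dots> \<le> ?b \<tau>" using K(2) elim by (intro mult_right_mono) auto
      finally show ?case .
    qed
    have "((\<lambda>\<tau>. ?b \<tau>) \<longlongrightarrow> (real (CARD('n) * CARD('n)) * (1 / c) * norm (M t - M t) * K) * norm (?P t) * K) (at t)"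
      by (intro tendsto_intros cont)
    then show "(?b \<longlongrightarrow> 0) (at t)" by simp
  qed
  then have Pc: "(?P \<longlongrightarrow> ?P t) (at t)" by (rule Lim_null[THEN iffD2])
  have "((\<lambda>\<tau>. - (?P \<tau> ** ((M \<tau> - M t) /\<^sub>R (\<tau> - t)) ** ?P t)) \<longlongrightarrow> - (?P t ** M' ** ?P t)) (at t)"
    using M unfolding has_vector_derivative_iff_tendsto
    by (intro tendsto_minus bounded_bilinear.tendsto[OF bounded_bilinear_mat_mult] Pc tendsto_const)
  moreover have "\<forall>\<^sub>F \<tau> in at t. - (?P \<tau> ** ((M \<tau> - M t) /\<^sub>R (\<tau> - t)) ** ?P t) = (?P \<tau> - ?P t) /\<^sub>R (\<tau> - t)"
    using diff
  proof eventually_elim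
    case (elim \<tau>)
    have "- (?P \<tau> ** ((M \<tau> - M t) /\<^sub>R (\<tau> - t)) ** ?P t) = (- (?P \<tau> ** (M \<tau> - M t) ** ?P t)) /\<^sub>R (\<tau> - t)"
      by (simp add: bounded_bilinear.scaleR_right[OF bounded_bilinear_mat_mult] bounded_bilinear.scaleR_left[OF bounded_bilinear_mat_mult])
    then show ?case using elim by simp
  qed
  ultimately show ?thesis unfolding has_vector_derivative_iff_tendsto by (simp add: tendsto_cong)
qed

section \<open>The Mehler kernel\<close>

context ornstein_uhlenbeck
begin

text \<open>\<open>mm s t x\<close>, \<open>Qf s t = Sf s t ** transpose (Sf s t)\<close> and \<open>kap s t x\<close> are the mean, covariance and
  density of the transition kernel from time \<open>t\<close> at \<open>x\<close> back to time \<open>s\<close>; \<open>kap * ww\<close> is the gradient of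
  \<open>kap\<close> in \<open>x\<close>. The value \<open>Sf s s = 0\<close> makes \<open>G s s\<close> the identity.\<close>

definition mm where "mm s t x = U s t *v x + gf s t"
definition Sf :: "real \<Rightarrow> real \<Rightarrow> real^'n^'n" where "Sf s t = (if s < t then SOME S. invertible S \<and> S ** transpose S = Qf s t else 0)"
definition G where "G t s f x = (LINT z|stdg. f (mm s t x + Sf s t *v z))" for f :: "real^'n \<Rightarrow> real"
definition Pm where "Pm s t = matrix_inv (Qf s t)"
definition cc where "cc s t = (2 * pi) powr (- real CARD('n) / 2) * det (Qf s t) powr (- 1 / 2)"
definition kap where "kap s t x y = cc s t * exp (- 1 / 2 * ((Pm s t *v (y - mm s t x)) \<bullet> (y - mm s t x)))"
definition ww where "ww s t x y = transpose (U s t) *v (Pm s t *v (y - mm s t x))"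

lemma Sf: assumes "s < t" shows "invertible (Sf s t)" "Sf s t ** transpose (Sf s t) = Qf s t"
proof -
  have ex: "\<exists>S::real^'n^'n. invertible S \<and> S ** transpose S = Qf s t"
  proof -
    obtain S :: "real^'n^'n" where "invertible S" "S ** transpose S = Qf s t"
      by (rule posdef_factor[OF Qf_pos[OF assms] Qf_sym])
    then show ?thesis by blast
  qed
  have "invertible (Sf s t) \<and> Sf s t ** transpose (Sf s t) = Qf s t"
    using someI_ex[OF ex] assms unfolding Sf_def by simp
  then show "invertible (Sf s t)" "Sf s t ** transpose (Sf s t) = Qf s t" by auto
qed

lemma Sf_square: "s \<le> t \<Longrightarrow> Sf s t ** transpose (Sf s t) = Qf s t"
  using Sf(2)[of s t] by (cases "s = t") (auto simp: Sf_def Qf_self bounded_bilinear.zero_left[OF bounded_bilinear_mat_mult])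

lemma kap_eq: "kap s t x = gauss_density (Qf s t) (mm s t x)"
  by (auto simp: kap_def gauss_density_def cc_def Pm_def fun_eq_iff)

lemma kap_nonneg [simp]: "0 \<le> kap s t x y" by (simp add: kap_eq)

lemma kap_measurable [measurable]: "kap s t x \<in> borel_measurable borel"
  by (simp add: kap_eq)

lemma ww_measurable [measurable]: "ww s t x \<in> borel_measurable borel"
  unfolding ww_def by measurable

lemma G_eq_normal:
  assumes "s < t" and [measurable]: "f \<in> borel_measurable borel"
  shows "G t s f x = (LINT y|normal (Qf s t) (mm s t x). f y)"
  unfolding G_def normal_eq_distr[OF Sf[OF assms(1)]] by (subst integral_distr) auto

lemma G_eq_kernel:
  assumes "s < t" and [measurable]: "f \<in> borel_measurable borel"
  shows "G t s f x = (LINT y|lborel. f y * kap s t x y)"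
  unfolding G_eq_normal[OF assms] normal_def kap_eq by (subst integral_density) (auto simp: mult.commute)

lemma Pm_sym: assumes "s < t" shows "(Pm s t *v v) \<bullet> w = (Pm s t *v w) \<bullet> v"
  unfolding Pm_def inverse_factor(2)[OF Sf[OF assms]] by (rule inner_commute)

lemma Qf_upper: "\<exists>C>0. \<forall>s t v. s \<le> t \<longrightarrow> (Qf s t *v v) \<bullet> v \<le> C * (norm v)\<^sup>2"
proof -
  obtain C where C: "C > 0" "\<And>s v. (cov B U s *v v) \<bullet> v \<le> C * (norm v)\<^sup>2" using cov_upper by blast
  then show ?thesis using Qf_le_cov order_trans by blast
qed

text \<open>The upper bound for \<open>Qf\<close> bounds its factor, and |z| <= |S| |S^{-1} z|. This
  gives Gaussian decay of the kernel with a rate independent of s and t.\<close>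

lemma Pm_lower: "\<exists>C>0. \<forall>s t z. s < t \<longrightarrow> (norm z)\<^sup>2 / C \<le> (Pm s t *v z) \<bullet> z"
proof -
  obtain C where C: "C > 0" "\<And>s t v. s \<le> t \<Longrightarrow> (Qf s t *v v) \<bullet> v \<le> C * (norm v)\<^sup>2" using Qf_upper by blast
  have "(norm z)\<^sup>2 / C \<le> (Pm s t *v z) \<bullet> z" if st: "s < t" for s t z
  proof -
    note S = Sf[OF st]
    let ?y = "matrix_inv (Sf s t) *v z"
    have "norm z = norm (Sf s t *v ?y)" by (simp add: matrix_inv_vec[OF S(1)])
    also have "\<dots> \<le> opn (Sf s t) * norm ?y" by (rule norm_mat_vec_le)
    also have "\<dots> \<le> sqrt C * norm ?y"
      by (intro mult_right_mono opn_factor_le[OF S(2)]) (use C st in auto)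
    finally have "(norm z)\<^sup>2 \<le> (sqrt C * norm ?y)\<^sup>2" by (intro power_mono) auto
    also have "\<dots> = C * (norm ?y)\<^sup>2" using C(1) by (simp add: power_mult_distrib)
    also have "(norm ?y)\<^sup>2 = (Pm s t *v z) \<bullet> z"
      unfolding Pm_def inverse_factor(2)[OF S] by (rule power2_norm_eq_inner)
    finally show ?thesis using C(1) by (simp add: divide_le_eq mult.commute)
  qed
  then show ?thesis using C(1) by blast
qed

lemma det_Qf_pos: "s < t \<Longrightarrow> det (Qf s t) > 0"
  using Sf[of s t] det_factor[of "Sf s t" "Qf s t"] invertible_det_nz[of "Sf s t"] by simp

lemma Qf_invertible: "s < t \<Longrightarrow> invertible (Qf s t)"
  using inverse_factor(1)[OF Sf] by blast

lemma Pm_deriv: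
  assumes "s < t"
  shows "(Pm s has_vector_derivative - (Pm s t ** W s t ** Pm s t)) (at t)"
proof -
  \<comment> \<open>For times beyond (s + t) / 2 the elapsed time is at least (t - s) / 2, so one
    lower bound for \<open>Qf\<close> serves a whole neighbourhood of t.\<close>
  let ?h = "min 1 ((t - s) / 2)"
  have "((\<lambda>\<tau>. matrix_inv (Qf s \<tau>)) has_vector_derivative - (matrix_inv (Qf s t) ** W s t ** matrix_inv (Qf s t))) (at t)"
  proof (rule matrix_inv_has_vector_derivative[OF Qf_deriv[OF assms]])
    show "?h * lam > 0" using assms lam_pos by simp
    have "\<forall>\<^sub>F \<tau> in nhds t. \<tau> > (s + t) / 2"
      unfolding eventually_nhds by (rule exI[of _ "{(s + t) / 2<..}"]) (use assms in auto)
    then show "\<forall>\<^sub>F \<tau> in nhds t. \<forall>v. (Qf s \<tau> *v v) \<bullet> v \<ge> ?h * lam * (norm v)\<^sup>2"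
    proof eventually_elim
      case (elim \<tau>)
      then show ?case using assms by (intro allI Qf_lower) (auto simp: min_def field_simps)
    qed
  qed
  then show ?thesis unfolding Pm_def .
qed

lemma cc_deriv:
  assumes "s < t"
  shows "(cc s has_real_derivative cc s t * (- 1 / 2 * trace (Pm s t ** W s t))) (at t)"
proof -
  let ?d = "\<lambda>\<tau>. det (Qf s \<tau>)" and ?T = "trace (Pm s t ** W s t)"
  have d: "(?d has_real_derivative ?d t * ?T) (at t)"
    using DERIV_det[OF Qf_deriv[OF assms] Qf_invertible[OF assms]] by (simp add: Pm_def)
  have e: "((\<lambda>\<tau>. ?d \<tau> powr (- 1 / 2)) has_real_derivative (- 1 / 2) * ?d t powr (- 1 / 2 - of_nat 1) * (?d t * ?T)) (at t)"
    by (rule DERIV_fun_powr[OF d det_Qf_pos[OF assms]])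
  have "(- 1 / 2) * ?d t powr (- 1 / 2 - of_nat 1) * (?d t * ?T) = ?d t powr (- 1 / 2) * (- 1 / 2 * ?T)"
  proof -
    have "?d t powr (- 1 / 2) = ?d t powr (- 1 / 2 - of_nat 1) * ?d t powr 1"
      by (subst powr_add[symmetric]) simp
    also have "?d t powr 1 = ?d t" using det_Qf_pos[OF assms] by simp
    finally show ?thesis by simp
  qed
  from DERIV_cong[OF e this]
  have "((\<lambda>\<tau>. ?d \<tau> powr (- 1 / 2)) has_real_derivative ?d t powr (- 1 / 2) * (- 1 / 2 * ?T)) (at t)" .
  from DERIV_cmult[OF this, of "(2 * pi) powr (- real CARD('n) / 2)"]
  show ?thesis unfolding cc_def[abs_def] by (simp only: mult.assoc)
qed

lemma mm_deriv:
  assumes "s < t"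
  shows "((\<lambda>\<tau>. mm s \<tau> x) has_vector_derivative U s t *v (A t *v x + g t)) (at t)"
proof -
  have "((\<lambda>\<tau>. U s \<tau> *v x) has_vector_derivative (U s t ** A t) *v x) (at t)"
    by (rule bounded_linear.has_vector_derivative[OF bounded_bilinear.bounded_linear_left[OF bounded_bilinear_mat_vec] U_second_deriv])
  from has_vector_derivative_add[OF this gf_deriv[OF assms]]
  show ?thesis by (simp add: mm_def[abs_def] matrix_vector_right_distrib matrix_vector_mul_assoc)
qed

text \<open>The logarithmic derivative of \<open>kap\<close> in time. Its three terms come from the
  determinant in the normalisation, the derivative of the inverse covariance, and the motion of the
  mean.\<close>

definition kt where "kt s t x y = - 1 / 2 * trace (Pm s t ** W s t)
   + 1 / 2 * ((W s t *v (Pm s t *v (y - mm s t x))) \<bullet> (Pm s t *v (y - mm s t x)))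
   + (Pm s t *v (y - mm s t x)) \<bullet> (U s t *v (A t *v x + g t))"

lemma kap_deriv_t:
  assumes st: "s < t"
  shows "((\<lambda>\<tau>. kap s \<tau> x y) has_real_derivative kap s t x y * kt s t x y) (at t)"
proof -
  let ?z = "\<lambda>\<tau>. y - mm s \<tau> x" and ?\<zeta> = "U s t *v (A t *v x + g t)"
  have z: "(?z has_vector_derivative - ?\<zeta>) (at t)"
    using has_vector_derivative_diff[OF has_vector_derivative_const mm_deriv[OF st], of y x] by simp
  have Pz: "((\<lambda>\<tau>. Pm s \<tau> *v ?z \<tau>) has_vector_derivative Pm s t *v (- ?\<zeta>) + (- (Pm s t ** W s t ** Pm s t)) *v ?z t) (at t)"
    by (rule bounded_bilinear.has_vector_derivative[OF bounded_bilinear_mat_vec Pm_deriv[OF st] z])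
  have q0: "((\<lambda>\<tau>. (Pm s \<tau> *v ?z \<tau>) \<bullet> ?z \<tau>) has_vector_derivative
     (Pm s t *v ?z t) \<bullet> (- ?\<zeta>) + (Pm s t *v (- ?\<zeta>) + (- (Pm s t ** W s t ** Pm s t)) *v ?z t) \<bullet> ?z t) (at t)"
    by (rule bounded_bilinear.has_vector_derivative[OF bounded_bilinear_inner Pz z])
  have q1: "(Pm s t *v ?z t) \<bullet> (- ?\<zeta>) + (Pm s t *v (- ?\<zeta>) + (- (Pm s t ** W s t ** Pm s t)) *v ?z t) \<bullet> ?z t
     = - 2 * ((Pm s t *v ?z t) \<bullet> ?\<zeta>) - (W s t *v (Pm s t *v ?z t)) \<bullet> (Pm s t *v ?z t)"
    using Pm_sym[OF st, of "W s t *v (Pm s t *v ?z t)" "?z t"] Pm_sym[OF st, of ?\<zeta> "?z t"]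
    by (simp add: bounded_bilinear.minus_left[OF bounded_bilinear_mat_vec] bounded_bilinear.minus_right[OF bounded_bilinear_mat_vec]
        inner_add_left inner_add_right inner_diff_left inner_diff_right matrix_vector_mul_assoc[symmetric] inner_commute)
  have q: "((\<lambda>\<tau>. (Pm s \<tau> *v ?z \<tau>) \<bullet> ?z \<tau>) has_real_derivative
      - 2 * ((Pm s t *v ?z t) \<bullet> ?\<zeta>) - (W s t *v (Pm s t *v ?z t)) \<bullet> (Pm s t *v ?z t)) (at t)"
    using q0 unfolding q1 has_real_derivative_iff_has_vector_derivative .
  have "((\<lambda>\<tau>. cc s \<tau> * exp (- 1 / 2 * ((Pm s \<tau> *v ?z \<tau>) \<bullet> ?z \<tau>))) has_real_derivative
    cc s t * (- 1 / 2 * trace (Pm s t ** W s t)) * exp (- 1 / 2 * ((Pm s t *v ?z t) \<bullet> ?z t))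
    + (exp (- 1 / 2 * ((Pm s t *v ?z t) \<bullet> ?z t)) * (- 1 / 2 * (- 2 * ((Pm s t *v ?z t) \<bullet> ?\<zeta>) - (W s t *v (Pm s t *v ?z t)) \<bullet> (Pm s t *v ?z t)))) * cc s t) (at t)"
    by (rule DERIV_mult[OF cc_deriv[OF st] DERIV_fun_exp[OF DERIV_cmult[OF q]]])
  then show ?thesis unfolding kap_def
    by (rule DERIV_cong) (simp add: kt_def algebra_simps)
qed

lemma quad_deriv:
  assumes st: "s < t"
  shows "((\<lambda>x. (Pm s t *v (y - mm s t x)) \<bullet> (y - mm s t x)) has_derivative (\<lambda>h. - 2 * (ww s t x y \<bullet> h))) (at x)"
proof -
  have z: "((\<lambda>x. y - mm s t x) has_derivative (\<lambda>h. - (U s t *v h))) (at x)"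
    unfolding mm_def by (auto intro!: derivative_eq_intros bounded_linear.has_derivative[OF matrix_vector_mul_bounded_linear])
  have Pz: "((\<lambda>x. Pm s t *v (y - mm s t x)) has_derivative (\<lambda>h. Pm s t *v (- (U s t *v h)))) (at x)"
    by (rule bounded_linear.has_derivative[OF matrix_vector_mul_bounded_linear z])
  have "((\<lambda>x. (Pm s t *v (y - mm s t x)) \<bullet> (y - mm s t x)) has_derivative
     (\<lambda>h. (Pm s t *v (y - mm s t x)) \<bullet> (- (U s t *v h)) + (Pm s t *v (- (U s t *v h))) \<bullet> (y - mm s t x))) (at x)"
    by (rule has_derivative_inner[OF Pz z])
  moreover have "(\<lambda>h. (Pm s t *v (y - mm s t x)) \<bullet> (- (U s t *v h)) + (Pm s t *v (- (U s t *v h))) \<bullet> (y - mm s t x)) = (\<lambda>h. - 2 * (ww s t x y \<bullet> h))"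
  proof
    fix h
    have "ww s t x y \<bullet> h = (Pm s t *v (y - mm s t x)) \<bullet> (U s t *v h)"
      by (simp add: ww_def inner_matrix_transpose)
    then show "(Pm s t *v (y - mm s t x)) \<bullet> (- (U s t *v h)) + (Pm s t *v (- (U s t *v h))) \<bullet> (y - mm s t x) = - 2 * (ww s t x y \<bullet> h)"
      using Pm_sym[OF st, of "U s t *v h" "y - mm s t x"] by (simp add: bounded_bilinear.minus_right[OF bounded_bilinear_mat_vec])
  qed
  ultimately show ?thesis by simp
qed

lemma kap_deriv_x:
  assumes st: "s < t"
  shows "((\<lambda>x. kap s t x y) has_derivative (\<lambda>h. kap s t x y * (ww s t x y \<bullet> h))) (at x)"
  unfolding kap_def
  by (rule derivative_eq_intros quad_deriv[OF st] refl)+ (auto simp: fun_eq_iff)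

lemma ww_deriv_x:
  "((\<lambda>x. ww s t x y) has_derivative (\<lambda>h. - (transpose (U s t) *v (Pm s t *v (U s t *v h))))) (at x)"
proof -
  have z: "((\<lambda>x. y - mm s t x) has_derivative (\<lambda>h. - (U s t *v h))) (at x)"
    unfolding mm_def by (auto intro!: derivative_eq_intros bounded_linear.has_derivative[OF matrix_vector_mul_bounded_linear])
  have "((\<lambda>x. ww s t x y) has_derivative (\<lambda>h. transpose (U s t) *v (Pm s t *v (- (U s t *v h))))) (at x)"
    unfolding ww_def by (rule bounded_linear.has_derivative[OF matrix_vector_mul_bounded_linear]
        bounded_linear.has_derivative[OF matrix_vector_mul_bounded_linear z])+
  then show ?thesis by (simp add: bounded_bilinear.minus_right[OF bounded_bilinear_mat_vec])
qed

text \<open>\<open>kap * wH\<close> is the Hessian of \<open>kap\<close> in x, applied to h: the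
  square of the logarithmic gradient \<open>ww\<close> plus the derivative of
  \<open>ww\<close>.\<close>

definition wH where "wH s t x y h = (ww s t x y \<bullet> h) *\<^sub>R ww s t x y - transpose (U s t) *v (Pm s t *v (U s t *v h))"

lemma kapww_deriv_x:
  assumes st: "s < t"
  shows "((\<lambda>x. kap s t x y *\<^sub>R ww s t x y) has_derivative (\<lambda>h. kap s t x y *\<^sub>R wH s t x y h)) (at x)"
proof -
  have "((\<lambda>x. kap s t x y *\<^sub>R ww s t x y) has_derivative
    (\<lambda>h. kap s t x y *\<^sub>R (- (transpose (U s t) *v (Pm s t *v (U s t *v h)))) + (kap s t x y * (ww s t x y \<bullet> h)) *\<^sub>R ww s t x y)) (at x)"
    by (rule has_derivative_scaleR[OF kap_deriv_x[OF st] ww_deriv_x])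
  moreover have "(\<lambda>h. kap s t x y *\<^sub>R (- (transpose (U s t) *v (Pm s t *v (U s t *v h)))) + (kap s t x y * (ww s t x y \<bullet> h)) *\<^sub>R ww s t x y) = (\<lambda>h. kap s t x y *\<^sub>R wH s t x y h)"
    by (auto simp: wH_def fun_eq_iff algebra_simps)
  ultimately show ?thesis by simp
qed

subsection \<open>Continuity in the parameters\<close>

lemma isCont_params:
  assumes "s < t"
  shows "isCont (Pm s) t" "isCont (cc s) t" "isCont (gf s) t" "isCont (U s) t" "isCont (W s) t" "isCont A t" "isCont g t"
proof -
  show "isCont (Pm s) t" using Pm_deriv[OF assms] has_vector_derivative_continuous by blast
  show "isCont (cc s) t" using cc_deriv[OF assms] DERIV_isCont by blast
  show "isCont (gf s) t" using gf_deriv[OF assms] has_vector_derivative_continuous by blast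
  show "isCont (U s) t" by (rule isCont_U)
  show "isCont (W s) t" using W_continuous[of UNIV s] by (simp add: continuous_on_eq_continuous_at)
  show "isCont A t" "isCont g t" using A_cont g_cont by (simp_all add: continuous_on_eq_continuous_at)
qed

lemmas mat_tendsto = bounded_bilinear.tendsto[OF bounded_bilinear_mat_vec] bounded_bilinear.tendsto[OF bounded_bilinear_mat_mult]
  bounded_linear.tendsto[OF bounded_linear_transpose] bounded_linear.tendsto[OF bounded_linear_trace]

context
  fixes F :: "'b filter" and T :: "'b \<Rightarrow> real" and X :: "'b \<Rightarrow> real^'n" and s t :: real and x :: "real^'n"
  assumes T: "(T \<longlongrightarrow> t) F" and X: "(X \<longlongrightarrow> x) F" and st: "s < t"
begin

text \<open>An arbitrary filter along which time and space converge is used, so that joint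
  continuity in (t, x) follows from a single set of rules.\<close>

lemma params_tendsto:
  "((\<lambda>p. Pm s (T p)) \<longlongrightarrow> Pm s t) F" "((\<lambda>p. cc s (T p)) \<longlongrightarrow> cc s t) F" "((\<lambda>p. gf s (T p)) \<longlongrightarrow> gf s t) F"
  "((\<lambda>p. U s (T p)) \<longlongrightarrow> U s t) F" "((\<lambda>p. W s (T p)) \<longlongrightarrow> W s t) F" "((\<lambda>p. A (T p)) \<longlongrightarrow> A t) F" "((\<lambda>p. g (T p)) \<longlongrightarrow> g t) F"
  by (rule isCont_tendsto_compose[OF _ T], rule isCont_params[OF st])+

lemma mm_tendsto: "((\<lambda>p. mm s (T p) (X p)) \<longlongrightarrow> mm s t x) F"
  unfolding mm_def by (intro tendsto_intros mat_tendsto params_tendsto X)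

lemma kap_tendsto: "((\<lambda>p. kap s (T p) (X p) y) \<longlongrightarrow> kap s t x y) F"
  unfolding kap_def by (intro tendsto_intros mat_tendsto params_tendsto mm_tendsto)

lemma ww_tendsto: "((\<lambda>p. ww s (T p) (X p) y) \<longlongrightarrow> ww s t x y) F"
  unfolding ww_def by (intro tendsto_intros mat_tendsto params_tendsto mm_tendsto)

lemma kt_tendsto: "((\<lambda>p. kt s (T p) (X p) y) \<longlongrightarrow> kt s t x y) F"
  unfolding kt_def by (intro tendsto_intros mat_tendsto params_tendsto mm_tendsto X)

lemma wH_tendsto: "((\<lambda>p. wH s (T p) (X p) y h) \<longlongrightarrow> wH s t x y h) F"
  unfolding wH_def by (intro tendsto_intros mat_tendsto params_tendsto ww_tendsto)

end


end

lemma continuous_bounded_interval: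
  fixes h :: "real \<Rightarrow> 'a::real_normed_vector"
  assumes "\<And>t. t \<in> {a..b} \<Longrightarrow> isCont h t"
  shows "\<exists>C\<ge>0. \<forall>t\<in>{a..b}. norm (h t) \<le> C"
proof -
  have "continuous_on {a..b} h" using assms by (intro continuous_at_imp_continuous_on) auto
  then have "bounded (h ` {a..b})" by (intro compact_imp_bounded compact_continuous_image) auto
  then obtain C where C: "\<forall>t\<in>{a..b}. norm (h t) \<le> C" by (auto simp: bounded_iff)
  show ?thesis by (rule exI[of _ "max C 0"]) (use C in \<open>auto simp: le_max_iff_disj\<close>)
qed

lemma matrix_bounded_interval:
  fixes h :: "real \<Rightarrow> real^'n^'n"
  assumes h: "\<And>t. t \<in> {a..b} \<Longrightarrow> isCont h t"
  shows "\<exists>C\<ge>0. \<forall>t\<in>{a..b}. \<forall>v. norm (h t *v v) \<le> C * norm v"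
proof -
  obtain C where C: "C \<ge> 0" "\<And>t. t \<in> {a..b} \<Longrightarrow> norm (h t) \<le> C"
    using continuous_bounded_interval[of a b h] h by blast
  obtain K where K: "K \<ge> 0" "\<And>M::real^'n^'n. opn M \<le> K * norm M" using opn_le_norm by blast
  have "norm (h t *v v) \<le> (K * C) * norm v" if t: "t \<in> {a..b}" for t v
  proof -
    have "norm (h t *v v) \<le> opn (h t) * norm v" by (rule norm_mat_vec_le)
    also have "\<dots> \<le> (K * norm (h t)) * norm v" by (intro mult_right_mono K(2)) auto
    also have "\<dots> \<le> (K * C) * norm v" using C(2)[OF t] K(1) by (intro mult_right_mono mult_left_mono) auto
    finally show ?thesis .
  qed
  then show ?thesis using K(1) C(1) by (intro exI[of _ "K * C"]) auto
qed

context ornstein_uhlenbeck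
begin

subsection \<open>Locally uniform domination\<close>

text \<open>Each derivative of the kernel is \<open>kap\<close> times a factor growing at most
  quadratically in z = y - \<open>mm s t x\<close>. Part of the Gaussian exponent absorbs this
  factor, and the remaining Gaussian in z is compared with one centred at 0. The bound justifies all
  differentiation under the integral.\<close>

lemma kernel_domination:
  assumes st: "s < t0"
  shows "\<exists>r C a. 0 < r \<and> 0 \<le> C \<and> 0 < a \<and> (\<forall>t x y. \<bar>t - t0\<bar> \<le> r \<longrightarrow> norm (x - x0) \<le> r \<longrightarrow>
     s < t \<and> kap s t x y \<le> C * exp (- a * (norm y)\<^sup>2) \<and>
     norm (kap s t x y * kt s t x y) \<le> C * exp (- a * (norm y)\<^sup>2) \<and>
     norm (kap s t x y *\<^sub>R ww s t x y) \<le> C * exp (- a * (norm y)\<^sup>2) \<and>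
     (\<forall>h. norm (kap s t x y *\<^sub>R wH s t x y h) \<le> C * exp (- a * (norm y)\<^sup>2) * norm h))"
proof -
  \<comment> \<open>Keeps all times considered away from s, where the kernel degenerates.\<close>
  define r where "r = min 1 ((t0 - s) / 2)"
  have r: "0 < r" "r \<le> 1" "s < t0 - r" using st by (auto simp: r_def min_def field_simps)
  let ?I = "{t0 - r..t0 + r}"
  have I: "s < t" if "t \<in> ?I" for t using that r by auto
  have bdd: "\<exists>C\<ge>0. \<forall>t\<in>?I. norm (h t) \<le> C" if "\<And>t. s < t \<Longrightarrow> isCont h t" for h :: "real \<Rightarrow> 'z::real_normed_vector"
    using continuous_bounded_interval[of "t0 - r" "t0 + r" h] that I by blast
  have bddo: "\<exists>C\<ge>0. \<forall>t\<in>?I. \<forall>v. norm (h t *v v) \<le> C * norm v" if "\<And>t. s < t \<Longrightarrow> isCont h t" for h :: "real \<Rightarrow> real^'n^'n"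
    using matrix_bounded_interval[of "t0 - r" "t0 + r" h] that I by blast
  obtain cP where cP: "cP \<ge> 0" "\<And>t v. t \<in> ?I \<Longrightarrow> norm (Pm s t *v v) \<le> cP * norm v"
    using bddo[of "Pm s"] isCont_params(1) by blast
  obtain cU where cU: "cU \<ge> 0" "\<And>t v. t \<in> ?I \<Longrightarrow> norm (U s t *v v) \<le> cU * norm v"
    using bddo[of "U s"] isCont_params(4) by blast
  have tU: "isCont (\<lambda>t. transpose (U s t)) t" if "s < t" for t
    using isCont_params(4)[OF that] bounded_linear.isCont[OF bounded_linear_transpose] by blast
  obtain cV where cV: "cV \<ge> 0" "\<And>t v. t \<in> ?I \<Longrightarrow> norm (transpose (U s t) *v v) \<le> cV * norm v"
    using bddo[of "\<lambda>t. transpose (U s t)"] tU by blast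
  obtain cW where cW: "cW \<ge> 0" "\<And>t v. t \<in> ?I \<Longrightarrow> norm (W s t *v v) \<le> cW * norm v"
    using bddo[of "W s"] isCont_params(5) by blast
  obtain cA where cA: "cA \<ge> 0" "\<And>t v. t \<in> ?I \<Longrightarrow> norm (A t *v v) \<le> cA * norm v"
    using bddo[of A] isCont_params(6) by blast
  obtain cg where cg: "cg \<ge> 0" "\<And>t. t \<in> ?I \<Longrightarrow> norm (g t) \<le> cg" using bdd[of g] isCont_params(7) by blast
  obtain cf where cf: "cf \<ge> 0" "\<And>t. t \<in> ?I \<Longrightarrow> norm (gf s t) \<le> cf" using bdd[of "gf s"] isCont_params(3) by blast
  obtain ck where ck: "ck \<ge> 0" "\<And>t. t \<in> ?I \<Longrightarrow> norm (cc s t) \<le> ck" using bdd[of "cc s"] isCont_params(2) by blast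
  have tr: "isCont (\<lambda>t. trace (Pm s t ** W s t)) t" if "s < t" for t
    using isCont_params[OF that] unfolding isCont_def by (intro mat_tendsto)
  obtain cT where cT: "cT \<ge> 0" "\<And>t. t \<in> ?I \<Longrightarrow> norm (trace (Pm s t ** W s t)) \<le> cT" using bdd[OF tr] by blast
  obtain q where q: "q > 0" "\<And>s t z. s < t \<Longrightarrow> (norm z)\<^sup>2 / q \<le> (Pm s t *v z) \<bullet> z" using Pm_lower by blast
  \<comment> \<open>The kernel decays at least like exp(-2a |z|^2). One share a absorbs (1 + |z|)^2;
    the other becomes rate a / 2 in y because |y|^2 <= 2 |z|^2 + 2 mx^2.\<close>
  define a where "a = 1 / (4 * q)"
  have a: "a > 0" using q by (simp add: a_def)
  define mx where "mx = cU * (norm x0 + 1) + cf"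
  define cz where "cz = cU * (cA * (norm x0 + 1) + cg)"
  have mx0: "mx \<ge> 0" and cz0: "cz \<ge> 0" using cU cf cA cg by (simp_all add: mx_def cz_def)
  define C0 where "C0 = ck * exp (2\<^sup>2 / (4 * a)) * exp (a * mx\<^sup>2)"
  have C0: "C0 \<ge> 0" using ck by (simp add: C0_def)
  define Ct where "Ct = cT + cW * cP * cP + cP * cz"
  define Cw where "Cw = cV * cP"
  define CH where "CH = Cw * Cw + cV * cP * cU"
  have nn: "Ct \<ge> 0" "Cw \<ge> 0" "CH \<ge> 0" using cT cW cP cz0 cV cU by (simp_all add: Ct_def Cw_def CH_def)
  define C where "C = C0 * (1 + Ct + Cw + CH)"
  have key: "s < t \<and> kap s t x y \<le> C * exp (- (a / 2) * (norm y)\<^sup>2) \<and>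
     norm (kap s t x y * kt s t x y) \<le> C * exp (- (a / 2) * (norm y)\<^sup>2) \<and>
     norm (kap s t x y *\<^sub>R ww s t x y) \<le> C * exp (- (a / 2) * (norm y)\<^sup>2) \<and>
     (\<forall>h. norm (kap s t x y *\<^sub>R wH s t x y h) \<le> C * exp (- (a / 2) * (norm y)\<^sup>2) * norm h)"
    if t: "\<bar>t - t0\<bar> \<le> r" and x: "norm (x - x0) \<le> r" for t x y
  proof -
    have tI: "t \<in> ?I" using t by auto
    have st': "s < t" by (rule I[OF tI])
    have nx: "norm x \<le> norm x0 + 1" using x r(2) norm_triangle_sub[of x x0] by linarith
    let ?z = "y - mm s t x"
    let ?E = "exp (- (a / 2) * (norm y)\<^sup>2)"
    have nm: "norm (mm s t x) \<le> mx"
    proof -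
      have "norm (mm s t x) \<le> norm (U s t *v x) + norm (gf s t)" unfolding mm_def by (rule norm_triangle_ineq)
      also have "\<dots> \<le> cU * norm x + cf" by (intro add_mono cU cf tI)
      also have "\<dots> \<le> mx" unfolding mx_def using nx cU(1) by (intro add_mono mult_left_mono) auto
      finally show ?thesis .
    qed
    have n\<zeta>: "norm (U s t *v (A t *v x + g t)) \<le> cz"
    proof -
      have "norm (A t *v x + g t) \<le> cA * norm x + cg" using norm_triangle_ineq[of "A t *v x" "g t"] cA(2)[OF tI, of x] cg(2)[OF tI] by linarith
      also have "\<dots> \<le> cA * (norm x0 + 1) + cg" using nx cA(1) by (intro add_mono mult_left_mono) auto
      finally show ?thesis unfolding cz_def using cU(2)[OF tI, of "A t *v x + g t"] cU(1) by (meson mult_left_mono order_trans)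
    qed
    have base: "kap s t x y * (1 + norm ?z)\<^sup>2 \<le> C0 * ?E"
    proof -
      have "(norm ?z)\<^sup>2 * (2 * a) \<le> 1 / 2 * ((Pm s t *v ?z) \<bullet> ?z)"
        using q(2)[OF st', of ?z] q(1) by (simp add: a_def field_simps)
      then have e1: "exp (- 1 / 2 * ((Pm s t *v ?z) \<bullet> ?z)) \<le> exp (- (2 * a) * (norm ?z)\<^sup>2)" by (simp add: mult.commute)
      have e2: "(1 + norm ?z)\<^sup>2 \<le> exp (2\<^sup>2 / (4 * a)) * exp (a * (norm ?z)\<^sup>2)"
        using powr_le_exp_square[of a 2 "norm ?z"] a by (simp add: add_nonneg_pos)
      have "kap s t x y * (1 + norm ?z)\<^sup>2 \<le> (ck * exp (- (2 * a) * (norm ?z)\<^sup>2)) * (exp (2\<^sup>2 / (4 * a)) * exp (a * (norm ?z)\<^sup>2))"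
        unfolding kap_def using ck(2)[OF tI] ck(1) by (intro mult_mono e1 e2) auto
      also have "\<dots> = ck * exp (2\<^sup>2 / (4 * a)) * exp (- a * (norm ?z)\<^sup>2)"
        by (simp add: exp_add[symmetric] mult.assoc mult.left_commute[of "exp (- (2 * a) * (norm ?z)\<^sup>2)"])
      also have "\<dots> \<le> ck * exp (2\<^sup>2 / (4 * a)) * (exp (a * mx\<^sup>2) * ?E)"
      proof (intro mult_left_mono)
        have "norm y \<le> norm ?z + mx" using norm_triangle_ineq[of ?z "mm s t x"] nm by simp
        then have "(norm y)\<^sup>2 \<le> (norm ?z + mx)\<^sup>2" by (intro power_mono) auto
        also have "\<dots> \<le> 2 * (norm ?z)\<^sup>2 + 2 * mx\<^sup>2" using sum_squares_bound[of "norm ?z" mx] by (simp add: power2_sum)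
        finally have "a * (norm y)\<^sup>2 \<le> a * (2 * (norm ?z)\<^sup>2 + 2 * mx\<^sup>2)" using a by (intro mult_left_mono) auto
        then have "- a * (norm ?z)\<^sup>2 \<le> a * mx\<^sup>2 + - (a / 2) * (norm y)\<^sup>2" by (simp add: algebra_simps)
        then show "exp (- a * (norm ?z)\<^sup>2) \<le> exp (a * mx\<^sup>2) * ?E" by (simp add: exp_add[symmetric])
      qed (use ck in auto)
      finally show ?thesis by (simp add: C0_def mult.assoc)
    qed
    \<comment> \<open>Serves all four claims: each factor is bounded by a constant times (1 +
      |z|)^2, to which \<open>base\<close> applies.\<close>
    have gen: "kap s t x y * c \<le> C * ?E" if "c \<le> c' * (1 + norm ?z)\<^sup>2" "0 \<le> c'" "c' \<le> 1 + Ct + Cw + CH" for c c'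
    proof -
      have "kap s t x y * c \<le> kap s t x y * (c' * (1 + norm ?z)\<^sup>2)" by (intro mult_left_mono that) auto
      also have "\<dots> = c' * (kap s t x y * (1 + norm ?z)\<^sup>2)" by simp
      also have "\<dots> \<le> c' * (C0 * ?E)" by (intro mult_left_mono base that)
      also have "\<dots> \<le> (1 + Ct + Cw + CH) * (C0 * ?E)" using C0 by (intro mult_right_mono that) auto
      finally show ?thesis by (simp add: C_def ac_simps)
    qed
    have z1: "1 \<le> (1 + norm ?z)\<^sup>2" "norm ?z \<le> (1 + norm ?z)\<^sup>2" "(norm ?z)\<^sup>2 \<le> (1 + norm ?z)\<^sup>2"
      using norm_ge_zero[of ?z] by (auto simp: power2_sum add_nonneg_nonneg)
    have P1: "norm (Pm s t *v ?z) \<le> cP * norm ?z" by (rule cP(2)[OF tI])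
    have w1: "norm (ww s t x y) \<le> Cw * norm ?z"
    proof -
      have "norm (ww s t x y) \<le> cV * norm (Pm s t *v ?z)" unfolding ww_def by (rule cV(2)[OF tI])
      also have "\<dots> \<le> cV * (cP * norm ?z)" by (intro mult_left_mono P1 cV)
      finally show ?thesis by (simp add: Cw_def mult.assoc)
    qed
    have k1: "kap s t x y \<le> C * ?E" using gen[of 1 1] z1 nn by simp
    have kt1: "norm (kt s t x y) \<le> Ct * (1 + norm ?z)\<^sup>2"
    proof -
      have a1: "\<bar>(W s t *v (Pm s t *v ?z)) \<bullet> (Pm s t *v ?z)\<bar> \<le> cW * cP * cP * (norm ?z)\<^sup>2"
      proof -
        have "\<bar>(W s t *v (Pm s t *v ?z)) \<bullet> (Pm s t *v ?z)\<bar> \<le> norm (W s t *v (Pm s t *v ?z)) * norm (Pm s t *v ?z)" by (rule Cauchy_Schwarz_ineq2)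
        also have "\<dots> \<le> (cW * norm (Pm s t *v ?z)) * norm (Pm s t *v ?z)" by (intro mult_right_mono cW tI) auto
        also have "\<dots> \<le> (cW * (cP * norm ?z)) * (cP * norm ?z)" using cW cP by (intro mult_mono P1 mult_left_mono) auto
        finally show ?thesis by (simp add: power2_eq_square ac_simps)
      qed
      have a2: "\<bar>(Pm s t *v ?z) \<bullet> (U s t *v (A t *v x + g t))\<bar> \<le> cP * cz * norm ?z"
      proof -
        have "\<bar>(Pm s t *v ?z) \<bullet> (U s t *v (A t *v x + g t))\<bar> \<le> norm (Pm s t *v ?z) * norm (U s t *v (A t *v x + g t))" by (rule Cauchy_Schwarz_ineq2)
        also have "\<dots> \<le> (cP * norm ?z) * cz" using cP by (intro mult_mono P1 n\<zeta>) auto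
        finally show ?thesis by (simp add: ac_simps)
      qed
      have "norm (kt s t x y) \<le> cT + cW * cP * cP * (norm ?z)\<^sup>2 + cP * cz * norm ?z"
        unfolding kt_def real_norm_def using a1 a2 cT(2)[OF tI] by simp
      also have "\<dots> \<le> cT * (1 + norm ?z)\<^sup>2 + cW * cP * cP * (1 + norm ?z)\<^sup>2 + cP * cz * (1 + norm ?z)\<^sup>2"
      proof (intro add_mono)
        show "cT \<le> cT * (1 + norm ?z)\<^sup>2" using mult_left_mono[OF z1(1) cT(1)] by simp
        show "cW * cP * cP * (norm ?z)\<^sup>2 \<le> cW * cP * cP * (1 + norm ?z)\<^sup>2" using cW cP by (intro mult_left_mono z1) auto
        show "cP * cz * norm ?z \<le> cP * cz * (1 + norm ?z)\<^sup>2" using cP cz0 by (intro mult_left_mono z1) auto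
      qed
      finally show ?thesis by (simp add: Ct_def algebra_simps)
    qed
    have k2: "norm (kap s t x y * kt s t x y) \<le> C * ?E"
      using gen[OF kt1] nn by (simp add: abs_mult)
    have k3: "norm (kap s t x y *\<^sub>R ww s t x y) \<le> C * ?E"
    proof -
      have "norm (ww s t x y) \<le> Cw * (1 + norm ?z)\<^sup>2" using w1 mult_left_mono[OF z1(2) nn(2)] by linarith
      from gen[OF this] nn show ?thesis by simp
    qed
    have k4: "norm (kap s t x y *\<^sub>R wH s t x y h) \<le> C * ?E * norm h" for h
    proof -
      have "norm (wH s t x y h) \<le> (CH * (1 + norm ?z)\<^sup>2) * norm h"
      proof -
        have b1: "norm ((ww s t x y \<bullet> h) *\<^sub>R ww s t x y) \<le> (Cw * Cw * (norm ?z)\<^sup>2) * norm h"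
        proof -
          have "norm ((ww s t x y \<bullet> h) *\<^sub>R ww s t x y) \<le> (norm (ww s t x y) * norm h) * norm (ww s t x y)"
            by (simp add: mult_right_mono Cauchy_Schwarz_ineq2)
          also have "\<dots> \<le> ((Cw * norm ?z) * norm h) * (Cw * norm ?z)" using nn by (intro mult_mono w1 mult_right_mono) auto
          finally show ?thesis by (simp add: power2_eq_square ac_simps)
        qed
        have b2: "norm (transpose (U s t) *v (Pm s t *v (U s t *v h))) \<le> (cV * cP * cU) * norm h"
        proof -
          have "norm (transpose (U s t) *v (Pm s t *v (U s t *v h))) \<le> cV * norm (Pm s t *v (U s t *v h))" by (rule cV(2)[OF tI])
          also have "\<dots> \<le> cV * (cP * norm (U s t *v h))" by (intro mult_left_mono cP cV tI)
          also have "\<dots> \<le> cV * (cP * (cU * norm h))" by (intro mult_left_mono cU cP cV tI)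
          finally show ?thesis by (simp add: mult.assoc)
        qed
        have "norm (wH s t x y h) \<le> (Cw * Cw * (norm ?z)\<^sup>2) * norm h + (cV * cP * cU) * norm h"
          unfolding wH_def by (rule norm_triangle_le_diff) (use b1 b2 in linarith)
        also have "\<dots> \<le> (Cw * Cw * (1 + norm ?z)\<^sup>2) * norm h + ((cV * cP * cU) * (1 + norm ?z)\<^sup>2) * norm h"
        proof (intro add_mono mult_right_mono)
          show "Cw * Cw * (norm ?z)\<^sup>2 \<le> Cw * Cw * (1 + norm ?z)\<^sup>2" using nn by (intro mult_left_mono z1) auto
          have "0 \<le> cV * cP * cU" using cV cP cU by simp
          from mult_left_mono[OF z1(1) this] show "cV * cP * cU \<le> cV * cP * cU * (1 + norm ?z)\<^sup>2" by simp
        qed auto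
        finally show ?thesis by (simp add: CH_def algebra_simps)
      qed
      then have "kap s t x y * norm (wH s t x y h) \<le> (kap s t x y * (CH * (1 + norm ?z)\<^sup>2)) * norm h"
        using mult_left_mono[OF _ kap_nonneg[of s t x y]] by (simp only: mult.assoc)
      also have "\<dots> \<le> C * ?E * norm h" using nn by (intro mult_right_mono gen[of _ CH]) auto
      finally show ?thesis by simp
    qed
    from st' k1 k2 k3 k4 show ?thesis by blast
  qed
  have "C \<ge> 0" using C0 nn by (simp add: C_def)
  with r(1) a key show ?thesis by (intro exI[of _ r] exI[of _ C] exI[of _ "a / 2"]) auto
qed

end

lemma measure_stdg_UNIV [simp]: "measure (stdg :: (real^'n) measure) UNIV = 1"
  using prob_space.prob_space[OF prob_space_stdg] by (metis space_stdg)

section \<open>The Mehler integral solves the Cauchy problem\<close>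

context ornstein_uhlenbeck
begin

lemma C_bD:
  assumes "f \<in> C_b"
  shows "f \<in> borel_measurable borel" "continuous_on UNIV f" "\<exists>F\<ge>0. \<forall>x. \<bar>f x\<bar> \<le> F"
proof -
  show c: "continuous_on UNIV f" using assms by (simp add: C_b_def)
  then show "f \<in> borel_measurable borel" by (rule borel_measurable_continuous_onI)
  obtain F where F: "\<And>x. \<bar>f x\<bar> \<le> F" using assms by (auto simp: C_b_def bounded_iff)
  have "F \<ge> 0" using F[of undefined] abs_ge_zero order_trans by blast
  with F show "\<exists>F\<ge>0. \<forall>x. \<bar>f x\<bar> \<le> F" by blast
qed

lemma kernel_local_bound:
  assumes "s < t0"
  obtains r D where "r > 0" "integrable lborel D"
    "\<And>t x. \<bar>t - t0\<bar> \<le> r \<Longrightarrow> norm (x - x0) \<le> r \<Longrightarrow> s < t"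
    "\<And>t x y. \<bar>t - t0\<bar> \<le> r \<Longrightarrow> norm (x - x0) \<le> r \<Longrightarrow> norm (kap s t x y) \<le> D y"
    "\<And>t x y. \<bar>t - t0\<bar> \<le> r \<Longrightarrow> norm (x - x0) \<le> r \<Longrightarrow> norm (kap s t x y * kt s t x y) \<le> D y"
    "\<And>t x y. \<bar>t - t0\<bar> \<le> r \<Longrightarrow> norm (x - x0) \<le> r \<Longrightarrow> norm (kap s t x y *\<^sub>R ww s t x y) \<le> D y"
    "\<And>t x y h. \<bar>t - t0\<bar> \<le> r \<Longrightarrow> norm (x - x0) \<le> r \<Longrightarrow> norm (kap s t x y *\<^sub>R wH s t x y h) \<le> D y * norm h"
proof -
  obtain r C a where r: "0 < r" "0 \<le> C" "0 < a" and b: "\<forall>t x y. \<bar>t - t0\<bar> \<le> r \<longrightarrow> norm (x - x0) \<le> r \<longrightarrow>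
     s < t \<and> kap s t x y \<le> C * exp (- a * (norm y)\<^sup>2) \<and>
     norm (kap s t x y * kt s t x y) \<le> C * exp (- a * (norm y)\<^sup>2) \<and>
     norm (kap s t x y *\<^sub>R ww s t x y) \<le> C * exp (- a * (norm y)\<^sup>2) \<and>
     (\<forall>h. norm (kap s t x y *\<^sub>R wH s t x y h) \<le> C * exp (- a * (norm y)\<^sup>2) * norm h)"
    using kernel_domination[OF assms, of x0] by blast
  have i: "integrable lborel (\<lambda>y::real^'n. C * exp (- a * (norm y)\<^sup>2))"
    using integrable_exp_neg_square[OF r(3)] by auto
  show ?thesis
    by (rule that[OF r(1) i]) (use b in auto)
qed

lemma kernel_measurables [measurable]:
  "kt s t x \<in> borel_measurable borel" "(\<lambda>y. wH s t x y h) \<in> borel_measurable borel"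
  unfolding kt_def wH_def by measurable

context
  fixes f :: "real^'n \<Rightarrow> real" and s :: real
  assumes f: "f \<in> C_b"
begin

lemma f_measurable [measurable]: "f \<in> borel_measurable borel" by (rule C_bD[OF f])

definition Gx where "Gx t x = (LINT y|lborel. (f y * kap s t x y) *\<^sub>R ww s t x y)"
definition GH where "GH t x h = (LINT y|lborel. (f y * kap s t x y) *\<^sub>R wH s t x y h)"

lemma kernel_integrable:
  assumes st: "s < t"
  shows "integrable lborel (\<lambda>y. f y * kap s t x y)"
    "integrable lborel (\<lambda>y. f y * (kap s t x y * kt s t x y))"
    "integrable lborel (\<lambda>y. (f y * kap s t x y) *\<^sub>R ww s t x y)"
    "integrable lborel (\<lambda>y. (f y * kap s t x y) *\<^sub>R wH s t x y h)"
proof -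
  obtain F where F: "F \<ge> 0" "\<And>x. \<bar>f x\<bar> \<le> F" using C_bD(3)[OF f] by blast
  obtain r :: real and D :: "real^'n \<Rightarrow> real" where D: "r > 0" "integrable lborel D"
    "\<And>y. norm (kap s t x y) \<le> D y" "\<And>y. norm (kap s t x y * kt s t x y) \<le> D y"
    "\<And>y. norm (kap s t x y *\<^sub>R ww s t x y) \<le> D y" "\<And>y h. norm (kap s t x y *\<^sub>R wH s t x y h) \<le> D y * norm h"
  proof (rule kernel_local_bound[OF st, of x])
    fix r :: real and D :: "real^'n \<Rightarrow> real" assume "r > 0" "integrable lborel D"
      "\<And>t' x' y. \<bar>t' - t\<bar> \<le> r \<Longrightarrow> norm (x' - x) \<le> r \<Longrightarrow> norm (kap s t' x' y) \<le> D y"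
      "\<And>t' x' y. \<bar>t' - t\<bar> \<le> r \<Longrightarrow> norm (x' - x) \<le> r \<Longrightarrow> norm (kap s t' x' y * kt s t' x' y) \<le> D y"
      "\<And>t' x' y. \<bar>t' - t\<bar> \<le> r \<Longrightarrow> norm (x' - x) \<le> r \<Longrightarrow> norm (kap s t' x' y *\<^sub>R ww s t' x' y) \<le> D y"
      "\<And>t' x' y h. \<bar>t' - t\<bar> \<le> r \<Longrightarrow> norm (x' - x) \<le> r \<Longrightarrow> norm (kap s t' x' y *\<^sub>R wH s t' x' y h) \<le> D y * norm h"
    then show ?thesis by (intro that[of r D]) auto
  qed
  have FD: "norm (f y *\<^sub>R v) \<le> norm (F * d)" if "norm v \<le> d" for y and v :: "'z::real_normed_vector" and d
  proof -
    have "norm (f y *\<^sub>R v) \<le> F * d" using F that by (simp add: mult_mono)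
    then show ?thesis by (simp add: order_trans[OF _ abs_ge_self])
  qed
  have iD: "integrable lborel (\<lambda>y. F * D y)" "integrable lborel (\<lambda>y. F * (D y * norm h))" using D(2) by auto
  show "integrable lborel (\<lambda>y. f y * kap s t x y)"
    by (rule Bochner_Integration.integrable_bound[OF iD(1)]) (use FD[OF D(3)] in auto)
  show "integrable lborel (\<lambda>y. f y * (kap s t x y * kt s t x y))"
    by (rule Bochner_Integration.integrable_bound[OF iD(1)]) (use FD[OF D(4)] in auto)
  show "integrable lborel (\<lambda>y. (f y * kap s t x y) *\<^sub>R ww s t x y)"
    by (rule Bochner_Integration.integrable_bound[OF iD(1)]) (use FD[OF D(5)] in \<open>auto simp: mult.assoc\<close>)
  show "integrable lborel (\<lambda>y. (f y * kap s t x y) *\<^sub>R wH s t x y h)"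
    by (rule Bochner_Integration.integrable_bound[OF iD(2)]) (use FD[OF D(6)] in \<open>auto simp: mult.assoc\<close>)
qed

lemma G_deriv_t:
  assumes st: "s < t"
  shows "((\<lambda>\<tau>. G \<tau> s f x) has_real_derivative (LINT y|lborel. f y * (kap s t x y * kt s t x y))) (at t)"
proof -
  obtain F where F: "F \<ge> 0" "\<And>x. \<bar>f x\<bar> \<le> F" using C_bD(3)[OF f] by blast
  obtain r D where D: "r > 0" "integrable lborel D"
    "\<And>t' x'. \<bar>t' - t\<bar> \<le> r \<Longrightarrow> norm (x' - x) \<le> r \<Longrightarrow> s < t'"
    "\<And>t' x' y. \<bar>t' - t\<bar> \<le> r \<Longrightarrow> norm (x' - x) \<le> r \<Longrightarrow> norm (kap s t' x' y * kt s t' x' y) \<le> D y"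
    by (rule kernel_local_bound[OF st, of x]) blast
  have s1: "s < t'" if "t' \<in> ball t r" for t' using D(3)[of t' x] that D(1) by (auto simp: dist_real_def)
  have "((\<lambda>\<tau>. LINT y|lborel. f y * kap s \<tau> x y) has_derivative (\<lambda>h. LINT y|lborel. (f y * (kap s t x y * kt s t x y)) * h)) (at t)"
  proof (rule parametric_integral_has_derivative[where D = "\<lambda>y. F * D y" and r = r and K' = "\<lambda>t y h. (f y * (kap s t x y * kt s t x y)) * h"])
    fix t' y assume "t' \<in> ball t r"
    then show "((\<lambda>\<tau>. f y * kap s \<tau> x y) has_derivative (\<lambda>h. (f y * (kap s t' x y * kt s t' x y)) * h)) (at t')"
      using DERIV_cmult[OF kap_deriv_t[OF s1], of t' "f y" x y] by (simp add: has_field_derivative_def)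
  next
    fix t' y h assume "t' \<in> ball t r"
    then have "norm (kap s t' x y * kt s t' x y) \<le> D y" using D(1) by (intro D(4)) (auto simp: dist_real_def)
    then have "\<bar>f y\<bar> * norm (kap s t' x y * kt s t' x y) \<le> F * D y" using F by (intro mult_mono) auto
    from mult_right_mono[OF this, of "\<bar>h\<bar>"]
    show "norm ((f y * (kap s t' x y * kt s t' x y)) * h) \<le> F * D y * norm h" by (simp add: abs_mult mult.assoc)
  next
    fix t' assume "t' \<in> ball t r"
    then show "integrable lborel (\<lambda>y. f y * kap s t' x y)" by (intro kernel_integrable s1)
  qed (use D in auto)
  then have H1: "((\<lambda>\<tau>. LINT y|lborel. f y * kap s \<tau> x y) has_real_derivative (LINT y|lborel. f y * (kap s t x y * kt s t x y))) (at t)"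
    unfolding has_field_derivative_def by (simp add: mult_commute_abs)
  have H2: "G \<tau> s f x = (LINT y|lborel. f y * kap s \<tau> x y)" if "\<tau> \<in> {s<..}" for \<tau>
    using that by (intro G_eq_kernel) auto
  show ?thesis
    by (rule has_field_derivative_transform_within_open[OF H1 open_greaterThan _ H2[symmetric]]) (use st in auto)
qed

lemma G_deriv_x:
  assumes st: "s < t"
  shows "(G t s f has_derivative (\<lambda>h. Gx t x \<bullet> h)) (at x)"
proof -
  obtain F where F: "F \<ge> 0" "\<And>x. \<bar>f x\<bar> \<le> F" using C_bD(3)[OF f] by blast
  obtain r D where D: "r > 0" "integrable lborel D"
    "\<And>t' x' y. \<bar>t' - t\<bar> \<le> r \<Longrightarrow> norm (x' - x) \<le> r \<Longrightarrow> norm (kap s t' x' y *\<^sub>R ww s t' x' y) \<le> D y"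
    by (rule kernel_local_bound[OF st, of x]) blast
  have "((\<lambda>x. LINT y|lborel. f y * kap s t x y) has_derivative (\<lambda>h. LINT y|lborel. ((f y * kap s t x y) *\<^sub>R ww s t x y) \<bullet> h)) (at x)"
  proof (rule parametric_integral_has_derivative[where D = "\<lambda>y. F * D y" and r = r and K' = "\<lambda>x y h. ((f y * kap s t x y) *\<^sub>R ww s t x y) \<bullet> h"])
    fix x' y assume "x' \<in> ball x r"
    show "((\<lambda>x. f y * kap s t x y) has_derivative (\<lambda>h. ((f y * kap s t x' y) *\<^sub>R ww s t x' y) \<bullet> h)) (at x')"
      using has_derivative_mult_right[OF kap_deriv_x[OF st], of "f y" y x'] by (simp add: mult.assoc)
  next
    fix x' y h assume "x' \<in> ball x r"
    then have "norm (kap s t x' y *\<^sub>R ww s t x' y) \<le> D y" using D(1) by (intro D(3)) (auto simp: dist_norm norm_minus_commute)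
    then have "\<bar>f y\<bar> * norm (kap s t x' y *\<^sub>R ww s t x' y) \<le> F * D y" using F by (intro mult_mono) auto
    then have "norm ((f y * kap s t x' y) *\<^sub>R ww s t x' y) \<le> F * D y" by (simp add: abs_mult mult.assoc)
    then show "norm (((f y * kap s t x' y) *\<^sub>R ww s t x' y) \<bullet> h) \<le> F * D y * norm h"
      using Cauchy_Schwarz_ineq2[of "(f y * kap s t x' y) *\<^sub>R ww s t x' y" h] mult_right_mono[OF _ norm_ge_zero[of h]]
      unfolding real_norm_def by (meson order_trans)
  next
    fix x' assume "x' \<in> ball x r"
    show "integrable lborel (\<lambda>y. f y * kap s t x' y)" by (intro kernel_integrable st)
  qed (use D in auto)
  moreover have "(\<lambda>h. LINT y|lborel. ((f y * kap s t x y) *\<^sub>R ww s t x y) \<bullet> h) = (\<lambda>h. Gx t x \<bullet> h)"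
    unfolding Gx_def by (rule ext, rule integral_inner_left) (rule kernel_integrable[OF st])
  moreover have "G t s f = (\<lambda>x. LINT y|lborel. f y * kap s t x y)"
    by (rule ext, rule G_eq_kernel[OF st]) measurable
  ultimately show ?thesis by simp
qed

lemma Gx_deriv_x:
  assumes st: "s < t"
  shows "(Gx t has_derivative GH t x) (at x)"
proof -
  obtain F where F: "F \<ge> 0" "\<And>x. \<bar>f x\<bar> \<le> F" using C_bD(3)[OF f] by blast
  obtain r D where D: "r > 0" "integrable lborel D"
    "\<And>t' x' y h. \<bar>t' - t\<bar> \<le> r \<Longrightarrow> norm (x' - x) \<le> r \<Longrightarrow> norm (kap s t' x' y *\<^sub>R wH s t' x' y h) \<le> D y * norm h"
    by (rule kernel_local_bound[OF st, of x]) blast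
  show ?thesis unfolding Gx_def[abs_def] GH_def[abs_def]
  proof (rule parametric_integral_has_derivative[where D = "\<lambda>y. F * D y" and r = r and K' = "\<lambda>x y h. (f y * kap s t x y) *\<^sub>R wH s t x y h"])
    fix x' y assume "x' \<in> ball x r"
    show "((\<lambda>x. (f y * kap s t x y) *\<^sub>R ww s t x y) has_derivative (\<lambda>h. (f y * kap s t x' y) *\<^sub>R wH s t x' y h)) (at x')"
      using has_derivative_scaleR_right[OF kapww_deriv_x[OF st], of "f y" y x'] by (simp add: mult.assoc)
  next
    fix x' y h assume "x' \<in> ball x r"
    then have "norm (kap s t x' y *\<^sub>R wH s t x' y h) \<le> D y * norm h" using D(1) by (intro D(3)) (auto simp: dist_norm norm_minus_commute)
    then have "\<bar>f y\<bar> * norm (kap s t x' y *\<^sub>R wH s t x' y h) \<le> F * (D y * norm h)" using F by (intro mult_mono) auto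
    then show "norm ((f y * kap s t x' y) *\<^sub>R wH s t x' y h) \<le> F * D y * norm h" by (simp add: abs_mult mult.assoc)
  next
    fix x' assume "x' \<in> ball x r"
    show "integrable lborel (\<lambda>y. (f y * kap s t x' y) *\<^sub>R ww s t x' y)" by (intro kernel_integrable st)
  qed (use D in auto)
qed

lemma grad_G: "s < t \<Longrightarrow> grad (G t s f) = Gx t"
  by (rule ext, rule grad_unique, rule G_deriv_x)

lemma hessian_G:
  assumes st: "s < t"
  shows "hessian (G t s f) x = matrix (GH t x)" "matrix (GH t x) *v h = GH t x h"
proof -
  have lin: "linear (GH t x)" using Gx_deriv_x[OF st] by (rule has_derivative_linear)
  then show e: "matrix (GH t x) *v h = GH t x h" for h by (simp add: matrix_works linear_matrix_vector_mul_eq)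
  show "hessian (G t s f) x = matrix (GH t x)"
    by (rule hessian_unique) (use Gx_deriv_x[OF st] in \<open>simp add: grad_G[OF st] e\<close>)
qed

text \<open>The evolution equation for the kernel, divided by \<open>kap\<close>. With w = U^T P z,
  summing <w, b>^2 over the columns b of \<open>B t\<close> gives <W P z, P z>, and summing <U^T P U
  b, b> gives the trace of P W.\<close>

lemma kernel_PDE:
  "1 / 2 * (\<Sum>j\<in>UNIV. wH s t x y (column j (B t)) \<bullet> column j (B t)) + (A t *v x + g t) \<bullet> ww s t x y = kt s t x y"
proof -
  let ?b = "\<lambda>j. column j (B t)" and ?w = "ww s t x y"
  have 1: "(\<Sum>j\<in>UNIV. (?w \<bullet> ?b j) * (?w \<bullet> ?b j)) = (W s t *v (Pm s t *v (y - mm s t x))) \<bullet> (Pm s t *v (y - mm s t x))"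
  proof -
    have "(transpose (B t) *v ?w) $ j = ?w \<bullet> ?b j" for j
      by (simp add: matrix_vector_mult_def transpose_def column_def inner_vec_def mult.commute)
    then have "(\<Sum>j\<in>UNIV. (?w \<bullet> ?b j) * (?w \<bullet> ?b j)) = (transpose (B t) *v ?w) \<bullet> (transpose (B t) *v ?w)"
      by (simp add: inner_vec_def)
    also have "\<dots> = ((B t ** transpose (B t)) *v ?w) \<bullet> ?w"
      by (simp add: matrix_vector_mul_assoc[symmetric] inner_matrix_transpose)
    finally show ?thesis unfolding W_quadratic ww_def .
  qed
  have 2: "(\<Sum>j\<in>UNIV. (transpose (U s t) *v (Pm s t *v (U s t *v ?b j))) \<bullet> ?b j) = trace (Pm s t ** W s t)"
  proof -
    have col: "column j (U s t ** B t) = U s t *v ?b j" for j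
      by (simp add: matrix_vector_mult_basis[symmetric] matrix_vector_mul_assoc)
    have "trace (Pm s t ** W s t) = trace (W s t ** Pm s t)" by (rule trace_mul_sym)
    also have "\<dots> = trace ((U s t ** B t) ** transpose (U s t ** B t) ** Pm s t)"
      by (simp add: W_def matrix_transpose_mul matrix_mul_assoc)
    also have "\<dots> = (\<Sum>j\<in>UNIV. (Pm s t *v (U s t *v ?b j)) \<bullet> (U s t *v ?b j))"
      unfolding trace_congruence col ..
    finally show ?thesis
      using inner_matrix_transpose[of "transpose (U s t)"] by simp
  qed
  have "(\<Sum>j\<in>UNIV. wH s t x y (?b j) \<bullet> ?b j) = (\<Sum>j\<in>UNIV. (?w \<bullet> ?b j) * (?w \<bullet> ?b j)) - (\<Sum>j\<in>UNIV. (transpose (U s t) *v (Pm s t *v (U s t *v ?b j))) \<bullet> ?b j)"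
    by (simp add: wH_def inner_diff_left sum_subtractf)
  moreover have "(A t *v x + g t) \<bullet> ?w = (Pm s t *v (y - mm s t x)) \<bullet> (U s t *v (A t *v x + g t))"
    unfolding ww_def by (subst inner_commute) (simp add: inner_matrix_transpose)
  ultimately show ?thesis unfolding 1 2 kt_def by (simp add: algebra_simps)
qed

lemma G_PDE:
  assumes st: "s < t"
  shows "deriv (\<lambda>\<tau>. G \<tau> s f x) t = OU_operator A B g t (G t s f) x"
proof -
  let ?b = "\<lambda>j. column j (B t)"
  note I = kernel_integrable[OF st]
  have GHb: "GH t x (?b j) \<bullet> ?b j = (LINT y|lborel. f y * kap s t x y * (wH s t x y (?b j) \<bullet> ?b j))" for j
    unfolding GH_def by (subst integral_inner_left[symmetric, OF I(4)]) simp
  have Ib: "integrable lborel (\<lambda>y. f y * kap s t x y * (wH s t x y (?b j) \<bullet> ?b j))" for j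
    using integrable_inner_left[OF I(4)] by simp
  have Gxb: "(A t *v x + g t) \<bullet> Gx t x = (LINT y|lborel. f y * kap s t x y * ((A t *v x + g t) \<bullet> ww s t x y))"
    unfolding Gx_def by (subst integral_inner_right[symmetric, OF I(3)]) simp
  have Ix: "integrable lborel (\<lambda>y. f y * kap s t x y * ((A t *v x + g t) \<bullet> ww s t x y))"
    using integrable_inner_right[OF I(3)] by simp
  have "OU_operator A B g t (G t s f) x = 1 / 2 * (\<Sum>j\<in>UNIV. GH t x (?b j) \<bullet> ?b j) + (A t *v x + g t) \<bullet> Gx t x"
    unfolding OU_operator_def trace_congruence hessian_G[OF st] grad_G[OF st] ..
  also have "\<dots> = 1 / 2 * (LINT y|lborel. (\<Sum>j\<in>UNIV. f y * kap s t x y * (wH s t x y (?b j) \<bullet> ?b j))) + (LINT y|lborel. f y * kap s t x y * ((A t *v x + g t) \<bullet> ww s t x y))"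
    unfolding GHb Gxb by (subst Bochner_Integration.integral_sum) (auto intro: Ib)
  also have "\<dots> = (LINT y|lborel. 1 / 2 * (\<Sum>j\<in>UNIV. f y * kap s t x y * (wH s t x y (?b j) \<bullet> ?b j)) + f y * kap s t x y * ((A t *v x + g t) \<bullet> ww s t x y))"
    using Ib Ix by simp
  also have "\<dots> = (LINT y|lborel. f y * (kap s t x y * kt s t x y))"
  proof (rule Bochner_Integration.integral_cong[OF refl])
    fix y
    have "f y * (kap s t x y * kt s t x y) = f y * kap s t x y * (1 / 2 * (\<Sum>j\<in>UNIV. wH s t x y (?b j) \<bullet> ?b j) + (A t *v x + g t) \<bullet> ww s t x y)"
      unfolding kernel_PDE by simp
    then show "1 / 2 * (\<Sum>j\<in>UNIV. f y * kap s t x y * (wH s t x y (?b j) \<bullet> ?b j)) + f y * kap s t x y * ((A t *v x + g t) \<bullet> ww s t x y) = f y * (kap s t x y * kt s t x y)"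
      by (simp add: sum_distrib_left[symmetric] algebra_simps)
  qed
  finally show ?thesis using DERIV_imp_deriv[OF G_deriv_t[OF st]] by simp
qed

lemma kernel_integral_continuous:
  fixes k :: "real \<Rightarrow> real^'n \<Rightarrow> real^'n \<Rightarrow> 'z::euclidean_space"
  assumes lim: "\<And>t x y. s < t \<Longrightarrow> ((\<lambda>p. k (fst p) (snd p) y) \<longlongrightarrow> k t x y) (at (t, x))"
    and meas: "\<And>t x. k t x \<in> borel_measurable borel"
    and bound: "\<And>t0 x0. s < t0 \<Longrightarrow> \<exists>r>0. \<exists>D. integrable lborel D \<and> (\<forall>t x y. \<bar>t - t0\<bar> \<le> r \<longrightarrow> norm (x - x0) \<le> r \<longrightarrow> norm (k t x y) \<le> D y)"
  shows "continuous_on ({s<..} \<times> UNIV) (\<lambda>(t, x). LINT y|lborel. f y *\<^sub>R k t x y)"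
proof (rule continuous_at_imp_continuous_on, safe)
  fix t0 :: real and x0 :: "real^'n" assume t0: "s < t0"
  obtain F where F: "F \<ge> 0" "\<And>x. \<bar>f x\<bar> \<le> F" using C_bD(3)[OF f] by blast
  obtain r D where D: "r > 0" "integrable lborel D" "\<And>t x y. \<bar>t - t0\<bar> \<le> r \<Longrightarrow> norm (x - x0) \<le> r \<Longrightarrow> norm (k t x y) \<le> D y"
    using bound[OF t0] by blast
  have "((\<lambda>p. LINT y|lborel. f y *\<^sub>R k (fst p) (snd p) y) \<longlongrightarrow> (LINT y|lborel. f y *\<^sub>R k t0 x0 y)) (at (t0, x0))"
  proof (rule parametric_integral_tendsto[where D = "\<lambda>y. F * D y"])
    show "((\<lambda>p. f y *\<^sub>R k (fst p) (snd p) y) \<longlongrightarrow> f y *\<^sub>R k t0 x0 y) (at (t0, x0))" for y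
      by (intro tendsto_intros lim t0)
    have "norm (f y *\<^sub>R k (fst p) (snd p) y) \<le> F * D y" if p: "dist p (t0, x0) < r" for p y
    proof -
      have "\<bar>fst p - t0\<bar> \<le> r" "norm (snd p - x0) \<le> r"
        using p dist_fst_le[of p "(t0, x0)"] dist_snd_le[of p "(t0, x0)"] by (auto simp: dist_norm)
      then have "norm (k (fst p) (snd p) y) \<le> D y" by (rule D(3))
      then show ?thesis using F by (simp add: mult_mono)
    qed
    then show "\<forall>\<^sub>F p in at (t0, x0). \<forall>y\<in>space lborel. norm (f y *\<^sub>R k (fst p) (snd p) y) \<le> F * D y"
      unfolding eventually_at using D(1) by (intro exI[of _ r]) auto
  qed (use D(2) meas in auto)
  then show "isCont (\<lambda>(t, x). LINT y|lborel. f y *\<^sub>R k t x y) (t0, x0)"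
    by (simp add: isCont_def case_prod_beta')
qed

lemma pair_tendsto: "((\<lambda>p. fst p) \<longlongrightarrow> t) (at (t, x))" "((\<lambda>p. snd p) \<longlongrightarrow> x) (at (t, x))"
  by (auto intro!: tendsto_eq_intros)

lemma G_continuous_interior: "continuous_on ({s<..} \<times> UNIV) (\<lambda>(t, x). G t s f x)"
proof -
  have "continuous_on ({s<..} \<times> UNIV) (\<lambda>(t, x). LINT y|lborel. f y *\<^sub>R kap s t x y)"
  proof (rule kernel_integral_continuous)
    fix t0 x0 assume "s < t0"
    then show "\<exists>r>0. \<exists>D. integrable lborel D \<and> (\<forall>t x y. \<bar>t - t0\<bar> \<le> r \<longrightarrow> norm (x - x0) \<le> r \<longrightarrow> norm (kap s t x y) \<le> D y)"
      by (rule kernel_local_bound[where ?x0.0 = x0]) blast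
  qed (auto intro: kap_tendsto pair_tendsto)
  then show ?thesis
    by (rule continuous_on_eq) (auto simp: G_eq_kernel)
qed

lemma G_C12: "C12_after s (\<lambda>t. G t s f)"
proof -
  have "continuous_on ({s<..} \<times> UNIV) (\<lambda>(t, x). LINT y|lborel. f y *\<^sub>R (kap s t x y * kt s t x y))"
  proof (rule kernel_integral_continuous)
    fix t0 x0 assume "s < t0"
    then show "\<exists>r>0. \<exists>D. integrable lborel D \<and> (\<forall>t x y. \<bar>t - t0\<bar> \<le> r \<longrightarrow> norm (x - x0) \<le> r \<longrightarrow> norm (kap s t x y * kt s t x y) \<le> D y)"
      by (rule kernel_local_bound[where ?x0.0 = x0]) blast
  qed (auto intro!: kap_tendsto kt_tendsto pair_tendsto tendsto_mult)
  then have c1: "continuous_on ({s<..} \<times> UNIV) (\<lambda>(t, x). deriv (\<lambda>\<tau>. G \<tau> s f x) t)"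
    by (rule continuous_on_eq) (auto simp: DERIV_imp_deriv[OF G_deriv_t])
  have "continuous_on ({s<..} \<times> UNIV) (\<lambda>(t, x). LINT y|lborel. f y *\<^sub>R (kap s t x y *\<^sub>R ww s t x y))"
  proof (rule kernel_integral_continuous)
    fix t0 x0 assume "s < t0"
    then show "\<exists>r>0. \<exists>D. integrable lborel D \<and> (\<forall>t x y. \<bar>t - t0\<bar> \<le> r \<longrightarrow> norm (x - x0) \<le> r \<longrightarrow> norm (kap s t x y *\<^sub>R ww s t x y) \<le> D y)"
      by (rule kernel_local_bound[where ?x0.0 = x0]) blast
  qed (auto intro!: kap_tendsto ww_tendsto pair_tendsto tendsto_scaleR)
  then have c2: "continuous_on ({s<..} \<times> UNIV) (\<lambda>(t, x). grad (G t s f) x)"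
    by (rule continuous_on_eq) (auto simp: grad_G Gx_def)
  have GHc: "continuous_on ({s<..} \<times> UNIV) (\<lambda>p. GH (fst p) (snd p) h)" for h
  proof -
    have "continuous_on ({s<..} \<times> UNIV) (\<lambda>(t, x). LINT y|lborel. f y *\<^sub>R (kap s t x y *\<^sub>R wH s t x y h))"
    proof (rule kernel_integral_continuous)
      fix t0 x0 assume "s < t0"
      then show "\<exists>r>0. \<exists>D. integrable lborel D \<and> (\<forall>t x y. \<bar>t - t0\<bar> \<le> r \<longrightarrow> norm (x - x0) \<le> r \<longrightarrow> norm (kap s t x y *\<^sub>R wH s t x y h) \<le> D y)"
      proof (rule kernel_local_bound[where ?x0.0 = x0])
        fix r D assume r: "r > 0" and D: "integrable lborel D"
          and b: "\<And>t x y h. \<bar>t - t0\<bar> \<le> r \<Longrightarrow> norm (x - x0) \<le> r \<Longrightarrow> norm (kap s t x y *\<^sub>R wH s t x y h) \<le> D y * norm h"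
        have "integrable lborel (\<lambda>y. D y * norm h)" using D by auto
        with r b show ?thesis by blast
      qed
    qed (auto intro!: kap_tendsto wH_tendsto pair_tendsto tendsto_scaleR)
    then show ?thesis by (simp add: GH_def case_prod_beta')
  qed
  have "continuous_on ({s<..} \<times> UNIV) (\<lambda>p. matrix (GH (fst p) (snd p)))"
    unfolding matrix_def by (intro continuous_on_vec_lambda continuous_on_component GHc)
  then have c3: "continuous_on ({s<..} \<times> UNIV) (\<lambda>(t, x). hessian (G t s f) x)"
    by (rule continuous_on_eq) (auto simp: hessian_G)
  have d: "(\<lambda>\<tau>. G \<tau> s f x) differentiable (at t) \<and> G t s f differentiable (at x) \<and> grad (G t s f) differentiable (at x)" if "s < t" for t x
    using G_deriv_t[OF that] G_deriv_x[OF that] Gx_deriv_x[OF that]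
    unfolding grad_G[OF that] by (auto simp: differentiable_def has_field_derivative_def)
  show ?thesis unfolding C12_after_def using c1 c2 c3 d by blast
qed

text \<open>\<open>Sf s t\<close> is picked separately for each t, so it need not be continuous in
  t. At the initial time only its smallness matters, and that is inherited from
  \<open>Qf s t\<close>.\<close>

lemma Sf_vec_bound: "\<exists>K\<ge>0. \<forall>t\<ge>s. \<forall>z. norm (Sf s t *v z) \<le> sqrt (K * norm (Qf s t)) * norm z"
proof -
  obtain K where K: "K > 0" "\<And>(M::real^'n^'n) x. norm (M *v x) \<le> norm M * norm x * K"
    using bounded_bilinear.pos_bounded[OF bounded_bilinear_mat_vec] by blast
  have "norm (Sf s t *v z) \<le> sqrt (K * norm (Qf s t)) * norm z" if "t \<ge> s" for t z
  proof -
    have q: "(Qf s t *v v) \<bullet> v \<le> (K * norm (Qf s t)) * (norm v)\<^sup>2" for v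
    proof -
      have "(Qf s t *v v) \<bullet> v \<le> norm (Qf s t *v v) * norm v" by (rule norm_cauchy_schwarz)
      also have "\<dots> \<le> (norm (Qf s t) * norm v * K) * norm v" by (intro mult_right_mono K(2)) auto
      finally show ?thesis by (simp add: power2_eq_square ac_simps)
    qed
    have "opn (Sf s t) \<le> sqrt (K * norm (Qf s t))"
      by (rule opn_factor_le[OF Sf_square[OF that] _ q]) (use K in auto)
    then show ?thesis using norm_mat_vec_le[of "Sf s t" z] by (meson mult_right_mono norm_ge_zero order_trans)
  qed
  then show ?thesis using K(1) by (intro exI[of _ K]) auto
qed

lemma mm_self: "mm s s x = x" by (simp add: mm_def U_id gf_self)
lemma G_self: "G s s f x = f x"
  by (simp add: G_def mm_self Sf_def)

lemma G_bounded: "\<exists>F. \<forall>t x. \<bar>G t s f x\<bar> \<le> F"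
proof -
  obtain F where F: "F \<ge> 0" "\<And>x. \<bar>f x\<bar> \<le> F" using C_bD(3)[OF f] by blast
  have "\<bar>G t s f x\<bar> \<le> F" for t x
  proof -
    have "integrable stdg (\<lambda>z. f (mm s t x + Sf s t *v z))"
      by (rule stdg.integrable_const_bound[where B = F]) (use F in auto)
    then have "\<bar>G t s f x\<bar> \<le> (LINT z|stdg. \<bar>f (mm s t x + Sf s t *v z)\<bar>)" unfolding G_def by simp
    also have "\<dots> \<le> F" using F
      by (intro stdg.integral_le_const AE_I2 integrable_abs \<open>integrable _ _\<close>) auto
    finally show ?thesis .
  qed
  then show ?thesis by blast
qed

text \<open>For t > s continuity comes from the kernel. At t = s the kernel has no density, so the
  integral over \<open>stdg\<close> is used: its integrand tends to f(x0) pointwise and is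
  bounded.\<close>

lemma G_continuous: "continuous_on ({s..} \<times> UNIV) (\<lambda>(t, x). G t s f x)"
  unfolding continuous_on_eq_continuous_within
proof safe
  fix t0 and x0 :: "real^'n" assume t0: "s \<le> t0"
  show "continuous (at (t0, x0) within {s..} \<times> UNIV) (\<lambda>(t, x). G t s f x)"
  proof (cases "t0 = s")
    case False
    then have "(t0, x0) \<in> {s<..} \<times> UNIV" using t0 by simp
    moreover have "open ({s<..} \<times> (UNIV :: (real^'n) set))" by (intro open_Times) auto
    ultimately have "isCont (\<lambda>(t, x). G t s f x) (t0, x0)"
      using G_continuous_interior continuous_on_eq_continuous_at by blast
    then show ?thesis by (rule continuous_at_imp_continuous_within)
  next
    case True
    obtain F where F: "F \<ge> 0" "\<And>x. \<bar>f x\<bar> \<le> F" using C_bD(3)[OF f] by blast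
    obtain K where K: "K \<ge> 0" "\<And>t z. t \<ge> s \<Longrightarrow> norm (Sf s t *v z) \<le> sqrt (K * norm (Qf s t)) * norm z"
      using Sf_vec_bound by blast
    let ?S = "{s..} \<times> (UNIV :: (real^'n) set)"
    let ?L = "at (s, x0) within ?S"
    have inS: "\<forall>\<^sub>F p in ?L. fst p \<ge> s" by (auto simp: eventually_at_filter intro!: always_eventually)
    have T: "(fst \<longlongrightarrow> s) ?L" and X: "(snd \<longlongrightarrow> x0) ?L" by (auto intro!: tendsto_eq_intros)
    have Q0: "((\<lambda>p. Qf s (fst p)) \<longlongrightarrow> 0) ?L"
      using continuous_on_tendsto_compose[OF Qf_continuous[of s] T] inS by (simp add: Qf_self)
    have g0: "((\<lambda>p. gf s (fst p)) \<longlongrightarrow> 0) ?L"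
      using continuous_on_tendsto_compose[OF gf_continuous[of s] T] inS by (simp add: gf_self)
    have U0: "((\<lambda>p. U s (fst p)) \<longlongrightarrow> mat 1) ?L"
      using isCont_tendsto_compose[OF isCont_U[of s s] T] by (simp add: U_id)
    have m0: "((\<lambda>p. mm s (fst p) (snd p)) \<longlongrightarrow> x0) ?L"
      using tendsto_add[OF bounded_bilinear.tendsto[OF bounded_bilinear_mat_vec U0 X] g0] by (simp add: mm_def)
    have S0: "((\<lambda>p. Sf s (fst p) *v z) \<longlongrightarrow> 0) ?L" for z
    proof (rule Lim_null_comparison)
      show "\<forall>\<^sub>F p in ?L. norm (Sf s (fst p) *v z) \<le> sqrt (K * norm (Qf s (fst p))) * norm z"
        using inS by eventually_elim (rule K(2))
      have "((\<lambda>p. sqrt (K * norm (Qf s (fst p))) * norm z) \<longlongrightarrow> sqrt (K * norm (0::real^'n^'n)) * norm z) ?L"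
        by (intro tendsto_intros Q0)
      then show "((\<lambda>p. sqrt (K * norm (Qf s (fst p))) * norm z) \<longlongrightarrow> 0) ?L" by simp
    qed
    have fc: "isCont f x" for x using C_bD(2)[OF f] by (simp add: continuous_on_eq_continuous_at)
    have "((\<lambda>p. LINT z|stdg. f (mm s (fst p) (snd p) + Sf s (fst p) *v z)) \<longlongrightarrow> (LINT z|(stdg :: (real^'n) measure). f x0)) ?L"
    proof (rule parametric_integral_tendsto[where D = "\<lambda>_. F"])
      fix z
      have "((\<lambda>p. mm s (fst p) (snd p) + Sf s (fst p) *v z) \<longlongrightarrow> x0 + 0) ?L" by (intro tendsto_intros m0 S0)
      then show "((\<lambda>p. f (mm s (fst p) (snd p) + Sf s (fst p) *v z)) \<longlongrightarrow> f x0) ?L"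
        using isCont_tendsto_compose[OF fc] by simp
    qed (use F in auto)
    moreover have "(LINT z|(stdg :: (real^'n) measure). f x0) = G s s f x0"
    by (simp add: G_self)
    ultimately show ?thesis using True by (simp add: continuous_within case_prod_beta' G_def)
  qed
qed

theorem G_classical_solution: "bounded_classical_solution A B g s f (\<lambda>t. G t s f)"
proof -
  have "bounded ((\<lambda>(t, x). G t s f x) ` ({s..} \<times> UNIV))"
    using G_bounded by (auto simp: bounded_iff)
  then show ?thesis
    unfolding bounded_classical_solution_def using G_continuous G_C12 G_PDE G_self by blast
qed

lemma evol_eq_G: "s \<le> t \<Longrightarrow> evol A B g t s f = G t s f"
  by (rule evol_eqI[OF G_classical_solution])

end

end

section \<open>Integrals of powers\<close>

text \<open>A substitute for Minkowski's inequality: |a + b| is at most twice the larger norm. Each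
  splitting of a function below costs a factor 2^p.\<close>

lemma powr_norm_add_le:
  fixes a b :: "'a::real_normed_vector"
  assumes "p \<ge> 0"
  shows "norm (a + b) powr p \<le> 2 powr p * (norm a powr p + norm b powr p)"
proof -
  have "norm (a + b) \<le> 2 * max (norm a) (norm b)" using norm_triangle_ineq[of a b] by linarith
  then have "norm (a + b) powr p \<le> (2 * max (norm a) (norm b)) powr p" using assms by (intro powr_mono2) auto
  also have "\<dots> = 2 powr p * max (norm a) (norm b) powr p" by (simp add: powr_mult)
  also have "max (norm a) (norm b) powr p \<le> norm a powr p + norm b powr p" by (simp add: max_def)
  finally show ?thesis by simp
qed

lemma nn_integral_powr_add_le:
  fixes u v :: "'a \<Rightarrow> 'b::euclidean_space"
  assumes "p \<ge> 0" and [measurable]: "u \<in> borel_measurable M" "v \<in> borel_measurable M"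
  shows "(\<integral>\<^sup>+x. ennreal (norm (u x + v x) powr p) \<partial>M)
    \<le> ennreal (2 powr p) * ((\<integral>\<^sup>+x. ennreal (norm (u x) powr p) \<partial>M) + (\<integral>\<^sup>+x. ennreal (norm (v x) powr p) \<partial>M))"
proof -
  have "(\<integral>\<^sup>+x. ennreal (norm (u x + v x) powr p) \<partial>M)
    \<le> (\<integral>\<^sup>+x. ennreal (2 powr p) * (ennreal (norm (u x) powr p) + ennreal (norm (v x) powr p)) \<partial>M)"
  proof (rule nn_integral_mono)
    fix x
    have "ennreal (norm (u x + v x) powr p) \<le> ennreal (2 powr p * (norm (u x) powr p + norm (v x) powr p))"
      by (rule ennreal_leI[OF powr_norm_add_le[OF assms(1)]])
    then show "ennreal (norm (u x + v x) powr p) \<le> ennreal (2 powr p) * (ennreal (norm (u x) powr p) + ennreal (norm (v x) powr p))"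
      by (simp add: ennreal_mult)
  qed
  then show ?thesis by (simp add: nn_integral_cmult nn_integral_add)
qed

lemma conjugate_exponent:
  fixes p q :: real
  assumes "p > 1" "q = p / (p - 1)"
  shows "q > 1" "1 / p + 1 / q = 1" "p + q = p * q"
proof -
  have p1: "p - 1 > 0" using assms by simp
  show "q > 1" using p1 assms by (simp add: less_divide_eq)
  have "1 / q = (p - 1) / p" using assms(2) by simp
  then show "1 / p + 1 / q = 1" using assms(1) by (simp add: diff_divide_distrib)
  have "q * (p - 1) = p" using p1 assms(2) by simp
  then show "p + q = p * q" by (simp add: algebra_simps)
qed

text \<open>Young's inequality with the factors 1/p and 1/q bounded by 1.\<close>

lemma product_le_powr_sum:
  fixes a b :: real
  assumes "p > 1" "q = p / (p - 1)" "a \<ge> 0" "b \<ge> 0"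
  shows "a * b \<le> a powr p + b powr q"
proof -
  note pq = conjugate_exponent[OF assms(1,2)]
  have "a * b \<le> a powr p / p + b powr q / q"
    by (rule Youngs_inequality) (use assms pq in auto)
  also have "\<dots> \<le> a powr p + b powr q"
  proof (rule add_mono)
    show "a powr p / p \<le> a powr p" using assms(1) mult_left_mono[of 1 p "a powr p"] by (simp add: divide_le_eq)
    show "b powr q / q \<le> b powr q" using pq(1) mult_left_mono[of 1 q "b powr q"] by (simp add: divide_le_eq)
  qed
  finally show ?thesis .
qed

text \<open>The crude constant \<open>1 + K\<close> comes from rescaling \<open>a b \<le> a\<^sup>p + b\<^sup>q\<close>.\<close>

lemma weighted_integral_powr_le:
  fixes h w :: "'a \<Rightarrow> real"
  assumes p: "p > 1" "q = p / (p - 1)" and [measurable]: "h \<in> borel_measurable M" "w \<in> borel_measurable M"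
    and w: "\<And>x. w x \<ge> 0" "integrable M (\<lambda>x. w x powr q)" "(LINT x|M. w x powr q) \<le> K"
  shows "(\<integral>\<^sup>+x. ennreal (\<bar>h x\<bar> powr p) \<partial>M) < \<infinity> \<Longrightarrow> integrable M (\<lambda>x. h x * w x)"
    "ennreal ((LINT x|M. \<bar>h x\<bar> * w x) powr p) \<le> ennreal ((1 + K) powr p) * (\<integral>\<^sup>+x. ennreal (\<bar>h x\<bar> powr p) \<partial>M)"
proof -
  note pq = conjugate_exponent[OF p]
  have "0 \<le> (LINT x|M. w x powr q)" by (intro Bochner_Integration.integral_nonneg) auto
  then have K0: "K \<ge> 0" using w(3) by linarith
  let ?X = "\<integral>\<^sup>+x. ennreal (\<bar>h x\<bar> powr p) \<partial>M"
  have young: "\<bar>h x\<bar> * w x \<le> \<bar>h x\<bar> powr p + w x powr q" for x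
    by (rule product_le_powr_sum[OF p]) (use w in auto)
  have fin: "integrable M (\<lambda>x. \<bar>h x\<bar> powr p)" if "?X < \<infinity>"
    using that by (intro integrableI_bounded) auto
  have int: "integrable M (\<lambda>x. \<bar>h x\<bar> * w x)" if X: "?X < \<infinity>"
  proof (rule Bochner_Integration.integrable_bound)
    show "integrable M (\<lambda>x. \<bar>h x\<bar> powr p + w x powr q)" using fin[OF X] w(2) by auto
    show "AE x in M. norm (\<bar>h x\<bar> * w x) \<le> norm (\<bar>h x\<bar> powr p + w x powr q)"
      using young w(1) by (auto simp: abs_mult)
  qed auto
  show "integrable M (\<lambda>x. h x * w x)" if "?X < \<infinity>"
    using int[OF that] by (rule Bochner_Integration.integrable_bound) (use w(1) in \<open>auto simp: abs_mult\<close>)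
  show "ennreal ((LINT x|M. \<bar>h x\<bar> * w x) powr p) \<le> ennreal ((1 + K) powr p) * ?X"
  proof (cases "?X < \<infinity>")
    case False
    then have "?X = \<top>" by (simp add: less_top[symmetric])
    moreover have "(1 + K) powr p > 0" using K0 by simp
    ultimately show ?thesis by (simp add: ennreal_mult_top)
  next
    case True
    define X where "X = (LINT x|M. \<bar>h x\<bar> powr p)"
    have X0: "X \<ge> 0" by (simp add: X_def)
    have eX: "?X = ennreal X" unfolding X_def by (rule nn_integral_eq_integral[OF fin[OF True]]) auto
    have "(LINT x|M. \<bar>h x\<bar> * w x) powr p \<le> (1 + K) powr p * X"
    proof (cases "X = 0")
      case X: True
      have "AE x in M. \<bar>h x\<bar> powr p = 0"
        using integral_nonneg_eq_0_iff_AE[OF fin[OF True]] X by (simp add: X_def)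
      then have "AE x in M. \<bar>h x\<bar> * w x = 0" by eventually_elim simp
      then have "(LINT x|M. \<bar>h x\<bar> * w x) = (LINT x|M. 0)" by (intro integral_cong_AE) auto
      then show ?thesis using X p by simp
    next
      case False
      then have Xp: "X > 0" using X0 by simp
      \<comment> \<open>This scale balances the two terms of Young's inequality: c^{-p} X and c^q
        both equal X^{1/p}.\<close>
      define c where "c = X powr (1 / (p * q))"
      have c: "c > 0" using Xp by (simp add: c_def)
      have cq: "c powr q = X powr (1 / p)" using pq p by (simp add: c_def powr_powr)
      have cp: "c powr (- p) * X = X powr (1 / p)"
      proof -
        have "1 / (p * q) * (- p) = - 1 / q" using p(1) by simp
        then have "c powr (- p) = X powr (- 1 / q)" by (simp only: c_def powr_powr)
        moreover have "X powr (- 1 / q) * X = X powr (- 1 / q + 1)" using powr_add[of X "- 1 / q" 1] Xp by simp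
        moreover have "- 1 / q + 1 = 1 / p" using pq(2) by simp
        ultimately show ?thesis by simp
      qed
      have pt: "\<bar>h x\<bar> * w x \<le> c powr (- p) * \<bar>h x\<bar> powr p + c powr q * w x powr q" for x
      proof -
        have "\<bar>h x\<bar> * w x = (\<bar>h x\<bar> / c) * (c * w x)" using c by simp
        also have "\<dots> \<le> (\<bar>h x\<bar> / c) powr p + (c * w x) powr q"
          by (rule product_le_powr_sum[OF p]) (use c w(1) in auto)
        also have "\<dots> = c powr (- p) * \<bar>h x\<bar> powr p + c powr q * w x powr q"
          using c w(1)[of x] by (simp add: powr_divide powr_mult powr_minus_divide)
        finally show ?thesis .
      qed
      have "(LINT x|M. \<bar>h x\<bar> * w x) \<le> (LINT x|M. c powr (- p) * \<bar>h x\<bar> powr p + c powr q * w x powr q)"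
        by (rule integral_mono[OF int[OF True] _ pt]) (use fin[OF True] w(2) in auto)
      also have "\<dots> = c powr (- p) * X + c powr q * (LINT x|M. w x powr q)"
        using fin[OF True] w(2) by (simp add: X_def)
      also have "\<dots> \<le> c powr (- p) * X + c powr q * K" using w(3) by (intro add_left_mono mult_left_mono) auto
      also have "\<dots> = (1 + K) * X powr (1 / p)" unfolding cp cq by (simp add: algebra_simps)
      finally have "(LINT x|M. \<bar>h x\<bar> * w x) powr p \<le> ((1 + K) * X powr (1 / p)) powr p"
        using p w(1) by (intro powr_mono2 Bochner_Integration.integral_nonneg) auto
      also have "\<dots> = (1 + K) powr p * X" using K0 Xp p by (simp add: powr_mult powr_powr)
      finally show ?thesis .
    qed
    then show ?thesis unfolding eX using X0 by (simp add: ennreal_mult[symmetric])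
  qed
qed

text \<open>The weight 1 turns the weighted estimate into a crude Jensen inequality; for a
  probability measure the constant is 2^p.\<close>

lemma (in finite_measure) integral_powr_le:
  fixes h :: "'a \<Rightarrow> real"
  assumes p: "p > 1" and h[measurable]: "h \<in> borel_measurable M"
  shows "(\<integral>\<^sup>+x. ennreal (\<bar>h x\<bar> powr p) \<partial>M) < \<infinity> \<Longrightarrow> integrable M h"
    "ennreal (\<bar>LINT x|M. h x\<bar> powr p) \<le> ennreal ((1 + measure M (space M)) powr p) * (\<integral>\<^sup>+x. ennreal (\<bar>h x\<bar> powr p) \<partial>M)"
proof -
  have K: "(LINT x|M. 1 powr (p / (p - 1))) \<le> measure M (space M)" by simp
  note H = weighted_integral_powr_le[OF p refl h, of "\<lambda>_. 1", OF _ _ _ K]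
  show "(\<integral>\<^sup>+x. ennreal (\<bar>h x\<bar> powr p) \<partial>M) < \<infinity> \<Longrightarrow> integrable M h" using H(1) by simp
  have "\<bar>LINT x|M. h x\<bar> \<le> (LINT x|M. \<bar>h x\<bar>)" by (rule integral_abs_bound)
  then have "\<bar>LINT x|M. h x\<bar> powr p \<le> (LINT x|M. \<bar>h x\<bar>) powr p" using p by (intro powr_mono2) auto
  then have "ennreal (\<bar>LINT x|M. h x\<bar> powr p) \<le> ennreal ((LINT x|M. \<bar>h x\<bar>) powr p)" by (rule ennreal_leI)
  also have "\<dots> \<le> ennreal ((1 + measure M (space M)) powr p) * (\<integral>\<^sup>+x. ennreal (\<bar>h x\<bar> powr p) \<partial>M)" using H(2) by simp
  finally show "ennreal (\<bar>LINT x|M. h x\<bar> powr p) \<le> ennreal ((1 + measure M (space M)) powr p) * (\<integral>\<^sup>+x. ennreal (\<bar>h x\<bar> powr p) \<partial>M)" .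
qed

lemma Lp_iff_nn_integral:
  fixes f :: "'a \<Rightarrow> 'b::euclidean_space"
  shows "f \<in> Lp p M \<longleftrightarrow> f \<in> borel_measurable M \<and> (\<integral>\<^sup>+x. ennreal (norm (f x) powr p) \<partial>M) < \<infinity>"
proof -
  have "integrable M (\<lambda>x. norm (f x) powr p) \<longleftrightarrow> (\<integral>\<^sup>+x. ennreal (norm (f x) powr p) \<partial>M) < \<infinity>"
    if [measurable]: "f \<in> borel_measurable M" by (simp add: integrable_iff_bounded)
  then show ?thesis by (auto simp: Lp_def)
qed

lemma Lp_norm_nonneg: "0 \<le> Lp_norm p M f" by (simp add: Lp_norm_def)

lemma Lp_norm_powr:
  assumes "f \<in> Lp p M" "p > 0"
  shows "ennreal (Lp_norm p M f powr p) = (\<integral>\<^sup>+x. ennreal (norm (f x) powr p) \<partial>M)"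
proof -
  have i: "integrable M (\<lambda>x. norm (f x) powr p)" using assms by (simp add: Lp_def)
  have "Lp_norm p M f powr p = (LINT x|M. norm (f x) powr p)"
    using assms(2) by (simp add: Lp_norm_def powr_powr)
  then show ?thesis using nn_integral_eq_integral[OF i] by simp
qed

text \<open>The estimates below are inequalities between nonnegative integrals, meaningful also when
  infinite. This converts them into membership in \<open>Lp\<close> and a bound on
  \<open>Lp_norm\<close>.\<close>

lemma Lp_norm_leI:
  fixes a :: "'a \<Rightarrow> 'c::euclidean_space" and b :: "'b \<Rightarrow> 'd::euclidean_space"
  assumes a: "a \<in> borel_measurable M" and b: "b \<in> Lp p N" and p: "p > 0" and C: "C \<ge> 0"
    and le: "(\<integral>\<^sup>+x. ennreal (norm (a x) powr p) \<partial>M) \<le> ennreal (C powr p) * (\<integral>\<^sup>+x. ennreal (norm (b x) powr p) \<partial>N)"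
  shows "a \<in> Lp p M" "Lp_norm p M a \<le> C * Lp_norm p N b"
proof -
  have e: "ennreal (C powr p) * (\<integral>\<^sup>+x. ennreal (norm (b x) powr p) \<partial>N) = ennreal ((C * Lp_norm p N b) powr p)"
    unfolding Lp_norm_powr[OF b p, symmetric] using C by (simp add: powr_mult Lp_norm_nonneg ennreal_mult)
  have "(\<integral>\<^sup>+x. ennreal (norm (a x) powr p) \<partial>M) < \<infinity>" using le unfolding e by (rule le_less_trans) simp
  then show aL: "a \<in> Lp p M" using a by (simp add: Lp_iff_nn_integral)
  have "Lp_norm p M a powr p \<le> (C * Lp_norm p N b) powr p"
    using le unfolding e Lp_norm_powr[OF aL p, symmetric] by (simp add: ennreal_le_iff)
  then show "Lp_norm p M a \<le> C * Lp_norm p N b"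
    using powr_mono2[of "1 / p" "Lp_norm p M a powr p" "(C * Lp_norm p N b) powr p"] p C
    by (simp add: powr_powr Lp_norm_nonneg)
qed

lemma Lp_norm_tendsto_0:
  fixes u :: "nat \<Rightarrow> 'a \<Rightarrow> 'b::euclidean_space"
  assumes u: "\<And>k. u k \<in> Lp p M" and p: "p > 0"
  shows "(\<lambda>k. Lp_norm p M (u k)) \<longlonglongrightarrow> 0 \<longleftrightarrow> (\<lambda>k. \<integral>\<^sup>+x. ennreal (norm (u k x) powr p) \<partial>M) \<longlonglongrightarrow> 0"
proof -
  have "(\<lambda>k. Lp_norm p M (u k)) \<longlonglongrightarrow> 0 \<longleftrightarrow> (\<lambda>k. Lp_norm p M (u k) powr p) \<longlonglongrightarrow> 0"
  proof
    assume L: "(\<lambda>k. Lp_norm p M (u k)) \<longlonglongrightarrow> 0"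
    show "(\<lambda>k. Lp_norm p M (u k) powr p) \<longlonglongrightarrow> 0"
      using tendsto_zero_powrI[OF L tendsto_const _ p] by (simp add: Lp_norm_nonneg)
  next
    assume L: "(\<lambda>k. Lp_norm p M (u k) powr p) \<longlonglongrightarrow> 0"
    have "(\<lambda>k. (Lp_norm p M (u k) powr p) powr (1 / p)) \<longlonglongrightarrow> 0"
      using p by (intro tendsto_zero_powrI[OF L tendsto_const]) auto
    then show "(\<lambda>k. Lp_norm p M (u k)) \<longlonglongrightarrow> 0" using p by (simp add: powr_powr Lp_norm_nonneg)
  qed
  also have "\<dots> \<longleftrightarrow> (\<lambda>k. ennreal (Lp_norm p M (u k) powr p)) \<longlonglongrightarrow> ennreal 0"
    by (subst tendsto_ennreal_iff) (auto intro: always_eventually)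
  finally show ?thesis by (simp only: Lp_norm_powr[OF u p] ennreal_0)
qed

subsection \<open>Density of the bounded continuous functions\<close>

lemma tendsto_nn_integral_powr_dominated:
  fixes u :: "nat \<Rightarrow> 'a \<Rightarrow> real"
  assumes p: "p > 0" and [measurable]: "\<And>n. u n \<in> borel_measurable M" and w: "integrable M w"
    and b: "\<And>n x. \<bar>u n x\<bar> powr p \<le> w x" and lim: "AE x in M. (\<lambda>n. u n x) \<longlonglongrightarrow> 0"
  shows "(\<lambda>n. \<integral>\<^sup>+x. ennreal (\<bar>u n x\<bar> powr p) \<partial>M) \<longlonglongrightarrow> 0"
proof -
  have "AE x in M. (\<lambda>n. \<bar>u n x\<bar> powr p) \<longlonglongrightarrow> 0"
    using lim
  proof eventually_elim
    case (elim x)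
    then have "(\<lambda>n. \<bar>u n x\<bar>) \<longlonglongrightarrow> 0" by (rule tendsto_rabs_zero)
    then show ?case using p by (intro tendsto_zero_powrI[OF _ tendsto_const]) auto
  qed
  then have L: "(\<lambda>n. LINT x|M. \<bar>u n x\<bar> powr p) \<longlonglongrightarrow> (LINT x|M. 0)"
    by (intro integral_dominated_convergence[where w = w]) (use w b in auto)
  have i: "integrable M (\<lambda>x. \<bar>u n x\<bar> powr p)" for n
    by (rule Bochner_Integration.integrable_bound[OF w]) (use b order_trans[OF b abs_ge_self] in auto)
  have "(\<lambda>n. ennreal (LINT x|M. \<bar>u n x\<bar> powr p)) \<longlonglongrightarrow> ennreal 0"
    using L by (intro tendsto_ennrealI) simp
  then show ?thesis by (simp add: nn_integral_eq_integral[OF i])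
qed

text \<open>First \<open>f\<close> is truncated to [-N, N]; then continuous functions converging to
  \<open>f\<close> almost everywhere are truncated in the same way, which keeps the second error
  dominated by a constant.\<close>

lemma C_b_dense_Lp:
  fixes f :: "real^'n \<Rightarrow> real"
  assumes M: "M = density lborel (\<lambda>x. ennreal (\<rho> x))" and [measurable]: "\<rho> \<in> borel_measurable borel"
    and fin: "finite_measure M" and f: "f \<in> Lp p M" and p: "p > 0" and e: "e > 0"
  shows "\<exists>\<phi>\<in>C_b. (\<integral>\<^sup>+x. ennreal (\<bar>\<phi> x - f x\<bar> powr p) \<partial>M) < ennreal e"
proof -
  interpret finite_measure M by (rule fin)
  have sM[measurable_cong]: "sets M = sets borel" by (simp add: M)
  have fm[measurable]: "f \<in> borel_measurable borel" using f by (simp add: Lp_def measurable_cong_sets[OF sM refl])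
  have fi: "integrable M (\<lambda>x. \<bar>f x\<bar> powr p)" using f by (simp add: Lp_def)
  define cl where "cl N y = max (- real N) (min (real N) y)" for N :: nat and y :: real
  have cl_le: "\<bar>cl N y\<bar> \<le> real N" for N y by (auto simp: cl_def)
  have cl_diff: "\<bar>cl N y - y\<bar> \<le> \<bar>y\<bar>" for N y by (auto simp: cl_def)
  have [measurable]: "cl N \<in> borel_measurable borel" for N unfolding cl_def by measurable
  \<comment> \<open>Two errors of this size, combined at the cost of the factor 2^p, add up to
    e.\<close>
  let ?e = "e / (2 * 2 powr p)"
  have e': "?e > 0" using e by simp
  have "(\<lambda>N. \<integral>\<^sup>+x. ennreal (\<bar>cl N (f x) - f x\<bar> powr p) \<partial>M) \<longlonglongrightarrow> 0"
  proof (rule tendsto_nn_integral_powr_dominated[OF p _ fi])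
    show "\<bar>cl n (f x) - f x\<bar> powr p \<le> \<bar>f x\<bar> powr p" for n x using p by (intro powr_mono2 cl_diff) auto
    have "(\<lambda>n. cl n (f x) - f x) \<longlonglongrightarrow> 0" for x
    proof (rule tendsto_eventually)
      obtain N where N: "\<bar>f x\<bar> \<le> real N" using real_arch_simple by blast
      show "\<forall>\<^sub>F n in sequentially. cl n (f x) - f x = 0"
        using eventually_ge_at_top[of N]
      proof eventually_elim
        case (elim n)
        then have "\<bar>f x\<bar> \<le> real n" using N by simp
        then show ?case by (auto simp: cl_def)
      qed
    qed
    then show "AE x in M. (\<lambda>n. cl n (f x) - f x) \<longlonglongrightarrow> 0" by simp
  qed measurable
  then have "\<forall>\<^sub>F N in sequentially. (\<integral>\<^sup>+x. ennreal (\<bar>cl N (f x) - f x\<bar> powr p) \<partial>M) < ennreal ?e"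
    using e' by (intro order_tendstoD(2)) auto
  then obtain N where N: "(\<integral>\<^sup>+x. ennreal (\<bar>cl N (f x) - f x\<bar> powr p) \<partial>M) < ennreal ?e"
    by (auto simp: eventually_sequentially)
  \<comment> \<open>This notion of measurability supplies continuous functions converging to
    \<open>f\<close> off a negligible set, which is also null for \<open>M\<close> since
    \<open>M\<close> has a density.\<close>
  have "f measurable_on UNIV"
    using measurable_on_iff_borel_measurable[of UNIV f] fm by (simp add: lebesgue_on_UNIV_eq measurable_completion)
  then obtain Z \<psi> where Z: "negligible Z" and \<psi>: "\<And>n. continuous_on UNIV (\<psi> n)"
    and lim: "\<And>x. x \<notin> Z \<Longrightarrow> (\<lambda>n. \<psi> n x) \<longlonglongrightarrow> f x"
    by (auto simp: measurable_on_def)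
  have \<psi>m[measurable]: "\<psi> n \<in> borel_measurable borel" for n by (rule borel_measurable_continuous_onI[OF \<psi>])
  have "AE x in lebesgue. x \<notin> Z" using Z by (simp add: negligible_iff_null_sets AE_not_in)
  then have "AE x in lborel. x \<notin> Z" by (simp add: AE_completion_iff)
  then have AEZ: "AE x in M. x \<notin> Z" unfolding M by (subst AE_density) auto
  have cont_cl: "isCont (cl N) y" for y unfolding cl_def by (intro continuous_intros)
  have "(\<lambda>n. \<integral>\<^sup>+x. ennreal (\<bar>cl N (\<psi> n x) - cl N (f x)\<bar> powr p) \<partial>M) \<longlonglongrightarrow> 0"
  proof (rule tendsto_nn_integral_powr_dominated[OF p, where w = "\<lambda>_. (2 * real N) powr p"])
    show "\<bar>cl N (\<psi> n x) - cl N (f x)\<bar> powr p \<le> (2 * real N) powr p" for n x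
      using p cl_le[of N "\<psi> n x"] cl_le[of N "f x"] by (intro powr_mono2) auto
    show "AE x in M. (\<lambda>n. cl N (\<psi> n x) - cl N (f x)) \<longlonglongrightarrow> 0"
      using AEZ
    proof eventually_elim
      case (elim x)
      have "(\<lambda>n. cl N (\<psi> n x)) \<longlonglongrightarrow> cl N (f x)" by (rule isCont_tendsto_compose[OF cont_cl lim[OF elim]])
      then show ?case by (simp add: LIM_zero)
    qed
  qed auto
  then have "\<forall>\<^sub>F n in sequentially. (\<integral>\<^sup>+x. ennreal (\<bar>cl N (\<psi> n x) - cl N (f x)\<bar> powr p) \<partial>M) < ennreal ?e"
    using e' by (intro order_tendstoD(2)) auto
  then obtain n where n: "(\<integral>\<^sup>+x. ennreal (\<bar>cl N (\<psi> n x) - cl N (f x)\<bar> powr p) \<partial>M) < ennreal ?e"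
    by (auto simp: eventually_sequentially)
  let ?\<phi> = "\<lambda>x. cl N (\<psi> n x)"
  have "continuous_on UNIV ?\<phi>" unfolding cl_def using \<psi> by (intro continuous_intros)
  moreover have "bounded (range ?\<phi>)" using cl_le by (auto simp: bounded_iff)
  ultimately have C: "?\<phi> \<in> C_b" by (simp add: C_b_def)
  have "(\<integral>\<^sup>+x. ennreal (\<bar>?\<phi> x - f x\<bar> powr p) \<partial>M) = (\<integral>\<^sup>+x. ennreal (norm ((cl N (\<psi> n x) - cl N (f x)) + (cl N (f x) - f x)) powr p) \<partial>M)"
    by simp
  also have "\<dots> \<le> ennreal (2 powr p) * ((\<integral>\<^sup>+x. ennreal (norm (cl N (\<psi> n x) - cl N (f x)) powr p) \<partial>M) + (\<integral>\<^sup>+x. ennreal (norm (cl N (f x) - f x) powr p) \<partial>M))"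
    using p by (intro nn_integral_powr_add_le) auto
  also have "\<dots> < ennreal (2 powr p) * (ennreal ?e + ennreal ?e)"
    using n N by (intro ennreal_mult_strict_left_mono add_strict_mono) auto
  also have "\<dots> = ennreal e" using e by (simp add: ennreal_plus[symmetric] ennreal_mult[symmetric] del: ennreal_plus)
  finally have lt: "(\<integral>\<^sup>+x. ennreal (\<bar>?\<phi> x - f x\<bar> powr p) \<partial>M) < ennreal e" .
  show ?thesis by (rule bexI[of _ ?\<phi>]) (rule lt, rule C)
qed

subsection \<open>Integration by parts\<close>

text \<open>Differentiate the constant function \<open>p \<mapsto> \<integral> \<psi> (x + p) dx\<close>.\<close>

lemma integral_grad_compact_support:
  fixes \<psi> :: "real^'n \<Rightarrow> real"
  assumes d: "\<And>x. (\<psi> has_derivative (\<lambda>h. \<psi>' x \<bullet> h)) (at x)" and c: "continuous_on UNIV \<psi>'"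
    and K: "\<And>x. norm x > R \<Longrightarrow> \<psi> x = 0" "\<And>x. norm x > R \<Longrightarrow> \<psi>' x = 0"
  shows "integrable lborel \<psi>'" "(LINT x|lborel. \<psi>' x) = 0"
proof -
  have cpsi: "continuous_on UNIV \<psi>"
    by (intro continuous_at_imp_continuous_on ballI has_derivative_continuous[OF d])
  have "bounded (\<psi>' ` cball 0 R)"
    by (intro compact_imp_bounded compact_continuous_image continuous_on_subset[OF c]) auto
  then obtain C where "\<forall>v\<in>\<psi>' ` cball 0 R. norm v \<le> C" unfolding bounded_iff by blast
  then have C: "\<And>x. norm x \<le> R \<Longrightarrow> norm (\<psi>' x) \<le> C" by auto
  have C': "norm (\<psi>' x) \<le> max C 0" for x
    using C[of x] K(2)[of x] by (cases "norm x \<le> R") (auto simp: le_max_iff_disj)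
  have ib: "integrable lborel (\<lambda>x::real^'n. max C 0 * indicator (cball 0 r) x)" for r
    by (intro integrable_mult_right integrable_real_indicator) (use emeasure_lborel_cball_finite in \<open>auto simp: less_top[symmetric]\<close>)
  have [measurable]: "\<psi>' \<in> borel_measurable borel" "\<psi> \<in> borel_measurable borel"
    using c cpsi by (auto intro: borel_measurable_continuous_onI)
  show i: "integrable lborel \<psi>'"
    by (rule Bochner_Integration.integrable_bound[OF ib[of R]]) (use C' K(2) in \<open>auto simp: indicator_def\<close>)
  have ic: "integrable lborel (\<lambda>x. \<psi> (x + q))" for q
  proof -
    have "bounded (\<psi> ` cball 0 R)"
      by (intro compact_imp_bounded compact_continuous_image continuous_on_subset[OF cpsi]) auto
    then obtain D where "\<forall>v\<in>\<psi> ` cball 0 R. norm v \<le> D" unfolding bounded_iff by blast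
    then have D: "\<And>x. norm x \<le> R \<Longrightarrow> \<bar>\<psi> x\<bar> \<le> D" by auto
    have D': "\<bar>\<psi> x\<bar> \<le> max D 0 * indicator (cball 0 R) x" for x
      using D[of x] K(1)[of x] by (auto simp: indicator_def le_max_iff_disj)
    have "integrable lborel (\<lambda>x::real^'n. max D 0 * indicator (cball 0 R) x)"
      by (intro integrable_mult_right integrable_real_indicator) (use emeasure_lborel_cball_finite in \<open>auto simp: less_top[symmetric]\<close>)
    then have "integrable lborel \<psi>"
      by (rule Bochner_Integration.integrable_bound) (use D' order_trans[OF D' abs_ge_self] in auto)
    then have "integrable (distr lborel borel (\<lambda>x. q + x)) \<psi>" by (simp add: lborel_distr_plus)
    then show ?thesis by (subst (asm) integrable_distr_eq) (auto simp: add.commute)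
  qed
  have const: "(LINT x|lborel. \<psi> (x + q)) = (LINT x|lborel. \<psi> x)" for q
  proof -
    have "(LINT x|lborel. \<psi> x) = (LINT x|distr lborel borel (\<lambda>x. q + x). \<psi> x)" by (simp add: lborel_distr_plus)
    also have "\<dots> = (LINT x|lborel. \<psi> (q + x))" by (rule integral_distr) auto
    finally show ?thesis by (simp add: add.commute)
  qed
  have "((\<lambda>q. LINT x|lborel. \<psi> (x + q)) has_derivative (\<lambda>h. LINT x|lborel. \<psi>' (x + 0) \<bullet> h)) (at 0)"
  proof (rule parametric_integral_has_derivative[where r = 1 and D = "\<lambda>x. max C 0 * indicator (cball 0 (R + 1)) x" and K' = "\<lambda>q x h. \<psi>' (x + q) \<bullet> h"])
    fix q x :: "real^'n" and h :: "real^'n"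
    show "((\<lambda>q. \<psi> (x + q)) has_derivative (\<lambda>h. \<psi>' (x + q) \<bullet> h)) (at q)"
      by (rule has_derivative_compose[where f = "\<lambda>q. x + q" and f' = "\<lambda>h. h", OF _ d]) (auto intro!: derivative_eq_intros)
    assume q: "q \<in> ball 0 1"
    have "norm (\<psi>' (x + q)) \<le> max C 0 * indicator (cball 0 (R + 1)) x"
    proof (cases "norm x \<le> R + 1")
      case True
      then show ?thesis using C'[of "x + q"] by simp
    next
      case False
      then have "norm (x + q) > R" using q norm_triangle_ineq2[of x "- q"] by simp
      then show ?thesis using K(2) by simp
    qed
    then show "norm (\<psi>' (x + q) \<bullet> h) \<le> max C 0 * indicator (cball 0 (R + 1)) x * norm h"
      using Cauchy_Schwarz_ineq2[of "\<psi>' (x + q)" h] mult_right_mono[OF _ norm_ge_zero[of h]]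
      unfolding real_norm_def by (meson order_trans)
  qed (use ib ic in auto)
  then have "((\<lambda>q. LINT x|lborel. \<psi> x) has_derivative (\<lambda>h. LINT x|lborel. \<psi>' x \<bullet> h)) (at (0::real^'n))"
    by (simp add: const)
  then have "(\<lambda>h. LINT x|lborel. \<psi>' x \<bullet> h) = (\<lambda>h. 0)"
    by (rule has_derivative_unique) simp
  then have "(LINT x|lborel. \<psi>' x) \<bullet> h = 0" for h
    using integral_inner_left[of h lborel \<psi>'] i by (simp add: fun_eq_iff)
  then show "(LINT x|lborel. \<psi>' x) = 0" by (metis inner_eq_zero_iff)
qed

lemma compact_support_bounds:
  fixes \<phi> :: "real^'n \<Rightarrow> real"
  assumes d: "\<And>x. \<phi> differentiable (at x)" and c: "continuous_on UNIV (grad \<phi>)" and K: "compact (closure {x. \<phi> x \<noteq> 0})"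
  obtains R where "R > 0" "\<And>x. norm x > R \<Longrightarrow> \<phi> x = 0" "\<And>x. norm x > R \<Longrightarrow> grad \<phi> x = 0"
    "\<exists>C. \<forall>x. \<bar>\<phi> x\<bar> \<le> C \<and> norm (grad \<phi> x) \<le> C"
proof -
  have "bounded {x. \<phi> x \<noteq> 0}" using compact_imp_bounded[OF K] bounded_subset closure_subset by blast
  then obtain R where R: "R > 0" "\<And>x. \<phi> x \<noteq> 0 \<Longrightarrow> norm x \<le> R" by (auto simp: bounded_pos)
  have z: "\<phi> x = 0" if "norm x > R" for x using R(2)[of x] that by auto
  have gz: "grad \<phi> x = 0" if x: "norm x > R" for x
  proof (rule grad_unique)
    have "open {x. norm x > R}" for x :: "real^'n" by (rule open_Collect_less) (auto intro: continuous_intros)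
    then show "(\<phi> has_derivative (\<lambda>h. 0 \<bullet> h)) (at x)"
      by (intro has_derivative_transform_within_open[of "\<lambda>_. 0" _ x UNIV "{x. norm x > R}" \<phi>]) (use x z in auto)
  qed
  have cp: "continuous_on UNIV \<phi>"
    by (intro continuous_at_imp_continuous_on ballI differentiable_imp_continuous_within[OF d])
  have "bounded (\<phi> ` cball 0 R)" "bounded (grad \<phi> ` cball 0 R)"
    by (intro compact_imp_bounded compact_continuous_image continuous_on_subset[OF cp] continuous_on_subset[OF c]; auto)+
  then obtain C1 C2 where "\<forall>v\<in>\<phi> ` cball 0 R. norm v \<le> C1" "\<forall>v\<in>grad \<phi> ` cball 0 R. norm v \<le> C2"
    unfolding bounded_iff by blast
  then have C: "\<And>x. norm x \<le> R \<Longrightarrow> \<bar>\<phi> x\<bar> \<le> C1" "\<And>x. norm x \<le> R \<Longrightarrow> norm (grad \<phi> x) \<le> C2" by auto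
  have "\<bar>\<phi> x\<bar> \<le> \<bar>C1\<bar> + \<bar>C2\<bar> \<and> norm (grad \<phi> x) \<le> \<bar>C1\<bar> + \<bar>C2\<bar>" for x
    using C[of x] z[of x] gz[of x] by (cases "norm x \<le> R") auto
  with R(1) z gz show ?thesis by (intro that[of R]) auto
qed

text \<open>The gradient of the product of \<open>h\<close> and the test function has integral
  0.\<close>

lemma integral_by_parts_compact_support:
  fixes h \<phi> :: "real^'n \<Rightarrow> real"
  assumes h: "\<And>x. (h has_derivative (\<lambda>v. h' x \<bullet> v)) (at x)" and hc: "continuous_on UNIV h'"
    and d: "\<And>x. \<phi> differentiable (at x)" and c: "continuous_on UNIV (grad \<phi>)" and K: "compact (closure {x. \<phi> x \<noteq> 0})"
  shows "(LINT x|lborel. h x *\<^sub>R grad \<phi> x) = - (LINT x|lborel. \<phi> x *\<^sub>R h' x)"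
proof -
  obtain R where R: "R > 0" "\<And>x. norm x > R \<Longrightarrow> \<phi> x = 0" "\<And>x. norm x > R \<Longrightarrow> grad \<phi> x = 0"
    using compact_support_bounds[OF d c K] by metis
  have cp: "continuous_on UNIV \<phi>"
    by (intro continuous_at_imp_continuous_on ballI differentiable_imp_continuous_within[OF d])
  have ch: "continuous_on UNIV h"
    by (intro continuous_at_imp_continuous_on ballI has_derivative_continuous[OF h])
  have cont_int: "integrable lborel u" if u: "continuous_on UNIV u" and z: "\<And>x. norm x > R \<Longrightarrow> u x = 0" for u :: "real^'n \<Rightarrow> real^'n"
  proof -
    have [measurable]: "u \<in> borel_measurable borel" by (rule borel_measurable_continuous_onI[OF u])
    have "bounded (u ` cball 0 R)" by (intro compact_imp_bounded compact_continuous_image continuous_on_subset[OF u]) auto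
    then obtain D where "\<forall>v\<in>u ` cball 0 R. norm v \<le> D" unfolding bounded_iff by blast
    then have D: "\<And>x. norm x \<le> R \<Longrightarrow> norm (u x) \<le> D" by auto
    have D': "norm (u x) \<le> max D 0 * indicator (cball 0 R) x" for x
      using D[of x] z[of x] by (auto simp: indicator_def le_max_iff_disj)
    have "integrable lborel (\<lambda>x::real^'n. max D 0 * indicator (cball 0 R) x)"
      by (intro integrable_mult_right integrable_real_indicator) (use emeasure_lborel_cball_finite in \<open>auto simp: less_top[symmetric]\<close>)
    then show ?thesis by (rule Bochner_Integration.integrable_bound) (use D' order_trans[OF D' abs_ge_self] in auto)
  qed
  have i1: "integrable lborel (\<lambda>x. h x *\<^sub>R grad \<phi> x)"
    by (rule cont_int) (use R in \<open>auto intro!: continuous_intros ch c\<close>)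
  have i2: "integrable lborel (\<lambda>x. \<phi> x *\<^sub>R h' x)"
    by (rule cont_int) (use R in \<open>auto intro!: continuous_intros cp hc\<close>)
  have "(LINT x|lborel. h x *\<^sub>R grad \<phi> x + \<phi> x *\<^sub>R h' x) = 0"
  proof (rule integral_grad_compact_support(2))
    fix x
    have "((\<lambda>x. h x * \<phi> x) has_derivative (\<lambda>v. h x * (grad \<phi> x \<bullet> v) + (h' x \<bullet> v) * \<phi> x)) (at x)"
      by (rule has_derivative_mult[OF h has_derivative_grad[OF d]])
    then show "((\<lambda>x. h x * \<phi> x) has_derivative (\<lambda>v. (h x *\<^sub>R grad \<phi> x + \<phi> x *\<^sub>R h' x) \<bullet> v)) (at x)"
      by (simp add: inner_add_left mult.commute)
  qed (use R in \<open>auto intro!: continuous_intros ch c cp hc\<close>)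
  then show ?thesis using i1 i2 by (simp add: add_eq_0_iff2)
qed

subsection \<open>Moments of the standard Gaussian measure\<close>

text \<open>Both 1 and -1 factor the identity covariance, so the image of \<open>stdg\<close> under
  either is the same normal law.\<close>

lemma stdg_uminus: "distr stdg borel (\<lambda>z. - z) = (stdg :: (real^'n) measure)"
proof -
  have i: "invertible (mat 1 :: real^'n^'n)" "invertible (- mat 1 :: real^'n^'n)"
    by (auto simp: invertible_def intro!: exI[of _ "mat 1"] exI[of _ "- mat 1"] simp: bounded_bilinear.minus_left[OF bounded_bilinear_mat_mult] bounded_bilinear.minus_right[OF bounded_bilinear_mat_mult])
  have t: "transpose (- mat 1 :: real^'n^'n) = - mat 1"
    by (simp add: transpose_def mat_def vec_eq_iff)
  have "normal (mat 1) 0 = distr stdg borel (\<lambda>z::real^'n. 0 + mat 1 *v z)"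
    by (rule normal_eq_distr) (use i in auto)
  then have 1: "normal (mat 1) 0 = distr stdg borel (\<lambda>z::real^'n. z)" by simp
  have "normal (mat 1) 0 = distr stdg borel (\<lambda>z::real^'n. 0 + (- mat 1) *v z)"
    by (rule normal_eq_distr) (use i in \<open>auto simp: t bounded_bilinear.minus_left[OF bounded_bilinear_mat_mult] bounded_bilinear.minus_right[OF bounded_bilinear_mat_mult]\<close>)
  then have 2: "normal (mat 1) 0 = distr stdg borel (\<lambda>z::real^'n. - z)"
    by (simp add: bounded_bilinear.minus_left[OF bounded_bilinear_mat_vec])
  have "distr stdg borel (\<lambda>z::real^'n. z) = stdg" by (rule distr_id2) simp
  with 1 2 show ?thesis by simp
qed

lemma stdg_integrable_linear: "integrable stdg (\<lambda>z::real^'n. z \<bullet> w)"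
proof (rule Bochner_Integration.integrable_bound)
  show "integrable stdg (\<lambda>z::real^'n. norm w * (1 + norm z) powr 1)" using integrable_stdg_moment[of 1] by auto
  have "\<bar>z \<bullet> w\<bar> \<le> norm w * (1 + norm z)" for z :: "real^'n"
    using Cauchy_Schwarz_ineq2[of z w] by (simp add: algebra_simps add_increasing)
  then show "AE z in (stdg :: (real^'n) measure). norm (z \<bullet> w) \<le> norm (norm w * (1 + norm z) powr 1)"
    by (auto simp: add_nonneg_nonneg)
qed measurable

lemma stdg_mean_zero: "(LINT z|(stdg :: (real^'n) measure). z \<bullet> w) = 0"
proof -
  have "(LINT z|(stdg :: (real^'n) measure). z \<bullet> w) = (LINT z|distr stdg borel (\<lambda>z::real^'n. - z). z \<bullet> w)"
    by (simp add: stdg_uminus)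
  also have "\<dots> = (LINT z|(stdg :: (real^'n) measure). (- z) \<bullet> w)" by (rule integral_distr) auto
  also have "\<dots> = - (LINT z|(stdg :: (real^'n) measure). z \<bullet> w)" by simp
  finally show ?thesis by simp
qed

text \<open>Only the ball of radius 1/2 around the unit vector e in direction w is kept. There <z,
  w> >= |w| / 2, and |z| <= 2 bounds the density from below.\<close>

lemma stdg_linear_moment_lower:
  assumes p: "p > 0"
  shows "\<exists>c>0. \<forall>w::real^'n. ennreal (c * norm w powr p) \<le> (\<integral>\<^sup>+z. ennreal (\<bar>z \<bullet> w\<bar> powr p) \<partial>stdg)"
proof -
  let ?k = "(2 * pi) powr (- real CARD('n) / 2) * exp (- 1 / 2 * (2::real)\<^sup>2)"
  let ?v = "measure lborel (ball (0::real^'n) (1 / 2))"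
  have v: "?v > 0" using content_ball_pos[of "1/2" "0::real^'n"] by simp
  define c where "c = (1 / 2) powr p * (?k * ?v)"
  have "c > 0" using v by (simp add: c_def)
  moreover have "ennreal (c * norm w powr p) \<le> (\<integral>\<^sup>+z. ennreal (\<bar>z \<bullet> w\<bar> powr p) \<partial>stdg)" for w :: "real^'n"
  proof (cases "w = 0")
    case False
    define e where "e = w /\<^sub>R norm w"
    have e: "norm e = 1" "e \<bullet> w = norm w" using False by (auto simp: e_def power2_norm_eq_inner[symmetric] power2_eq_square)
    have "ennreal (c * norm w powr p) = ennreal ((norm w / 2) powr p * ?k) * emeasure lborel (ball e (1 / 2))"
    proof -
      have "emeasure lborel (ball e (1 / 2)) = ennreal (measure lborel (ball e (1 / 2)))"
        using emeasure_lborel_ball_finite[of e "1 / 2"] by (intro emeasure_eq_ennreal_measure) (simp add: less_top[symmetric])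
      also have "measure lborel (ball e (1 / 2)) = ?v" using content_ball_conv_unit_ball[of "1/2" e] content_ball_conv_unit_ball[of "1/2" "0::real^'n"] by simp
      finally show ?thesis
        using v by (simp add: c_def ennreal_mult[symmetric] powr_divide powr_mult ac_simps)
    qed
    also have "\<dots> = (\<integral>\<^sup>+z. ennreal ((norm w / 2) powr p * ?k) * indicator (ball e (1 / 2)) z \<partial>lborel)"
      by (simp add: nn_integral_cmult_indicator)
    also have "\<dots> \<le> (\<integral>\<^sup>+z. ennreal (std_density z) * ennreal (\<bar>z \<bullet> w\<bar> powr p) \<partial>lborel)"
    proof (rule nn_integral_mono)
      fix z :: "real^'n"
      show "ennreal ((norm w / 2) powr p * ?k) * indicator (ball e (1 / 2)) z \<le> ennreal (std_density z) * ennreal (\<bar>z \<bullet> w\<bar> powr p)"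
      proof (cases "z \<in> ball e (1 / 2)")
        case True
        then have d: "norm (z - e) < 1 / 2" by (simp add: dist_norm norm_minus_commute)
        have "(z - e) \<bullet> w \<ge> - (norm (z - e) * norm w)" using Cauchy_Schwarz_ineq2[of "z - e" w] by linarith
        moreover have "norm (z - e) * norm w \<le> 1 / 2 * norm w" using d by (intro mult_right_mono) auto
        ultimately have "norm w / 2 \<le> z \<bullet> w" using e(2) by (simp add: inner_diff_left)
        then have 1: "(norm w / 2) powr p \<le> \<bar>z \<bullet> w\<bar> powr p" using p by (intro powr_mono2) auto
        have "norm z \<le> 2" using d e(1) norm_triangle_sub[of z e] by linarith
        then have "(norm z)\<^sup>2 \<le> 2\<^sup>2" by (intro power_mono) auto
        then have 2: "?k \<le> std_density z" by (simp add: std_density_def)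
        have "(norm w / 2) powr p * ?k \<le> \<bar>z \<bullet> w\<bar> powr p * std_density z" by (intro mult_mono 1 2) auto
        then show ?thesis using True by (simp add: ennreal_mult[symmetric] mult.commute)
      qed simp
    qed
    also have "\<dots> = (\<integral>\<^sup>+z. ennreal (\<bar>z \<bullet> w\<bar> powr p) \<partial>stdg)" by (rule nn_integral_stdg[symmetric]) measurable
    finally show ?thesis .
  qed (use p in simp)
  ultimately show ?thesis by blast
qed

subsection \<open>The Gaussian Poincare inequality\<close>

text \<open>Pisier's argument: join independent \<open>x\<close> and \<open>y\<close> by \<open>sin \<theta> x + cos \<theta> y\<close>, whose derivative in
  \<open>\<theta>\<close> is again independent of it by rotation invariance.\<close>

lemma gauss_poincare_pairs:
  fixes H :: "real^'n \<Rightarrow> real"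
  assumes p: "p > 1" and H: "\<And>x. (H has_derivative (\<lambda>v. H' x \<bullet> v)) (at x)" and Hc: "continuous_on UNIV H'"
  shows "(\<integral>\<^sup>+x. (\<integral>\<^sup>+y. ennreal (\<bar>H x - H y\<bar> powr p) \<partial>stdg) \<partial>stdg)
     \<le> ennreal ((1 + pi / 2) powr p * (pi / 2)) * ((\<integral>\<^sup>+x. ennreal (norm (H' x) powr p) \<partial>stdg) * (\<integral>\<^sup>+y. ennreal (norm (y::real^'n) powr p) \<partial>stdg))"
proof -
  let ?s = "stdg :: (real^'n) measure"
  define N where "N = restrict_space lborel {0..pi / 2}"
  have N_sets: "sets N = sets (restrict_space borel {0..pi / 2})" unfolding N_def by (intro sets_restrict_space_cong) simp
  have mN: "emeasure N (space N) = ennreal (pi / 2)"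
    unfolding N_def by (simp add: emeasure_restrict_space space_restrict_space)
  interpret N: finite_measure N by standard (simp add: mN)
  have mN': "measure N (space N) = pi / 2" using mN by (simp add: measure_def)
  have [measurable]: "H' \<in> borel_measurable borel" by (rule borel_measurable_continuous_onI[OF Hc])
  have Hcont: "continuous_on UNIV H"
    by (intro continuous_at_imp_continuous_on ballI has_derivative_continuous[OF H])
  have [measurable]: "H \<in> borel_measurable borel" by (rule borel_measurable_continuous_onI[OF Hcont])
  have [measurable]: "(\<lambda>\<theta>. sin \<theta>) \<in> borel_measurable N" "(\<lambda>\<theta>. cos \<theta>) \<in> borel_measurable N"
    unfolding N_def by (auto intro!: measurable_restrict_space1)
  have sf: "sigma_finite_measure ?s" by (rule sigma_finite_stdg)
  let ?P = "\<lambda>\<theta> x y. sin \<theta> *\<^sub>R x + cos \<theta> *\<^sub>R (y::real^'n)"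
  let ?Q = "\<lambda>\<theta> x y. sin \<theta> *\<^sub>R y - cos \<theta> *\<^sub>R (x::real^'n)"
  let ?F = "\<lambda>\<theta> x y. ennreal (norm (H' (?P \<theta> x y)) powr p) * ennreal (norm (?Q \<theta> x y) powr p)"
  let ?C = "ennreal ((1 + pi / 2) powr p)"
  have pt: "ennreal (\<bar>H x - H y\<bar> powr p) \<le> ?C * (\<integral>\<^sup>+\<theta>. ?F \<theta> x y \<partial>N)" for x y
  proof -
    define k where "k \<theta> = H' (?P \<theta> x y) \<bullet> (- ?Q \<theta> x y)" for \<theta>
    have kc: "continuous_on X k" for X
      unfolding k_def by (intro continuous_intros continuous_on_compose2[OF Hc]) auto
    have dP: "((\<lambda>\<theta>. ?P \<theta> x y) has_vector_derivative (- ?Q \<theta> x y)) (at \<theta>)" for \<theta>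
    proof -
      have 1: "((\<lambda>\<theta>. sin \<theta> *\<^sub>R x) has_vector_derivative sin \<theta> *\<^sub>R 0 + cos \<theta> *\<^sub>R x) (at \<theta>)"
        by (rule has_vector_derivative_scaleR[OF DERIV_sin has_vector_derivative_const])
      have 2: "((\<lambda>\<theta>. cos \<theta> *\<^sub>R y) has_vector_derivative cos \<theta> *\<^sub>R 0 + (- sin \<theta>) *\<^sub>R y) (at \<theta>)"
        by (rule has_vector_derivative_scaleR[OF DERIV_cos has_vector_derivative_const])
      from has_vector_derivative_add[OF 1 2] show ?thesis by simp
    qed
    have "(k has_integral (H (?P (pi / 2) x y) - H (?P 0 x y))) {0..pi / 2}"
    proof (rule fundamental_theorem_of_calculus)
      fix \<theta> assume "\<theta> \<in> {0..pi / 2}"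
      have "((\<lambda>\<theta>. H (?P \<theta> x y)) has_derivative (\<lambda>h. H' (?P \<theta> x y) \<bullet> (h *\<^sub>R (- ?Q \<theta> x y)))) (at \<theta>)"
        by (rule has_derivative_compose[OF dP[unfolded has_vector_derivative_def] H])
      then have "((\<lambda>\<theta>. H (?P \<theta> x y)) has_vector_derivative k \<theta>) (at \<theta>)"
        by (simp add: has_vector_derivative_def k_def)
      then show "((\<lambda>\<theta>. H (?P \<theta> x y)) has_vector_derivative k \<theta>) (at \<theta> within {0..pi / 2})"
        by (rule has_vector_derivative_at_within)
    qed simp
    then have "integral {0..pi / 2} k = H x - H y" by (simp add: integral_unique)
    moreover have "set_integrable lborel {0..pi / 2} k" by (rule borel_integrable_atLeastAtMost'[OF kc])
    ultimately have "(LINT \<theta>:{0..pi / 2}|lborel. k \<theta>) = H x - H y"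
      by (simp add: set_borel_integral_eq_integral(2))
    then have LN: "(LINT \<theta>|N. k \<theta>) = H x - H y"
      unfolding N_def by (subst integral_restrict_space) (auto simp: set_lebesgue_integral_def)
    have km: "k \<in> borel_measurable N"
      unfolding N_def by (intro measurable_restrict_space1) (simp add: borel_measurable_continuous_onI[OF kc])
    \<comment> \<open>The path parameter runs over an interval of length pi / 2, whence the factor
      (1 + pi / 2)^p; the remaining factor pi / 2 in the constant comes from integrating over
      \<theta> at the end.\<close>
    have "ennreal (\<bar>H x - H y\<bar> powr p) \<le> ?C * (\<integral>\<^sup>+\<theta>. ennreal (\<bar>k \<theta>\<bar> powr p) \<partial>N)"
      using N.integral_powr_le(2)[OF p km] unfolding LN mN' .
    also have "\<dots> \<le> ?C * (\<integral>\<^sup>+\<theta>. ?F \<theta> x y \<partial>N)"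
    proof (intro mult_left_mono nn_integral_mono)
      fix \<theta>
      have "\<bar>k \<theta>\<bar> \<le> norm (H' (?P \<theta> x y)) * norm (?Q \<theta> x y)"
        using Cauchy_Schwarz_ineq2[of "H' (?P \<theta> x y)" "- ?Q \<theta> x y"] by (simp add: k_def norm_minus_commute)
      then have "\<bar>k \<theta>\<bar> powr p \<le> (norm (H' (?P \<theta> x y)) * norm (?Q \<theta> x y)) powr p" using p by (intro powr_mono2) auto
      then show "ennreal (\<bar>k \<theta>\<bar> powr p) \<le> ?F \<theta> x y" by (simp add: powr_mult ennreal_mult[symmetric])
    qed simp
    finally show ?thesis .
  qed
  interpret sN: pair_sigma_finite ?s N
    by (intro pair_sigma_finite.intro sf N.sigma_finite_measure_axioms)
  have "(\<integral>\<^sup>+x. (\<integral>\<^sup>+y. ennreal (\<bar>H x - H y\<bar> powr p) \<partial>?s) \<partial>?s) \<le> (\<integral>\<^sup>+x. (\<integral>\<^sup>+y. ?C * (\<integral>\<^sup>+\<theta>. ?F \<theta> x y \<partial>N) \<partial>?s) \<partial>?s)"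
    by (intro nn_integral_mono pt)
  also have "\<dots> = (\<integral>\<^sup>+x. ?C * (\<integral>\<^sup>+y. (\<integral>\<^sup>+\<theta>. ?F \<theta> x y \<partial>N) \<partial>?s) \<partial>?s)"
    by (intro nn_integral_cong nn_integral_cmult) measurable
  also have "\<dots> = ?C * (\<integral>\<^sup>+x. (\<integral>\<^sup>+y. (\<integral>\<^sup>+\<theta>. ?F \<theta> x y \<partial>N) \<partial>?s) \<partial>?s)"
    by (rule nn_integral_cmult) measurable
  also have "(\<integral>\<^sup>+x. (\<integral>\<^sup>+y. (\<integral>\<^sup>+\<theta>. ?F \<theta> x y \<partial>N) \<partial>?s) \<partial>?s) = (\<integral>\<^sup>+x. (\<integral>\<^sup>+\<theta>. (\<integral>\<^sup>+y. ?F \<theta> x y \<partial>?s) \<partial>N) \<partial>?s)"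
    by (intro nn_integral_cong sN.Fubini'[symmetric]) measurable
  also have "\<dots> = (\<integral>\<^sup>+\<theta>. (\<integral>\<^sup>+x. (\<integral>\<^sup>+y. ?F \<theta> x y \<partial>?s) \<partial>?s) \<partial>N)"
    by (intro sN.Fubini'[symmetric]) measurable
  also have "\<dots> = (\<integral>\<^sup>+\<theta>. (\<integral>\<^sup>+x. ennreal (norm (H' x) powr p) \<partial>?s) * (\<integral>\<^sup>+y. ennreal (norm y powr p) \<partial>?s) \<partial>N)"
  proof (rule nn_integral_cong_AE)
    \<comment> \<open>The rotation has cosine part sin \<theta>, which \<open>stdg_rotation\<close>
      requires to be positive; on [0, pi / 2] only \<theta> = 0 is lost.\<close>
    have "AE \<theta> in N. \<theta> \<noteq> 0"
      unfolding N_def by (subst AE_restrict_space_iff) (use AE_lborel_singleton[of "0::real"] in auto)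
    moreover have "AE \<theta> in N. \<theta> \<in> {0..pi / 2}" unfolding N_def by (auto simp: space_restrict_space)
    ultimately show "AE \<theta> in N. (\<integral>\<^sup>+x. (\<integral>\<^sup>+y. ?F \<theta> x y \<partial>?s) \<partial>?s) = (\<integral>\<^sup>+x. ennreal (norm (H' x) powr p) \<partial>?s) * (\<integral>\<^sup>+y. ennreal (norm y powr p) \<partial>?s)"
    proof eventually_elim
      case (elim \<theta>)
      then have "sin \<theta> > 0" using pi_half_less_two by (intro sin_gt_zero) auto
      have "(\<integral>\<^sup>+x. (\<integral>\<^sup>+y. ?F \<theta> x y \<partial>?s) \<partial>?s) = (\<integral>\<^sup>+x. (\<integral>\<^sup>+y. ennreal (norm (H' x) powr p) * ennreal (norm y powr p) \<partial>?s) \<partial>?s)"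
        by (rule stdg_rotation[where F = "\<lambda>x y. ennreal (norm (H' x) powr p) * ennreal (norm y powr p)", OF _ \<open>sin \<theta> > 0\<close>]) (simp, measurable)
      also have "\<dots> = (\<integral>\<^sup>+x. ennreal (norm (H' x) powr p) * (\<integral>\<^sup>+y. ennreal (norm y powr p) \<partial>?s) \<partial>?s)"
        by (simp add: nn_integral_cmult)
      also have "\<dots> = (\<integral>\<^sup>+x. ennreal (norm (H' x) powr p) \<partial>?s) * (\<integral>\<^sup>+y. ennreal (norm y powr p) \<partial>?s)"
        by (rule nn_integral_multc) measurable
      finally show ?case .
    qed
  qed
  also have "\<dots> = (\<integral>\<^sup>+x. ennreal (norm (H' x) powr p) \<partial>?s) * (\<integral>\<^sup>+y. ennreal (norm y powr p) \<partial>?s) * ennreal (pi / 2)"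
    by (simp add: mN)
  finally have le: "(\<integral>\<^sup>+x. (\<integral>\<^sup>+y. ennreal (\<bar>H x - H y\<bar> powr p) \<partial>?s) \<partial>?s)
     \<le> ?C * ((\<integral>\<^sup>+x. ennreal (norm (H' x) powr p) \<partial>?s) * (\<integral>\<^sup>+y. ennreal (norm y powr p) \<partial>?s) * ennreal (pi / 2))" .
  have "ennreal ((1 + pi / 2) powr p * (pi / 2)) = ?C * ennreal (pi / 2)" by (rule ennreal_mult) auto
  then show ?thesis using le by (simp only: mult.assoc mult.commute mult.left_commute)
qed

section \<open>Invariance and the extension to integrable functions\<close>

lemma gauss_density_pos:
  assumes "det Q > 0"
  shows "gauss_density Q m x > 0"
  using assms by (simp add: gauss_density_def)

lemma ennreal_tendsto_0_cmult:
  fixes u :: "nat \<Rightarrow> ennreal"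
  assumes "c < \<infinity>" "u \<longlonglongrightarrow> 0"
  shows "(\<lambda>k. c * u k) \<longlonglongrightarrow> 0"
  using ennreal_tendsto_cmult[of c u 0 sequentially] assms by simp

lemma ennreal_tendsto_0_squeeze:
  fixes u v :: "nat \<Rightarrow> ennreal"
  assumes "\<And>k. u k \<le> v k" "v \<longlonglongrightarrow> 0"
  shows "u \<longlonglongrightarrow> 0"
  by (rule tendsto_sandwich[OF _ _ tendsto_const assms(2)]) (use assms(1) in auto)

context ornstein_uhlenbeck
begin

abbreviation \<mu> where "\<mu> t \<equiv> mu B g U t"
abbreviation evLp where "evLp p t s f \<equiv> evol_Lp A B g U p t s f"

definition Rf :: "real \<Rightarrow> real^'n^'n" where
  "Rf t = (SOME R. invertible R \<and> R ** transpose R = cov B U t)"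

lemma Rf: "invertible (Rf t)" "Rf t ** transpose (Rf t) = cov B U t"
proof -
  have ex: "\<exists>R::real^'n^'n. invertible R \<and> R ** transpose R = cov B U t"
  proof -
    obtain R :: "real^'n^'n" where "invertible R" "R ** transpose R = cov B U t"
      by (rule posdef_factor[OF cov_pos cov_sym])
    then show ?thesis by blast
  qed
  have "invertible (Rf t) \<and> Rf t ** transpose (Rf t) = cov B U t"
    using someI_ex[OF ex] unfolding Rf_def by simp
  then show "invertible (Rf t)" "Rf t ** transpose (Rf t) = cov B U t" by auto
qed

lemma mu_eq_normal: "\<mu> t = normal (cov B U t) (mean g U t)"
  by (simp add: mu_def normal_def gauss_density_def)

lemma sets_mu [simp, measurable_cong]: "sets (\<mu> t) = sets borel" by (simp add: mu_eq_normal)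
lemma space_mu [simp]: "space (\<mu> t) = UNIV" by (simp add: mu_eq_normal)
lemma measurable_mu [simp]: "borel_measurable (\<mu> t) = borel_measurable borel"
  by (rule measurable_cong_sets) auto

lemma prob_space_mu: "prob_space (\<mu> t)"
  unfolding mu_eq_normal by (rule prob_space_normal[OF Rf])

lemma emeasure_mu_UNIV [simp]: "emeasure (\<mu> t) UNIV = 1"
  using prob_space.emeasure_space_1[OF prob_space_mu, of t] by simp
lemma measure_mu_UNIV [simp]: "measure (\<mu> t) UNIV = 1"
  using prob_space.prob_space[OF prob_space_mu, of t] by simp

lemma mu_eq_distr: "\<mu> t = distr stdg borel (\<lambda>z. mean g U t + Rf t *v z)"
  unfolding mu_eq_normal by (rule normal_eq_distr[OF Rf])

lemma nn_integral_mu: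
  "f \<in> borel_measurable borel \<Longrightarrow> (\<integral>\<^sup>+x. f x \<partial>\<mu> t) = (\<integral>\<^sup>+z. f (mean g U t + Rf t *v z) \<partial>stdg)"
  unfolding mu_eq_normal by (rule nn_integral_normal[OF Rf])

definition rho where "rho t x = gauss_density (cov B U t) (mean g U t) x"

lemma rho_pos: "rho t x > 0"
proof -
  have "det (Rf t) \<noteq> 0" using Rf(1)[of t] by (simp add: invertible_det_nz)
  then have "det (cov B U t) > 0" unfolding det_factor[OF Rf(2)] by simp
  then show ?thesis unfolding rho_def by (rule gauss_density_pos)
qed

lemma rho_measurable [measurable]: "rho t \<in> borel_measurable borel"
  unfolding rho_def by measurable

lemma mu_eq_density: "\<mu> t = density lborel (\<lambda>x. ennreal (rho t x))"
  by (simp add: mu_eq_normal normal_def rho_def)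

text \<open>The density is positive, so all the measures \<open>mu\<close> share the null sets of
  Lebesgue measure. Weak gradients live with the latter, \<open>evol_Lp\<close> with the
  former.\<close>

lemma AE_mu_iff: "(AE x in \<mu> t. P x) \<longleftrightarrow> (AE x in lborel. P x)"
  unfolding mu_eq_density by (subst AE_density) (auto simp: rho_pos)

lemma nn_integral_mu_density: "f \<in> borel_measurable borel \<Longrightarrow> (\<integral>\<^sup>+x. f x \<partial>\<mu> t) = (\<integral>\<^sup>+x. ennreal (rho t x) * f x \<partial>lborel)"
  unfolding mu_eq_density by (simp add: nn_integral_density)

text \<open>Pulled back to \<open>stdg\<close>, both sides are standard Gaussian integrals.
  Multiplied by the inverse of \<open>Rf s\<close>, the identity \<open>cov_split\<close> says
  exactly M M^T + N N^T = 1, the hypothesis of \<open>stdg_convolution\<close>;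
  \<open>mean_split\<close> matches the means.\<close>

lemma invariance:
  assumes st: "s < t" and [measurable]: "F \<in> borel_measurable borel"
  shows "(\<integral>\<^sup>+x. (\<integral>\<^sup>+z. F (mm s t x + Sf s t *v z) \<partial>stdg) \<partial>\<mu> t) = (\<integral>\<^sup>+x. F x \<partial>\<mu> s)"
proof -
  let ?I = "matrix_inv (Rf s)"
  define M where "M = ?I ** (U s t ** Rf t)"
  define N where "N = ?I ** Sf s t"
  have MN: "M ** transpose M + N ** transpose N = mat 1"
  proof -
    have "M ** transpose M + N ** transpose N
       = ?I ** (U s t ** (Rf t ** transpose (Rf t)) ** transpose (U s t)) ** transpose ?I + ?I ** (Sf s t ** transpose (Sf s t)) ** transpose ?I"
      by (simp add: M_def N_def matrix_transpose_mul matrix_mul_assoc)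
    also have "\<dots> = ?I ** (U s t ** cov B U t ** transpose (U s t) + Qf s t) ** transpose ?I"
      unfolding Rf(2) Sf(2)[OF st]
      by (simp add: bounded_bilinear.add_left[OF bounded_bilinear_mat_mult] bounded_bilinear.add_right[OF bounded_bilinear_mat_mult])
    also have "\<dots> = ?I ** (Rf s ** transpose (Rf s)) ** transpose ?I"
      unfolding Rf(2) cov_split[OF less_imp_le[OF st]] by (simp add: add.commute)
    also have "\<dots> = (?I ** Rf s) ** transpose (?I ** Rf s)"
      by (simp add: matrix_transpose_mul matrix_mul_assoc)
    finally show ?thesis by (simp add: matrix_inv_mult[OF Rf(1)])
  qed
  have I: "invertible ?I" using matrix_inv_mult[OF Rf(1)] invertible_def by blast
  have Ninv: "invertible N" unfolding N_def by (rule invertible_mult[OF I Sf(1)[OF st]])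
  have e: "mm s t (mean g U t + Rf t *v x) + Sf s t *v z = mean g U s + Rf s *v (M *v x + N *v z)" for x z
  proof -
    have "Rf s *v (M *v x + N *v z) = U s t *v (Rf t *v x) + Sf s t *v z"
      by (simp add: M_def N_def matrix_vector_right_distrib matrix_vector_mul_assoc[symmetric] matrix_inv_vec[OF Rf(1)])
    then show ?thesis
      unfolding mean_split[OF less_imp_le[OF st]] mm_def by (simp add: matrix_vector_right_distrib)
  qed
  have mm_meas [measurable]: "mm s t \<in> borel_measurable borel" unfolding mm_def by measurable
  have "(\<integral>\<^sup>+x. (\<integral>\<^sup>+z. F (mm s t x + Sf s t *v z) \<partial>stdg) \<partial>\<mu> t) = (\<integral>\<^sup>+x. (\<integral>\<^sup>+z. F (mm s t (mean g U t + Rf t *v x) + Sf s t *v z) \<partial>stdg) \<partial>stdg)"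
    by (rule nn_integral_mu) measurable
  also have "\<dots> = (\<integral>\<^sup>+x. (\<integral>\<^sup>+z. F (mean g U s + Rf s *v (M *v x + N *v z)) \<partial>stdg) \<partial>stdg)" unfolding e ..
  also have "\<dots> = (\<integral>\<^sup>+w. F (mean g U s + Rf s *v w) \<partial>stdg)"
    by (rule stdg_convolution[OF MN Ninv]) measurable
  also have "\<dots> = (\<integral>\<^sup>+x. F x \<partial>\<mu> s)" by (rule nn_integral_mu[symmetric]) measurable
  finally show ?thesis .
qed

lemma mm_measurable [measurable]: "mm s t \<in> borel_measurable borel" unfolding mm_def by measurable

lemma G_measurable [measurable]:
  assumes [measurable]: "f \<in> borel_measurable borel"
  shows "G t s f \<in> borel_measurable borel"
  unfolding G_def[abs_def] by (rule stdg.borel_measurable_lebesgue_integral) measurable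

text \<open>Jensen's inequality with constant 2^p, where 2 is 1 plus the total mass of
  \<open>stdg\<close>.\<close>

lemma G_powr_le:
  assumes p: "p > 1" and [measurable]: "f \<in> borel_measurable borel"
  shows "ennreal (\<bar>G t s f x\<bar> powr p) \<le> ennreal (2 powr p) * (\<integral>\<^sup>+z. ennreal (\<bar>f (mm s t x + Sf s t *v z)\<bar> powr p) \<partial>stdg)"
  using stdg.integral_powr_le(2)[OF p, of "\<lambda>z. f (mm s t x + Sf s t *v z)"] by (simp add: G_def)

text \<open>For f in L^p the integral defining \<open>G t s f x\<close> may fail to converge at some
  x; there the right side is infinite. Where it is finite, f - \<phi> and hence f is integrable
  along the kernel, and linearity holds.\<close>

lemma G_diff_powr_le:
  assumes p: "p > 1" and fm[measurable]: "f \<in> borel_measurable borel" and \<phi>: "\<phi> \<in> C_b"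
  shows "ennreal (\<bar>G t s f x - G t s \<phi> x\<bar> powr p) \<le> ennreal (2 powr p) * (\<integral>\<^sup>+z. ennreal (\<bar>f (mm s t x + Sf s t *v z) - \<phi> (mm s t x + Sf s t *v z)\<bar> powr p) \<partial>stdg)"
    (is "_ \<le> _ * ?X")
proof (cases "?X < \<infinity>")
  case False
  then have "?X = \<top>" by (simp add: less_top[symmetric])
  then show ?thesis by (simp add: ennreal_mult_top)
next
  case True
  have [measurable]: "\<phi> \<in> borel_measurable borel" by (rule C_bD(1)[OF \<phi>])
  obtain F where F: "F \<ge> 0" "\<And>x. \<bar>\<phi> x\<bar> \<le> F" using C_bD(3)[OF \<phi>] by blast
  let ?y = "\<lambda>z. mm s t x + Sf s t *v z"
  have i1: "integrable stdg (\<lambda>z. f (?y z) - \<phi> (?y z))"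
    by (rule stdg.integral_powr_le(1)[OF p _ True]) measurable
  have i2: "integrable stdg (\<lambda>z. \<phi> (?y z))"
    by (rule stdg.integrable_const_bound[where B = F]) (use F in auto)
  have "integrable stdg (\<lambda>z. (f (?y z) - \<phi> (?y z)) + \<phi> (?y z))" using i1 i2 by (rule Bochner_Integration.integrable_add)
  then have i3: "integrable stdg (\<lambda>z. f (?y z))" by simp
  have "G t s f x - G t s \<phi> x = (LINT z|stdg. f (?y z) - \<phi> (?y z))" unfolding G_def using i2 i3 by simp
  then show ?thesis using stdg.integral_powr_le(2)[OF p, of "\<lambda>z. f (?y z) - \<phi> (?y z)"] by simp
qed

lemma G_Lp_bound:
  assumes st: "s < t" and p: "p > 1" and [measurable]: "f \<in> borel_measurable borel"
  shows "(\<integral>\<^sup>+x. ennreal (\<bar>G t s f x\<bar> powr p) \<partial>\<mu> t) \<le> ennreal (2 powr p) * (\<integral>\<^sup>+x. ennreal (\<bar>f x\<bar> powr p) \<partial>\<mu> s)"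
proof -
  have "(\<integral>\<^sup>+x. ennreal (\<bar>G t s f x\<bar> powr p) \<partial>\<mu> t) \<le> (\<integral>\<^sup>+x. ennreal (2 powr p) * (\<integral>\<^sup>+z. ennreal (\<bar>f (mm s t x + Sf s t *v z)\<bar> powr p) \<partial>stdg) \<partial>\<mu> t)"
    by (intro nn_integral_mono G_powr_le p) measurable
  also have "\<dots> = ennreal (2 powr p) * (\<integral>\<^sup>+x. (\<integral>\<^sup>+z. ennreal (\<bar>f (mm s t x + Sf s t *v z)\<bar> powr p) \<partial>stdg) \<partial>\<mu> t)"
    by (rule nn_integral_cmult) measurable
  also have "(\<integral>\<^sup>+x. (\<integral>\<^sup>+z. ennreal (\<bar>f (mm s t x + Sf s t *v z)\<bar> powr p) \<partial>stdg) \<partial>\<mu> t) = (\<integral>\<^sup>+x. ennreal (\<bar>f x\<bar> powr p) \<partial>\<mu> s)"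
    by (rule invariance[OF st]) measurable
  finally show ?thesis .
qed

lemma G_diff_Lp_bound:
  assumes st: "s < t" and p: "p > 1" and fm[measurable]: "f \<in> borel_measurable borel" and \<phi>: "\<phi> \<in> C_b"
  shows "(\<integral>\<^sup>+x. ennreal (\<bar>G t s f x - G t s \<phi> x\<bar> powr p) \<partial>\<mu> t) \<le> ennreal (2 powr p) * (\<integral>\<^sup>+x. ennreal (\<bar>f x - \<phi> x\<bar> powr p) \<partial>\<mu> s)"
proof -
  have [measurable]: "\<phi> \<in> borel_measurable borel" by (rule C_bD(1)[OF \<phi>])
  have "(\<integral>\<^sup>+x. ennreal (\<bar>G t s f x - G t s \<phi> x\<bar> powr p) \<partial>\<mu> t) \<le> (\<integral>\<^sup>+x. ennreal (2 powr p) * (\<integral>\<^sup>+z. ennreal (\<bar>f (mm s t x + Sf s t *v z) - \<phi> (mm s t x + Sf s t *v z)\<bar> powr p) \<partial>stdg) \<partial>\<mu> t)"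
    by (intro nn_integral_mono G_diff_powr_le p fm \<phi>)
  also have "\<dots> = ennreal (2 powr p) * (\<integral>\<^sup>+x. (\<integral>\<^sup>+z. ennreal (\<bar>f (mm s t x + Sf s t *v z) - \<phi> (mm s t x + Sf s t *v z)\<bar> powr p) \<partial>stdg) \<partial>\<mu> t)"
    by (rule nn_integral_cmult) measurable
  also have "(\<integral>\<^sup>+x. (\<integral>\<^sup>+z. ennreal (\<bar>f (mm s t x + Sf s t *v z) - \<phi> (mm s t x + Sf s t *v z)\<bar> powr p) \<partial>stdg) \<partial>\<mu> t) = (\<integral>\<^sup>+x. ennreal (\<bar>f x - \<phi> x\<bar> powr p) \<partial>\<mu> s)"
    by (rule invariance[OF st, of "\<lambda>y. ennreal (\<bar>f y - \<phi> y\<bar> powr p)"]) measurable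
  finally show ?thesis .
qed

lemma Lp_mu_measurable: "(f :: real^'n \<Rightarrow> 'z::euclidean_space) \<in> Lp p (\<mu> t) \<Longrightarrow> f \<in> borel_measurable borel"
  by (simp add: Lp_def)

lemma C_b_Lp:
  assumes "\<phi> \<in> C_b" "p > 0"
  shows "\<phi> \<in> Lp p (\<mu> t)"
proof -
  have [measurable]: "\<phi> \<in> borel_measurable borel" by (rule C_bD(1)[OF assms(1)])
  obtain F where F: "F \<ge> 0" "\<And>x. \<bar>\<phi> x\<bar> \<le> F" using C_bD(3)[OF assms(1)] by blast
  interpret prob_space "\<mu> t" by (rule prob_space_mu)
  have "integrable (\<mu> t) (\<lambda>x. norm (\<phi> x) powr p)"
    by (rule integrable_const_bound[where B = "F powr p"]) (use F assms(2) in \<open>auto intro!: powr_mono2\<close>)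
  then show ?thesis by (simp add: Lp_def)
qed

lemma G_in_Lp:
  assumes "s < t" "p > 1" "f \<in> Lp p (\<mu> s)"
  shows "G t s f \<in> Lp p (\<mu> t)"
proof -
  have [measurable]: "f \<in> borel_measurable borel" by (rule Lp_mu_measurable[OF assms(3)])
  have "(\<integral>\<^sup>+x. ennreal (norm (f x) powr p) \<partial>\<mu> s) < \<infinity>" using assms(3) by (simp add: Lp_iff_nn_integral)
  then have "ennreal (2 powr p) * (\<integral>\<^sup>+x. ennreal (\<bar>f x\<bar> powr p) \<partial>\<mu> s) < \<infinity>" by (simp add: ennreal_mult_less_top)
  then have "(\<integral>\<^sup>+x. ennreal (\<bar>G t s f x\<bar> powr p) \<partial>\<mu> t) < \<infinity>"
    by (rule le_less_trans[OF G_Lp_bound[OF assms(1,2)], rotated]) measurable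
  then show ?thesis by (simp add: Lp_iff_nn_integral)
qed

lemma Lp_diff:
  fixes u v :: "real^'n \<Rightarrow> 'z::euclidean_space"
  assumes "u \<in> Lp p (\<mu> t)" "v \<in> Lp p (\<mu> t)" "p > 0"
  shows "(\<lambda>x. u x - v x) \<in> Lp p (\<mu> t)"
proof -
  have [measurable]: "u \<in> borel_measurable borel" "v \<in> borel_measurable borel"
    using assms by (auto intro: Lp_mu_measurable)
  have "(\<integral>\<^sup>+x. ennreal (norm (u x + (- v x)) powr p) \<partial>\<mu> t) \<le> ennreal (2 powr p) * ((\<integral>\<^sup>+x. ennreal (norm (u x) powr p) \<partial>\<mu> t) + (\<integral>\<^sup>+x. ennreal (norm (- v x) powr p) \<partial>\<mu> t))"
    using assms(3) by (intro nn_integral_powr_add_le) auto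
  also have "\<dots> < \<infinity>" using assms by (simp add: Lp_iff_nn_integral ennreal_mult_less_top)
  finally show ?thesis by (simp add: Lp_iff_nn_integral)
qed

lemma C_b_approximation:
  assumes "f \<in> Lp p (\<mu> s)" "p > 0"
  obtains \<phi> where "\<And>k::nat. \<phi> k \<in> C_b" "(\<lambda>k. \<integral>\<^sup>+x. ennreal (\<bar>\<phi> k x - f x\<bar> powr p) \<partial>\<mu> s) \<longlonglongrightarrow> 0"
proof -
  have fin: "finite_measure (\<mu> s)" using prob_space_mu prob_space.finite_measure by blast
  have "\<exists>\<phi>\<in>C_b. (\<integral>\<^sup>+x. ennreal (\<bar>\<phi> x - f x\<bar> powr p) \<partial>\<mu> s) < ennreal (1 / real (Suc k))" for k
    by (rule C_b_dense_Lp[OF mu_eq_density rho_measurable fin assms]) simp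
  then obtain \<phi> where \<phi>: "\<And>k. \<phi> k \<in> C_b" "\<And>k. (\<integral>\<^sup>+x. ennreal (\<bar>\<phi> k x - f x\<bar> powr p) \<partial>\<mu> s) < ennreal (1 / real (Suc k))"
    by metis
  have "(\<lambda>k. ennreal (1 / real (Suc k))) \<longlonglongrightarrow> 0"
    unfolding ennreal_0[symmetric] by (intro tendsto_ennrealI LIMSEQ_Suc[OF lim_1_over_n])
  then have "(\<lambda>k. \<integral>\<^sup>+x. ennreal (\<bar>\<phi> k x - f x\<bar> powr p) \<partial>\<mu> s) \<longlonglongrightarrow> 0"
    by (rule ennreal_tendsto_0_squeeze[of _ "\<lambda>k. ennreal (1 / real (Suc k))", rotated]) (use \<phi>(2) less_imp_le in auto)
  with \<phi>(1) show ?thesis by (rule that)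
qed

text \<open>\<open>G t s f\<close> has the property \<open>P\<close> that the choice operator asks
  for, so the chosen function has it too. It may come with another approximating sequence, but along
  that sequence the images also converge to \<open>G t s f\<close>, so the two limits agree almost
  everywhere.\<close>

lemma evol_Lp_eq_G:
  assumes st: "s < t" and p: "p > 1" and f: "f \<in> Lp p (\<mu> s)"
  shows "evLp p t s f \<in> Lp p (\<mu> t)" "AE x in lborel. evLp p t s f x = G t s f x"
proof -
  have p0: "p > 0" using p by simp
  have fm[measurable]: "f \<in> borel_measurable borel" by (rule Lp_mu_measurable[OF f])
  define P where "P h \<longleftrightarrow> h \<in> Lp p (\<mu> t) \<and> (\<exists>\<phi> :: nat \<Rightarrow> real^'n \<Rightarrow> real. (\<forall>k. \<phi> k \<in> C_b) \<and>
        (\<lambda>k. Lp_norm p (\<mu> s) (\<lambda>x. \<phi> k x - f x)) \<longlonglongrightarrow> 0 \<and>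
        (\<lambda>k. Lp_norm p (\<mu> t) (\<lambda>x. evol A B g t s (\<phi> k) x - h x)) \<longlonglongrightarrow> 0)" for h
  have dL: "(\<lambda>x. \<phi> x - f x) \<in> Lp p (\<mu> s)" if "\<phi> \<in> C_b" for \<phi>
    by (rule Lp_diff[OF C_b_Lp[OF that p0] f p0])
  have GL: "G t s \<phi> \<in> Lp p (\<mu> t)" if "\<phi> \<in> C_b" for \<phi>
    by (rule G_in_Lp[OF st p C_b_Lp[OF that p0]])
  have ev: "evol A B g t s \<phi> = G t s \<phi>" if "\<phi> \<in> C_b" for \<phi> using evol_eq_G[OF that] st by simp
  have Gconv: "(\<lambda>k. \<integral>\<^sup>+x. ennreal (norm (G t s (\<phi> k) x - G t s f x) powr p) \<partial>\<mu> t) \<longlonglongrightarrow> 0"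
    if \<phi>: "\<And>k. \<phi> k \<in> C_b" and L: "(\<lambda>k. \<integral>\<^sup>+x. ennreal (\<bar>\<phi> k x - f x\<bar> powr p) \<partial>\<mu> s) \<longlonglongrightarrow> 0" for \<phi> :: "nat \<Rightarrow> real^'n \<Rightarrow> real"
  proof (rule ennreal_tendsto_0_squeeze)
    show "(\<integral>\<^sup>+x. ennreal (norm (G t s (\<phi> k) x - G t s f x) powr p) \<partial>\<mu> t) \<le> ennreal (2 powr p) * (\<integral>\<^sup>+x. ennreal (\<bar>\<phi> k x - f x\<bar> powr p) \<partial>\<mu> s)" for k
      using G_diff_Lp_bound[OF st p fm \<phi>[of k]] by (simp add: abs_minus_commute)
    show "(\<lambda>k. ennreal (2 powr p) * (\<integral>\<^sup>+x. ennreal (\<bar>\<phi> k x - f x\<bar> powr p) \<partial>\<mu> s)) \<longlonglongrightarrow> 0"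
      by (rule ennreal_tendsto_0_cmult[OF _ L]) simp
  qed
  have "P (G t s f)"
  proof -
    obtain \<phi> where \<phi>: "\<And>k::nat. \<phi> k \<in> C_b" and L: "(\<lambda>k. \<integral>\<^sup>+x. ennreal (\<bar>\<phi> k x - f x\<bar> powr p) \<partial>\<mu> s) \<longlonglongrightarrow> 0"
      by (rule C_b_approximation[OF f p0]) blast
    have 1: "(\<lambda>k. Lp_norm p (\<mu> s) (\<lambda>x. \<phi> k x - f x)) \<longlonglongrightarrow> 0"
      using L by (subst Lp_norm_tendsto_0[OF dL[OF \<phi>] p0]) simp
    have 2: "(\<lambda>k. Lp_norm p (\<mu> t) (\<lambda>x. G t s (\<phi> k) x - G t s f x)) \<longlonglongrightarrow> 0"
      by (subst Lp_norm_tendsto_0[OF Lp_diff[OF GL[OF \<phi>] G_in_Lp[OF st p f] p0] p0]) (rule Gconv[OF \<phi> L])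
    show ?thesis unfolding P_def using G_in_Lp[OF st p f] \<phi> 1 2 by (auto simp: ev[OF \<phi>] intro!: exI[of _ \<phi>])
  qed
  then have "P (SOME h. P h)" by (rule someI[of P])
  moreover have "(SOME h. P h) = evLp p t s f" unfolding evol_Lp_def P_def ..
  ultimately have Ph: "P (evLp p t s f)" by simp
  then show hL: "evLp p t s f \<in> Lp p (\<mu> t)" by (simp add: P_def)
  let ?h = "evLp p t s f"
  have [measurable]: "?h \<in> borel_measurable borel" by (rule Lp_mu_measurable[OF hL])
  obtain \<phi> :: "nat \<Rightarrow> real^'n \<Rightarrow> real" where \<phi>: "\<And>k. \<phi> k \<in> C_b"
    and 1: "(\<lambda>k. Lp_norm p (\<mu> s) (\<lambda>x. \<phi> k x - f x)) \<longlonglongrightarrow> 0"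
    and 2: "(\<lambda>k. Lp_norm p (\<mu> t) (\<lambda>x. evol A B g t s (\<phi> k) x - ?h x)) \<longlonglongrightarrow> 0"
    using Ph unfolding P_def by blast
  have [measurable]: "\<phi> k \<in> borel_measurable borel" for k by (rule C_bD(1)[OF \<phi>])
  have L1: "(\<lambda>k. \<integral>\<^sup>+x. ennreal (\<bar>\<phi> k x - f x\<bar> powr p) \<partial>\<mu> s) \<longlonglongrightarrow> 0"
    using 1 by (subst (asm) Lp_norm_tendsto_0[OF dL[OF \<phi>] p0]) simp
  have L2: "(\<lambda>k. \<integral>\<^sup>+x. ennreal (norm (G t s (\<phi> k) x - ?h x) powr p) \<partial>\<mu> t) \<longlonglongrightarrow> 0"
    using 2 unfolding ev[OF \<phi>] by (subst (asm) Lp_norm_tendsto_0[OF Lp_diff[OF GL[OF \<phi>] hL p0] p0])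
  have L3: "(\<lambda>k. \<integral>\<^sup>+x. ennreal (norm (G t s (\<phi> k) x - G t s f x) powr p) \<partial>\<mu> t) \<longlonglongrightarrow> 0" by (rule Gconv[OF \<phi> L1])
  let ?A = "\<integral>\<^sup>+x. ennreal (norm (?h x - G t s f x) powr p) \<partial>\<mu> t"
  have le: "?A \<le> ennreal (2 powr p) * ((\<integral>\<^sup>+x. ennreal (norm (G t s (\<phi> k) x - ?h x) powr p) \<partial>\<mu> t) + (\<integral>\<^sup>+x. ennreal (norm (G t s (\<phi> k) x - G t s f x) powr p) \<partial>\<mu> t))" for k
  proof -
    have "?A = (\<integral>\<^sup>+x. ennreal (norm ((?h x - G t s (\<phi> k) x) + (G t s (\<phi> k) x - G t s f x)) powr p) \<partial>\<mu> t)" by simp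
    also have "\<dots> \<le> ennreal (2 powr p) * ((\<integral>\<^sup>+x. ennreal (norm (?h x - G t s (\<phi> k) x) powr p) \<partial>\<mu> t) + (\<integral>\<^sup>+x. ennreal (norm (G t s (\<phi> k) x - G t s f x) powr p) \<partial>\<mu> t))"
      using p0 by (intro nn_integral_powr_add_le) auto
    finally show ?thesis by (simp only: norm_minus_commute[of "?h _"])
  qed
  have "(\<lambda>k. ennreal (2 powr p) * ((\<integral>\<^sup>+x. ennreal (norm (G t s (\<phi> k) x - ?h x) powr p) \<partial>\<mu> t) + (\<integral>\<^sup>+x. ennreal (norm (G t s (\<phi> k) x - G t s f x) powr p) \<partial>\<mu> t))) \<longlonglongrightarrow> 0"
    using tendsto_add[OF L2 L3] by (intro ennreal_tendsto_0_cmult) auto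
  then have "?A \<le> 0" by (rule LIMSEQ_le_const) (use le in auto)
  then have "?A = 0" by simp
  then have "AE x in \<mu> t. ennreal (norm (?h x - G t s f x) powr p) = 0"
    by (subst (asm) nn_integral_0_iff_AE) auto
  then have "AE x in \<mu> t. ?h x = G t s f x" by eventually_elim (auto simp: ennreal_eq_0_iff)
  then show "AE x in lborel. ?h x = G t s f x" by (simp add: AE_mu_iff)
qed

subsection \<open>Kernel representation of the gradient\<close>

text \<open>The formula of \<open>Gx\<close> freed from the assumption that \<open>f\<close> is
  bounded and continuous; for f in L^p it is the candidate for the weak gradient.\<close>

definition Kx where "Kx f s t x = (LINT y|lborel. (f y * kap s t x y) *\<^sub>R ww s t x y)" for f :: "real^'n \<Rightarrow> real"

lemma G_has_derivative_Kx:
  assumes "f \<in> C_b" "s < t"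
  shows "(G t s f has_derivative (\<lambda>h. Kx f s t x \<bullet> h)) (at x)" "continuous_on UNIV (Kx f s t)"
proof -
  have e: "Gx f s t = Kx f s t" by (rule ext) (simp add: Gx_def[OF assms(1)] Kx_def)
  show "(G t s f has_derivative (\<lambda>h. Kx f s t x \<bullet> h)) (at x)" using G_deriv_x[OF assms] by (simp add: e)
  have "isCont (Kx f s t) x" for x using Gx_deriv_x[OF assms, of x] has_derivative_continuous unfolding e by blast
  then show "continuous_on UNIV (Kx f s t)" by (simp add: continuous_at_imp_continuous_on)
qed

text \<open>The logarithmic gradient of the kernel in the coordinates y =
  \<open>mm s t x + Sf s t *v z\<close>, where it no longer depends on x.\<close>

definition vv where "vv s t z = transpose (U s t) *v (Pm s t *v (Sf s t *v z))"

lemma vv_measurable [measurable]: "vv s t \<in> borel_measurable borel" unfolding vv_def by measurable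

lemma ww_at_Sf: "ww s t x (mm s t x + Sf s t *v z) = vv s t z" by (simp add: ww_def vv_def)

lemma Kx_eq_stdg:
  assumes st: "s < t" and [measurable]: "f \<in> borel_measurable borel"
  shows "Kx f s t x = (LINT z|stdg. f (mm s t x + Sf s t *v z) *\<^sub>R vv s t z)"
proof -
  have "Kx f s t x = (LINT y|lborel. kap s t x y *\<^sub>R (f y *\<^sub>R ww s t x y))" by (simp add: Kx_def mult.commute)
  also have "\<dots> = (LINT y|normal (Qf s t) (mm s t x). f y *\<^sub>R ww s t x y)"
    unfolding normal_def kap_eq by (subst integral_density) auto
  also have "\<dots> = (LINT z|stdg. f (mm s t x + Sf s t *v z) *\<^sub>R ww s t x (mm s t x + Sf s t *v z))"
    unfolding normal_eq_distr[OF Sf[OF st]] by (subst integral_distr) auto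
  finally show ?thesis by (simp add: ww_at_Sf)
qed

text \<open>Let y = Q^{-1} S z. Then S^T y = z, so <Q y, y> = |z|^2, and Q >= \<open>lam\<close>
  yields |y| <= |z| / sqrt lam. That lower bound is where t - s >= 1 is used.\<close>

lemma vv_bound:
  assumes "t - s \<ge> 1"
  shows "norm (vv s t z) \<le> opn (U s t) / sqrt lam * norm z"
proof -
  have st: "s < t" using assms by simp
  let ?y = "Pm s t *v (Sf s t *v z)"
  have "Sf s t *v (transpose (Sf s t) *v ?y) = Sf s t *v z"
  proof -
    have "Sf s t *v (transpose (Sf s t) *v ?y) = (Sf s t ** transpose (Sf s t)) *v ?y"
      by (rule matrix_vector_mul_assoc)
    also have "\<dots> = (Qf s t ** matrix_inv (Qf s t)) *v (Sf s t *v z)"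
      unfolding Sf(2)[OF st] Pm_def by (simp only: matrix_vector_mul_assoc matrix_mul_assoc)
    finally show ?thesis by (simp add: matrix_inv_mult[OF Qf_invertible[OF st]])
  qed
  then have "matrix_inv (Sf s t) *v (Sf s t *v (transpose (Sf s t) *v ?y)) = matrix_inv (Sf s t) *v (Sf s t *v z)" by simp
  then have z: "transpose (Sf s t) *v ?y = z" by (simp only: matrix_inv_vec[OF Sf(1)[OF st]])
  have "lam * (norm ?y)\<^sup>2 \<le> (Qf s t *v ?y) \<bullet> ?y" using Qf_lower[of 1 t s ?y] assms by simp
  also have "\<dots> = (norm (transpose (Sf s t) *v ?y))\<^sup>2"
    by (simp add: Sf(2)[OF st, symmetric] matrix_vector_mul_assoc[symmetric] inner_matrix_transpose power2_norm_eq_inner)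
  also have "\<dots> = (norm z)\<^sup>2" by (simp only: z)
  finally have "sqrt (lam * (norm ?y)\<^sup>2) \<le> sqrt ((norm z)\<^sup>2)" by (rule real_sqrt_le_mono)
  then have y: "norm ?y \<le> norm z / sqrt lam" using lam_pos by (simp add: real_sqrt_mult field_simps)
  have "norm (vv s t z) \<le> opn (transpose (U s t)) * norm ?y" unfolding vv_def by (rule norm_mat_vec_le)
  also have "\<dots> \<le> opn (U s t) * (norm z / sqrt lam)" unfolding opn_transpose by (intro mult_left_mono y opn_nonneg)
  finally show ?thesis by simp
qed

lemma opn_U_pos: "opn (U s t) > 0"
proof -
  have "opn (U s t) \<noteq> 0"
  proof
    assume "opn (U s t) = 0"
    then have "U s t *v v = 0" for v using norm_mat_vec_le[of "U s t" v] by simp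
    then have "U t s *v (U s t *v v) = 0" for v by simp
    then have "v = 0" for v :: "real^'n" by (simp add: matrix_vector_mul_assoc U_inverse)
    from this[of "axis undefined 1"] show False by (simp add: axis_eq_0_iff)
  qed
  then show ?thesis using opn_nonneg[of "U s t"] by simp
qed

lemma stdg_weight_integrable: "q \<ge> 0 \<Longrightarrow> integrable stdg (\<lambda>z::real^'n. norm z powr q)"
  by (rule Bochner_Integration.integrable_bound[OF integrable_stdg_moment[of q]]) (auto intro!: powr_mono2)

text \<open>The crude Hoelder inequality with weight |z|: its moment of order q under
  \<open>stdg\<close> does not depend on s, t or x, so the flow enters only through
  \<open>opn (U s t)\<close>.\<close>

lemma Kx_powr_bound:
  assumes p: "p > 1"
  shows "\<exists>C>0. \<forall>s t x f. t - s \<ge> 1 \<longrightarrow> f \<in> borel_measurable borel \<longrightarrow>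
    ennreal (norm (Kx f s t x) powr p) \<le> ennreal ((C * opn (U s t)) powr p) * (\<integral>\<^sup>+z. ennreal (\<bar>f (mm s t x + Sf s t *v z)\<bar> powr p) \<partial>stdg)"
proof -
  define q where "q = p / (p - 1)"
  have q: "q > 1" using conjugate_exponent(1)[OF p q_def] .
  define K where "K = (LINT z|(stdg :: (real^'n) measure). norm z powr q)"
  have K0: "K \<ge> 0" by (simp add: K_def)
  have iq: "integrable stdg (\<lambda>z::real^'n. norm z powr q)" by (rule stdg_weight_integrable) (use q in simp)
  define C where "C = (1 + K) / sqrt lam"
  have C: "C > 0" using K0 lam_pos by (simp add: C_def)
  have "ennreal (norm (Kx f s t x) powr p) \<le> ennreal ((C * opn (U s t)) powr p) * (\<integral>\<^sup>+z. ennreal (\<bar>f (mm s t x + Sf s t *v z)\<bar> powr p) \<partial>stdg)"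
    (is "_ \<le> _ * ?X")
    if ts: "t - s \<ge> 1" and fm[measurable]: "f \<in> borel_measurable borel" for s t x f
  proof (cases "?X < \<infinity>")
    case False
    then have "?X = \<top>" by (simp add: less_top[symmetric])
    \<comment> \<open>With a zero factor the right side would be 0 rather than infinite;
      invertibility of the flow excludes this.\<close>
    moreover have "(C * opn (U s t)) powr p > 0" using C opn_U_pos[of s t] by simp
    ultimately show ?thesis by (simp add: ennreal_mult_top)
  next
    case True
    have st: "s < t" using ts by simp
    let ?h = "\<lambda>z. f (mm s t x + Sf s t *v z)"
    let ?b = "opn (U s t) / sqrt lam"
    have b0: "?b \<ge> 0" using opn_nonneg[of "U s t"] lam_pos by simp
    note H = weighted_integral_powr_le[OF p q_def, of ?h stdg norm K]
    have i: "integrable stdg (\<lambda>z. ?h z * norm z)" by (rule H(1)) (use iq True in \<open>auto simp: K_def\<close>)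
    then have i': "integrable stdg (\<lambda>z. \<bar>?h z\<bar> * norm z)"
      using integrable_abs[OF i] by (simp add: abs_mult)
    have le: "norm (?h z *\<^sub>R vv s t z) \<le> ?b * (\<bar>?h z\<bar> * norm z)" for z
      using mult_left_mono[OF vv_bound[OF ts, of z] abs_ge_zero[of "?h z"]] by (simp add: ac_simps)
    have ib: "integrable stdg (\<lambda>z. ?b * (\<bar>?h z\<bar> * norm z))" using i' by (rule integrable_mult_right)
    have ii: "integrable stdg (\<lambda>z. ?h z *\<^sub>R vv s t z)"
      by (rule Bochner_Integration.integrable_bound[OF ib]) (use order_trans[OF le abs_ge_self] in auto)
    have "norm (Kx f s t x) \<le> (LINT z|stdg. norm (?h z *\<^sub>R vv s t z))"
      unfolding Kx_eq_stdg[OF st fm] by (rule integral_norm_bound)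
    also have "\<dots> \<le> (LINT z|stdg. ?b * (\<bar>?h z\<bar> * norm z))"
      by (rule integral_mono[OF integrable_norm[OF ii] ib le])
    also have "\<dots> = ?b * (LINT z|stdg. \<bar>?h z\<bar> * norm z)" by simp
    finally have "norm (Kx f s t x) powr p \<le> (?b * (LINT z|stdg. \<bar>?h z\<bar> * norm z)) powr p"
      using p by (intro powr_mono2) auto
    also have "\<dots> = ?b powr p * (LINT z|stdg. \<bar>?h z\<bar> * norm z) powr p"
      using b0 by (intro powr_mult)
    finally have "ennreal (norm (Kx f s t x) powr p) \<le> ennreal (?b powr p) * ennreal ((LINT z|stdg. \<bar>?h z\<bar> * norm z) powr p)"
      by (simp add: ennreal_leI ennreal_mult[symmetric])
    also have "\<dots> \<le> ennreal (?b powr p) * (ennreal ((1 + K) powr p) * ?X)"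
      by (intro mult_left_mono H(2)) (use iq in \<open>auto simp: K_def\<close>)
    also have "\<dots> = ennreal ((?b * (1 + K)) powr p) * ?X"
    proof -
      have "(?b * (1 + K)) powr p = ?b powr p * (1 + K) powr p" by (rule powr_mult)
      then show ?thesis by (simp only: ennreal_mult[OF powr_ge_zero powr_ge_zero] mult.assoc)
    qed
    also have "?b * (1 + K) = C * opn (U s t)" by (simp add: C_def)
    finally show ?thesis .
  qed
  with C show ?thesis by blast
qed

lemma Kx_measurable [measurable]:
  assumes "s < t" and [measurable]: "f \<in> borel_measurable borel"
  shows "Kx f s t \<in> borel_measurable borel"
proof -
  have "Kx f s t = (\<lambda>x. LINT z|stdg. f (mm s t x + Sf s t *v z) *\<^sub>R vv s t z)"
    by (rule ext) (rule Kx_eq_stdg[OF assms])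
  also have "\<dots> \<in> borel_measurable borel" by (rule stdg.borel_measurable_lebesgue_integral) measurable
  finally show ?thesis .
qed

text \<open>Integrating the pointwise bound in x against \<open>mu\<close> at time t collapses the
  inner Gaussian average to \<open>mu\<close> at time s, by \<open>invariance\<close>.\<close>

lemma Kx_Lp_bound:
  assumes p: "p > 1"
  shows "\<exists>C>0. \<forall>s t f. t - s \<ge> 1 \<longrightarrow> f \<in> borel_measurable borel \<longrightarrow>
    (\<integral>\<^sup>+x. ennreal (norm (Kx f s t x) powr p) \<partial>\<mu> t) \<le> ennreal ((C * opn (U s t)) powr p) * (\<integral>\<^sup>+x. ennreal (\<bar>f x\<bar> powr p) \<partial>\<mu> s)"
proof -
  obtain C where C: "C > 0" "\<And>s t x f. t - s \<ge> 1 \<Longrightarrow> f \<in> borel_measurable borel \<Longrightarrow>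
    ennreal (norm (Kx f s t x) powr p) \<le> ennreal ((C * opn (U s t)) powr p) * (\<integral>\<^sup>+z. ennreal (\<bar>f (mm s t x + Sf s t *v z)\<bar> powr p) \<partial>stdg)"
    using Kx_powr_bound[OF p] by blast
  have "(\<integral>\<^sup>+x. ennreal (norm (Kx f s t x) powr p) \<partial>\<mu> t) \<le> ennreal ((C * opn (U s t)) powr p) * (\<integral>\<^sup>+x. ennreal (\<bar>f x\<bar> powr p) \<partial>\<mu> s)"
    if ts: "t - s \<ge> 1" and fm[measurable]: "f \<in> borel_measurable borel" for s t f
  proof -
    have st: "s < t" using ts by simp
    have "(\<integral>\<^sup>+x. ennreal (norm (Kx f s t x) powr p) \<partial>\<mu> t) \<le> (\<integral>\<^sup>+x. ennreal ((C * opn (U s t)) powr p) * (\<integral>\<^sup>+z. ennreal (\<bar>f (mm s t x + Sf s t *v z)\<bar> powr p) \<partial>stdg) \<partial>\<mu> t)"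
      by (intro nn_integral_mono C(2)[OF ts fm])
    also have "\<dots> = ennreal ((C * opn (U s t)) powr p) * (\<integral>\<^sup>+x. (\<integral>\<^sup>+z. ennreal (\<bar>f (mm s t x + Sf s t *v z)\<bar> powr p) \<partial>stdg) \<partial>\<mu> t)"
      by (rule nn_integral_cmult) measurable
    also have "(\<integral>\<^sup>+x. (\<integral>\<^sup>+z. ennreal (\<bar>f (mm s t x + Sf s t *v z)\<bar> powr p) \<partial>stdg) \<partial>\<mu> t) = (\<integral>\<^sup>+x. ennreal (\<bar>f x\<bar> powr p) \<partial>\<mu> s)"
      by (rule invariance[OF st]) measurable
    finally show ?thesis .
  qed
  with C(1) show ?thesis by blast
qed

end

section \<open>Comparison of the exponents\<close>

lemma powr_le_imp_le:
  fixes a b p :: real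
  assumes "a powr p \<le> b powr p" "p > 0" "b \<ge> 0"
  shows "a \<le> b"
proof (rule ccontr)
  assume "\<not> a \<le> b"
  then have "b powr p < a powr p" using assms by (intro powr_less_mono2) auto
  with assms show False by simp
qed

lemma Lp_norm_le:
  assumes "f \<in> Lp p M" "p > 0" "C \<ge> 0" "(\<integral>\<^sup>+x. ennreal (norm (f x) powr p) \<partial>M) \<le> ennreal (C powr p)"
  shows "Lp_norm p M f \<le> C"
proof (rule powr_le_imp_le[OF _ assms(2,3)])
  have "ennreal (Lp_norm p M f powr p) \<le> ennreal (C powr p)"
    unfolding Lp_norm_powr[OF assms(1,2)] by (rule assms(4))
  then show "Lp_norm p M f powr p \<le> C powr p" by simp
qed

lemma Lp_norm_ge:
  assumes "f \<in> Lp p M" "p > 0" "ennreal (C powr p) \<le> (\<integral>\<^sup>+x. ennreal (norm (f x) powr p) \<partial>M)"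
  shows "C \<le> Lp_norm p M f"
proof (rule powr_le_imp_le[OF _ assms(2) Lp_norm_nonneg])
  have "ennreal (C powr p) \<le> ennreal (Lp_norm p M f powr p)"
    unfolding Lp_norm_powr[OF assms(1,2)] by (rule assms(3))
  then show "C powr p \<le> Lp_norm p M f powr p" by simp
qed

lemma (in prob_space) integral_norm_le_Lp_norm:
  fixes F :: "'a \<Rightarrow> 'b::euclidean_space"
  assumes F: "F \<in> Lp p M" and p: "p > 1"
  shows "integrable M F" "(LINT x|M. norm (F x)) \<le> 2 * Lp_norm p M F"
proof -
  have Fm[measurable]: "F \<in> borel_measurable M" using F by (simp add: Lp_def)
  have fin: "(\<integral>\<^sup>+x. ennreal (norm (F x) powr p) \<partial>M) < \<infinity>" using F by (simp add: Lp_iff_nn_integral)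
  have "integrable M (\<lambda>x. norm (F x))" by (rule integral_powr_le(1)[OF p]) (use fin in auto)
  then show "integrable M F" by (simp add: integrable_norm_iff)
  have "ennreal ((LINT x|M. norm (F x)) powr p) \<le> ennreal (2 powr p) * (\<integral>\<^sup>+x. ennreal (norm (F x) powr p) \<partial>M)"
    using integral_powr_le(2)[OF p, of "\<lambda>x. norm (F x)"] by (simp add: prob_space abs_of_nonneg)
  also have "\<dots> = ennreal ((2 * Lp_norm p M F) powr p)"
    using p Lp_norm_powr[OF F] Lp_norm_nonneg[of p M F] by (simp add: powr_mult ennreal_mult)
  finally have "(LINT x|M. norm (F x)) powr p \<le> (2 * Lp_norm p M F) powr p" by simp
  then show "(LINT x|M. norm (F x)) \<le> 2 * Lp_norm p M F"
    by (rule powr_le_imp_le) (use p Lp_norm_nonneg[of p M F] in auto)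
qed

text \<open>In all sign cases the first-order remainder is at most (x - r)^2. The squared positive
  part is thus once continuously differentiable, which is the smoothness demanded of test
  functions.\<close>

lemma DERIV_square_pos_part: "((\<lambda>r::real. (max 0 r)\<^sup>2) has_real_derivative 2 * max 0 r) (at r)"
proof -
  have b: "\<bar>(max 0 x)\<^sup>2 - (max 0 r)\<^sup>2 - 2 * max 0 r * (x - r)\<bar> \<le> (x - r)\<^sup>2" for x
  proof (cases "r \<ge> 0")
    case r: True
    show ?thesis
    proof (cases "x \<ge> 0")
      case True
      have "x\<^sup>2 - r\<^sup>2 - 2 * r * (x - r) = (x - r)\<^sup>2" by (simp add: power2_eq_square algebra_simps)
      then show ?thesis using r True by (simp add: max_def)
    next
      case False
      then have "r * x \<le> 0" using r by (simp add: mult_nonneg_nonpos)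
      moreover have "(x - r)\<^sup>2 = r\<^sup>2 - 2 * (r * x) + x\<^sup>2" by (simp add: power2_eq_square algebra_simps)
      moreover have "(max 0 x)\<^sup>2 - (max 0 r)\<^sup>2 - 2 * max 0 r * (x - r) = r\<^sup>2 - 2 * (r * x)"
        using False r by (simp add: max_def power2_eq_square algebra_simps)
      moreover have "0 \<le> r\<^sup>2" "0 \<le> x\<^sup>2" by simp_all
      ultimately show ?thesis by linarith
    qed
  next
    case r: False
    then have "max 0 r = 0" by simp
    moreover have "(max 0 x)\<^sup>2 \<le> (x - r)\<^sup>2" unfolding abs_le_square_iff[symmetric] using r by auto
    ultimately show ?thesis by simp
  qed
  have "((\<lambda>x. ((max 0 x)\<^sup>2 - (max 0 r)\<^sup>2) / (x - r) - 2 * max 0 r) \<longlongrightarrow> 0) (at r)"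
  proof (rule Lim_null_comparison)
    show "\<forall>\<^sub>F x in at r. norm (((max 0 x)\<^sup>2 - (max 0 r)\<^sup>2) / (x - r) - 2 * max 0 r) \<le> \<bar>x - r\<bar>"
    proof (rule eventually_at_filter[THEN iffD2], rule always_eventually, intro allI impI)
      fix x :: real assume "x \<noteq> r"
      then have ne: "x - r \<noteq> 0" by simp
      then have "((max 0 x)\<^sup>2 - (max 0 r)\<^sup>2) / (x - r) - 2 * max 0 r
          = ((max 0 x)\<^sup>2 - (max 0 r)\<^sup>2 - 2 * max 0 r * (x - r)) / (x - r)"
        by (simp add: diff_divide_distrib)
      then have "norm (((max 0 x)\<^sup>2 - (max 0 r)\<^sup>2) / (x - r) - 2 * max 0 r)
          = \<bar>(max 0 x)\<^sup>2 - (max 0 r)\<^sup>2 - 2 * max 0 r * (x - r)\<bar> / \<bar>x - r\<bar>"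
        by (simp only: real_norm_def abs_divide)
      also have "\<dots> \<le> (x - r)\<^sup>2 / \<bar>x - r\<bar>" by (intro divide_right_mono b) simp
      also have "\<dots> = \<bar>x - r\<bar>"
      proof -
        have "(x - r)\<^sup>2 = \<bar>x - r\<bar> * \<bar>x - r\<bar>" by (simp add: power2_eq_square)
        then show ?thesis unfolding \<open>(x - r)\<^sup>2 = _\<close> using ne by (intro nonzero_mult_div_cancel_right) simp
      qed
      finally show "norm (((max 0 x)\<^sup>2 - (max 0 r)\<^sup>2) / (x - r) - 2 * max 0 r) \<le> \<bar>x - r\<bar>" .
    qed
    show "((\<lambda>x. \<bar>x - r\<bar>) \<longlongrightarrow> 0) (at r)" by (auto intro!: tendsto_eq_intros)
  qed
  then show ?thesis unfolding has_field_derivative_iff by (rule LIM_zero_cancel)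
qed

lemma test_function_exists:
  obtains \<phi> :: "real^'n \<Rightarrow> real" where "\<And>x. \<phi> differentiable (at x)" "continuous_on UNIV (grad \<phi>)"
    "compact (closure {x. \<phi> x \<noteq> 0})" "\<And>x. 0 \<le> \<phi> x" "\<And>x. \<phi> x \<le> indicator (cball 0 1) x"
    "continuous_on UNIV \<phi>" "(LINT x|lborel. \<phi> x) > 0"
proof -
  define \<phi> :: "real^'n \<Rightarrow> real" where "\<phi> x = (max 0 (1 - x \<bullet> x))\<^sup>2" for x
  have d: "(\<phi> has_derivative (\<lambda>h. ((- 4 * max 0 (1 - x \<bullet> x)) *\<^sub>R x) \<bullet> h)) (at x)" for x
  proof -
    have i: "((\<lambda>x::real^'n. 1 - x \<bullet> x) has_derivative (\<lambda>h. - 2 * (x \<bullet> h))) (at x)"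
      by (auto intro!: derivative_eq_intros simp: inner_commute)
    show ?thesis
      using has_derivative_compose[OF i DERIV_square_pos_part[of "1 - x \<bullet> x", unfolded has_field_derivative_def]]
      by (simp add: \<phi>_def[abs_def] algebra_simps)
  qed
  then have g: "grad \<phi> = (\<lambda>x. (- 4 * max 0 (1 - x \<bullet> x)) *\<^sub>R x)" using grad_unique by blast
  have gc: "continuous_on UNIV (grad \<phi>)" unfolding g by (intro continuous_intros)
  have c: "continuous_on UNIV \<phi>" unfolding \<phi>_def[abs_def] by (intro continuous_intros)
  have z: "\<phi> x = 0" if "x \<notin> cball 0 1" for x
  proof -
    have "1 \<le> x \<bullet> x" using that by (simp add: power2_norm_eq_inner[symmetric])
    then show ?thesis by (simp add: \<phi>_def)
  qed
  have le: "\<phi> x \<le> indicator (cball 0 1) x" for x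
  proof (cases "x \<in> cball 0 1")
    case True
    have "(max 0 (1 - x \<bullet> x))\<^sup>2 \<le> 1\<^sup>2" by (intro power_mono) auto
    then show ?thesis using True by (simp add: \<phi>_def)
  qed (simp add: z)
  have "{x. \<phi> x \<noteq> 0} \<subseteq> cball 0 1" using z by blast
  then have k: "compact (closure {x. \<phi> x \<noteq> 0})"
    unfolding compact_closure by (rule bounded_subset[OF bounded_cball])
  have [measurable]: "\<phi> \<in> borel_measurable borel" by (rule borel_measurable_continuous_onI[OF c])
  have fin: "emeasure lborel (cball (0::real^'n) r) < \<top>" for r using emeasure_lborel_cball_finite by (auto simp: less_top[symmetric])
  have fin': "emeasure lborel (ball (0::real^'n) r) < \<top>" for r using emeasure_lborel_ball_finite by (auto simp: less_top[symmetric])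
  have i1: "integrable lborel (indicator (cball 0 1) :: real^'n \<Rightarrow> real)"
    by (rule integrable_real_indicator) (use fin in auto)
  have i: "integrable lborel \<phi>"
    by (rule Bochner_Integration.integrable_bound[OF i1]) (use le in \<open>auto simp: \<phi>_def\<close>)
  have i2: "integrable lborel (\<lambda>x::real^'n. (1 / 4 :: real) * indicator (ball 0 (1 / 2)) x)"
    by (intro integrable_mult_right integrable_real_indicator) (use fin' in auto)
  have "0 < 1 / 4 * measure lborel (ball (0::real^'n) (1 / 2))" using content_ball_pos[of "1/2" "0::real^'n"] by simp
  also have "\<dots> = (LINT x|lborel. 1 / 4 * indicator (ball (0::real^'n) (1 / 2)) x)" by simp
  also have "\<dots> \<le> (LINT x|lborel. \<phi> x)"
  proof (rule integral_mono[OF i2 i])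
    fix x :: "real^'n"
    have "1 / 4 \<le> \<phi> x" if "x \<in> ball 0 (1 / 2)"
    proof -
      have "(norm x)\<^sup>2 \<le> (1 / 2)\<^sup>2" using that by (intro power_mono) auto
      moreover have "x \<bullet> x = (norm x)\<^sup>2" by (rule power2_norm_eq_inner[symmetric])
      moreover have "(1 / 2 :: real)\<^sup>2 = 1 / 4" by (simp add: power2_eq_square)
      ultimately have "1 / 2 \<le> 1 - x \<bullet> x" by linarith
      then have "(1 / 2)\<^sup>2 \<le> \<phi> x" unfolding \<phi>_def by (intro power_mono) auto
      then show ?thesis by (simp add: power2_eq_square)
    qed
    moreover have "0 \<le> \<phi> x" by (simp add: \<phi>_def)
    ultimately show "1 / 4 * indicator (ball 0 (1 / 2)) x \<le> \<phi> x" by (auto simp: indicator_def)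
  qed
  finally have pos: "(LINT x|lborel. \<phi> x) > 0" .
  show ?thesis
  proof (rule that[OF _ gc k _ le c pos])
    show "\<phi> differentiable (at x)" for x using d unfolding differentiable_def by blast
    show "0 \<le> \<phi> x" for x by (simp add: \<phi>_def)
  qed
qed

section \<open>The common growth condition and its necessity\<close>

context ornstein_uhlenbeck
begin

definition decay_rate where
  "decay_rate \<omega> \<longleftrightarrow> (\<exists>M. \<forall>s t. t - s \<ge> 1 \<longrightarrow> opn (U s t) \<le> M * exp (\<omega> * (t - s)))"

lemma decay_rate_of_gt_omega0:
  assumes "omega0 U < \<omega>"
  shows "decay_rate \<omega>"
proof -
  obtain M where "\<And>t s. t \<le> s \<Longrightarrow> opn (U t s) \<le> M * exp (\<omega> * (s - t))" using decay_of_gt_omega0[OF assms] by blast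
  then have "\<forall>s t. t - s \<ge> 1 \<longrightarrow> opn (U s t) \<le> M * exp (\<omega> * (t - s))" by simp
  then show ?thesis unfolding decay_rate_def by blast
qed

lemma Rf_opn_bound: "\<exists>r\<ge>0. \<forall>t. opn (Rf t) \<le> r"
proof -
  obtain C where C: "C > 0" "\<And>s v. (cov B U s *v v) \<bullet> v \<le> C * (norm v)\<^sup>2" using cov_upper by blast
  have "opn (Rf t) \<le> sqrt C" for t by (rule opn_factor_le[OF Rf(2)]) (use C in auto)
  moreover have "sqrt C \<ge> 0" using C by simp
  ultimately show ?thesis by blast
qed

lemma linear_in_Lp:
  assumes p: "p > 0"
  shows "\<exists>C>0. \<forall>t v. (\<lambda>x. x \<bullet> v) \<in> Lp p (\<mu> t) \<and> Lp_norm p (\<mu> t) (\<lambda>x. x \<bullet> v) \<le> C * norm v"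
proof -
  obtain r where r: "r \<ge> 0" "\<And>t. opn (Rf t) \<le> r" using Rf_opn_bound by blast
  obtain m where m: "\<And>t. norm (mean g U t) \<le> m" using mean_bound by blast
  have m0: "m \<ge> 0" using m[of 0] norm_ge_zero order_trans by blast
  define J where "J = (LINT z|(stdg :: (real^'n) measure). (1 + norm z) powr p)"
  have J0: "J \<ge> 0" by (simp add: J_def)
  define D where "D = m + r + 1"
  have D: "D > 0" using m0 r by (simp add: D_def)
  \<comment> \<open>The root 1/p undoes the power in \<open>Lp_norm\<close>; the ones added to J
    here and in \<open>D\<close> only keep the constant positive.\<close>
  define C where "C = D * (J + 1) powr (1 / p)"
  have C: "C > 0" using D J0 by (simp add: C_def)
  have "(\<lambda>x. x \<bullet> v) \<in> Lp p (\<mu> t) \<and> Lp_norm p (\<mu> t) (\<lambda>x. x \<bullet> v) \<le> C * norm v" for t and v :: "real^'n"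
  proof -
    have pt: "\<bar>(mean g U t + Rf t *v z) \<bullet> v\<bar> powr p \<le> (D * norm v) powr p * (1 + norm z) powr p" for z
    proof -
      have "norm (mean g U t + Rf t *v z) \<le> m + r * norm z"
      proof -
        have "norm (Rf t *v z) \<le> r * norm z"
          by (rule order_trans[OF norm_mat_vec_le mult_right_mono[OF r(2)]]) simp
        then show ?thesis using norm_triangle_ineq[of "mean g U t" "Rf t *v z"] m[of t] by linarith
      qed
      also have "\<dots> \<le> D * (1 + norm z)"
        using m0 r(1) by (simp add: D_def algebra_simps)
      finally have n: "norm (mean g U t + Rf t *v z) \<le> D * (1 + norm z)" .
      have "\<bar>(mean g U t + Rf t *v z) \<bullet> v\<bar> \<le> norm (mean g U t + Rf t *v z) * norm v" by (rule Cauchy_Schwarz_ineq2)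
      also have "\<dots> \<le> (D * (1 + norm z)) * norm v" by (intro mult_right_mono n) simp
      finally have "\<bar>(mean g U t + Rf t *v z) \<bullet> v\<bar> \<le> (D * norm v) * (1 + norm z)" by (simp add: ac_simps)
      then have "\<bar>(mean g U t + Rf t *v z) \<bullet> v\<bar> powr p \<le> ((D * norm v) * (1 + norm z)) powr p"
        using p by (intro powr_mono2) auto
      also have "\<dots> = (D * norm v) powr p * (1 + norm z) powr p" by (rule powr_mult)
      finally show ?thesis .
    qed
    have i: "integrable stdg (\<lambda>z::real^'n. (D * norm v) powr p * (1 + norm z) powr p)"
      by (intro integrable_mult_right integrable_stdg_moment) (use p in simp)
    have "(\<integral>\<^sup>+x. ennreal (\<bar>x \<bullet> v\<bar> powr p) \<partial>\<mu> t) = (\<integral>\<^sup>+z. ennreal (\<bar>(mean g U t + Rf t *v z) \<bullet> v\<bar> powr p) \<partial>stdg)"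
      by (rule nn_integral_mu) measurable
    also have "\<dots> \<le> (\<integral>\<^sup>+z. ennreal ((D * norm v) powr p * (1 + norm (z::real^'n)) powr p) \<partial>stdg)"
      by (intro nn_integral_mono ennreal_leI pt)
    also have "\<dots> = ennreal ((D * norm v) powr p * J)"
      unfolding J_def by (subst nn_integral_eq_integral[OF i]) auto
    also have "\<dots> \<le> ennreal ((C * norm v) powr p)"
    proof (rule ennreal_leI)
      have "(C * norm v) powr p = (D * norm v) powr p * (J + 1)"
        using J0 p by (simp add: C_def powr_mult powr_powr mult.commute mult.left_commute)
      then show "(D * norm v) powr p * J \<le> (C * norm v) powr p" by (simp add: mult_left_mono)
    qed
    finally have le: "(\<integral>\<^sup>+x. ennreal (norm (x \<bullet> v) powr p) \<partial>\<mu> t) \<le> ennreal ((C * norm v) powr p)" by simp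
    have L: "(\<lambda>x. x \<bullet> v) \<in> Lp p (\<mu> t)"
      using le_less_trans[OF le] by (simp add: Lp_iff_nn_integral)
    show ?thesis using L Lp_norm_le[OF L p _ le] C by simp
  qed
  with C show ?thesis by blast
qed

text \<open>With x - mean = R z the pairing with w becomes <z, R^T w>, and |R^T w|^2 = <cov w, w> >=
  \<open>lam\<close> |w|^2 makes the constant independent of t.\<close>

lemma centered_linear_moment_lower:
  assumes p: "p > 0"
  shows "\<exists>c>0. \<forall>t w. ennreal ((c * norm w) powr p) \<le> (\<integral>\<^sup>+x. ennreal (\<bar>(x - mean g U t) \<bullet> w\<bar> powr p) \<partial>\<mu> t)"
proof -
  obtain c where c: "c > 0" "\<And>w::real^'n. ennreal (c * norm w powr p) \<le> (\<integral>\<^sup>+z. ennreal (\<bar>z \<bullet> w\<bar> powr p) \<partial>stdg)"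
    using stdg_linear_moment_lower[OF p] by blast
  define b where "b = c powr (1 / p) * sqrt lam"
  have "b > 0" using c lam_pos by (simp add: b_def)
  moreover have "ennreal ((b * norm w) powr p) \<le> (\<integral>\<^sup>+x. ennreal (\<bar>(x - mean g U t) \<bullet> w\<bar> powr p) \<partial>\<mu> t)" for t w
  proof -
    have "lam * (norm w)\<^sup>2 \<le> (cov B U t *v w) \<bullet> w" by (rule cov_lower)
    also have "\<dots> = (norm (transpose (Rf t) *v w))\<^sup>2"
      by (simp add: Rf(2)[symmetric] matrix_vector_mul_assoc[symmetric] inner_matrix_transpose power2_norm_eq_inner)
    finally have "sqrt (lam * (norm w)\<^sup>2) \<le> sqrt ((norm (transpose (Rf t) *v w))\<^sup>2)" by (rule real_sqrt_le_mono)
    then have n: "sqrt lam * norm w \<le> norm (transpose (Rf t) *v w)" by (simp add: real_sqrt_mult)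
    have "(b * norm w) powr p = c * (sqrt lam * norm w) powr p"
      using c p by (simp add: b_def powr_mult powr_powr mult.assoc)
    also have "\<dots> \<le> c * norm (transpose (Rf t) *v w) powr p"
      using n c p lam_pos by (intro mult_left_mono powr_mono2) auto
    finally have "ennreal ((b * norm w) powr p) \<le> ennreal (c * norm (transpose (Rf t) *v w) powr p)" by (rule ennreal_leI)
    also have "\<dots> \<le> (\<integral>\<^sup>+z. ennreal (\<bar>z \<bullet> (transpose (Rf t) *v w)\<bar> powr p) \<partial>stdg)" by (rule c(2))
    also have "\<dots> = (\<integral>\<^sup>+z. ennreal (\<bar>((mean g U t + Rf t *v z) - mean g U t) \<bullet> w\<bar> powr p) \<partial>stdg)"
      by (simp add: inner_matrix_transpose)
    also have "\<dots> = (\<integral>\<^sup>+x. ennreal (\<bar>(x - mean g U t) \<bullet> w\<bar> powr p) \<partial>\<mu> t)"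
      by (rule nn_integral_mu[symmetric]) measurable
    finally show ?thesis .
  qed
  ultimately show ?thesis by blast
qed

lemma integral_mu_linear: "(LINT x|\<mu> s. x \<bullet> v) = mean g U s \<bullet> v"
proof -
  have "(LINT x|\<mu> s. x \<bullet> v) = (LINT z|stdg. (mean g U s + Rf s *v z) \<bullet> v)"
    unfolding mu_eq_distr by (rule integral_distr) measurable
  also have "\<dots> = (LINT z|stdg. mean g U s \<bullet> v + z \<bullet> (transpose (Rf s) *v v))"
    by (simp add: inner_add_left inner_matrix_transpose)
  also have "\<dots> = mean g U s \<bullet> v"
    by (subst Bochner_Integration.integral_add) (auto simp: stdg_integrable_linear stdg_mean_zero)
  finally show ?thesis .
qed

lemma G_linear: "G t s (\<lambda>x. x \<bullet> v) x = mm s t x \<bullet> v"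
proof -
  have "G t s (\<lambda>x. x \<bullet> v) x = (LINT z|stdg. mm s t x \<bullet> v + z \<bullet> (transpose (Sf s t) *v v))"
    by (simp add: G_def inner_add_left inner_matrix_transpose)
  also have "\<dots> = mm s t x \<bullet> v"
    by (subst Bochner_Integration.integral_add) (auto simp: stdg_integrable_linear stdg_mean_zero)
  finally show ?thesis .
qed

text \<open>By \<open>mean_split\<close> the shift \<open>gf s t\<close> cancels, leaving a linear
  function of the centred variable.\<close>

lemma G_linear_centered:
  assumes "s < t"
  shows "G t s (\<lambda>x. x \<bullet> v) x - mean g U s \<bullet> v = (x - mean g U t) \<bullet> (transpose (U s t) *v v)"
proof -
  have "mm s t x - mean g U s = U s t *v (x - mean g U t)"
    using mean_split[of s t] assms by (simp add: mm_def matrix_vector_mult_diff_distrib)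
  then show ?thesis unfolding G_linear by (simp add: inner_diff_left[symmetric] inner_matrix_transpose)
qed

lemma decay_rateI:
  assumes "\<And>s t v. t - s \<ge> 1 \<Longrightarrow> norm (transpose (U s t) *v v) \<le> M * exp (\<omega> * (t - s)) * norm v"
  shows "decay_rate \<omega>"
proof -
  have "opn (U s t) \<le> M * exp (\<omega> * (t - s))" if "t - s \<ge> 1" for s t
    unfolding opn_transpose[of "U s t", symmetric] by (rule onorm_le) (rule assms[OF that])
  then show ?thesis unfolding decay_rate_def by blast
qed

text \<open>The centred image of <x, v> has norm at least c |U(s,t)^T v|, while <x, v> has norm at
  most C |v|; both constants are uniform in time, so the assumed estimate bounds the flow.\<close>

lemma decay_exponents_imp_decay_rate:
  assumes p: "p > 1" and \<omega>: "\<omega> \<in> decay_exponents A B g U p"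
  shows "decay_rate \<omega>"
proof -
  have p0: "p > 0" using p by simp
  obtain M where M: "M > 0" "\<And>s t f. s < t \<Longrightarrow> f \<in> Lp p (\<mu> s) \<Longrightarrow>
     Lp_norm p (\<mu> t) (\<lambda>x. evLp p t s f x - (LINT y|\<mu> s. f y)) \<le> M * exp (\<omega> * (t - s)) * Lp_norm p (\<mu> s) f"
    using \<omega> unfolding decay_exponents_def by blast
  obtain C where C: "C > 0" "\<And>t v. (\<lambda>x. x \<bullet> v) \<in> Lp p (\<mu> t)" "\<And>t v. Lp_norm p (\<mu> t) (\<lambda>x. x \<bullet> v) \<le> C * norm v"
    using linear_in_Lp[OF p0] by blast
  obtain c where c: "c > 0" "\<And>t w. ennreal ((c * norm w) powr p) \<le> (\<integral>\<^sup>+x. ennreal (\<bar>(x - mean g U t) \<bullet> w\<bar> powr p) \<partial>\<mu> t)"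
    using centered_linear_moment_lower[OF p0] by blast
  show ?thesis
  proof (rule decay_rateI[of "M * C / c"])
    fix s t :: real and v :: "real^'n" assume "t - s \<ge> 1"
    then have st: "s < t" by simp
    let ?w = "transpose (U s t) *v v" and ?f = "\<lambda>x. x \<bullet> v"
    let ?h = "\<lambda>x. evLp p t s ?f x - (LINT y|\<mu> s. ?f y)"
    have hL: "?h \<in> Lp p (\<mu> t)"
      by (intro Lp_diff evol_Lp_eq_G(1)[OF st p C(2)] C_b_Lp p0) (auto simp: C_b_def)
    have "AE x in \<mu> t. ?h x = (x - mean g U t) \<bullet> ?w"
      using evol_Lp_eq_G(2)[OF st p C(2), of v] unfolding AE_mu_iff integral_mu_linear
      by eventually_elim (simp add: G_linear_centered[OF st])
    then have "AE x in \<mu> t. ennreal (norm (?h x) powr p) = ennreal (\<bar>(x - mean g U t) \<bullet> ?w\<bar> powr p)"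
      by eventually_elim (simp only: real_norm_def)
    then have "(\<integral>\<^sup>+x. ennreal (norm (?h x) powr p) \<partial>\<mu> t) = (\<integral>\<^sup>+x. ennreal (\<bar>(x - mean g U t) \<bullet> ?w\<bar> powr p) \<partial>\<mu> t)"
      by (rule nn_integral_cong_AE)
    then have "ennreal ((c * norm ?w) powr p) \<le> (\<integral>\<^sup>+x. ennreal (norm (?h x) powr p) \<partial>\<mu> t)" using c(2) by simp
    then have "c * norm ?w \<le> Lp_norm p (\<mu> t) ?h" by (rule Lp_norm_ge[OF hL p0])
    also have "\<dots> \<le> M * exp (\<omega> * (t - s)) * Lp_norm p (\<mu> s) ?f" by (rule M(2)[OF st C(2)])
    also have "\<dots> \<le> M * exp (\<omega> * (t - s)) * (C * norm v)" using M(1) by (intro mult_left_mono C(3)) auto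
    finally show "norm ?w \<le> M * C / c * exp (\<omega> * (t - s)) * norm v" using c(1) by (simp add: field_simps)
  qed
qed

text \<open>Uniform in t: the means are bounded, the determinants are bounded above because the
  covariances stay in a compact set, and \<open>lam\<close> bounds the inverse covariance. It
  compares Lebesgue integrals over bounded sets with integrals against \<open>mu\<close>.\<close>

lemma rho_lower: "\<exists>c>0. \<forall>t x. norm x \<le> r \<longrightarrow> c \<le> rho t x"
proof (cases "r \<ge> 0")
  case r: True
  obtain C where C: "\<And>s. norm (cov B U s) \<le> C" using cov_norm_bound by blast
  obtain m where m: "\<And>t. norm (mean g U t) \<le> m" using mean_bound by blast
  have m0: "m \<ge> 0" using m[of 0] norm_ge_zero order_trans by blast
  have "continuous_on (cball 0 C) (det :: real^'n^'n \<Rightarrow> real)" unfolding det_def[abs_def] by (intro continuous_intros)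
  then have "bounded ((det :: real^'n^'n \<Rightarrow> real) ` cball 0 C)"
    by (intro compact_imp_bounded compact_continuous_image) auto
  then obtain D where "\<forall>M\<in>cball 0 C. \<bar>det (M::real^'n^'n)\<bar> \<le> D" unfolding bounded_iff by auto
  then have D: "\<And>M::real^'n^'n. norm M \<le> C \<Longrightarrow> \<bar>det M\<bar> \<le> D" by simp
  let ?k = "(2 * pi) powr (- real CARD('n) / 2)"
  define c where "c = ?k * (D + 1) powr (- 1 / 2) * exp (- 1 / 2 * ((r + m)\<^sup>2 / lam))"
  have D1: "D + 1 > 0" using D[OF C[of 0]] abs_ge_zero[of "det (cov B U 0)"] by linarith
  have "c > 0" using D1 by (simp add: c_def)
  moreover have "c \<le> rho t x" if x: "norm x \<le> r" for t x
  proof -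
    have dp: "det (cov B U t) > 0"
    proof -
      have "det (Rf t) \<noteq> 0" using Rf(1)[of t] by (simp add: invertible_det_nz)
      then show ?thesis unfolding det_factor[OF Rf(2)] by simp
    qed
    have 1: "(D + 1) powr (- 1 / 2) \<le> det (cov B U t) powr (- 1 / 2)"
      using D[OF C[of t]] dp by (intro powr_mono2') auto
    let ?y = "x - mean g U t"
    have y: "norm ?y \<le> r + m" using norm_triangle_ineq4[of x "mean g U t"] m[of t] x by linarith
    have "(matrix_inv (cov B U t) *v ?y) \<bullet> ?y \<le> norm (matrix_inv (cov B U t) *v ?y) * norm ?y" by (rule norm_cauchy_schwarz)
    also have "\<dots> \<le> (norm ?y / lam) * norm ?y"
      by (intro mult_right_mono inverse_posdef_bound(2)[OF lam_pos cov_lower]) simp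
    also have "\<dots> = (norm ?y)\<^sup>2 / lam" by (simp add: power2_eq_square)
    also have "\<dots> \<le> (r + m)\<^sup>2 / lam" using y lam_pos by (intro divide_right_mono power_mono) auto
    finally have 2: "exp (- 1 / 2 * ((r + m)\<^sup>2 / lam)) \<le> exp (- 1 / 2 * ((matrix_inv (cov B U t) *v ?y) \<bullet> ?y))" by simp
    show ?thesis unfolding c_def rho_def gauss_density_def
      by (intro mult_mono 1 2 mult_left_mono mult_nonneg_nonneg) auto
  qed
  ultimately show ?thesis by blast
next
  case False
  then have "\<not> norm (x::real^'n) \<le> r" for x using norm_ge_zero[of x] by linarith
  then show ?thesis by (intro exI[of _ 1]) auto
qed

lemma integrable_mu_iff_lborel:
  fixes F :: "real^'n \<Rightarrow> 'z::{banach,second_countable_topology}"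
  assumes [measurable]: "F \<in> borel_measurable borel"
  shows "integrable (\<mu> t) F \<longleftrightarrow> integrable lborel (\<lambda>x. rho t x *\<^sub>R F x)"
  unfolding mu_eq_density by (rule integrable_density) (auto simp: rho_pos less_imp_le)

text \<open>The weak gradient F is only known through test functions, so it is averaged with a fixed
  bump: the integral of \<phi> F equals that of \<phi> times U(s,t)^T v. As the density
  \<open>rho\<close> is at least c on the unit ball, this average is controlled by the L^1 norm
  under \<open>mu\<close>, and so by the L^p norm.\<close>

lemma gradient_decay_exponents_imp_decay_rate:
  assumes p: "p > 1" and \<omega>: "\<omega> \<in> gradient_decay_exponents A B g U p"
  shows "decay_rate \<omega>"
proof -
  have p0: "p > 0" using p by simp
  obtain N where N: "N > 0" "\<And>s t f. t - s \<ge> 1 \<Longrightarrow> f \<in> Lp p (\<mu> s) \<Longrightarrow>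
     \<exists>F. has_weak_gradient (evLp p t s f) F \<and> F \<in> Lp p (\<mu> t) \<and> Lp_norm p (\<mu> t) F \<le> N * exp (\<omega> * (t - s)) * Lp_norm p (\<mu> s) f"
    using \<omega> unfolding gradient_decay_exponents_def by blast
  obtain C where C: "C > 0" "\<And>t v. (\<lambda>x. x \<bullet> v) \<in> Lp p (\<mu> t)" "\<And>t v. Lp_norm p (\<mu> t) (\<lambda>x. x \<bullet> v) \<le> C * norm v"
    using linear_in_Lp[OF p0] by blast
  obtain c where c: "c > 0" "\<And>t x. norm x \<le> 1 \<Longrightarrow> c \<le> rho t x" using rho_lower[of 1] by blast
  obtain \<phi> :: "real^'n \<Rightarrow> real" where \<phi>: "\<And>x. \<phi> differentiable (at x)" "continuous_on UNIV (grad \<phi>)"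
    "compact (closure {x. \<phi> x \<noteq> 0})" "\<And>x. 0 \<le> \<phi> x" "\<And>x. \<phi> x \<le> indicator (cball 0 1) x"
    "continuous_on UNIV \<phi>" "(LINT x|lborel. \<phi> x) > 0"
    by (rule test_function_exists) blast
  have [measurable]: "\<phi> \<in> borel_measurable borel" "grad \<phi> \<in> borel_measurable borel"
    by (rule borel_measurable_continuous_onI; fact)+
  let ?K = "LINT x|lborel. \<phi> x"
  show ?thesis
  proof (rule decay_rateI[of "2 * N * C / (c * ?K)"])
    fix s t :: real and v :: "real^'n" assume ts: "t - s \<ge> 1"
    then have st: "s < t" by simp
    let ?w = "transpose (U s t) *v v" and ?f = "\<lambda>x. x \<bullet> v"
    let ?h = "evLp p t s ?f"
    obtain F where F: "has_weak_gradient ?h F" "F \<in> Lp p (\<mu> t)"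
      "Lp_norm p (\<mu> t) F \<le> N * exp (\<omega> * (t - s)) * Lp_norm p (\<mu> s) ?f"
      using N(2)[OF ts C(2)] by blast
    have [measurable]: "F \<in> borel_measurable borel" by (rule Lp_mu_measurable[OF F(2)])
    have [measurable]: "?h \<in> borel_measurable borel" by (rule Lp_mu_measurable[OF evol_Lp_eq_G(1)[OF st p C(2)]])
    have d: "((\<lambda>x. mm s t x \<bullet> v) has_derivative (\<lambda>h. ?w \<bullet> h)) (at x)" for x
    proof -
      have "((\<lambda>x. x \<bullet> ?w + gf s t \<bullet> v) has_derivative (\<lambda>h. ?w \<bullet> h)) (at x)"
        by (auto intro!: derivative_eq_intros simp: inner_commute)
      then show ?thesis by (simp only: mm_def inner_add_left inner_matrix_transpose)
    qed
    have "(LINT x|lborel. ?h x *\<^sub>R grad \<phi> x) = (LINT x|lborel. (mm s t x \<bullet> v) *\<^sub>R grad \<phi> x)"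
    proof (rule integral_cong_AE)
      show "AE x in lborel. ?h x *\<^sub>R grad \<phi> x = (mm s t x \<bullet> v) *\<^sub>R grad \<phi> x"
        using evol_Lp_eq_G(2)[OF st p C(2), of v] by eventually_elim (simp add: G_linear)
    qed measurable
    also have "\<dots> = - (LINT x|lborel. \<phi> x *\<^sub>R ?w)"
      by (rule integral_by_parts_compact_support[OF d _ \<phi>(1,2,3)]) simp
    finally have "(LINT x|lborel. ?h x *\<^sub>R grad \<phi> x) = - (LINT x|lborel. \<phi> x *\<^sub>R ?w)" .
    moreover have "(LINT x|lborel. ?h x *\<^sub>R grad \<phi> x) = - (LINT x|lborel. \<phi> x *\<^sub>R F x)"
      using F(1) \<phi>(1,2,3) unfolding has_weak_gradient_def by blast
    ultimately have e: "(LINT x|lborel. \<phi> x *\<^sub>R ?w) = (LINT x|lborel. \<phi> x *\<^sub>R F x)" by simp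
    note Fi = prob_space.integral_norm_le_Lp_norm[OF prob_space_mu F(2) p]
    have "integrable (\<mu> t) (\<lambda>x. norm (F x))" by (rule integrable_norm[OF Fi(1)])
    then have i1: "integrable lborel (\<lambda>x. rho t x * norm (F x))" by (simp add: integrable_mu_iff_lborel)
    then have i2: "integrable lborel (\<lambda>x. 1 / c * (rho t x * norm (F x)))" by (rule integrable_mult_right)
    have b: "norm (\<phi> x *\<^sub>R F x) \<le> 1 / c * (rho t x * norm (F x))" for x
    proof -
      have "\<phi> x \<le> rho t x / c"
      proof (cases "norm x \<le> 1")
        case True
        then have "1 \<le> rho t x / c" using c by simp
        then show ?thesis using \<phi>(5)[of x] True by simp
      next
        case False
        then have "\<phi> x \<le> 0" using \<phi>(5)[of x] by simp
        moreover have "0 \<le> rho t x / c" using rho_pos[of t x] c(1) by simp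
        ultimately show ?thesis by linarith
      qed
      then show ?thesis using mult_right_mono[OF _ norm_ge_zero[of "F x"]] \<phi>(4)[of x] by fastforce
    qed
    have i3: "integrable lborel (\<lambda>x. \<phi> x *\<^sub>R F x)"
      by (rule Bochner_Integration.integrable_bound[OF i2]) (use order_trans[OF b abs_ge_self] in auto)
    have "?K * norm ?w = norm (LINT x|lborel. \<phi> x *\<^sub>R ?w)"
      \<comment> \<open>A non-integrable function would have integral 0 by convention; positivity of
        the integral rules this out.\<close>
      using \<phi>(7) by (cases "integrable lborel \<phi>") (auto simp: not_integrable_integral_eq)
    also have "\<dots> \<le> (LINT x|lborel. norm (\<phi> x *\<^sub>R F x))" unfolding e by (rule integral_norm_bound)
    also have "\<dots> \<le> (LINT x|lborel. 1 / c * (rho t x * norm (F x)))"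
      by (rule integral_mono[OF integrable_norm[OF i3] i2 b])
    also have "\<dots> = 1 / c * (LINT x|\<mu> t. norm (F x))"
      unfolding mu_eq_density by (subst integral_density) (auto simp: rho_pos less_imp_le)
    also have "\<dots> \<le> 1 / c * (2 * (N * exp (\<omega> * (t - s)) * (C * norm v)))"
    proof -
      have "N * exp (\<omega> * (t - s)) * Lp_norm p (\<mu> s) ?f \<le> N * exp (\<omega> * (t - s)) * (C * norm v)"
        using N(1) by (intro mult_left_mono C(3)) auto
      then have "(LINT x|\<mu> t. norm (F x)) \<le> 2 * (N * exp (\<omega> * (t - s)) * (C * norm v))" using Fi(2) F(3) by linarith
      then show ?thesis using c(1) by (intro mult_left_mono) auto
    qed
    finally have "?K * norm ?w \<le> 1 / c * (2 * (N * exp (\<omega> * (t - s)) * (C * norm v)))" .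
    then have "norm ?w \<le> (1 / c * (2 * (N * exp (\<omega> * (t - s)) * (C * norm v)))) / ?K"
      by (simp only: pos_le_divide_eq[OF \<phi>(7)] mult.commute[of _ ?K])
    also have "\<dots> = 2 * N * C / (c * ?K) * exp (\<omega> * (t - s)) * norm v" by simp
    finally show "norm ?w \<le> 2 * N * C / (c * ?K) * exp (\<omega> * (t - s)) * norm v" .
  qed
qed

end

text \<open>Valid also when h is not integrable, since pairing with v / |v|^2 undoes the scaling of
  a nonzero v. This matters because for f in L^p the kernel integral may diverge at some x.\<close>

lemma integral_scaleR_vector:
  fixes h :: "'a \<Rightarrow> real" and v :: "'z::euclidean_space"
  shows "(LINT y|M. h y *\<^sub>R v) = (LINT y|M. h y) *\<^sub>R v"
  by (rule integral_bounded_linear'[OF bounded_linear_scaleR_left bounded_linear_inner_left[of "v /\<^sub>R (v \<bullet> v)"]])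
    auto

section \<open>Sufficiency for the gradient: Fubini against test functions\<close>

context ornstein_uhlenbeck
begin

lemma kernel_joint_measurable [measurable (raw)]:
  assumes [measurable]: "h \<in> borel_measurable M" "k \<in> borel_measurable M"
  shows "(\<lambda>z. kap s t (h z) (k z)) \<in> borel_measurable M" "(\<lambda>z. ww s t (h z) (k z)) \<in> borel_measurable M"
  unfolding kap_def ww_def mm_def by measurable

lemma nn_integral_kernel:
  assumes st: "s < t" and [measurable]: "F \<in> borel_measurable borel"
  shows "(\<integral>\<^sup>+y. ennreal (kap s t x y) * F y \<partial>lborel) = (\<integral>\<^sup>+z. F (mm s t x + Sf s t *v z) \<partial>stdg)"
proof -
  have "(\<integral>\<^sup>+y. ennreal (kap s t x y) * F y \<partial>lborel) = (\<integral>\<^sup>+y. F y \<partial>normal (Qf s t) (mm s t x))"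
    unfolding normal_def kap_eq by (subst nn_integral_density) auto
  also have "\<dots> = (\<integral>\<^sup>+z. F (mm s t x + Sf s t *v z) \<partial>stdg)" by (rule nn_integral_normal[OF Sf[OF st]]) measurable
  finally show ?thesis .
qed

lemma Lp_locally_integrable:
  fixes h :: "real^'n \<Rightarrow> 'z::euclidean_space"
  assumes h: "h \<in> Lp p (\<mu> t)" and p: "p > 1" and K: "compact K"
  shows "set_integrable lborel K h"
proof -
  have [measurable]: "h \<in> borel_measurable borel" by (rule Lp_mu_measurable[OF h])
  have [measurable]: "K \<in> sets borel" using K by (simp add: borel_compact)
  obtain r where r: "\<And>x. x \<in> K \<Longrightarrow> norm x \<le> r" using compact_imp_bounded[OF K] unfolding bounded_iff by blast
  obtain c where c: "c > 0" "\<And>x. norm x \<le> r \<Longrightarrow> c \<le> rho t x" using rho_lower[of r] by blast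
  have "integrable lborel (\<lambda>x. rho t x *\<^sub>R h x)"
    using prob_space.integral_norm_le_Lp_norm(1)[OF prob_space_mu h p] by (simp add: integrable_mu_iff_lborel)
  then have i: "integrable lborel (\<lambda>x. (1 / c) *\<^sub>R (rho t x *\<^sub>R h x))" by (rule integrable_scaleR_right)
  have b: "norm (indicator K x *\<^sub>R h x) \<le> norm ((1 / c) *\<^sub>R (rho t x *\<^sub>R h x))" for x
  proof (cases "x \<in> K")
    case True
    then have "1 \<le> rho t x / c" using c r by simp
    then have "1 * norm (h x) \<le> (rho t x / c) * norm (h x)" by (intro mult_right_mono) auto
    then show ?thesis using True c(1) rho_pos[of t x] by (simp add: abs_of_pos)
  qed simp
  show ?thesis unfolding set_integrable_def
    by (rule Bochner_Integration.integrable_bound[OF i]) (use b in auto)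
qed

text \<open>Supplies the hypothesis of Fubini in (x, y). After the substitution to
  \<open>stdg\<close>, Young's inequality separates |f|^p, integrable by \<open>invariance\<close>,
  from a power of 1 + |z| with a fixed finite moment \<open>J\<close>.\<close>

lemma kernel_joint_integrable:
  fixes W :: "real^'n \<Rightarrow> real^'n \<Rightarrow> real^'n"
  assumes ts: "t - s \<ge> 1" and p: "p > 1" and f: "f \<in> Lp p (\<mu> s)"
    and [measurable]: "(\<lambda>z. W (fst z) (snd z)) \<in> borel_measurable (borel \<Otimes>\<^sub>M borel)"
    and b: "\<And>x y. norm (W x y) \<le> C * indicator (cball 0 r) x * kap s t x y * (\<bar>f y\<bar> * (1 + norm (ww s t x y)))"
  shows "integrable (lborel \<Otimes>\<^sub>M lborel) (\<lambda>(x, y). W x y)"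
proof -
  have st: "s < t" using ts by simp
  have [measurable]: "f \<in> borel_measurable borel" by (rule Lp_mu_measurable[OF f])
  define q where "q = p / (p - 1)"
  have q: "q > 1" using conjugate_exponent(1)[OF p q_def] .
  define D where "D = 1 + opn (U s t) / sqrt lam"
  have D: "D \<ge> 1" using opn_nonneg[of "U s t"] lam_pos by (simp add: D_def)
  define J where "J = (LINT z|(stdg :: (real^'n) measure). D powr q * (1 + norm z) powr q)"
  have iJ: "integrable stdg (\<lambda>z::real^'n. D powr q * (1 + norm z) powr q)"
    by (intro integrable_mult_right integrable_stdg_moment) (use q in simp)
  obtain c where c: "c > 0" "\<And>x. norm x \<le> r \<Longrightarrow> c \<le> rho t x" using rho_lower[of r] by blast
  \<comment> \<open>On the ball of radius r the density \<open>rho\<close> is at least c, so the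
    cutoff in x is dominated by C' times \<open>rho\<close>, and the outer Lebesgue integral becomes
    one against \<open>mu\<close>.\<close>
  define C' where "C' = \<bar>C\<bar> / c"
  have C': "C' \<ge> 0" using c(1) by (simp add: C'_def)
  let ?H = "\<lambda>x. \<integral>\<^sup>+z. ennreal (\<bar>f (mm s t x + Sf s t *v z)\<bar> powr p) \<partial>stdg"
  have inner: "(\<integral>\<^sup>+y. ennreal (norm (W x y)) \<partial>lborel) \<le> ennreal C' * (ennreal (rho t x) * (?H x + ennreal J))" for x
  proof -
    have ind: "C * indicator (cball 0 r) x \<le> C' * rho t x"
    proof (cases "norm x \<le> r")
      case True
      have "\<bar>C\<bar> = C' * c" using c(1) by (simp add: C'_def)
      also have "\<dots> \<le> C' * rho t x" using C' c(2)[OF True] by (intro mult_left_mono)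
      finally show ?thesis using True by simp
    next
      case False
      then show ?thesis using C' rho_pos[of t x] by (simp add: less_imp_le)
    qed
    have "norm (W x y) \<le> (C' * rho t x) * (kap s t x y * (\<bar>f y\<bar> * (1 + norm (ww s t x y))))" for y
    proof -
      have "(C * indicator (cball 0 r) x) * (kap s t x y * (\<bar>f y\<bar> * (1 + norm (ww s t x y))))
         \<le> (C' * rho t x) * (kap s t x y * (\<bar>f y\<bar> * (1 + norm (ww s t x y))))"
        by (intro mult_right_mono ind) auto
      then show ?thesis using b[of x y] by (simp only: mult.assoc)
    qed
    then have "(\<integral>\<^sup>+y. ennreal (norm (W x y)) \<partial>lborel) \<le> (\<integral>\<^sup>+y. ennreal ((C' * rho t x) * (kap s t x y * (\<bar>f y\<bar> * (1 + norm (ww s t x y))))) \<partial>lborel)"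
      by (intro nn_integral_mono ennreal_leI)
    also have "\<dots> = (\<integral>\<^sup>+y. ennreal (C' * rho t x) * (ennreal (kap s t x y) * ennreal (\<bar>f y\<bar> * (1 + norm (ww s t x y)))) \<partial>lborel)"
      using C' rho_pos[of t x] by (simp add: ennreal_mult less_imp_le)
    also have "\<dots> = ennreal (C' * rho t x) * (\<integral>\<^sup>+y. ennreal (kap s t x y) * ennreal (\<bar>f y\<bar> * (1 + norm (ww s t x y))) \<partial>lborel)"
      by (rule nn_integral_cmult) measurable
    also have "(\<integral>\<^sup>+y. ennreal (kap s t x y) * ennreal (\<bar>f y\<bar> * (1 + norm (ww s t x y))) \<partial>lborel)
       = (\<integral>\<^sup>+z. ennreal (\<bar>f (mm s t x + Sf s t *v z)\<bar> * (1 + norm (vv s t z))) \<partial>stdg)"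
      by (subst nn_integral_kernel[OF st]) (auto simp: ww_at_Sf)
    also have "\<dots> \<le> (\<integral>\<^sup>+z. ennreal (\<bar>f (mm s t x + Sf s t *v z)\<bar> powr p) + ennreal (D powr q * (1 + norm z) powr q) \<partial>stdg)"
    proof (rule nn_integral_mono)
      fix z :: "real^'n"
      have "1 + norm (vv s t z) \<le> D * (1 + norm z)"
      proof -
        define b where "b = opn (U s t) / sqrt lam"
        have "b \<ge> 0" using opn_nonneg[of "U s t"] lam_pos by (simp add: b_def)
        moreover have "D * (1 + norm z) = 1 + norm z + b + b * norm z" by (simp add: D_def b_def[symmetric] algebra_simps)
        moreover have "norm (vv s t z) \<le> b * norm z" using vv_bound[OF ts, of z] by (simp add: b_def)
        ultimately show ?thesis using norm_ge_zero[of z] by linarith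
      qed
      then have "\<bar>f (mm s t x + Sf s t *v z)\<bar> * (1 + norm (vv s t z)) \<le> \<bar>f (mm s t x + Sf s t *v z)\<bar> * (D * (1 + norm z))"
        by (intro mult_left_mono) auto
      also have "\<dots> \<le> \<bar>f (mm s t x + Sf s t *v z)\<bar> powr p + (D * (1 + norm z)) powr q"
        using D by (intro product_le_powr_sum[OF p q_def]) auto
      also have "(D * (1 + norm z)) powr q = D powr q * (1 + norm z) powr q" by (rule powr_mult)
      finally have "ennreal (\<bar>f (mm s t x + Sf s t *v z)\<bar> * (1 + norm (vv s t z)))
        \<le> ennreal (\<bar>f (mm s t x + Sf s t *v z)\<bar> powr p + D powr q * (1 + norm z) powr q)" by (rule ennreal_leI)
      then show "ennreal (\<bar>f (mm s t x + Sf s t *v z)\<bar> * (1 + norm (vv s t z)))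
        \<le> ennreal (\<bar>f (mm s t x + Sf s t *v z)\<bar> powr p) + ennreal (D powr q * (1 + norm z) powr q)"
        by (simp only: ennreal_plus[OF powr_ge_zero mult_nonneg_nonneg[OF powr_ge_zero powr_ge_zero]])
    qed
    also have "\<dots> = ?H x + (\<integral>\<^sup>+z. ennreal (D powr q * (1 + norm (z::real^'n)) powr q) \<partial>stdg)"
      by (rule nn_integral_add) measurable
    also have "(\<integral>\<^sup>+z. ennreal (D powr q * (1 + norm (z::real^'n)) powr q) \<partial>stdg) = ennreal J"
      unfolding J_def by (rule nn_integral_eq_integral[OF iJ]) auto
    finally show ?thesis
      using C' rho_pos[of t x] by (simp add: ennreal_mult less_imp_le mult_left_mono mult.assoc)
  qed
  have "(\<integral>\<^sup>+z. ennreal (norm (W (fst z) (snd z))) \<partial>(lborel \<Otimes>\<^sub>M lborel)) = (\<integral>\<^sup>+x. \<integral>\<^sup>+y. ennreal (norm (W x y)) \<partial>lborel \<partial>lborel)"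
    by (subst lborel.nn_integral_fst[symmetric]) auto
  also have "\<dots> \<le> (\<integral>\<^sup>+x. ennreal C' * (ennreal (rho t x) * (?H x + ennreal J)) \<partial>lborel)"
    by (intro nn_integral_mono inner)
  also have "\<dots> = ennreal C' * (\<integral>\<^sup>+x. ennreal (rho t x) * (?H x + ennreal J) \<partial>lborel)"
    by (rule nn_integral_cmult) measurable
  also have "(\<integral>\<^sup>+x. ennreal (rho t x) * (?H x + ennreal J) \<partial>lborel) = (\<integral>\<^sup>+x. ?H x + ennreal J \<partial>\<mu> t)"
    by (rule nn_integral_mu_density[symmetric]) measurable
  also have "\<dots> = (\<integral>\<^sup>+x. ?H x \<partial>\<mu> t) + (\<integral>\<^sup>+x. ennreal J \<partial>\<mu> t)"
    by (rule nn_integral_add) measurable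
  also have "(\<integral>\<^sup>+x. ?H x \<partial>\<mu> t) = (\<integral>\<^sup>+x. ennreal (\<bar>f x\<bar> powr p) \<partial>\<mu> s)" by (rule invariance[OF st]) measurable
  also have "ennreal C' * (\<dots> + (\<integral>\<^sup>+x. ennreal J \<partial>\<mu> t)) < \<infinity>"
    using f by (simp add: Lp_iff_nn_integral ennreal_mult_less_top)
  finally have fin: "(\<integral>\<^sup>+z. ennreal (norm (W (fst z) (snd z))) \<partial>(lborel \<Otimes>\<^sub>M lborel)) < \<infinity>" .
  have "integrable (lborel \<Otimes>\<^sub>M lborel) (\<lambda>z. W (fst z) (snd z))"
    by (rule integrableI_bounded[OF _ fin]) measurable
  then show ?thesis by (simp add: case_prod_beta')
qed

text \<open>For f in L^p differentiation under the integral is replaced by Fubini: for each fixed y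
  the smooth kernel is integrated by parts in x against the test function, and the order of
  integration is then restored.\<close>

lemma evol_Lp_has_weak_gradient:
  assumes ts: "t - s \<ge> 1" and p: "p > 1" and f: "f \<in> Lp p (\<mu> s)" and KL: "Kx f s t \<in> Lp p (\<mu> t)"
  shows "has_weak_gradient (evLp p t s f) (Kx f s t)"
  unfolding has_weak_gradient_def
proof (intro conjI allI impI)
  have st: "s < t" using ts by simp
  have fm[measurable]: "f \<in> borel_measurable borel" by (rule Lp_mu_measurable[OF f])
  show "set_integrable lborel K (evLp p t s f)" "set_integrable lborel K (Kx f s t)" if "compact K" for K
    using Lp_locally_integrable[OF evol_Lp_eq_G(1)[OF st p f] p that] Lp_locally_integrable[OF KL p that] by auto
  fix \<phi> :: "real^'n \<Rightarrow> real"
  assume \<phi>: "(\<forall>x. \<phi> differentiable (at x)) \<and> continuous_on UNIV (grad \<phi>) \<and> compact (closure {x. \<phi> x \<noteq> 0})"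
  then have \<phi>': "\<And>x. \<phi> differentiable (at x)" "continuous_on UNIV (grad \<phi>)" "compact (closure {x. \<phi> x \<noteq> 0})" by auto
  have "continuous_on UNIV \<phi>"
    using differentiable_imp_continuous_within[OF \<phi>'(1)] by (simp add: continuous_at_imp_continuous_on)
  then have [measurable]: "\<phi> \<in> borel_measurable borel" "grad \<phi> \<in> borel_measurable borel"
    using \<phi>'(2) by (auto intro: borel_measurable_continuous_onI)
  have [measurable]: "evLp p t s f \<in> borel_measurable borel" by (rule Lp_mu_measurable[OF evol_Lp_eq_G(1)[OF st p f]])
  obtain r C where r: "\<And>x. norm x > r \<Longrightarrow> \<phi> x = 0" "\<And>x. norm x > r \<Longrightarrow> grad \<phi> x = 0"
    and C: "\<And>x. \<bar>\<phi> x\<bar> \<le> C" "\<And>x. norm (grad \<phi> x) \<le> C"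
    using compact_support_bounds[OF \<phi>'] by metis
  have C0: "C \<ge> 0" using C(1)[of 0] by linarith
  have C1: "norm (grad \<phi> x) \<le> C * indicator (cball 0 r) x" "\<bar>\<phi> x\<bar> \<le> C * indicator (cball 0 r) x" for x
    using C[of x] r[of x] by (auto simp: indicator_def)
  let ?W1 = "\<lambda>x y. (f y * kap s t x y) *\<^sub>R grad \<phi> x"
  let ?W2 = "\<lambda>x y. \<phi> x *\<^sub>R ((f y * kap s t x y) *\<^sub>R ww s t x y)"
  have i1: "integrable (lborel \<Otimes>\<^sub>M lborel) (\<lambda>(x, y). ?W1 x y)"
  proof (rule kernel_joint_integrable[OF ts p f])
    fix x y :: "real^'n"
    have "norm (?W1 x y) = norm (grad \<phi> x) * (kap s t x y * (\<bar>f y\<bar> * 1))" by (simp add: abs_mult)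
    also have "\<dots> \<le> (C * indicator (cball 0 r) x) * (kap s t x y * (\<bar>f y\<bar> * (1 + norm (ww s t x y))))"
      using C0 by (intro mult_mono C1 mult_left_mono mult_nonneg_nonneg) auto
    finally show "norm (?W1 x y) \<le> C * indicator (cball 0 r) x * kap s t x y * (\<bar>f y\<bar> * (1 + norm (ww s t x y)))"
      by (simp only: mult.assoc)
  qed measurable
  have i2: "integrable (lborel \<Otimes>\<^sub>M lborel) (\<lambda>(x, y). ?W2 x y)"
  proof (rule kernel_joint_integrable[OF ts p f])
    fix x y :: "real^'n"
    have "norm (?W2 x y) = \<bar>\<phi> x\<bar> * (kap s t x y * (\<bar>f y\<bar> * norm (ww s t x y)))" by (simp add: abs_mult ac_simps)
    also have "\<dots> \<le> (C * indicator (cball 0 r) x) * (kap s t x y * (\<bar>f y\<bar> * (1 + norm (ww s t x y))))"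
      using C0 by (intro mult_mono C1 mult_left_mono mult_nonneg_nonneg) auto
    finally show "norm (?W2 x y) \<le> C * indicator (cball 0 r) x * kap s t x y * (\<bar>f y\<bar> * (1 + norm (ww s t x y)))"
      by (simp only: mult.assoc)
  qed measurable
  have parts: "(LINT x|lborel. ?W1 x y) = - (LINT x|lborel. ?W2 x y)" for y
  proof (rule integral_by_parts_compact_support[OF _ _ \<phi>'])
    show "((\<lambda>x. f y * kap s t x y) has_derivative (\<lambda>v. ((f y * kap s t x y) *\<^sub>R ww s t x y) \<bullet> v)) (at x)" for x
    proof -
      have "((\<lambda>x. kap s t x y) has_derivative (\<lambda>v. kap s t x y * (ww s t x y \<bullet> v))) (at x)" by (rule kap_deriv_x[OF st])
      from has_derivative_mult_right[OF this, of "f y"] show ?thesis by (simp add: mult.assoc)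
    qed
    have "isCont (\<lambda>x. kap s t x y *\<^sub>R ww s t x y) x" for x
      using kapww_deriv_x[OF st] has_derivative_continuous by blast
    then have "continuous_on UNIV (\<lambda>x. f y *\<^sub>R (kap s t x y *\<^sub>R ww s t x y))"
      by (intro continuous_on_scaleR continuous_on_const continuous_at_imp_continuous_on) auto
    then show "continuous_on UNIV (\<lambda>x. (f y * kap s t x y) *\<^sub>R ww s t x y)" by simp
  qed
  have "(LINT x|lborel. evLp p t s f x *\<^sub>R grad \<phi> x) = (LINT x|lborel. G t s f x *\<^sub>R grad \<phi> x)"
  proof (rule integral_cong_AE)
    show "AE x in lborel. evLp p t s f x *\<^sub>R grad \<phi> x = G t s f x *\<^sub>R grad \<phi> x"
      using evol_Lp_eq_G(2)[OF st p f] by eventually_elim simp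
  qed measurable
  also have "\<dots> = (LINT x|lborel. LINT y|lborel. ?W1 x y)"
    unfolding G_eq_kernel[OF st fm]
  proof (rule Bochner_Integration.integral_cong[OF refl])
    fix x
    show "(LINT y|lborel. f y * kap s t x y) *\<^sub>R grad \<phi> x = (LINT y|lborel. ?W1 x y)"
      by (rule integral_scaleR_vector[symmetric])
  qed
  also have "\<dots> = (LINT y|lborel. LINT x|lborel. ?W1 x y)"
    by (rule lborel_pair.Fubini_integral[OF i1, symmetric])
  also have "\<dots> = - (LINT y|lborel. LINT x|lborel. ?W2 x y)" unfolding parts by simp
  also have "(LINT y|lborel. LINT x|lborel. ?W2 x y) = (LINT x|lborel. LINT y|lborel. ?W2 x y)"
    by (rule lborel_pair.Fubini_integral[OF i2])
  also have "\<dots> = (LINT x|lborel. \<phi> x *\<^sub>R Kx f s t x)" by (simp only: Kx_def integral_scaleR_right)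
  finally show "(LINT x|lborel. evLp p t s f x *\<^sub>R grad \<phi> x) = - (LINT x|lborel. \<phi> x *\<^sub>R Kx f s t x)" .
qed

lemma decay_rate_imp_gradient_decay_exponents:
  assumes p: "p > 1" and \<omega>: "decay_rate \<omega>"
  shows "\<omega> \<in> gradient_decay_exponents A B g U p"
proof -
  obtain M where M: "\<And>s t. t - s \<ge> 1 \<Longrightarrow> opn (U s t) \<le> M * exp (\<omega> * (t - s))" using \<omega> unfolding decay_rate_def by blast
  obtain C where C: "C > 0" "\<And>s t f. t - s \<ge> 1 \<Longrightarrow> f \<in> borel_measurable borel \<Longrightarrow>
    (\<integral>\<^sup>+x. ennreal (norm (Kx f s t x) powr p) \<partial>\<mu> t) \<le> ennreal ((C * opn (U s t)) powr p) * (\<integral>\<^sup>+x. ennreal (\<bar>f x\<bar> powr p) \<partial>\<mu> s)"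
    using Kx_Lp_bound[OF p] by blast
  have "\<exists>F. has_weak_gradient (evLp p t s f) F \<and> F \<in> Lp p (\<mu> t) \<and>
      Lp_norm p (\<mu> t) F \<le> C * (\<bar>M\<bar> + 1) * exp (\<omega> * (t - s)) * Lp_norm p (\<mu> s) f"
    if ts: "t - s \<ge> 1" and f: "f \<in> Lp p (\<mu> s)" for s t f
  proof -
    have st: "s < t" using ts by simp
    have [measurable]: "f \<in> borel_measurable borel" by (rule Lp_mu_measurable[OF f])
    have Km: "Kx f s t \<in> borel_measurable (\<mu> t)" using st by simp
    have "Kx f s t \<in> Lp p (\<mu> t) \<and> Lp_norm p (\<mu> t) (Kx f s t) \<le> (C * opn (U s t)) * Lp_norm p (\<mu> s) f"
      using Lp_norm_leI[OF Km f, of "C * opn (U s t)"] C(2)[OF ts, of f] C(1) opn_nonneg[of "U s t"] p by simp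
    then have 1: "Kx f s t \<in> Lp p (\<mu> t)" "Lp_norm p (\<mu> t) (Kx f s t) \<le> (C * opn (U s t)) * Lp_norm p (\<mu> s) f" by auto
    \<comment> \<open>\<open>decay_rate\<close> does not fix the sign of \<open>M\<close>; the
      replacement makes the resulting constant strictly positive.\<close>
    have "opn (U s t) \<le> (\<bar>M\<bar> + 1) * exp (\<omega> * (t - s))"
      by (rule order_trans[OF M[OF ts] mult_right_mono]) auto
    then have "C * opn (U s t) \<le> C * ((\<bar>M\<bar> + 1) * exp (\<omega> * (t - s)))" using C(1) by (intro mult_left_mono) auto
    then have "(C * opn (U s t)) * Lp_norm p (\<mu> s) f \<le> (C * ((\<bar>M\<bar> + 1) * exp (\<omega> * (t - s)))) * Lp_norm p (\<mu> s) f"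
      by (intro mult_right_mono Lp_norm_nonneg)
    then have "Lp_norm p (\<mu> t) (Kx f s t) \<le> C * (\<bar>M\<bar> + 1) * exp (\<omega> * (t - s)) * Lp_norm p (\<mu> s) f"
      using 1(2) by (simp only: mult.assoc)
    with evol_Lp_has_weak_gradient[OF ts p f 1(1)] 1(1) show ?thesis by blast
  qed
  moreover have "C * (\<bar>M\<bar> + 1) > 0" using C(1) by simp
  ultimately show ?thesis unfolding gradient_decay_exponents_def by blast
qed

section \<open>Sufficiency for the centred operator: Poincare inequality and extension by
  density\<close>

lemma integral_G_invariant:
  assumes st: "s < t" and \<phi>: "\<phi> \<in> C_b"
  shows "(LINT x|\<mu> t. G t s \<phi> x) = (LINT x|\<mu> s. \<phi> x)"
proof -
  have [measurable]: "\<phi> \<in> borel_measurable borel" by (rule C_bD(1)[OF \<phi>])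
  obtain F where F: "F \<ge> 0" "\<And>x. \<bar>\<phi> x\<bar> \<le> F" using C_bD(3)[OF \<phi>] by blast
  \<comment> \<open>\<open>invariance\<close> concerns nonnegative integrands, so \<phi> is shifted
    by its bound F; both measures have mass 1, and the shift cancels at the end.\<close>
  have nn: "0 \<le> \<phi> x + F" for x using F(2)[of x] by linarith
  interpret s: prob_space "\<mu> s" by (rule prob_space_mu)
  interpret t: prob_space "\<mu> t" by (rule prob_space_mu)
  have int_s: "integrable (\<mu> s) \<phi>" by (rule s.integrable_const_bound[where B = F]) (use F in auto)
  have iz: "integrable stdg (\<lambda>z. \<phi> (mm s t x + Sf s t *v z))" for x
    by (rule stdg.integrable_const_bound[where B = F]) (use F in auto)
  have Gb: "\<bar>G t s \<phi> x\<bar> \<le> F" for x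
  proof -
    have "\<bar>G t s \<phi> x\<bar> \<le> (LINT z|stdg. \<bar>\<phi> (mm s t x + Sf s t *v z)\<bar>)" unfolding G_def by (rule integral_abs_bound)
    also have "\<dots> \<le> (LINT z|(stdg :: (real^'n) measure). F)"
      by (intro integral_mono integrable_abs iz F) auto
    finally show ?thesis by simp
  qed
  have int_t: "integrable (\<mu> t) (G t s \<phi>)" by (rule t.integrable_const_bound[where B = F]) (use Gb in auto)
  have "(\<integral>\<^sup>+x. (\<integral>\<^sup>+z. ennreal (\<phi> (mm s t x + Sf s t *v z) + F) \<partial>stdg) \<partial>\<mu> t) = (\<integral>\<^sup>+x. ennreal (\<phi> x + F) \<partial>\<mu> s)"
    by (rule invariance[OF st]) measurable
  moreover have "(\<integral>\<^sup>+z. ennreal (\<phi> (mm s t x + Sf s t *v z) + F) \<partial>stdg) = ennreal (G t s \<phi> x + F)" for x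
    using nn iz by (subst nn_integral_eq_integral) (auto simp: G_def)
  moreover have "(\<integral>\<^sup>+x. ennreal (G t s \<phi> x + F) \<partial>\<mu> t) = ennreal ((LINT x|\<mu> t. G t s \<phi> x) + F)"
  proof (subst nn_integral_eq_integral)
    show "AE x in \<mu> t. 0 \<le> G t s \<phi> x + F"
    proof (rule AE_I2)
      show "0 \<le> G t s \<phi> x + F" for x using Gb[of x] by linarith
    qed
  qed (use int_t in auto)
  moreover have "(\<integral>\<^sup>+x. ennreal (\<phi> x + F) \<partial>\<mu> s) = ennreal ((LINT x|\<mu> s. \<phi> x) + F)"
    using nn int_s by (subst nn_integral_eq_integral) auto
  ultimately have "ennreal ((LINT x|\<mu> t. G t s \<phi> x) + F) = ennreal ((LINT x|\<mu> s. \<phi> x) + F)" by simp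
  moreover have "0 \<le> (LINT x|\<mu> t. G t s \<phi> x) + F"
    using t.integral_ge_const[OF int_t, of "- F"] Gb by (auto simp: abs_le_iff minus_le_iff)
  moreover have "0 \<le> (LINT x|\<mu> s. \<phi> x) + F"
    using s.integral_ge_const[OF int_s, of "- F"] F(2) by (auto simp: abs_le_iff minus_le_iff)
  ultimately show ?thesis by simp
qed

text \<open>In whitened coordinates x = mean + R z the function G \<phi> becomes H, whose
  \<open>stdg\<close> mean is the mean of \<phi> by invariance. Its oscillation H(z) - E H is the
  average of H(z) - H(w), to which \<open>gauss_poincare_pairs\<close> applies; the gradient of H
  gains R^T, bounded uniformly in t.\<close>

lemma G_poincare:
  assumes p: "p > 1"
  shows "\<exists>C>0. \<forall>s t \<phi>. s < t \<longrightarrow> \<phi> \<in> C_b \<longrightarrow>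
    (\<integral>\<^sup>+x. ennreal (\<bar>G t s \<phi> x - (LINT y|\<mu> s. \<phi> y)\<bar> powr p) \<partial>\<mu> t) \<le> ennreal (C powr p) * (\<integral>\<^sup>+x. ennreal (norm (Kx \<phi> s t x) powr p) \<partial>\<mu> t)"
proof -
  obtain r where r: "r \<ge> 0" "\<And>t. opn (Rf t) \<le> r" using Rf_opn_bound by blast
  define J where "J = (LINT z|(stdg :: (real^'n) measure). norm z powr p)"
  have J0: "J \<ge> 0" by (simp add: J_def)
  have Jeq: "(\<integral>\<^sup>+z. ennreal (norm (z::real^'n) powr p) \<partial>stdg) = ennreal J"
    unfolding J_def by (rule nn_integral_eq_integral[OF stdg_weight_integrable]) (use p in auto)
  define a where "a = (1 + pi / 2) powr p * (pi / 2)"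
  have "1 + pi / 2 > 0" using pi_gt_zero by linarith
  then have a0: "a > 0" unfolding a_def by (intro mult_pos_pos) auto
  \<comment> \<open>The added 1 guarantees a positive constant even if r = 0.\<close>
  define b where "b = 2 powr p * (a * (r powr p * J)) + 1"
  have b0: "b > 0" using a0 J0 unfolding b_def by (intro add_nonneg_pos mult_nonneg_nonneg) auto
  define C where "C = b powr (1 / p)"
  have C: "C > 0" "C powr p = b" using b0 p by (auto simp: C_def powr_powr)
  have "(\<integral>\<^sup>+x. ennreal (\<bar>G t s \<phi> x - (LINT y|\<mu> s. \<phi> y)\<bar> powr p) \<partial>\<mu> t) \<le> ennreal (C powr p) * (\<integral>\<^sup>+x. ennreal (norm (Kx \<phi> s t x) powr p) \<partial>\<mu> t)"
    if st: "s < t" and \<phi>: "\<phi> \<in> C_b" for s t \<phi>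
  proof -
    have fm[measurable]: "\<phi> \<in> borel_measurable borel" by (rule C_bD(1)[OF \<phi>])
    define H where "H z = G t s \<phi> (mean g U t + Rf t *v z)" for z
    define H' where "H' z = transpose (Rf t) *v Kx \<phi> s t (mean g U t + Rf t *v z)" for z
    have Hd: "(H has_derivative (\<lambda>v. H' z \<bullet> v)) (at z)" for z
    proof -
      have "((\<lambda>z. mean g U t + Rf t *v z) has_derivative (\<lambda>v. Rf t *v v)) (at z)"
        using has_derivative_add[OF has_derivative_const bounded_linear_imp_has_derivative[OF matrix_vector_mul_bounded_linear]] by simp
      from has_derivative_compose[OF this G_has_derivative_Kx(1)[OF \<phi> st]]
      show ?thesis unfolding H_def[abs_def] H'_def
        by (simp add: inner_matrix_transpose inner_commute)
    qed
    have Hc: "continuous_on UNIV H'"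
      unfolding H'_def[abs_def]
      by (intro bounded_linear.continuous_on[OF matrix_vector_mul_bounded_linear]
        continuous_on_compose2[OF G_has_derivative_Kx(2)[OF \<phi> st]] continuous_intros) auto
    have [measurable]: "Kx \<phi> s t \<in> borel_measurable borel" using st by simp
    have Hm[measurable]: "H \<in> borel_measurable borel" unfolding H_def[abs_def] by measurable
    obtain F where F: "\<And>x. \<bar>G t s \<phi> x\<bar> \<le> F" using G_bounded[OF \<phi>] by blast
    have iH: "integrable stdg H" by (rule stdg.integrable_const_bound[where B = F]) (use F in \<open>auto simp: H_def\<close>)
    have mean: "(LINT y|\<mu> s. \<phi> y) = (LINT w|stdg. H w)"
    proof -
      have "(LINT y|\<mu> s. \<phi> y) = (LINT x|\<mu> t. G t s \<phi> x)" by (rule integral_G_invariant[OF st \<phi>, symmetric])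
      also have "\<dots> = (LINT w|stdg. H w)" unfolding mu_eq_distr H_def by (rule integral_distr) measurable
      finally show ?thesis .
    qed
    have "(\<integral>\<^sup>+x. ennreal (\<bar>G t s \<phi> x - (LINT y|\<mu> s. \<phi> y)\<bar> powr p) \<partial>\<mu> t) = (\<integral>\<^sup>+z. ennreal (\<bar>H z - (LINT w|stdg. H w)\<bar> powr p) \<partial>stdg)"
      unfolding mean by (subst nn_integral_mu) (auto simp: H_def)
    also have "\<dots> \<le> (\<integral>\<^sup>+z. ennreal (2 powr p) * (\<integral>\<^sup>+w. ennreal (\<bar>H z - H w\<bar> powr p) \<partial>stdg) \<partial>stdg)"
    proof (rule nn_integral_mono)
      fix z
      have "H z - (LINT w|stdg. H w) = (LINT w|stdg. H z - H w)" using iH by simp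
      then show "ennreal (\<bar>H z - (LINT w|stdg. H w)\<bar> powr p) \<le> ennreal (2 powr p) * (\<integral>\<^sup>+w. ennreal (\<bar>H z - H w\<bar> powr p) \<partial>stdg)"
        using stdg.integral_powr_le(2)[OF p, of "\<lambda>w. H z - H w"] by simp
    qed
    also have "\<dots> = ennreal (2 powr p) * (\<integral>\<^sup>+z. (\<integral>\<^sup>+w. ennreal (\<bar>H z - H w\<bar> powr p) \<partial>stdg) \<partial>stdg)"
      by (rule nn_integral_cmult) measurable
    also have "\<dots> \<le> ennreal (2 powr p) * (ennreal a * ((\<integral>\<^sup>+z. ennreal (norm (H' z) powr p) \<partial>stdg) * ennreal J))"
      using gauss_poincare_pairs[OF p Hd Hc] unfolding a_def Jeq by (rule mult_left_mono) simp
    also have "(\<integral>\<^sup>+z. ennreal (norm (H' z) powr p) \<partial>stdg) \<le> ennreal (r powr p) * (\<integral>\<^sup>+x. ennreal (norm (Kx \<phi> s t x) powr p) \<partial>\<mu> t)"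
    proof -
      have "norm (H' z) powr p \<le> r powr p * norm (Kx \<phi> s t (mean g U t + Rf t *v z)) powr p" for z
      proof -
        let ?k = "Kx \<phi> s t (mean g U t + Rf t *v z)"
        have "norm (H' z) \<le> opn (transpose (Rf t)) * norm ?k" unfolding H'_def by (rule norm_mat_vec_le)
        also have "\<dots> \<le> r * norm ?k" unfolding opn_transpose by (intro mult_right_mono r) simp
        finally have "norm (H' z) powr p \<le> (r * norm ?k) powr p" using p by (intro powr_mono2) auto
        then show ?thesis by (simp only: powr_mult)
      qed
      then have "(\<integral>\<^sup>+z. ennreal (norm (H' z) powr p) \<partial>stdg) \<le> (\<integral>\<^sup>+z. ennreal (r powr p) * ennreal (norm (Kx \<phi> s t (mean g U t + Rf t *v z)) powr p) \<partial>stdg)"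
        by (intro nn_integral_mono) (simp add: ennreal_mult[symmetric] ennreal_leI)
      also have "\<dots> = ennreal (r powr p) * (\<integral>\<^sup>+z. ennreal (norm (Kx \<phi> s t (mean g U t + Rf t *v z)) powr p) \<partial>stdg)"
        by (rule nn_integral_cmult) measurable
      also have "(\<integral>\<^sup>+z. ennreal (norm (Kx \<phi> s t (mean g U t + Rf t *v z)) powr p) \<partial>stdg) = (\<integral>\<^sup>+x. ennreal (norm (Kx \<phi> s t x) powr p) \<partial>\<mu> t)"
        by (rule nn_integral_mu[symmetric]) measurable
      finally show ?thesis .
    qed
    finally have "(\<integral>\<^sup>+x. ennreal (\<bar>G t s \<phi> x - (LINT y|\<mu> s. \<phi> y)\<bar> powr p) \<partial>\<mu> t)
        \<le> ennreal (2 powr p) * (ennreal a * ((ennreal (r powr p) * (\<integral>\<^sup>+x. ennreal (norm (Kx \<phi> s t x) powr p) \<partial>\<mu> t)) * ennreal J))"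
      by (simp add: mult_left_mono mult_right_mono)
    also have "\<dots> = ennreal (2 powr p * (a * (r powr p * J))) * (\<integral>\<^sup>+x. ennreal (norm (Kx \<phi> s t x) powr p) \<partial>\<mu> t)"
      using a0 J0 by (simp add: ennreal_mult ac_simps)
    also have "\<dots> \<le> ennreal (C powr p) * (\<integral>\<^sup>+x. ennreal (norm (Kx \<phi> s t x) powr p) \<partial>\<mu> t)"
      unfolding C(2) by (intro mult_right_mono ennreal_leI) (auto simp: b_def)
    finally show ?thesis .
  qed
  with C(1) show ?thesis by blast
qed

lemma mean_powr_le:
  assumes p: "p > 1" and [measurable]: "u \<in> borel_measurable borel"
  shows "ennreal (\<bar>LINT y|\<mu> s. u y\<bar> powr p) \<le> ennreal (2 powr p) * (\<integral>\<^sup>+x. ennreal (\<bar>u x\<bar> powr p) \<partial>\<mu> s)"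
proof -
  interpret prob_space "\<mu> s" by (rule prob_space_mu)
  show ?thesis using integral_powr_le(2)[OF p, of u] by simp
qed

text \<open>Needed because the Poincare inequality is available for bounded continuous functions
  only, where \<open>G\<close> is differentiable. The errors of the approximation vanish in the
  limit; splitting off each of them costs 2^p twice in the main term, hence 4 d in place of
  d.\<close>

lemma centered_bound_extends:
  assumes st: "s < t" and p: "p > 1" and f: "f \<in> Lp p (\<mu> s)"
    and b: "\<And>\<phi>. \<phi> \<in> C_b \<Longrightarrow> (\<integral>\<^sup>+x. ennreal (\<bar>G t s \<phi> x - (LINT y|\<mu> s. \<phi> y)\<bar> powr p) \<partial>\<mu> t) \<le> ennreal (d powr p) * (\<integral>\<^sup>+x. ennreal (\<bar>\<phi> x\<bar> powr p) \<partial>\<mu> s)"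
  shows "(\<integral>\<^sup>+x. ennreal (\<bar>G t s f x - (LINT y|\<mu> s. f y)\<bar> powr p) \<partial>\<mu> t) \<le> ennreal ((4 * d) powr p) * (\<integral>\<^sup>+x. ennreal (\<bar>f x\<bar> powr p) \<partial>\<mu> s)"
    (is "?A \<le> _ * ?N")
proof -
  have p0: "p > 0" using p by simp
  have fm[measurable]: "f \<in> borel_measurable borel" by (rule Lp_mu_measurable[OF f])
  obtain \<phi> where \<phi>: "\<And>k::nat. \<phi> k \<in> C_b" and L: "(\<lambda>k. \<integral>\<^sup>+x. ennreal (\<bar>\<phi> k x - f x\<bar> powr p) \<partial>\<mu> s) \<longlonglongrightarrow> 0"
    by (rule C_b_approximation[OF f p0]) blast
  have [measurable]: "\<phi> k \<in> borel_measurable borel" for k by (rule C_bD(1)[OF \<phi>])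
  interpret s: prob_space "\<mu> s" by (rule prob_space_mu)
  define e where "e k = (\<integral>\<^sup>+x. ennreal (\<bar>\<phi> k x - f x\<bar> powr p) \<partial>\<mu> s)" for k
  let ?m = "\<lambda>u. LINT y|\<mu> s. u y"
  let ?c = "ennreal (2 powr p)"
  have int_f: "integrable (\<mu> s) f" by (rule s.integral_norm_le_Lp_norm(1)[OF f p])
  have int_\<phi>: "integrable (\<mu> s) (\<phi> k)" for k by (rule s.integral_norm_le_Lp_norm(1)[OF C_b_Lp[OF \<phi> p0] p])
  have le: "?A \<le> ?c * (ennreal (d powr p) * (?c * ?N)) + ?c * (ennreal (d powr p) * ?c + ?c * (?c + ?c)) * e k" for k
  proof -
    let ?u = "\<lambda>x. G t s (\<phi> k) x - ?m (\<phi> k)" and ?v = "\<lambda>x. G t s f x - G t s (\<phi> k) x" and ?w = "\<lambda>x::real^'n. ?m (\<phi> k) - ?m f"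
    have 1: "(\<integral>\<^sup>+x. ennreal (norm (?u x) powr p) \<partial>\<mu> t) \<le> ennreal (d powr p) * (?c * (?N + e k))"
    proof -
      have "(\<integral>\<^sup>+x. ennreal (\<bar>\<phi> k x\<bar> powr p) \<partial>\<mu> s) = (\<integral>\<^sup>+x. ennreal (norm (f x + (\<phi> k x - f x)) powr p) \<partial>\<mu> s)" by simp
      also have "\<dots> \<le> ?c * ((\<integral>\<^sup>+x. ennreal (norm (f x) powr p) \<partial>\<mu> s) + (\<integral>\<^sup>+x. ennreal (norm (\<phi> k x - f x) powr p) \<partial>\<mu> s))"
        using p0 by (intro nn_integral_powr_add_le) auto
      finally have "(\<integral>\<^sup>+x. ennreal (\<bar>\<phi> k x\<bar> powr p) \<partial>\<mu> s) \<le> ?c * (?N + e k)" by (simp add: e_def)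
      then have "ennreal (d powr p) * (\<integral>\<^sup>+x. ennreal (\<bar>\<phi> k x\<bar> powr p) \<partial>\<mu> s) \<le> ennreal (d powr p) * (?c * (?N + e k))"
        by (intro mult_left_mono) auto
      then show ?thesis using order_trans[OF b[OF \<phi>[of k]]] by simp
    qed
    have 2: "(\<integral>\<^sup>+x. ennreal (norm (?v x) powr p) \<partial>\<mu> t) \<le> ?c * e k"
      using G_diff_Lp_bound[OF st p fm \<phi>[of k]] by (simp add: e_def abs_minus_commute)
    have 3: "(\<integral>\<^sup>+x. ennreal (norm (?w x) powr p) \<partial>\<mu> t) \<le> ?c * e k"
    proof -
      have "?m (\<phi> k) - ?m f = ?m (\<lambda>x. \<phi> k x - f x)" using int_f int_\<phi> by simp
      then show ?thesis using mean_powr_le[OF p, of "\<lambda>x. \<phi> k x - f x" s] by (simp add: e_def)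
    qed
    have "?A = (\<integral>\<^sup>+x. ennreal (norm (?u x + (?v x + ?w x)) powr p) \<partial>\<mu> t)" by (simp add: algebra_simps)
    also have "\<dots> \<le> ?c * ((\<integral>\<^sup>+x. ennreal (norm (?u x) powr p) \<partial>\<mu> t) + (\<integral>\<^sup>+x. ennreal (norm (?v x + ?w x) powr p) \<partial>\<mu> t))"
      using p0 by (intro nn_integral_powr_add_le) auto
    also have "\<dots> \<le> ?c * (ennreal (d powr p) * (?c * (?N + e k)) + ?c * (?c * e k + ?c * e k))"
    proof (intro mult_left_mono add_mono 1)
      have "(\<integral>\<^sup>+x. ennreal (norm (?v x + ?w x) powr p) \<partial>\<mu> t) \<le> ?c * ((\<integral>\<^sup>+x. ennreal (norm (?v x) powr p) \<partial>\<mu> t) + (\<integral>\<^sup>+x. ennreal (norm (?w x) powr p) \<partial>\<mu> t))"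
        using p0 by (intro nn_integral_powr_add_le) auto
      also have "\<dots> \<le> ?c * (?c * e k + ?c * e k)" by (intro mult_left_mono add_mono 2 3) auto
      finally show "(\<integral>\<^sup>+x. ennreal (norm (?v x + ?w x) powr p) \<partial>\<mu> t) \<le> ?c * (?c * e k + ?c * e k)" .
    qed auto
    also have "\<dots> = ?c * (ennreal (d powr p) * (?c * ?N)) + ?c * (ennreal (d powr p) * ?c + ?c * (?c + ?c)) * e k"
      by (simp only: distrib_left distrib_right mult.assoc add.assoc)
    finally show ?thesis .
  qed
  let ?X = "?c * (ennreal (d powr p) * (?c * ?N))"
  have "(\<lambda>k. ?c * (ennreal (d powr p) * ?c + ?c * (?c + ?c)) * e k) \<longlonglongrightarrow> 0"
    by (rule ennreal_tendsto_0_cmult[OF _ L[folded e_def]]) (simp add: ennreal_mult_less_top)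
  then have "(\<lambda>k. ?X + ?c * (ennreal (d powr p) * ?c + ?c * (?c + ?c)) * e k) \<longlonglongrightarrow> ?X + 0"
    by (intro tendsto_add tendsto_const)
  then have "?A \<le> ?X + 0" by (rule LIMSEQ_le_const) (use le in blast)
  also have "?X + 0 = ennreal ((4 * d) powr p) * ?N"
  proof -
    have "(4 * d) powr p = 2 powr p * (d powr p * 2 powr p)"
      using powr_mult[of 2 2 p] by (simp add: powr_mult mult.commute mult.left_commute)
    then show ?thesis by (simp add: ennreal_mult mult.assoc)
  qed
  finally show ?thesis .
qed

text \<open>Handles t - s < 1, where no gradient estimate is at hand. The constant comes from 2^p
  (2^p + 2^p) <= 8^p.\<close>

lemma centered_crude_bound:
  assumes st: "s < t" and p: "p > 1" and f: "f \<in> Lp p (\<mu> s)"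
  shows "(\<integral>\<^sup>+x. ennreal (\<bar>G t s f x - (LINT y|\<mu> s. f y)\<bar> powr p) \<partial>\<mu> t) \<le> ennreal (8 powr p) * (\<integral>\<^sup>+x. ennreal (\<bar>f x\<bar> powr p) \<partial>\<mu> s)"
    (is "?A \<le> _ * ?N")
proof -
  have fm[measurable]: "f \<in> borel_measurable borel" by (rule Lp_mu_measurable[OF f])
  let ?c = "ennreal (2 powr p)" and ?m = "LINT y|\<mu> s. f y"
  have "?A = (\<integral>\<^sup>+x. ennreal (norm (G t s f x + - ?m) powr p) \<partial>\<mu> t)" by simp
  also have "\<dots> \<le> ?c * ((\<integral>\<^sup>+x. ennreal (norm (G t s f x) powr p) \<partial>\<mu> t) + (\<integral>\<^sup>+x. ennreal (norm (- ?m) powr p) \<partial>\<mu> t))"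
    using p by (intro nn_integral_powr_add_le) auto
  also have "\<dots> \<le> ?c * (?c * ?N + ?c * ?N)"
    using G_Lp_bound[OF st p fm] mean_powr_le[OF p fm, of s] by (intro mult_left_mono add_mono) auto
  also have "\<dots> = ennreal (2 powr p * (2 powr p + 2 powr p)) * ?N"
  proof -
    have "ennreal (2 powr p * (2 powr p + 2 powr p)) = ?c * (?c + ?c)"
      by (simp only: ennreal_mult[OF powr_ge_zero add_nonneg_nonneg[OF powr_ge_zero powr_ge_zero]] ennreal_plus[OF powr_ge_zero powr_ge_zero])
    then show ?thesis by (simp only: distrib_left distrib_right mult.assoc)
  qed
  also have "\<dots> \<le> ennreal (8 powr p) * ?N"
  proof (intro mult_right_mono ennreal_leI)
    have "2 powr p \<ge> 2 powr (1::real)" using p by (intro powr_mono) auto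
    then have "2 powr p * (2 powr p * 2) \<le> 2 powr p * (2 powr p * 2 powr p)" by (intro mult_left_mono) auto
    also have "\<dots> = 8 powr p" by (simp add: powr_mult[symmetric])
    finally show "2 powr p * (2 powr p + 2 powr p) \<le> 8 powr p" by simp
  qed simp
  finally show ?thesis .
qed

lemma decay_rate_imp_centered_decay:
  assumes p: "p > 1" and \<omega>: "decay_rate \<omega>"
  shows "\<exists>M>0. \<forall>s t. s < t \<longrightarrow> (\<forall>f \<in> Lp p (\<mu> s).
     Lp_norm p (\<mu> t) (\<lambda>x. evLp p t s f x - (LINT y|\<mu> s. f y)) \<le> M * exp (\<omega> * (t - s)) * Lp_norm p (\<mu> s) f)"
proof -
  have p0: "p > 0" using p by simp
  obtain M where M: "\<And>s t. t - s \<ge> 1 \<Longrightarrow> opn (U s t) \<le> M * exp (\<omega> * (t - s))" using \<omega> unfolding decay_rate_def by blast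
  obtain C where C: "C > 0" "\<And>s t f. t - s \<ge> 1 \<Longrightarrow> f \<in> borel_measurable borel \<Longrightarrow>
    (\<integral>\<^sup>+x. ennreal (norm (Kx f s t x) powr p) \<partial>\<mu> t) \<le> ennreal ((C * opn (U s t)) powr p) * (\<integral>\<^sup>+x. ennreal (\<bar>f x\<bar> powr p) \<partial>\<mu> s)"
    using Kx_Lp_bound[OF p] by blast
  obtain P where P: "P > 0" "\<And>s t \<phi>. s < t \<Longrightarrow> \<phi> \<in> C_b \<Longrightarrow>
    (\<integral>\<^sup>+x. ennreal (\<bar>G t s \<phi> x - (LINT y|\<mu> s. \<phi> y)\<bar> powr p) \<partial>\<mu> t) \<le> ennreal (P powr p) * (\<integral>\<^sup>+x. ennreal (norm (Kx \<phi> s t x) powr p) \<partial>\<mu> t)"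
    using G_poincare[OF p] by blast
  \<comment> \<open>The first summand covers t - s < 1 through the crude constant 8, the second t -
    s >= 1 through the Poincare constant \<open>P\<close>, the gradient constant \<open>C\<close>
    and the factor 4 of the extension.\<close>
  define N where "N = 8 * exp \<bar>\<omega>\<bar> + 4 * (P * C) * \<bar>M\<bar>"
  have N: "N > 0" using P(1) C(1) unfolding N_def by (intro add_pos_nonneg mult_nonneg_nonneg) auto
  have "Lp_norm p (\<mu> t) (\<lambda>x. evLp p t s f x - (LINT y|\<mu> s. f y)) \<le> N * exp (\<omega> * (t - s)) * Lp_norm p (\<mu> s) f"
    if st: "s < t" and f: "f \<in> Lp p (\<mu> s)" for s t f
  proof -
    have [measurable]: "evLp p t s f \<in> borel_measurable borel" by (rule Lp_mu_measurable[OF evol_Lp_eq_G(1)[OF st p f]])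
    let ?N = "\<integral>\<^sup>+x. ennreal (\<bar>f x\<bar> powr p) \<partial>\<mu> s"
    let ?A = "\<integral>\<^sup>+x. ennreal (\<bar>G t s f x - (LINT y|\<mu> s. f y)\<bar> powr p) \<partial>\<mu> t"
    have "\<exists>d\<ge>0. d \<le> N * exp (\<omega> * (t - s)) \<and> ?A \<le> ennreal (d powr p) * ?N"
    proof (cases "t - s \<ge> 1")
      case True
      let ?d = "P * (C * opn (U s t))"
      have d0: "?d \<ge> 0" using P(1) C(1) opn_nonneg[of "U s t"] by simp
      have "(\<integral>\<^sup>+x. ennreal (\<bar>G t s \<phi> x - (LINT y|\<mu> s. \<phi> y)\<bar> powr p) \<partial>\<mu> t) \<le> ennreal (?d powr p) * (\<integral>\<^sup>+x. ennreal (\<bar>\<phi> x\<bar> powr p) \<partial>\<mu> s)"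
        if \<phi>: "\<phi> \<in> C_b" for \<phi>
      proof -
        have "(\<integral>\<^sup>+x. ennreal (\<bar>G t s \<phi> x - (LINT y|\<mu> s. \<phi> y)\<bar> powr p) \<partial>\<mu> t)
          \<le> ennreal (P powr p) * (ennreal ((C * opn (U s t)) powr p) * (\<integral>\<^sup>+x. ennreal (\<bar>\<phi> x\<bar> powr p) \<partial>\<mu> s))"
          by (rule order_trans[OF P(2)[OF st \<phi>] mult_left_mono[OF C(2)[OF True C_bD(1)[OF \<phi>]]]]) simp
        also have "\<dots> = ennreal (?d powr p) * (\<integral>\<^sup>+x. ennreal (\<bar>\<phi> x\<bar> powr p) \<partial>\<mu> s)"
          by (simp only: powr_mult[of P] ennreal_mult[OF powr_ge_zero powr_ge_zero] mult.assoc)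
        finally show ?thesis .
      qed
      then have "?A \<le> ennreal ((4 * ?d) powr p) * ?N" by (rule centered_bound_extends[OF st p f])
      moreover have "4 * ?d \<le> N * exp (\<omega> * (t - s))"
      proof -
        have "opn (U s t) \<le> \<bar>M\<bar> * exp (\<omega> * (t - s))" by (rule order_trans[OF M[OF True] mult_right_mono]) auto
        then have "(4 * (P * C)) * opn (U s t) \<le> (4 * (P * C)) * (\<bar>M\<bar> * exp (\<omega> * (t - s)))"
          using P(1) C(1) by (intro mult_left_mono) auto
        also have "\<dots> = (4 * (P * C) * \<bar>M\<bar>) * exp (\<omega> * (t - s))" by (simp only: mult.assoc)
        also have "\<dots> \<le> N * exp (\<omega> * (t - s))" by (intro mult_right_mono) (auto simp: N_def)
        finally show ?thesis by (simp only: mult.assoc)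
      qed
      ultimately show ?thesis using d0 by (intro exI[of _ "4 * ?d"]) auto
    next
      case False
      \<comment> \<open>On a time interval shorter than 1 the factor exp(\<omega>(t - s)) is at
        least exp(-|\<omega>|), which the factor exp |\<omega>| in \<open>N\<close>
        compensates.\<close>
      have "8 \<le> N * exp (\<omega> * (t - s))"
      proof -
        have "\<bar>\<omega> * (t - s)\<bar> \<le> \<bar>\<omega>\<bar> * 1" unfolding abs_mult using st False by (intro mult_left_mono) auto
        then have "0 \<le> \<bar>\<omega>\<bar> + \<omega> * (t - s)" by linarith
        then have "8 * 1 \<le> 8 * (exp \<bar>\<omega>\<bar> * exp (\<omega> * (t - s)))" by (intro mult_left_mono) (auto simp: exp_add[symmetric])
        also have "\<dots> = (8 * exp \<bar>\<omega>\<bar>) * exp (\<omega> * (t - s))" by simp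
        also have "\<dots> \<le> N * exp (\<omega> * (t - s))"
          using P(1) C(1) by (intro mult_right_mono) (auto simp: N_def)
        finally show ?thesis by simp
      qed
      then show ?thesis using centered_crude_bound[OF st p f] by (intro exI[of _ 8]) auto
    qed
    then obtain d where d: "d \<ge> 0" "d \<le> N * exp (\<omega> * (t - s))" "?A \<le> ennreal (d powr p) * ?N" by blast
    have "AE x in \<mu> t. evLp p t s f x = G t s f x" using evol_Lp_eq_G(2)[OF st p f] by (simp add: AE_mu_iff)
    then have "AE x in \<mu> t. ennreal (norm (evLp p t s f x - (LINT y|\<mu> s. f y)) powr p) = ennreal (\<bar>G t s f x - (LINT y|\<mu> s. f y)\<bar> powr p)"
      by eventually_elim simp
    then have eq: "(\<integral>\<^sup>+x. ennreal (norm (evLp p t s f x - (LINT y|\<mu> s. f y)) powr p) \<partial>\<mu> t) = ?A"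
      by (rule nn_integral_cong_AE)
    have "Lp_norm p (\<mu> t) (\<lambda>x. evLp p t s f x - (LINT y|\<mu> s. f y)) \<le> d * Lp_norm p (\<mu> s) f"
      by (rule Lp_norm_leI(2)[OF _ f p0 d(1)]) (use d(3) in \<open>auto simp: eq[simplified]\<close>)
    also have "\<dots> \<le> N * exp (\<omega> * (t - s)) * Lp_norm p (\<mu> s) f" by (intro mult_right_mono d(2) Lp_norm_nonneg)
    finally show ?thesis .
  qed
  with N show ?thesis by blast
qed

lemma decay_exponents_eq:
  assumes p: "p > 1"
  shows "decay_exponents A B g U p = gradient_decay_exponents A B g U p"
proof -
  have "\<omega> \<in> decay_exponents A B g U p" if "decay_rate \<omega>" for \<omega>
    using decay_rate_imp_centered_decay[OF p that] unfolding decay_exponents_def by blast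
  then show ?thesis
    using decay_exponents_imp_decay_rate[OF p] gradient_decay_exponents_imp_decay_rate[OF p]
      decay_rate_imp_gradient_decay_exponents[OF p] by blast
qed

end

theorem mainTheorem8:
  fixes A B :: "real \<Rightarrow> real^'n^'n" and g :: "real \<Rightarrow> real^'n"
    and U :: "real \<Rightarrow> real \<Rightarrow> real^'n^'n" and \<eta>\<^sub>0 :: real
  assumes "continuous_on UNIV A" and "bounded (range A)"
    and "continuous_on UNIV B" and "bounded (range B)"
    and "continuous_on UNIV g" and "bounded (range g)"
    and "\<eta>\<^sub>0 > 0"
    and "\<And>t \<xi>. (((1 / 2) *\<^sub>R (B t ** transpose (B t))) *v \<xi>) \<bullet> \<xi> \<ge> \<eta>\<^sub>0 * (norm \<xi>)\<^sup>2"
    and "\<And>t s. ((\<lambda>\<tau>. U \<tau> s) has_vector_derivative - (A t ** U t s)) (at t)"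
    and "\<And>s. U s s = mat 1"
    and "omega0 U < 0"
  shows "(\<forall>p>1. decay_exponents A B g U p = gradient_decay_exponents A B g U p) \<and>
    (\<forall>p>1. \<forall>\<omega> \<in> {omega0 U<..<0}. \<exists>M>0. \<forall>s t. s < t \<longrightarrow> (\<forall>f \<in> Lp p (mu B g U s).
       Lp_norm p (mu B g U t) (\<lambda>x. evol_Lp A B g U p t s f x - (LINT y|mu B g U s. f y))
         \<le> M * exp (\<omega> * (t - s)) * Lp_norm p (mu B g U s) f))"
proof -
  interpret ornstein_uhlenbeck A B g U \<eta>\<^sub>0
    by (rule ornstein_uhlenbeck.intro) (fact assms)+
  show ?thesis
    using decay_exponents_eq decay_rate_imp_centered_decay[OF _ decay_rate_of_gt_omega0] by simp
qed

end
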